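(* Let $n,N\in\mathbb{N}$ and let $\Omega\subset\mathbb{R}^n$ be a bounded open set. Let $1<p_1<p_2<\infty$ and $0<s_1<s_2<1$. There exists $\delta=\delta(s_1,s_2,p_1,p_2,n,N)>0$ such that the following holds for any $s\in(s_1,s_2)$ and $p\in(p_1,p_2)$ such that $sp+\delta>n$. If $u\in W^{s,p}_{loc}(\Omega,\mathbb{R}^N)\cap L^{p-1}_{sp}(\mathbb{R}^n,\mathbb{R}^N)$ is a local weak solution of $$(-\Delta_p)^s u=f\quad\text{in }\Omega,$$ where $f\in L^{\frac{p}{p-1}}_{loc}(\Omega,\mathbb{R}^N)$, then $u\in C^{0,\alpha}_{loc}(\Omega,\mathbb{R}^N)$ where $\alpha:=(sp+\delta-n)/p$. Moreover, there exists a uniform constant $C=C(n,s,p,\delta)>0$ such that for any ball $B_{4R}(x_0)\subset\subset\Omega$, $$[u]_{C^{0,\alpha}(B_R(x_0),\mathbb{R}^N)}\le C R^{-\frac{\delta}{p}}\left(\int_{B_{4R}(x_0)}\int_{\mathbb{R}^n}\frac{|u(x)-u(y)|^p}{|x-y|^{n+sp}}\,dx\,dy+\|f\|_{L^{\frac{p}{p-1}}(B_{2R}(x_0),\mathbb{R}^N)}\,[u]_{W^{s,p}(B_{2R}(x_0),\mathbb{R}^N)}\right)^{\frac1p}.$$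
   Context: For an open set $U\subset\mathbb{R}^n$, $[f]_{W^{s,p}(U,\mathbb{R}^N)}=\left(\int_U\int_U\frac{|f(x)-f(y)|^p}{|x-y|^{n+sp}}\,dx\,dy\right)^{1/p}$, and $W^{s,p}(U,\mathbb{R}^N)$ is the set of $f\in L^p(U,\mathbb{R}^N)$ with $[f]_{W^{s,p}(U,\mathbb{R}^N)}<\infty$; $W^{s,p}_{loc}(\Omega,\mathbb{R}^N)$ is the set of $f$ belonging to $W^{s,p}(U,\mathbb{R}^N)$ for every open $U\subset\subset\Omega$. For $q>0$, $\beta>0$, the tail space is $L^q_\beta(\mathbb{R}^n,\mathbb{R}^N)=\left\{f\in L^q_{loc}(\mathbb{R}^n,\mathbb{R}^N):\int_{\mathbb{R}^n}\frac{|f(x)|^q}{1+|x|^{n+\beta}}\,dx<\infty\right\}$; here it is used with $q=p-1$, $\beta=sp$. The operator $(-\Delta_p)^s$ is understood in the distributional sense: $u$ is a local weak solution of $(-\Delta_p)^su=f$ in $\Omega$ if for all $\varphi\in C_c^\infty(\Omega,\mathbb{R}^N)$, $$\int_{\mathbb{R}^n}\int_{\mathbb{R}^n}\frac{|u(x)-u(y)|^{p-2}(u(x)-u(y))\cdot(\varphi(x)-\varphi(y))}{|x-y|^{n+sp}}\,dx\,dy=\int_{\mathbb{R}^n}f\cdot\varphi\,dx.$$ $B_r(x_0)$ is the open ball of radius $r$ centered at $x_0$, and $[f]_{C^{0,\alpha}(U,\mathbb{R}^N)}=\sup_{x\ne y\in U}\frac{|f(x)-f(y)|}{|x-y|^\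alpha}$.
   Formalization: The constant C may depend on max(1, diam Ω) besides n, s, p, δ; with C = C(n,s,p,δ) alone the estimate fails, since replacing u(x) by u(x/λ) and letting λ→∞ would remove the f-term, which is false for concentrating bumps u = ψ(x/ε). *)

theory Defs
  imports "HOL-Analysis.Analysis"
begin

text \<open>
  Maps from the space \<open>real ^ 'n\<close> to the Euclidean space of dimension \<open>N\<close> are represented
  by functions of type \<open>real ^ 'n \<Rightarrow> nat \<Rightarrow> real\<close> of which only the components with index
  below \<open>N\<close> are meaningful. The dimension \<open>N\<close> is a number and not a type, because one constant
  of the main estimate has to be chosen before \<open>N\<close> is. All notions below depend only on the
  components with index below \<open>N\<close>.
\<close>

type_synonym 'n vfield = "real ^ 'n \<Rightarrow> nat \<Rightarrow> real"

definition vnorm :: "nat \<Rightarrow> (nat \<Rightarrow> real) \<Rightarrow> real" where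
  "vnorm N v = L2_set v {..<N}"

definition vdist :: "nat \<Rightarrow> (nat \<Rightarrow> real) \<Rightarrow> (nat \<Rightarrow> real) \<Rightarrow> real" where
  "vdist N v w = vnorm N (\<lambda>i. v i - w i)"

definition vinner :: "nat \<Rightarrow> (nat \<Rightarrow> real) \<Rightarrow> (nat \<Rightarrow> real) \<Rightarrow> real" where
  "vinner N v w = (\<Sum>i<N. v i * w i)"

text \<open>Real powers of extended nonnegative reals; only used with exponent \<open>a > 0\<close>.\<close>

definition epowr :: "ennreal \<Rightarrow> real \<Rightarrow> ennreal" where
  "epowr x a = (if x = \<infinity> then \<infinity> else ennreal (enn2real x powr a))"

definition compactly_inside :: "'a::topological_space set \<Rightarrow> 'a set \<Rightarrow> bool" where
  "compactly_inside U \<Omega> \<longleftrightarrow> compact (closure U) \<and> closure U \<subseteq> \<Omega>"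

text \<open>
  Lebesgue spaces. The exponent may be any \<open>q > 0\<close> (the tail space is used with \<open>q = p - 1\<close>,
  which can be less than one). Measurability is Lebesgue measurability.
\<close>

definition Lq_norm :: "nat \<Rightarrow> real \<Rightarrow> (real ^ 'n) set \<Rightarrow> 'n::finite vfield \<Rightarrow> ennreal" where
  "Lq_norm N q U f = epowr (\<integral>\<^sup>+ x\<in>U. ennreal (vnorm N (f x) powr q) \<partial>lebesgue) (1 / q)"

definition Lq :: "nat \<Rightarrow> real \<Rightarrow> (real ^ 'n) set \<Rightarrow> 'n::finite vfield set" where
  "Lq N q U = {f. (\<forall>i<N. (\<lambda>x. f x i) \<in> borel_measurable (lebesgue_on U)) \<and> Lq_norm N q U f < \<infinity>}"

definition Lq_loc :: "nat \<Rightarrow> real \<Rightarrow> (real ^ 'n) set \<Rightarrow> 'n::finite vfield set" where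
  "Lq_loc N q \<Omega> = {f. \<forall>U. open U \<and> compactly_inside U \<Omega> \<longrightarrow> f \<in> Lq N q U}"

definition tail_space :: "nat \<Rightarrow> real \<Rightarrow> real \<Rightarrow> 'n::finite vfield set" where
  "tail_space N q \<beta> = {f \<in> Lq_loc N q UNIV.
     (\<integral>\<^sup>+ x. ennreal (vnorm N (f x) powr q / (1 + norm x powr (real CARD('n) + \<beta>))) \<partial>lebesgue) < \<infinity>}"

definition gagliardo_energy ::
  "nat \<Rightarrow> real \<Rightarrow> real \<Rightarrow> (real ^ 'n) set \<Rightarrow> (real ^ 'n) set \<Rightarrow> 'n::finite vfield \<Rightarrow> ennreal" where
  "gagliardo_energy N s p A B f =
     (\<integral>\<^sup>+ x\<in>A. (\<integral>\<^sup>+ y\<in>B.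
        ennreal (vdist N (f x) (f y) powr p / norm (x - y) powr (real CARD('n) + s * p))
      \<partial>lebesgue) \<partial>lebesgue)"

definition W_seminorm :: "nat \<Rightarrow> real \<Rightarrow> real \<Rightarrow> (real ^ 'n) set \<Rightarrow> 'n::finite vfield \<Rightarrow> ennreal" where
  "W_seminorm N s p U f = epowr (gagliardo_energy N s p U U f) (1 / p)"

definition W_space :: "nat \<Rightarrow> real \<Rightarrow> real \<Rightarrow> (real ^ 'n) set \<Rightarrow> 'n::finite vfield set" where
  "W_space N s p U = {f \<in> Lq N p U. W_seminorm N s p U f < \<infinity>}"

definition W_loc :: "nat \<Rightarrow> real \<Rightarrow> real \<Rightarrow> (real ^ 'n) set \<Rightarrow> 'n::finite vfield set" where
  "W_loc N s p \<Omega> = {f. \<forall>U. open U \<and> compactly_inside U \<Omega> \<longrightarrow> f \<in> W_space N s p U}"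

definition holder_seminorm :: "nat \<Rightarrow> real \<Rightarrow> (real ^ 'n) set \<Rightarrow> 'n::finite vfield \<Rightarrow> ennreal" where
  "holder_seminorm N \<alpha> U f =
     (SUP (x, y) \<in> {(x, y). x \<in> U \<and> y \<in> U \<and> x \<noteq> y}.
        ennreal (vdist N (f x) (f y) / norm (x - y) powr \<alpha>))"

text \<open>
  On the bounded sets \<open>U\<close> occurring here a finite seminorm already forces boundedness, so the
  supremum norm need not be mentioned.
\<close>

definition holder_loc :: "nat \<Rightarrow> real \<Rightarrow> (real ^ 'n) set \<Rightarrow> 'n::finite vfield set" where
  "holder_loc N \<alpha> \<Omega> =
     {f. \<forall>U. open U \<and> compactly_inside U \<Omega> \<longrightarrow> holder_seminorm N \<alpha> U f < \<infinity>}"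

primrec Ck :: "nat \<Rightarrow> (real ^ 'n::finite \<Rightarrow> real) \<Rightarrow> bool" where
  "Ck 0 g \<longleftrightarrow> continuous_on UNIV g"
| "Ck (Suc k) g \<longleftrightarrow> (\<forall>x. g differentiable (at x)) \<and>
     (\<forall>i. Ck k (\<lambda>x. frechet_derivative g (at x) (axis i 1)))"

definition test_fields :: "nat \<Rightarrow> (real ^ 'n) set \<Rightarrow> 'n::finite vfield set" where
  "test_fields N \<Omega> = {\<phi>. (\<forall>i<N. \<forall>k. Ck k (\<lambda>x. \<phi> x i)) \<and>
     (\<exists>K. compact K \<and> K \<subseteq> \<Omega> \<and> (\<forall>x. x \<notin> K \<longrightarrow> (\<forall>i<N. \<phi> x i = 0)))}"

text \<open>
  For \<open>u\<close> in the intersection of \<open>W_loc N s p \<Omega>\<close> and \<open>tail_space N (p - 1) (s * p)\<close>, and \<open>f\<close> in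
  \<open>Lq_loc N (p / (p - 1)) \<Omega>\<close>, both integrals below converge absolutely. The values of \<open>f\<close>
  outside \<open>\<Omega>\<close> play no role, as \<open>\<phi>\<close> vanishes there. Where \<open>u x = u y\<close> the first integrand is
  zero, also if \<open>p < 2\<close>.
\<close>

definition weak_solution ::
  "nat \<Rightarrow> real \<Rightarrow> real \<Rightarrow> (real ^ 'n) set \<Rightarrow> 'n::finite vfield \<Rightarrow> 'n vfield \<Rightarrow> bool" where
  "weak_solution N s p \<Omega> f u \<longleftrightarrow> (\<forall>\<phi> \<in> test_fields N \<Omega>.
     (LINT x|lebesgue. (LINT y|lebesgue.
        vdist N (u x) (u y) powr (p - 2) * vinner N (\<lambda>i. u x i - u y i) (\<lambda>i. \<phi> x i - \<phi> y i)
          / norm (x - y) powr (real CARD('n) + s * p)))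
     = (LINT x|lebesgue. vinner N (f x) (\<phi> x)))"

text \<open>
  The right-hand side of the Hoelder estimate on \<open>ball x0 R\<close>, with constant \<open>C\<close>. It may be
  infinite, since \<open>u\<close> need not have finite \<open>p\<close>-energy far away.

  Under \<open>u(x) \<mapsto> u(x / \<lambda>)\<close> the term with \<open>f\<close> scales like the energy times \<open>\<lambda> powr (- s)\<close>. Hence
  the estimate cannot hold for all domains and radii with \<open>C\<close> depending on \<open>n, s, p, \<delta>\<close> only:
  letting \<open>\<lambda> \<rightarrow> \<infinity>\<close> would remove the term with \<open>f\<close> altogether. In the main statement \<open>C\<close> may
  therefore depend on \<open>max 1 (diameter \<Omega>)\<close> as well; for domains of diameter at most one the
  constant is the same for all of them.
\<close>

definition holder_bound ::
  "nat \<Rightarrow> real \<Rightarrow> real \<Rightarrow> real \<Rightarrow> real \<Rightarrow> 'n::finite vfield \<Rightarrow> 'n vfield \<Rightarrow> real ^ 'n \<Rightarrow> real \<Rightarrow> ennreal" where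
  "holder_bound N s p \<delta> C f u x0 R =
     ennreal C * ennreal (R powr (- \<delta> / p)) *
     epowr (gagliardo_energy N s p (ball x0 (4 * R)) UNIV u +
            Lq_norm N (p / (p - 1)) (ball x0 (2 * R)) f * W_seminorm N s p (ball x0 (2 * R)) u) (1 / p)"

end

theory Submission
  imports Defs
begin

text \<open>
  The proof is Widman's hole filling. Put \<open>d x y = |u x - u y|\<close> and let \<open>T r\<close> be the energy
  of pairs \<open>(x, y)\<close> with \<open>x\<close> in the ball \<open>B\<^sub>r\<close> and \<open>y\<close> in a large ball \<open>A\<close>. Testing with
  \<open>\<eta> (u - u z)\<close>, where \<open>\<eta>\<close> cuts off between \<open>B\<^sub>r\<^sub>/\<^sub>2\<close> and \<open>B\<^sub>r\<close> and \<open>z\<close> is a well chosen point of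
  the annulus \<open>B\<^sub>r - B\<^sub>r\<^sub>/\<^sub>2\<close>, bounds \<open>T (r/2)\<close> by the energy of pairs that do not both lie in
  \<open>B\<^sub>r\<^sub>/\<^sub>2\<close>. Such a pair either meets the annulus or joins \<open>B\<^sub>r\<^sub>/\<^sub>2\<close> to the outside of \<open>B\<^sub>r\<close>; in the
  latter case \<open>d x y \<le> d x z + d z y\<close>, averaged over \<open>z\<close> in the annulus, reduces it to pairs meeting
  the annulus. Hence \<open>T (r/2) \<le> C (T r - T (r/2)) + O(r\<^sup>s)\<close>, so \<open>T r = O(r\<^sup>\<delta>)\<close> for a small \<open>\<delta>\<close> that
  depends on \<open>C\<close> only, and Campanato's argument gives the Hoelder estimate.
  The interaction with the complement of \<open>A\<close> is moved to the right-hand side. It lies in the dual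
  Lebesgue space because of the tail condition, and it is controlled by the energy when that is finite.
\<close>

section \<open>The singular kernel and integral inequalities\<close>

text \<open>The natural test function is built from the solution itself, while the weak form admits
  only smooth ones. The gap is closed by mollification: the error of translating a function,
  averaged over a kernel of height \<open>\<epsilon> powr (- n)\<close>, is bounded by the Gagliardo
  energy alone. Energies are taken relative to a bounded set because the energy of a ball against
  the whole space may be infinite. The right-hand side is paired with \<open>u - u z\<close> on a
  ball of radius \<open>r\<close>, where the \<open>L^p\<close> norm of that difference is of order
  \<open>r powr s\<close>. This is the origin of the error rate in the iteration and the reason why
  \<open>\<delta> < s\<close> is imposed. The exponent must be fixed before \<open>s\<close> and
  \<open>p\<close> are, so the hole filling constant is kept explicit enough to be bounded on the
  whole parameter range. It involves \<open>u\<close> only through the Euclidean length of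
  differences, and is therefore the same for every \<open>N\<close>.\<close>

definition kernel_const :: "real \<Rightarrow> real \<Rightarrow> real \<Rightarrow> real" where
  "kernel_const n s p = unit_ball_vol n *
     (4 powr p * 2 powr (n + s * p) / (1 - 2 powr (- (p * (1 - s)))) + 2 powr n / (1 - 2 powr (- (s * p))))"

lemma dyadic_shell:
  fixes t :: real
  assumes "1 \<le> t"
  obtains k :: nat where "2 powr real k \<le> t" "t < 2 powr (real k + 1)"
proof
  let ?k = "nat \<lfloor>log 2 t\<rfloor>"
  have t: "t = 2 powr log 2 t" "0 \<le> log 2 t" using assms by auto
  show "2 powr real ?k \<le> t" by (subst (2) t(1), rule powr_mono) (use t(2) in linarith, simp)
  show "t < 2 powr (real ?k + 1)"
    by (subst t(1), rule powr_less_mono) (use t(2) in linarith, simp)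
qed

lemma suminf_ennreal_geometric:
  assumes "0 \<le> c" "0 \<le> q" "q < (1::real)"
  shows "(\<Sum>k. ennreal (c * q ^ k)) = ennreal (c / (1 - q))"
proof (rule suminf_ennreal_eq)
  show "(\<lambda>k. c * q ^ k) sums (c / (1 - q))"
    using sums_mult[OF geometric_sums[of q], of c] assms by simp
qed (use assms in simp)

lemma ennreal_le_suminf: "f k \<le> suminf f" for f :: "nat \<Rightarrow> ennreal"
  using sum_le_suminf[of f "{k}"] by simp

lemma emeasure_ball_powr:
  assumes "0 < r"
  shows "emeasure lborel (ball x r :: (real ^ 'n::finite) set)
    = ennreal (unit_ball_vol (real CARD('n)) * r powr real CARD('n))"
  using assms by (simp add: emeasure_ball powr_realpow)

text \<open>Dyadic shells around \<open>x\<close>, enlarged to balls, reduce the integral to two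
  geometric series, which are the two terms of \<open>kernel_const\<close>. Inside radius
  \<open>r\<close> the numerator gains \<open>norm (x - y) powr p\<close>, giving the ratio
  \<open>2 powr (- (p * (1 - s)))\<close>; outside it is at most 1 and the ratio is
  \<open>2 powr (- (s * p))\<close>. The slope \<open>4 / r\<close> of the numerator is that of
  \<open>cutoff\<close>.\<close>

lemma kernel_integral:
  fixes x :: "real ^ 'n::finite"
  assumes s: "0 < s" "s < 1" and p: "0 < p" and r: "0 < r"
  shows "(\<integral>\<^sup>+y. ennreal (min 1 (4 * norm (x - y) / r) powr p / norm (x - y) powr (real CARD('n) + s * p)) \<partial>lborel)
    \<le> ennreal (kernel_const (real CARD('n)) s p * r powr (- (s * p)))"
proof -
  define n where "n = real CARD('n)"
  define w where "w = unit_ball_vol n"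
  have n: "n > 0" and w: "w > 0" by (auto simp: n_def w_def)
  have sp: "s * p > 0" "p * (1 - s) > 0" using s p by auto
  define q1 where "q1 = 2 powr (- (p * (1 - s)))"
  define q2 where "q2 = 2 powr (- (s * p))"
  have q: "0 < q1" "q1 < 1" "0 < q2" "q2 < 1" using sp by (auto simp: q1_def q2_def powr_less_one)
  define c1 where "c1 = (\<lambda>k::nat. (4 * 2 powr (- real k)) powr p * (r * 2 powr (- real k - 1)) powr (- (n + s * p)))"
  define c2 where "c2 = (\<lambda>k::nat. (r * 2 powr real k) powr (- (n + s * p)))"
  define B1 where "B1 = (\<lambda>k::nat. ball x (r * 2 powr (- real k)))"
  define B2 where "B2 = (\<lambda>k::nat. ball x (r * 2 powr (real k + 1)))"
  have pw: "ennreal (min 1 (4 * norm (x - y) / r) powr p / norm (x - y) powr (n + s * p))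
     \<le> (\<Sum>k. ennreal (c1 k) * indicator (B1 k) y) + (\<Sum>k. ennreal (c2 k) * indicator (B2 k) y)" for y
  proof -
    define t where "t = norm (x - y)"
    consider "t = 0" | "0 < t" "t < r" | "r \<le> t" using t_def by force
    then show ?thesis
    proof cases
      case 1 then show ?thesis using t_def by simp
    next
      case 2
      then have "1 \<le> r / t" by simp
      then obtain k where k: "2 powr real k \<le> r / t" "r / t < 2 powr (real k + 1)" by (rule dyadic_shell)
      have hi: "t \<le> r * 2 powr (- real k)" using k(1) 2 by (simp add: powr_minus field_simps)
      have lo: "r * 2 powr (- real k - 1) < t"
        using k(2) 2 by (simp add: powr_minus powr_add powr_diff field_simps)
      \<comment> \<open>The shell given by \<open>k\<close> contains its outer sphere, while the
        ball \<open>B1 k\<close> is open. On the outer sphere the index is lowered by one;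
        \<open>k = 0\<close> cannot occur there, since \<open>t < r\<close>.\<close>
      obtain k' where k': "r * 2 powr (- real k' - 1) \<le> t" "t < r * 2 powr (- real k')"
      proof (cases "t < r * 2 powr (- real k)")
        case True then show ?thesis using that[of k] lo by simp
      next
        case F: False
        then have tk: "t = r * 2 powr (- real k)" using hi by simp
        show ?thesis
        proof (cases k)
          case 0 with F 2 show ?thesis by simp
        next
          case (Suc j)
          have "real k = real j + 1" using Suc by simp
          then have "t = r * 2 powr (- real j - 1)" using tk by (simp add: minus_add_distrib)
          moreover have "2 powr (- real j - 1) < 2 powr (- real j)" by simp
          ultimately show ?thesis using that[of j] r by simp
        qed
      qed
      have "min 1 (4 * t / r) powr p / t powr (n + s * p) = min 1 (4 * t / r) powr p * t powr (- (n + s * p))"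
        by (metis divide_powr_uminus)
      also have "\<dots> \<le> c1 k'"
        unfolding c1_def
      proof (rule mult_mono)
        show "min 1 (4 * t / r) powr p \<le> (4 * 2 powr (- real k')) powr p"
        proof (intro powr_mono2)
          have "4 * t / r \<le> 4 * 2 powr (- real k')" using k' r by (simp add: field_simps)
          then show "min 1 (4 * t / r) \<le> 4 * 2 powr (- real k')" by linarith
        qed (use 2 p r in auto)
        show "t powr (- (n + s * p)) \<le> (r * 2 powr (- real k' - 1)) powr (- (n + s * p))"
          using k'(1) r n sp by (intro powr_mono2') auto
      qed auto
      finally have "ennreal (min 1 (4 * t / r) powr p / t powr (n + s * p)) \<le> ennreal (c1 k') * indicator (B1 k') y"
        using k' by (auto simp: B1_def t_def dist_norm ennreal_leI)
      also have "\<dots> \<le> (\<Sum>k. ennreal (c1 k) * indicator (B1 k) y)"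
        by (rule ennreal_le_suminf[of "\<lambda>k. ennreal (c1 k) * indicator (B1 k) y"])
      finally show ?thesis unfolding t_def by (simp add: add_increasing2)
    next
      case 3
      then have "1 \<le> t / r" using r by simp
      then obtain k where k: "2 powr real k \<le> t / r" "t / r < 2 powr (real k + 1)" by (rule dyadic_shell)
      have t0: "t > 0" using 3 r by simp
      have "min 1 (4 * t / r) powr p / t powr (n + s * p) = min 1 (4 * t / r) powr p * t powr (- (n + s * p))"
        by (metis divide_powr_uminus)
      also have "\<dots> \<le> 1 * c2 k"
        unfolding c2_def
      proof (rule mult_mono)
        show "min 1 (4 * t / r) powr p \<le> 1"
          using 3 p r by (simp add: min_def)
        show "t powr (- (n + s * p)) \<le> (r * 2 powr real k) powr (- (n + s * p))"
          using k(1) r n sp t0 by (intro powr_mono2') (auto simp: field_simps)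
      qed auto
      finally have "ennreal (min 1 (4 * t / r) powr p / t powr (n + s * p)) \<le> ennreal (c2 k) * indicator (B2 k) y"
        using k r by (auto simp: B2_def t_def dist_norm ennreal_leI field_simps)
      also have "\<dots> \<le> (\<Sum>k. ennreal (c2 k) * indicator (B2 k) y)"
        by (rule ennreal_le_suminf[of "\<lambda>k. ennreal (c2 k) * indicator (B2 k) y"])
      finally show ?thesis unfolding t_def by (simp add: add_increasing)
    qed
  qed
  have i1: "ennreal (c1 k) * emeasure lborel (B1 k) = ennreal (w * 4 powr p * 2 powr (n + s * p) * r powr (- (s * p)) * q1 ^ k)" for k
  proof -
    have "c1 k * (w * (r * 2 powr (- real k)) powr n)
      = w * 4 powr p * (r powr (- (n + s * p)) * r powr n)
        * (2 powr (- real k * p) * 2 powr ((- real k - 1) * (- (n + s * p))) * 2 powr (- real k * n))"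
      using r unfolding c1_def by (simp only: powr_mult powr_powr mult_ac)
    also have "r powr (- (n + s * p)) * r powr n = r powr (- (s * p))"
      by (simp flip: powr_add)
    also have "2 powr (- real k * p) * 2 powr ((- real k - 1) * (- (n + s * p))) * 2 powr (- real k * n)
      = 2 powr (n + s * p) * q1 ^ k"
      unfolding q1_def by (simp add: powr_powr algebra_simps flip: powr_add powr_realpow)
    finally have "c1 k * (w * (r * 2 powr (- real k)) powr n)
      = w * 4 powr p * 2 powr (n + s * p) * r powr (- (s * p)) * q1 ^ k" by (simp only: mult_ac)
    moreover have "ennreal (c1 k) * emeasure lborel (B1 k) = ennreal (c1 k * (w * (r * 2 powr (- real k)) powr n))"
      using r w by (simp add: B1_def emeasure_ball_powr w_def n_def ennreal_mult' c1_def)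
    ultimately show ?thesis by (simp only:)
  qed
  have i2: "ennreal (c2 k) * emeasure lborel (B2 k) = ennreal (w * 2 powr n * r powr (- (s * p)) * q2 ^ k)" for k
  proof -
    have "c2 k * (w * (r * 2 powr (real k + 1)) powr n)
      = w * (r powr (- (n + s * p)) * r powr n)
        * (2 powr (real k * (- (n + s * p))) * 2 powr ((real k + 1) * n))"
      using r unfolding c2_def by (simp only: powr_mult powr_powr mult_ac)
    also have "r powr (- (n + s * p)) * r powr n = r powr (- (s * p))"
      by (simp flip: powr_add)
    also have "2 powr (real k * (- (n + s * p))) * 2 powr ((real k + 1) * n) = 2 powr n * q2 ^ k"
      unfolding q2_def by (simp add: powr_powr algebra_simps flip: powr_add powr_realpow)
    finally have "c2 k * (w * (r * 2 powr (real k + 1)) powr n)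
      = w * 2 powr n * r powr (- (s * p)) * q2 ^ k" by (simp only: mult_ac)
    moreover have "ennreal (c2 k) * emeasure lborel (B2 k) = ennreal (c2 k * (w * (r * 2 powr (real k + 1)) powr n))"
      using r w by (simp add: B2_def emeasure_ball_powr w_def n_def ennreal_mult' c2_def)
    ultimately show ?thesis by (simp only:)
  qed
  have m: "B1 k \<in> sets borel" "B2 k \<in> sets borel" for k by (auto simp: B1_def B2_def)
  have "(\<integral>\<^sup>+y. ennreal (min 1 (4 * norm (x - y) / r) powr p / norm (x - y) powr (n + s * p)) \<partial>lborel)
    \<le> (\<integral>\<^sup>+y. (\<Sum>k. ennreal (c1 k) * indicator (B1 k) y) + (\<Sum>k. ennreal (c2 k) * indicator (B2 k) y) \<partial>lborel)"
    by (intro nn_integral_mono pw)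
  also have "\<dots> = (\<Sum>k. ennreal (c1 k) * emeasure lborel (B1 k)) + (\<Sum>k. ennreal (c2 k) * emeasure lborel (B2 k))"
    using m by (simp add: nn_integral_add nn_integral_suminf nn_integral_cmult_indicator)
  also have "\<dots> = ennreal (w * 4 powr p * 2 powr (n + s * p) * r powr (- (s * p)) / (1 - q1))
      + ennreal (w * 2 powr n * r powr (- (s * p)) / (1 - q2))"
    unfolding i1 i2 using q w by (subst (1 2) suminf_ennreal_geometric) auto
  also have "\<dots> = ennreal (kernel_const n s p * r powr (- (s * p)))"
    using q w by (simp add: ennreal_plus[symmetric] kernel_const_def w_def q1_def q2_def
       del: ennreal_plus) (simp add: algebra_simps)
  finally show ?thesis unfolding n_def .
qed

lemma kernel_const_pos:
  assumes "0 \<le> n" "0 < s" "s < 1" "0 < p"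
  shows "0 < kernel_const n s p"
proof -
  have "2 powr (- (p * (1 - s))) < 1" "2 powr (- (s * p)) < 1"
    using assms by (auto simp: powr_less_one)
  then show ?thesis using assms unfolding kernel_const_def by (auto intro!: mult_pos_pos add_pos_pos)
qed

text \<open>The denominators of \<open>kernel_const\<close> degenerate only as
  \<open>p * (1 - s)\<close> or \<open>s * p\<close> tends to 0, and on the parameter range these
  are at least \<open>p1 * (1 - s2)\<close> and \<open>s1 * p1\<close>. This is what lets
  \<open>\<delta>\<close> be chosen before \<open>s\<close> and \<open>p\<close>.\<close>

lemma kernel_const_mono:
  assumes "0 \<le> n" "0 < s1" "s1 \<le> s" "s \<le> s2" "s2 < 1" "1 < p1" "p1 \<le> p" "p \<le> p2"
  shows "kernel_const n s p \<le> unit_ball_vol n *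
     (4 powr p2 * 2 powr (n + p2) / (1 - 2 powr (- (p1 * (1 - s2)))) + 2 powr n / (1 - 2 powr (- (s1 * p1))))"
proof -
  have "p1 * (1 - s2) \<le> p * (1 - s)" "s1 * p1 \<le> s * p" "s * p \<le> p2"
    using assms by (auto intro!: mult_mono) (smt (verit) mult_le_cancel_right1)
  moreover have "2 powr (- (p1 * (1 - s2))) < 1" "2 powr (- (s1 * p1)) < 1"
    using assms by (auto simp: powr_less_one)
  ultimately show ?thesis
    using assms unfolding kernel_const_def by (intro mult_left_mono add_mono frac_le mult_mono) auto
qed

text \<open>Integrate Young's inequality for \<open>f / A\<close> and \<open>g / B\<close>. This
  requires positive \<open>A\<close> and \<open>B\<close>, so it is done for \<open>a + e\<close>
  and \<open>b + e\<close>, and \<open>e\<close> tends to 0. Bounds \<open>a\<close> and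
  \<open>b\<close> in place of norms keep roots of extended reals out of later estimates.\<close>

lemma nn_integral_Holder:
  assumes [measurable]: "f \<in> borel_measurable M" "g \<in> borel_measurable M"
    and nn: "\<And>x. 0 \<le> f x" "\<And>x. 0 \<le> g x"
    and pq: "1 < p" "1 < q" "1 / p + 1 / q = 1"
    and F: "(\<integral>\<^sup>+x. ennreal (f x powr p) \<partial>M) \<le> ennreal (a powr p)" "0 \<le> a"
    and G: "(\<integral>\<^sup>+x. ennreal (g x powr q) \<partial>M) \<le> ennreal (b powr q)" "0 \<le> b"
  shows "(\<integral>\<^sup>+x. ennreal (f x * g x) \<partial>M) \<le> ennreal (a * b)"
proof -
  have *: "(\<integral>\<^sup>+x. ennreal (f x * g x) \<partial>M) \<le> ennreal (A * B)" if AB: "a \<le> A" "b \<le> B" "0 < A" "0 < B" for A B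
  proof -
    have pw: "ennreal (f x * g x) \<le> ennreal (A * B / (p * A powr p)) * ennreal (f x powr p)
        + ennreal (A * B / (q * B powr q)) * ennreal (g x powr q)" for x
    proof -
      have "f x / A * (g x / B) \<le> (f x / A) powr p / p + (g x / B) powr q / q"
        using Youngs_inequality[of p q "f x / A" "g x / B"] pq nn that by simp
      then have "A * B * (f x / A * (g x / B)) \<le> A * B * ((f x / A) powr p / p + (g x / B) powr q / q)"
        using AB by (intro mult_left_mono) auto
      also have "A * B * (f x / A * (g x / B)) = f x * g x" using AB by simp
      also have "A * B * ((f x / A) powr p / p + (g x / B) powr q / q)
         = (A * B / (p * A powr p)) * f x powr p + (A * B / (q * B powr q)) * g x powr q"
        using AB nn by (simp add: powr_divide field_simps)
      finally show ?thesis using AB nn pq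
        by (simp add: ennreal_mult[symmetric] ennreal_plus[symmetric] del: ennreal_plus)
    qed
    have "(\<integral>\<^sup>+x. ennreal (f x * g x) \<partial>M) \<le> ennreal (A * B / (p * A powr p)) * (\<integral>\<^sup>+x. ennreal (f x powr p) \<partial>M)
        + ennreal (A * B / (q * B powr q)) * (\<integral>\<^sup>+x. ennreal (g x powr q) \<partial>M)"
      by (subst (1 2) nn_integral_cmult[symmetric], measurable, subst nn_integral_add[symmetric], measurable)
        (intro nn_integral_mono pw)
    also have "\<dots> \<le> ennreal (A * B / (p * A powr p)) * ennreal (A powr p)
        + ennreal (A * B / (q * B powr q)) * ennreal (B powr q)"
      using F G AB pq by (intro add_mono mult_left_mono order.trans[OF F(1)] order.trans[OF G(1)] ennreal_leI powr_mono2) auto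
    also have "\<dots> = ennreal (A * B / p + A * B / q)"
      using AB pq by (simp add: ennreal_mult[symmetric] ennreal_plus[symmetric] del: ennreal_plus)
    also have "A * B / p + A * B / q = A * B * (1 / p + 1 / q)" by (simp add: algebra_simps)
    finally show ?thesis using pq(3) by simp
  qed
  have "((\<lambda>e. (a + e) * (b + e)) \<longlongrightarrow> (a + 0) * (b + 0)) (at_right 0)"
    by (intro tendsto_intros)
  then have "((\<lambda>e. ennreal ((a + e) * (b + e))) \<longlongrightarrow> ennreal (a * b)) (at_right 0)"
    by (simp add: tendsto_ennrealI)
  moreover have "\<forall>\<^sub>F e in at_right 0. (\<integral>\<^sup>+x. ennreal (f x * g x) \<partial>M) \<le> ennreal ((a + e) * (b + e))"
    unfolding eventually_at_right_field using F G by (intro exI[of _ 1]) (auto intro!: *)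
  ultimately show ?thesis by (intro tendsto_lowerbound) auto
qed

text \<open>A function above \<open>c\<close> on all of \<open>S\<close> would have an integral
  strictly above \<open>c\<close> times the measure of \<open>S\<close>; strictness is where the
  positive and finite measure enters.\<close>

lemma exists_le_average:
  assumes [measurable]: "f \<in> borel_measurable M" "S \<in> sets M"
    and S: "emeasure M S \<noteq> 0" and c: "c \<noteq> \<infinity>"
    and le: "(\<integral>\<^sup>+x\<in>S. f x \<partial>M) \<le> c * emeasure M S" and fin: "emeasure M S \<noteq> \<infinity>"
  shows "\<exists>z\<in>S. f z \<le> c"
proof (rule ccontr)
  assume "\<not> ?thesis"
  then have gt: "c < f z" if "z \<in> S" for z using that by auto
  have "(\<integral>\<^sup>+x. c * indicator S x \<partial>M) < (\<integral>\<^sup>+x. f x * indicator S x \<partial>M)"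
  proof (rule nn_integral_less)
    show "(\<integral>\<^sup>+x. c * indicator S x \<partial>M) \<noteq> \<infinity>"
      using fin c by (simp add: nn_integral_cmult_indicator ennreal_mult_eq_top_iff)
    show "AE x in M. c * indicator S x \<le> f x * indicator S x"
      using gt by (auto simp: indicator_def less_imp_le)
    show "\<not> (AE x in M. f x * indicator S x \<le> c * indicator S x)"
    proof
      assume "AE x in M. f x * indicator S x \<le> c * indicator S x"
      then have "AE x in M. x \<notin> S" by eventually_elim (use gt in \<open>force simp: indicator_def not_less[symmetric] split: if_splits\<close>)
      then show False using S by (simp add: AE_iff_null_sets[symmetric] null_sets_def)
    qed
  qed auto
  then show False using le by (simp add: nn_integral_cmult_indicator)
qed

text \<open>The constant \<open>2 powr q\<close> is not sharp but valid for every
  \<open>q > 0\<close>. Convexity would fail for the exponent \<open>p - 1\<close>, which may lie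
  below 1.\<close>

lemma powr_add_le:
  assumes "0 \<le> (a::real)" "0 \<le> b" "0 < q"
  shows "(a + b) powr q \<le> 2 powr q * (a powr q + b powr q)"
proof -
  have "(a + b) powr q \<le> (2 * max a b) powr q" using assms by (intro powr_mono2) auto
  also have "\<dots> = 2 powr q * max a b powr q" using assms by (simp add: powr_mult)
  also have "\<dots> \<le> 2 powr q * (a powr q + b powr q)" by (intro mult_left_mono) (auto simp: max_def)
  finally show ?thesis .
qed

text \<open>A crude Young inequality: the product is at most the \<open>p\<close>-th power of the
  larger factor. Hole filling tolerates any constant here, so no small parameter is carried.\<close>

lemma powr_mult_le_add:
  assumes "0 \<le> (a::real)" "0 \<le> b" "1 < p"
  shows "a powr (p - 1) * b \<le> a powr p + b powr p"
proof (cases "a \<le> b")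
  case True
  then have "a powr (p - 1) * b \<le> b powr (p - 1) * b" using assms by (intro mult_right_mono powr_mono2) auto
  also have "\<dots> = b powr p" using assms by (cases "b = 0") (auto simp: powr_diff)
  finally show ?thesis by (smt (verit) powr_ge_zero)
next
  case False
  then have "a powr (p - 1) * b \<le> a powr (p - 1) * a" using assms by (intro mult_left_mono) auto
  also have "\<dots> = a powr p" using assms by (cases "a = 0") (auto simp: powr_diff)
  finally show ?thesis by (smt (verit) powr_ge_zero)
qed

section \<open>Hole filling for a pseudo-metric\<close>

text \<open>The constant of \<open>far_energy\<close>. The factor \<open>2 / unit_ball_vol n\<close>
  comes from dividing by the measure of the annulus, \<open>2 powr p\<close> from the triangle
  inequality raised to the power \<open>p\<close>, and the two summands from the two distances
  \<open>d z x\<close> and \<open>d z y\<close>.\<close>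

definition far_const :: "real \<Rightarrow> real \<Rightarrow> real \<Rightarrow> real" where
  "far_const n s p = 2 / unit_ball_vol n * 2 powr p *
    (2 powr (n + s * p) * kernel_const n s p + 4 powr (n + s * p) * unit_ball_vol n)"

text \<open>The constant of \<open>cutoff_energy\<close>. The 6 is the 3 of Young's inequality
  doubled by symmetry in \<open>x\<close> and \<open>y\<close>; \<open>2 + far_const n s p\<close>
  adds up the three kinds of pairs that meet or cross the annulus; the last summand pays for the
  deviation from the value at the good point.\<close>

definition hole_const :: "real \<Rightarrow> real \<Rightarrow> real \<Rightarrow> real" where
  "hole_const n s p = 6 * (2 + far_const n s p)
    + 4 * kernel_const n s p * (2 / unit_ball_vol n * 2 powr (n + s * p))"

text \<open>Lipschitz with slope \<open>4 / r\<close> instead of smooth. It is 1 up to radius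
  \<open>r / 2\<close> and already vanishes from radius \<open>3 * r / 4\<close> on, which leaves
  room for mollifying the test function inside the ball of radius \<open>r\<close>.\<close>

definition cutoff :: "'a::euclidean_space \<Rightarrow> real \<Rightarrow> 'a \<Rightarrow> real" where
  "cutoff c r x = max 0 (min 1 (3 - 4 * norm (x - c) / r))"

lemma cutoff_range: "0 \<le> cutoff c r x" "cutoff c r x \<le> 1"
  by (auto simp: cutoff_def)

lemma cutoff_eq_1: "0 < r \<Longrightarrow> x \<in> ball c (r / 2) \<Longrightarrow> cutoff c r x = 1"
  by (auto simp: cutoff_def dist_norm norm_minus_commute field_simps)

lemma cutoff_eq_0: "0 < r \<Longrightarrow> x \<notin> ball c (3 * r / 4) \<Longrightarrow> cutoff c r x = 0"
  by (auto simp: cutoff_def dist_norm norm_minus_commute field_simps)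

lemma cutoff_diff:
  assumes "0 < r"
  shows "\<bar>cutoff c r x - cutoff c r y\<bar> \<le> min 1 (4 * norm (x - y) / r)"
proof -
  have "\<bar>norm (x - c) - norm (y - c)\<bar> \<le> norm (x - y)"
    by (metis add_diff_cancel_right' diff_add_cancel norm_triangle_ineq3 diff_diff_eq2 diff_add_eq)
  then have "4 * \<bar>norm (x - c) - norm (y - c)\<bar> / r \<le> 4 * norm (x - y) / r"
    using assms by (intro divide_right_mono) auto
  moreover have "(3 - 4 * norm (x - c) / r) - (3 - 4 * norm (y - c) / r)
      = - (4 * (norm (x - c) - norm (y - c)) / r)"
    by (simp add: diff_divide_distrib)
  then have "\<bar>(3 - 4 * norm (x - c) / r) - (3 - 4 * norm (y - c) / r)\<bar>
      = 4 * \<bar>norm (x - c) - norm (y - c)\<bar> / r"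
    using assms by (metis abs_divide abs_minus_cancel abs_mult abs_numeral abs_of_pos)
  ultimately have "\<bar>(3 - 4 * norm (x - c) / r) - (3 - 4 * norm (y - c) / r)\<bar> \<le> 4 * norm (x - y) / r"
    by simp
  then show ?thesis unfolding cutoff_def by (simp add: max_def min_def abs_le_iff)
qed

lemma cutoff_measurable [measurable]: "cutoff c r \<in> borel_measurable borel"
  unfolding cutoff_def by measurable

abbreviation annulus :: "'a::metric_space \<Rightarrow> real \<Rightarrow> 'a set" where
  "annulus x r \<equiv> ball x r - ball x (r / 2)"

declare borel_open [OF open_ball, measurable]

text \<open>
  Only the pseudo-metric \<open>d x y = |u x - u y|\<close> enters the geometric part of the argument. The parameter
  \<open>dim\<close> is a locale parameter because a constant of the locale cannot mention \<open>'n\<close> alone.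
\<close>

locale gagliardo =
  fixes s p dim :: real and d :: "real ^ 'n::finite \<Rightarrow> real ^ 'n \<Rightarrow> real"
  assumes dim: "dim = real CARD('n)" and s: "0 < s" "s < 1" and p: "1 < p"
    and d_measurable': "case_prod d \<in> borel_measurable (borel \<Otimes>\<^sub>M borel)"
    and d_nonneg [simp]: "0 \<le> d x y"
    and d_sym: "d x y = d y x"
    and d_self [simp]: "d x x = 0"
    and d_triangle: "d x z \<le> d x y + d y z"
begin

abbreviation ex :: real where "ex \<equiv> dim + s * p"
abbreviation vol :: real where "vol \<equiv> unit_ball_vol dim"
abbreviation \<kappa> :: real where "\<kappa> \<equiv> kernel_const dim s p"

definition G :: "real ^ 'n \<Rightarrow> real ^ 'n \<Rightarrow> ennreal" where
  "G x y = ennreal (d x y powr p / norm (x - y) powr ex)"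

definition en :: "(real ^ 'n) set \<Rightarrow> (real ^ 'n) set \<Rightarrow> ennreal" where
  "en X Y = (\<integral>\<^sup>+x\<in>X. (\<integral>\<^sup>+y\<in>Y. G x y \<partial>lborel) \<partial>lborel)"

lemma d_measurable [measurable (raw)]:
  assumes "f \<in> borel_measurable M" "g \<in> borel_measurable M"
  shows "(\<lambda>x. d (f x) (g x)) \<in> borel_measurable M"
  using measurable_compose[OF measurable_Pair[OF assms] d_measurable'] by simp

lemma G_measurable [measurable (raw)]:
  assumes [measurable]: "f \<in> borel_measurable M" "g \<in> borel_measurable M"
  shows "(\<lambda>x. G (f x) (g x)) \<in> borel_measurable M"
  unfolding G_def by measurable

lemma G_measurable' [measurable]: "G x \<in> borel_measurable borel"
proof -
  have "(\<lambda>y. G x y) \<in> borel_measurable borel" by (rule G_measurable) simp_all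
  then show ?thesis .
qed

lemma d_measurable1 [measurable]: "d x \<in> borel_measurable borel"
proof -
  have "(\<lambda>y. d x y) \<in> borel_measurable borel" by (rule d_measurable) simp_all
  then show ?thesis .
qed

lemma G_sym: "G x y = G y x"
  by (simp add: G_def d_sym[of x y] norm_minus_commute)

lemma dim_ge_1: "1 \<le> dim" by (simp add: dim Suc_leI)

lemma emeasure_ball: "0 < r \<Longrightarrow> emeasure lborel (ball x r :: (real ^ 'n) set) = ennreal (vol * r powr dim)"
  by (simp add: emeasure_ball_powr dim)

lemma vol_pos: "0 < vol" and \<kappa>_pos: "0 < \<kappa>" and sp_pos: "0 < s * p" and ex_pos: "0 < ex"
  using s p dim_ge_1 by (auto intro!: kernel_const_pos add_pos_pos)

lemma far_const_nonneg: "0 \<le> far_const dim s p"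
  using vol_pos \<kappa>_pos by (simp add: far_const_def)

lemma hole_const_nonneg: "0 \<le> hole_const dim s p"
  using vol_pos \<kappa>_pos far_const_nonneg by (simp add: hole_const_def)

text \<open>For points at distance at most \<open>\<rho>\<close> the kernel is at least
  \<open>\<rho> powr (- ex)\<close>. This inequality is the source of all Poincare type bounds
  below.\<close>

lemma d_powr_le: 
  assumes "norm (x - y) \<le> \<rho>"
  shows "ennreal (d x y powr p) \<le> ennreal (\<rho> powr ex) * G x y"
proof (cases "x = y")
  case False
  have "d x y powr p = norm (x - y) powr ex * (d x y powr p / norm (x - y) powr ex)"
    using False by simp
  also have "\<dots> \<le> \<rho> powr ex * (d x y powr p / norm (x - y) powr ex)"
    using assms ex_pos by (intro mult_right_mono powr_mono2) auto
  finally show ?thesis by (simp add: G_def ennreal_mult[symmetric] ennreal_leI)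
qed simp

lemma en_commute:
  assumes [measurable]: "X \<in> sets borel" "Y \<in> sets borel"
  shows "en X Y = en Y X"
proof -
  have "en X Y = (\<integral>\<^sup>+x. (\<integral>\<^sup>+y. G x y * indicator Y y * indicator X x \<partial>lborel) \<partial>lborel)"
    unfolding en_def by (subst nn_integral_multc) auto
  also have "\<dots> = (\<integral>\<^sup>+y. (\<integral>\<^sup>+x. G x y * indicator Y y * indicator X x \<partial>lborel) \<partial>lborel)"
    by (rule lborel_pair.Fubini') measurable
  also have "\<dots> = en Y X"
    unfolding en_def by (subst nn_integral_multc[symmetric]) (auto simp: G_sym mult_ac intro!: nn_integral_cong)
  finally show ?thesis .
qed

lemma en_mono: "X \<subseteq> X' \<Longrightarrow> Y \<subseteq> Y' \<Longrightarrow> en X Y \<le> en X' Y'"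
  unfolding en_def by (intro nn_integral_mono mult_mono) (auto simp: indicator_def)

lemma en_Un:
  assumes [measurable]: "X \<in> sets borel" "X' \<in> sets borel" "Y \<in> sets borel" and "X \<inter> X' = {}"
  shows "en (X \<union> X') Y = en X Y + en X' Y"
proof -
  have "indicator (X \<union> X') x = indicator X x + (indicator X' x :: ennreal)" for x
    using assms(4) by (auto simp: indicator_def)
  then show ?thesis unfolding en_def by (simp add: distrib_left nn_integral_add)
qed

text \<open>Replacing averages of \<open>u\<close> by values at well chosen points avoids Jensen's inequality.\<close>

lemma exists_average_point:
  assumes [measurable]: "X \<in> sets borel" "Z \<in> sets borel"
    and m: "0 < m" "ennreal m \<le> emeasure lborel Z" "emeasure lborel Z \<noteq> \<infinity>"
    and \<rho>: "\<And>x z. x \<in> X \<Longrightarrow> z \<in> Z \<Longrightarrow> norm (z - x) \<le> \<rho>"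
  shows "\<exists>z\<in>Z. (\<integral>\<^sup>+x\<in>X. ennreal (d z x powr p) \<partial>lborel) \<le> ennreal (\<rho> powr ex / m) * en Z X"
proof (cases "en Z X = \<infinity>")
  case True
  have "emeasure lborel Z \<noteq> 0" using m by auto
  then obtain z where "z \<in> Z" by fastforce
  moreover have "\<rho> powr ex / m > 0 \<or> X = {}"
  \<comment> \<open>With infinite energy the claim is trivial unless the factor is 0. For
    \<open>\<rho> = 0\<close> the set \<open>X\<close> lies in a single point, and the energy would
    vanish.\<close>
  proof (cases "\<rho> = 0")
    case t: True
    have "X \<subseteq> {z}" using \<rho> \<open>z \<in> Z\<close> t by fastforce
    then have "emeasure lborel X = 0" using emeasure_mono[of X "{z}" lborel] by simp
    then have "en X Z = 0" unfolding en_def by (simp add: nn_integral_null_set null_setsI)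
    then show ?thesis using True by (simp add: en_commute)
  next
    case False then show ?thesis using m by (simp add: powr_gt_zero)
  qed
  ultimately show ?thesis using True by (intro bexI[of _ z]) (auto simp: ennreal_mult_top)
next
  case False
  have "(\<integral>\<^sup>+z\<in>Z. (\<integral>\<^sup>+x\<in>X. ennreal (d z x powr p) \<partial>lborel) \<partial>lborel)
    \<le> (\<integral>\<^sup>+z\<in>Z. ennreal (\<rho> powr ex) * (\<integral>\<^sup>+x\<in>X. G z x \<partial>lborel) \<partial>lborel)"
  proof (intro nn_integral_mono)
    fix z
    show "(\<integral>\<^sup>+x\<in>X. ennreal (d z x powr p) \<partial>lborel) * indicator Z z
       \<le> ennreal (\<rho> powr ex) * (\<integral>\<^sup>+x\<in>X. G z x \<partial>lborel) * indicator Z z"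
      using \<rho> by (subst nn_integral_cmult[symmetric])
        (auto simp: indicator_def intro!: nn_integral_mono d_powr_le)
  qed
  also have "\<dots> = ennreal (\<rho> powr ex) * en Z X"
    unfolding en_def by (subst nn_integral_cmult[symmetric]) (auto simp: mult_ac)
  also have "\<dots> = ennreal (\<rho> powr ex / m) * en Z X * ennreal m"
    using m by (simp add: mult.assoc mult.commute[of _ "ennreal m"]) (simp add: mult.assoc[symmetric] ennreal_mult[symmetric])
  also have "\<dots> \<le> ennreal (\<rho> powr ex / m) * en Z X * emeasure lborel Z"
    using m by (intro mult_left_mono) auto
  finally show ?thesis using m False
    by (intro exists_le_average) (auto simp: ennreal_mult_eq_top_iff)
qed

lemma kernel_integral':
  fixes x :: "real ^ 'n"
  assumes "0 < r"
  shows "(\<integral>\<^sup>+y. ennreal (min 1 (4 * norm (x - y) / r) powr p / norm (x - y) powr ex) \<partial>lborel)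
    \<le> ennreal (\<kappa> * r powr (- (s * p)))"
  using kernel_integral[OF s _ assms, of p x] p by (simp add: dim)

section \<open>Energies on one ball, its inner half and the annulus between them\<close>

context
  fixes x1 :: "real ^ 'n" and r :: real and A :: "(real ^ 'n) set"
  assumes r: "0 < r" and A [measurable]: "A \<in> sets borel" and BA: "ball x1 r \<subseteq> A"
begin

text \<open>Since \<open>dim \<ge> 1\<close>, the ball of half the radius has at most half the
  volume, and the annulus keeps the rest.\<close>

lemma annulus_measure: "ennreal (vol * r powr dim / 2) \<le> emeasure lborel (annulus x1 r)" "emeasure lborel (annulus x1 r) \<noteq> \<infinity>"
proof -
  have "emeasure lborel (annulus x1 r) = emeasure lborel (ball x1 r) - emeasure lborel (ball x1 (r / 2))"
    using r by (intro emeasure_Diff) (auto simp: emeasure_ball)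
  also have "\<dots> = ennreal (vol * r powr dim - vol * (r / 2) powr dim)"
    using r vol_pos by (simp add: emeasure_ball ennreal_minus)
  finally have e: "emeasure lborel (annulus x1 r) = ennreal (vol * r powr dim - vol * (r / 2) powr dim)" .
  have "2 powr 1 \<le> 2 powr dim" using dim_ge_1 by (intro powr_mono) auto
  then have "(r / 2) powr dim \<le> r powr dim / 2"
    using r by (simp add: powr_divide field_simps)
  then have "vol * (r / 2) powr dim \<le> vol * (r powr dim / 2)" using vol_pos by (intro mult_left_mono) auto
  then show "ennreal (vol * r powr dim / 2) \<le> emeasure lborel (annulus x1 r)" unfolding e by (intro ennreal_leI) auto
  show "emeasure lborel (annulus x1 r) \<noteq> \<infinity>" unfolding e by simp
qed

text \<open>The triangle inequality through \<open>z\<close>. The term \<open>d z y\<close> finds a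
  comparable kernel, as \<open>norm (z - y) \<le> 4 * norm (x - y)\<close>; the term
  \<open>d z x\<close> keeps the kernel in \<open>x - y\<close>, which is later integrated over
  \<open>y\<close>. Here \<open>norm (x - y) \<ge> r / 2\<close>, so the minimum equals 1 and is
  inserted to match \<open>kernel_integral\<close>.\<close>

lemma far_pointwise:
  assumes x: "x \<in> (ball x1 (r / 2))" and y: "y \<notin> (ball x1 r)" and z: "z \<in> (annulus x1 r)"
  shows "G x y \<le> ennreal (2 powr p * (2 * r) powr ex) * G z x *
        ennreal (min 1 (4 * norm (x - y) / r) powr p / norm (x - y) powr ex)
      + ennreal (2 powr p * 4 powr ex) * G z y"
proof -
  have xy: "r / 2 \<le> norm (x - y)"
    using x y norm_triangle_ineq4[of "x - y" "x - x1"] norm_minus_commute[of y x1] norm_minus_commute[of x x1]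
    by (auto simp: dist_norm not_less algebra_simps)
  have xz: "norm (z - x) \<le> 3 * r / 2"
    using x z norm_triangle_ineq4[of "z - x1" "x - x1"]
    by (auto simp: dist_norm norm_minus_commute)
  have zy: "norm (z - y) \<le> 4 * norm (x - y)"
    using norm_triangle_ineq[of "z - x" "x - y"] xy xz by simp
  have zy0: "0 < norm (z - y)" using z y by auto
  have xy0: "0 < norm (x - y)" using xy r by linarith
  have m1: "min 1 (4 * norm (x - y) / r) = 1" using xy r by (simp add: min_def field_simps)
  have "d x y powr p \<le> (d z x + d z y) powr p"
    using d_triangle[of x y z] p by (intro powr_mono2) (auto simp: d_sym)
  also have "\<dots> \<le> 2 powr p * (d z x powr p + d z y powr p)" using p by (intro powr_add_le) auto
  finally have 1: "d x y powr p \<le> 2 powr p * (d z x powr p + d z y powr p)" .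
  have 2: "d z y powr p / norm (x - y) powr ex \<le> 4 powr ex * (d z y powr p / norm (z - y) powr ex)"
  proof -
    have "norm (z - y) powr ex \<le> (4 * norm (x - y)) powr ex" using zy ex_pos by (intro powr_mono2) auto
    also have "\<dots> = 4 powr ex * norm (x - y) powr ex" by (simp add: powr_mult)
    finally show ?thesis using xy0 zy0 by (simp add: field_simps mult_left_mono)
  qed
  have 3: "ennreal (d z x powr p) \<le> ennreal ((2 * r) powr ex) * G z x"
    using xz r by (intro d_powr_le) auto
  have "G x y \<le> ennreal (2 powr p * (d z x powr p + d z y powr p) / norm (x - y) powr ex)"
    unfolding G_def by (intro ennreal_leI divide_right_mono 1) auto
  also have "\<dots> = ennreal (2 powr p) * ennreal (d z x powr p) * ennreal (1 / norm (x - y) powr ex)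
     + ennreal (2 powr p) * ennreal (d z y powr p / norm (x - y) powr ex)"
    by (simp add: ennreal_mult[symmetric] ennreal_plus[symmetric] del: ennreal_plus)
      (simp add: algebra_simps add_divide_distrib)
  also have "\<dots> \<le> ennreal (2 powr p) * (ennreal ((2 * r) powr ex) * G z x) * ennreal (1 / norm (x - y) powr ex)
     + ennreal (2 powr p) * ennreal (4 powr ex * (d z y powr p / norm (z - y) powr ex))"
    by (intro add_mono mult_mono 3 ennreal_leI 2 order_refl) auto
  also have "\<dots> = ennreal (2 powr p * (2 * r) powr ex) * G z x *
        ennreal (min 1 (4 * norm (x - y) / r) powr p / norm (x - y) powr ex)
      + ennreal (2 powr p * 4 powr ex) * G z y"
    unfolding m1 by (simp add: G_def ennreal_mult[symmetric] mult_ac)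
  finally show ?thesis .
qed

text \<open>Integrating \<open>far_pointwise\<close> over \<open>z\<close> in the annulus gives two
  factors of order \<open>r powr dim\<close>: \<open>(2 * r) powr ex\<close> times the kernel
  integral over \<open>y\<close>, and the volume of the ball in which \<open>x\<close> varies. The
  measure of the annulus is of the same order, so the powers of \<open>r\<close> cancel.\<close>

lemma far_energy: "en (ball x1 (r / 2)) (A - (ball x1 r)) \<le> ennreal (far_const dim s p) * en (annulus x1 r) A"
proof -
  define c1 where "c1 = 2 powr p * (2 * r) powr ex"
  define c2 where "c2 = 2 powr p * 4 powr ex"
  define k where "k = (\<lambda>(x :: real ^ 'n) (y :: real ^ 'n). ennreal (min 1 (4 * norm (x - y) / r) powr p / norm (x - y) powr ex))"
  define I where "I = ennreal (\<kappa> * r powr (- (s * p)))"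
  have km [measurable (raw)]: "(\<lambda>t. k (f t) (g t)) \<in> borel_measurable M"
    if [measurable]: "f \<in> borel_measurable M" "g \<in> borel_measurable M" for f g and M :: "'m measure"
    unfolding k_def by measurable
  have k1 [measurable]: "k x \<in> borel_measurable borel" for x
    unfolding k_def by measurable
  have kI: "(\<integral>\<^sup>+y. k x y \<partial>lborel) \<le> I" for x
    unfolding k_def I_def by (rule kernel_integral'[OF r])
  have fixz: "en (ball x1 (r / 2)) (A - (ball x1 r)) \<le> ennreal c1 * I * (\<integral>\<^sup>+x\<in>(ball x1 (r / 2)). G z x \<partial>lborel)
      + ennreal c2 * (\<integral>\<^sup>+y\<in>A - (ball x1 r). G z y \<partial>lborel) * emeasure lborel (ball x1 (r / 2))" if z: "z \<in> (annulus x1 r)" for z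
  proof -
    have "en (ball x1 (r / 2)) (A - (ball x1 r)) \<le> (\<integral>\<^sup>+x\<in>(ball x1 (r / 2)). (ennreal c1 * I * G z x
        + ennreal c2 * (\<integral>\<^sup>+y\<in>A - (ball x1 r). G z y \<partial>lborel)) \<partial>lborel)"
      unfolding en_def
    proof (intro nn_integral_mono)
      fix x
      show "(\<integral>\<^sup>+y\<in>A - (ball x1 r). G x y \<partial>lborel) * indicator (ball x1 (r / 2)) x \<le>
         (ennreal c1 * I * G z x + ennreal c2 * (\<integral>\<^sup>+y\<in>A - (ball x1 r). G z y \<partial>lborel)) * indicator (ball x1 (r / 2)) x"
      proof (cases "x \<in> (ball x1 (r / 2))")
        case True
        have "(\<integral>\<^sup>+y\<in>A - (ball x1 r). G x y \<partial>lborel) \<le>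
           (\<integral>\<^sup>+y. ennreal c1 * G z x * k x y + ennreal c2 * (G z y * indicator (A - (ball x1 r)) y) \<partial>lborel)"
          using far_pointwise[OF True _ z] unfolding c1_def c2_def k_def
          by (intro nn_integral_mono) (auto simp: indicator_def)
        also have "\<dots> = (\<integral>\<^sup>+y. ennreal c1 * G z x * k x y \<partial>lborel)
            + (\<integral>\<^sup>+y. ennreal c2 * (G z y * indicator (A - (ball x1 r)) y) \<partial>lborel)"
          by (rule nn_integral_add) measurable
        also have "\<dots> = ennreal c1 * G z x * (\<integral>\<^sup>+y. k x y \<partial>lborel)
            + ennreal c2 * (\<integral>\<^sup>+y\<in>A - (ball x1 r). G z y \<partial>lborel)"
          by (subst (1 2) nn_integral_cmult) auto
        also have "\<dots> \<le> ennreal c1 * G z x * I + ennreal c2 * (\<integral>\<^sup>+y\<in>A - (ball x1 r). G z y \<partial>lborel)"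
          by (intro add_mono mult_left_mono kI) auto
        finally show ?thesis using True by (simp add: mult_ac)
      qed simp
    qed
    also have "\<dots> = ennreal c1 * I * (\<integral>\<^sup>+x\<in>(ball x1 (r / 2)). G z x \<partial>lborel)
      + ennreal c2 * (\<integral>\<^sup>+y\<in>A - (ball x1 r). G z y \<partial>lborel) * emeasure lborel (ball x1 (r / 2))"
      by (simp add: distrib_right nn_integral_add nn_integral_cmult_indicator mult.assoc nn_integral_cmult)
    finally show ?thesis .
  qed
  have "en (ball x1 (r / 2)) (A - (ball x1 r)) * ennreal (vol * r powr dim / 2) \<le> en (ball x1 (r / 2)) (A - (ball x1 r)) * emeasure lborel (annulus x1 r)"
    by (intro mult_left_mono annulus_measure) auto
  also have "\<dots> = (\<integral>\<^sup>+z\<in>(annulus x1 r). en (ball x1 (r / 2)) (A - (ball x1 r)) \<partial>lborel)" by (simp add: nn_integral_cmult_indicator)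
  also have "\<dots> \<le> (\<integral>\<^sup>+z\<in>(annulus x1 r). (ennreal c1 * I * (\<integral>\<^sup>+x\<in>(ball x1 (r / 2)). G z x \<partial>lborel)
      + ennreal c2 * emeasure lborel (ball x1 (r / 2)) * (\<integral>\<^sup>+y\<in>A - (ball x1 r). G z y \<partial>lborel)) \<partial>lborel)"
    using fixz by (intro nn_integral_mono) (auto simp: indicator_def mult_ac)
  also have "\<dots> = ennreal c1 * I * en (annulus x1 r) (ball x1 (r / 2)) + ennreal c2 * emeasure lborel (ball x1 (r / 2)) * en (annulus x1 r) (A - (ball x1 r))"
    unfolding en_def by (simp add: distrib_right nn_integral_add nn_integral_cmult mult.assoc)
  also have "\<dots> \<le> ennreal c1 * I * en (annulus x1 r) A + ennreal c2 * emeasure lborel (ball x1 r) * en (annulus x1 r) A"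
    using BA r by (intro add_mono mult_left_mono mult_mono en_mono emeasure_mono) auto
  also have "\<dots> = ennreal (c1 * (\<kappa> * r powr (- (s * p))) + c2 * (vol * r powr dim)) * en (annulus x1 r) A"
    using r vol_pos \<kappa>_pos unfolding I_def
    by (simp add: emeasure_ball c1_def c2_def ennreal_mult[symmetric] distrib_right[symmetric] ennreal_plus[symmetric]
        del: ennreal_plus)
  also have "c1 * (\<kappa> * r powr (- (s * p))) + c2 * (vol * r powr dim)
      = far_const dim s p * (vol * r powr dim / 2)"
  proof -
    have "(2 * r) powr ex * r powr (- (s * p)) = 2 powr ex * (r powr ex * r powr (- (s * p)))"
      using r by (simp add: powr_mult)
    also have "r powr ex * r powr (- (s * p)) = r powr dim" by (simp flip: powr_add)
    finally have e: "(2 * r) powr ex * r powr (- (s * p)) = 2 powr ex * r powr dim" .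
    have "c1 * (\<kappa> * r powr (- (s * p))) = 2 powr p * \<kappa> * ((2 * r) powr ex * r powr (- (s * p)))"
      by (simp add: c1_def)
    then have "c1 * (\<kappa> * r powr (- (s * p))) = 2 powr p * \<kappa> * (2 powr ex * r powr dim)" unfolding e .
    then show ?thesis unfolding far_const_def c2_def using vol_pos by (simp add: field_simps)
  qed
  finally have "en (ball x1 (r / 2)) (A - (ball x1 r)) * ennreal (vol * r powr dim / 2)
     \<le> ennreal (far_const dim s p) * en (annulus x1 r) A * ennreal (vol * r powr dim / 2)"
    using r vol_pos \<kappa>_pos by (simp only: ennreal_mult' far_const_nonneg mult_ac)
  then show ?thesis using vol_pos r
    by (simp add: mult.commute[of _ "ennreal (vol * r powr dim / 2)"] ennreal_mult_le_mult_iff)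
qed

text \<open>This is the error made by testing with the cutoff. Its integrand vanishes where the
  cutoff agrees at \<open>x\<close> and \<open>y\<close>, so pairs inside the inner ball drop out:
  that is the hole. Young's inequality splits the rest into \<open>d x y powr p\<close> on pairs
  that meet or cross the annulus, and \<open>d z x powr p\<close> times the kernel, which the choice
  of \<open>z\<close> controls.\<close>

lemma cutoff_energy:
  assumes z: "z \<in> (annulus x1 r)"
    and zP: "(\<integral>\<^sup>+x\<in>(ball x1 r). ennreal (d z x powr p) \<partial>lborel)
      \<le> ennreal (2 / vol * 2 powr ex * r powr (s * p)) * en (annulus x1 r) (ball x1 r)"
  shows "(\<integral>\<^sup>+x\<in>A. (\<integral>\<^sup>+y\<in>A. ennreal (\<bar>cutoff x1 r x - cutoff x1 r y\<bar> * d x y powr (p - 1) * (d z x + d z y)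
      / norm (x - y) powr ex) \<partial>lborel) \<partial>lborel) \<le> ennreal (hole_const dim s p) * en (annulus x1 r) A"
proof -
  define Q where "Q = (\<lambda>x y. ennreal (\<bar>cutoff x1 r x - cutoff x1 r y\<bar> * d x y powr (p - 1) * (d z x + d z y)
      / norm (x - y) powr ex))"
  have Qm [measurable (raw)]: "(\<lambda>t. Q (f t) (g t)) \<in> borel_measurable M"
    if [measurable]: "f \<in> borel_measurable M" "g \<in> borel_measurable M" for f g and M :: "'m measure"
    unfolding Q_def by measurable
  have Q1 [measurable]: "Q x \<in> borel_measurable borel" for x
    unfolding Q_def by measurable
  have Qsym: "Q x y = Q y x" for x y
    by (simp add: Q_def d_sym[of x y] norm_minus_commute[of x y] abs_minus_commute add.commute)
  define k where "k = (\<lambda>(x :: real ^ 'n) (y :: real ^ 'n). ennreal (min 1 (4 * norm (x - y) / r) powr p / norm (x - y) powr ex))"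
  have km [measurable (raw)]: "(\<lambda>t. k (f t) (g t)) \<in> borel_measurable M"
    if [measurable]: "f \<in> borel_measurable M" "g \<in> borel_measurable M" for f g and M :: "'m measure"
    unfolding k_def by measurable
  have k1 [measurable]: "k x \<in> borel_measurable borel" for x
    unfolding k_def by measurable
  define I where "I = ennreal (\<kappa> * r powr (- (s * p)))"
  have kI: "(\<integral>\<^sup>+y. k x y \<partial>lborel) \<le> I" for x
    unfolding k_def I_def by (rule kernel_integral'[OF r])
  define J where "J = (\<lambda>x y. G x y * (indicator (annulus x1 r) x * indicator A y + indicator (ball x1 (r / 2)) x * indicator (annulus x1 r) y
      + indicator (ball x1 (r / 2)) x * indicator (A - (ball x1 r)) y))"
  have pw: "Q x y * indicator A y * indicator (ball x1 r) x \<le>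
      3 * J x y + 2 * (ennreal (d z x powr p) * indicator (ball x1 r) x) * k x y" for x y
  proof (cases "x \<in> (ball x1 r) \<and> y \<in> A \<and> cutoff x1 r x \<noteq> cutoff x1 r y")
    case True
    define e where "e = \<bar>cutoff x1 r x - cutoff x1 r y\<bar>"
    have e: "0 \<le> e" "e \<le> min 1 (4 * norm (x - y) / r)" using cutoff_diff[OF r] by (auto simp: e_def)
    have nb: "\<not> (x \<in> (ball x1 (r / 2)) \<and> y \<in> (ball x1 (r / 2)))" using True cutoff_eq_1[OF r, of x x1] cutoff_eq_1[OF r, of y x1] by metis
    have "(ball x1 (r / 2)) \<subseteq> (ball x1 r)" using r by auto
    then have ind: "1 \<le> indicator (annulus x1 r) x * indicator A y + indicator (ball x1 (r / 2)) x * indicator (annulus x1 r) y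
      + indicator (ball x1 (r / 2)) x * (indicator (A - (ball x1 r)) y :: ennreal)"
      using nb True by (auto simp: indicator_def)
    have "G x y * 1 \<le> J x y" unfolding J_def using ind by (intro mult_left_mono) auto
    then have GJ: "G x y \<le> J x y" by simp
    \<comment> \<open>The deviation from \<open>z\<close> is moved to \<open>x\<close>, the point
      known to lie in the ball; \<open>zP\<close> says nothing about a \<open>y\<close> outside
      it.\<close>
    have t: "d z y \<le> d z x + d x y" by (rule d_triangle)
    have "e * d x y powr (p - 1) * (d z x + d z y) \<le> e * d x y powr (p - 1) * (2 * d z x + d x y)"
      using t e by (intro mult_left_mono) auto
    also have "\<dots> = 2 * (d x y powr (p - 1) * (e * d z x)) + e * (d x y powr (p - 1) * d x y)"
      by (simp add: algebra_simps)
    also have "d x y powr (p - 1) * d x y = d x y powr p"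
      using p by (cases "d x y = 0") (auto simp: powr_diff)
    also have "2 * (d x y powr (p - 1) * (e * d z x)) + e * d x y powr p
      \<le> 2 * (d x y powr p + (e * d z x) powr p) + 1 * d x y powr p"
      using e p by (intro add_mono mult_left_mono powr_mult_le_add mult_right_mono) auto
    also have "(e * d z x) powr p \<le> (min 1 (4 * norm (x - y) / r) * d z x) powr p"
      using e p by (intro powr_mono2 mult_right_mono) auto
    also have "\<dots> = min 1 (4 * norm (x - y) / r) powr p * d z x powr p"
      using r by (simp add: powr_mult)
    finally have "e * d x y powr (p - 1) * (d z x + d z y)
      \<le> 3 * d x y powr p + 2 * d z x powr p * min 1 (4 * norm (x - y) / r) powr p"
      by (simp add: mult_ac)
    then have "e * d x y powr (p - 1) * (d z x + d z y) / norm (x - y) powr ex \<le>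
       (3 * d x y powr p + 2 * d z x powr p * min 1 (4 * norm (x - y) / r) powr p) / norm (x - y) powr ex"
      by (intro divide_right_mono) auto
    also have "\<dots> = 3 * (d x y powr p / norm (x - y) powr ex)
       + 2 * d z x powr p * (min 1 (4 * norm (x - y) / r) powr p / norm (x - y) powr ex)"
      by (simp add: add_divide_distrib)
    finally have "Q x y \<le> ennreal (3 * (d x y powr p / norm (x - y) powr ex)
       + 2 * d z x powr p * (min 1 (4 * norm (x - y) / r) powr p / norm (x - y) powr ex))"
      unfolding Q_def e_def[symmetric] by (rule ennreal_leI)
    also have "\<dots> = 3 * G x y + 2 * ennreal (d z x powr p) * k x y"
    proof -
      have *: "ennreal (3 * a + 2 * b * c) = 3 * ennreal a + 2 * ennreal b * ennreal c"
        if "0 \<le> a" "0 \<le> b" "0 \<le> c" for a b c using that by (simp add: ennreal_mult)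
      show ?thesis unfolding G_def k_def by (rule *) auto
    qed
    also have "\<dots> \<le> 3 * J x y + 2 * ennreal (d z x powr p) * k x y"
      by (intro add_mono mult_left_mono GJ) auto
    finally show ?thesis using True by simp
  next
    case False
    then have "Q x y * indicator A y * indicator (ball x1 r) x = 0" by (auto simp: Q_def indicator_def)
    then show ?thesis by (simp only: zero_le)
  qed
  have Jm [measurable (raw)]: "(\<lambda>t. J (f t) (g t)) \<in> borel_measurable M"
    if [measurable]: "f \<in> borel_measurable M" "g \<in> borel_measurable M" for f g and M :: "'m measure"
    unfolding J_def by measurable
  have J1 [measurable]: "J x \<in> borel_measurable borel" for x
    unfolding J_def by measurable
  have "(\<integral>\<^sup>+x. (\<integral>\<^sup>+y. J x y \<partial>lborel) \<partial>lborel) = en (annulus x1 r) A + en (ball x1 (r / 2)) (annulus x1 r) + en (ball x1 (r / 2)) (A - (ball x1 r))"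
  proof -
    have "(\<integral>\<^sup>+y. J x y \<partial>lborel) = (\<integral>\<^sup>+y\<in>A. G x y \<partial>lborel) * indicator (annulus x1 r) x
        + (\<integral>\<^sup>+y\<in>(annulus x1 r). G x y \<partial>lborel) * indicator (ball x1 (r / 2)) x + (\<integral>\<^sup>+y\<in>A - (ball x1 r). G x y \<partial>lborel) * indicator (ball x1 (r / 2)) x" for x
    proof -
      have "(\<integral>\<^sup>+y. J x y \<partial>lborel) = (\<integral>\<^sup>+y. G x y * indicator A y * indicator (annulus x1 r) x + G x y * indicator (annulus x1 r) y * indicator (ball x1 (r / 2)) x
          + G x y * indicator (A - (ball x1 r)) y * indicator (ball x1 (r / 2)) x \<partial>lborel)"
        unfolding J_def by (simp add: distrib_left mult_ac)
      also have "\<dots> = (\<integral>\<^sup>+y. G x y * indicator A y * indicator (annulus x1 r) x + G x y * indicator (annulus x1 r) y * indicator (ball x1 (r / 2)) x \<partial>lborel)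
          + (\<integral>\<^sup>+y. G x y * indicator (A - (ball x1 r)) y * indicator (ball x1 (r / 2)) x \<partial>lborel)"
        by (rule nn_integral_add) measurable
      also have "(\<integral>\<^sup>+y. G x y * indicator A y * indicator (annulus x1 r) x + G x y * indicator (annulus x1 r) y * indicator (ball x1 (r / 2)) x \<partial>lborel)
         = (\<integral>\<^sup>+y. G x y * indicator A y * indicator (annulus x1 r) x \<partial>lborel) + (\<integral>\<^sup>+y. G x y * indicator (annulus x1 r) y * indicator (ball x1 (r / 2)) x \<partial>lborel)"
        by (rule nn_integral_add) measurable
      finally show ?thesis by (simp add: nn_integral_multc)
    qed
    then show ?thesis unfolding en_def by (simp add: nn_integral_add)
  qed
  also have "\<dots> \<le> en (annulus x1 r) A + en (annulus x1 r) A + ennreal (far_const dim s p) * en (annulus x1 r) A"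
  proof (intro add_mono far_energy)
    have "en (ball x1 (r / 2)) (annulus x1 r) = en (annulus x1 r) (ball x1 (r / 2))" by (rule en_commute) auto
    also have "\<dots> \<le> en (annulus x1 r) A" using BA r by (intro en_mono) auto
    finally show "en (ball x1 (r / 2)) (annulus x1 r) \<le> en (annulus x1 r) A" .
  qed auto
  also have "\<dots> = ennreal (2 + far_const dim s p) * en (annulus x1 r) A"
    using far_const_nonneg by (simp add: ennreal_plus distrib_right mult_2)
  finally have JJ: "(\<integral>\<^sup>+x. (\<integral>\<^sup>+y. J x y \<partial>lborel) \<partial>lborel) \<le> ennreal (2 + far_const dim s p) * en (annulus x1 r) A" .
  have S: "(\<integral>\<^sup>+x. (\<integral>\<^sup>+y. Q x y * indicator A y * indicator (ball x1 r) x \<partial>lborel) \<partial>lborel)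
     \<le> ennreal (hole_const dim s p / 2) * en (annulus x1 r) A"
  proof -
    have "(\<integral>\<^sup>+x. (\<integral>\<^sup>+y. Q x y * indicator A y * indicator (ball x1 r) x \<partial>lborel) \<partial>lborel)
      \<le> (\<integral>\<^sup>+x. (\<integral>\<^sup>+y. 3 * J x y + 2 * (ennreal (d z x powr p) * indicator (ball x1 r) x) * k x y \<partial>lborel) \<partial>lborel)"
      by (intro nn_integral_mono pw)
    also have "\<dots> = (\<integral>\<^sup>+x. 3 * (\<integral>\<^sup>+y. J x y \<partial>lborel) + 2 * (ennreal (d z x powr p) * indicator (ball x1 r) x) * (\<integral>\<^sup>+y. k x y \<partial>lborel) \<partial>lborel)"
      by (simp add: nn_integral_add nn_integral_cmult)
    also have "\<dots> \<le> (\<integral>\<^sup>+x. 3 * (\<integral>\<^sup>+y. J x y \<partial>lborel) + 2 * I * (ennreal (d z x powr p) * indicator (ball x1 r) x) \<partial>lborel)"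
    proof (intro nn_integral_mono add_mono order_refl)
      fix x
      have "2 * (ennreal (d z x powr p) * indicator (ball x1 r) x) * (\<integral>\<^sup>+y. k x y \<partial>lborel)
        \<le> 2 * (ennreal (d z x powr p) * indicator (ball x1 r) x) * I" by (intro mult_left_mono kI) auto
      then show "2 * (ennreal (d z x powr p) * indicator (ball x1 r) x) * (\<integral>\<^sup>+y. k x y \<partial>lborel)
        \<le> 2 * I * (ennreal (d z x powr p) * indicator (ball x1 r) x)" by (simp only: mult_ac)
    qed
    also have "\<dots> = 3 * (\<integral>\<^sup>+x. (\<integral>\<^sup>+y. J x y \<partial>lborel) \<partial>lborel) + 2 * I * (\<integral>\<^sup>+x\<in>(ball x1 r). ennreal (d z x powr p) \<partial>lborel)"
      by (simp add: nn_integral_add nn_integral_cmult)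
    also have "\<dots> \<le> 3 * (ennreal (2 + far_const dim s p) * en (annulus x1 r) A)
        + 2 * I * (ennreal (2 / vol * 2 powr ex * r powr (s * p)) * en (annulus x1 r) A)"
      by (intro add_mono mult_left_mono JJ order.trans[OF zP] en_mono BA) auto
    also have "\<dots> = ennreal (hole_const dim s p / 2) * en (annulus x1 r) A"
    proof -
      have "2 * I * ennreal (2 / vol * 2 powr ex * r powr (s * p))
          = ennreal (2 * (\<kappa> * r powr (- (s * p))) * (2 / vol * 2 powr ex * r powr (s * p)))"
      proof -
        have *: "2 * ennreal a * ennreal b = ennreal (2 * a * b)" if "0 \<le> a" "0 \<le> b" for a b
          using that by (simp add: ennreal_mult)
        show ?thesis unfolding I_def using \<kappa>_pos vol_pos by (intro *) auto
      qed
      also have "2 * (\<kappa> * r powr (- (s * p))) * (2 / vol * 2 powr ex * r powr (s * p))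
          = 2 * \<kappa> * (2 / vol * 2 powr ex) * (r powr (- (s * p)) * r powr (s * p))" by (simp add: mult_ac)
      also have "r powr (- (s * p)) * r powr (s * p) = 1" using r by (simp flip: powr_add)
      finally have 1: "2 * I * ennreal (2 / vol * 2 powr ex * r powr (s * p)) = ennreal (2 * \<kappa> * (2 / vol * 2 powr ex))"
        by simp
      have 2: "3 * ennreal (2 + far_const dim s p) = ennreal (3 * (2 + far_const dim s p))"
        using far_const_nonneg by (subst ennreal_mult) auto
      have "hole_const dim s p / 2 = 3 * (2 + far_const dim s p) + 2 * \<kappa> * (2 / vol * 2 powr ex)"
        by (simp add: hole_const_def)
      moreover have "ennreal (3 * (2 + far_const dim s p) + 2 * \<kappa> * (2 / vol * 2 powr ex))
        = ennreal (3 * (2 + far_const dim s p)) + ennreal (2 * \<kappa> * (2 / vol * 2 powr ex))"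
        using \<kappa>_pos vol_pos far_const_nonneg by (intro ennreal_plus) auto
      ultimately have 3: "ennreal (hole_const dim s p / 2) =
          3 * ennreal (2 + far_const dim s p) + 2 * I * ennreal (2 / vol * 2 powr ex * r powr (s * p))"
        by (simp only: 1 2)
      show ?thesis unfolding 3 by (simp only: distrib_right mult.assoc)
    qed
    finally show ?thesis .
  qed
  \<comment> \<open>At least one of the two points lies in the ball, or \<open>Q\<close> is 0, since
    the cutoff vanishes outside. By symmetry of \<open>Q\<close> the integral is at most twice the
    part with \<open>x\<close> in the ball.\<close>
  have "(\<integral>\<^sup>+x\<in>A. (\<integral>\<^sup>+y\<in>A. Q x y \<partial>lborel) \<partial>lborel)
    \<le> (\<integral>\<^sup>+x. (\<integral>\<^sup>+y. Q x y * indicator A y * indicator (ball x1 r) x + Q y x * indicator A x * indicator (ball x1 r) y \<partial>lborel) \<partial>lborel)"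
  proof (intro nn_integral_mono)
    fix x
    have "(\<integral>\<^sup>+y\<in>A. Q x y \<partial>lborel) * indicator A x = (\<integral>\<^sup>+y. Q x y * indicator A y * indicator A x \<partial>lborel)"
      by (simp add: nn_integral_multc)
    also have "\<dots> \<le> (\<integral>\<^sup>+y. Q x y * indicator A y * indicator (ball x1 r) x + Q y x * indicator A x * indicator (ball x1 r) y \<partial>lborel)"
    proof (intro nn_integral_mono)
      fix y
      have "cutoff x1 r x = 0" if "x \<notin> (ball x1 r)" for x
        using that r by (intro cutoff_eq_0) auto
      then have "x \<in> (ball x1 r) \<or> y \<in> (ball x1 r) \<or> Q x y = 0" by (auto simp: Q_def)
      then show "Q x y * indicator A y * indicator A x \<le> Q x y * indicator A y * indicator (ball x1 r) x + Q y x * indicator A x * indicator (ball x1 r) y"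
        using BA by (auto simp: indicator_def Qsym[of y x])
    qed
    finally show "(\<integral>\<^sup>+y\<in>A. Q x y \<partial>lborel) * indicator A x
      \<le> (\<integral>\<^sup>+y. Q x y * indicator A y * indicator (ball x1 r) x + Q y x * indicator A x * indicator (ball x1 r) y \<partial>lborel)" .
  qed
  also have "\<dots> = (\<integral>\<^sup>+x. (\<integral>\<^sup>+y. Q x y * indicator A y * indicator (ball x1 r) x \<partial>lborel) \<partial>lborel)
     + (\<integral>\<^sup>+x. (\<integral>\<^sup>+y. Q y x * indicator A x * indicator (ball x1 r) y \<partial>lborel) \<partial>lborel)"
    by (simp add: nn_integral_add)
  also have "(\<integral>\<^sup>+x. (\<integral>\<^sup>+y. Q y x * indicator A x * indicator (ball x1 r) y \<partial>lborel) \<partial>lborel)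
     = (\<integral>\<^sup>+x. (\<integral>\<^sup>+y. Q x y * indicator A y * indicator (ball x1 r) x \<partial>lborel) \<partial>lborel)"
    by (rule lborel_pair.Fubini') measurable
  also have "(\<integral>\<^sup>+x. (\<integral>\<^sup>+y. Q x y * indicator A y * indicator (ball x1 r) x \<partial>lborel) \<partial>lborel) + \<dots>
     \<le> ennreal (hole_const dim s p / 2) * en (annulus x1 r) A + ennreal (hole_const dim s p / 2) * en (annulus x1 r) A"
    by (intro add_mono S)
  also have "\<dots> = ennreal (hole_const dim s p) * en (annulus x1 r) A"
    using hole_const_nonneg by (subst (3) field_sum_of_halves[symmetric], subst ennreal_plus) (auto simp: distrib_right)
  finally show ?thesis unfolding Q_def .
qed

text \<open>Choosing \<open>z\<close> in the annulus, and not anywhere in the ball, makes the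
  right-hand side an energy of pairs that meet the annulus, which hole filling can absorb. The
  exponent \<open>s * p\<close> is what remains of \<open>ex\<close> after division by the
  volume.\<close>

lemma exists_good_point:
  obtains z where "z \<in> (annulus x1 r)"
    "(\<integral>\<^sup>+x\<in>(ball x1 r). ennreal (d z x powr p) \<partial>lborel) \<le> ennreal (2 / vol * 2 powr ex * r powr (s * p)) * en (annulus x1 r) (ball x1 r)"
proof -
  have "\<exists>z\<in>(annulus x1 r). (\<integral>\<^sup>+x\<in>(ball x1 r). ennreal (d z x powr p) \<partial>lborel) \<le> ennreal ((2 * r) powr ex / (vol * r powr dim / 2)) * en (annulus x1 r) (ball x1 r)"
  proof (rule exists_average_point)
    show "norm (z - x) \<le> 2 * r" if "x \<in> (ball x1 r)" "z \<in> (annulus x1 r)" for x z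
      using that norm_triangle_ineq4[of "z - x1" "x - x1"] by (auto simp: dist_norm norm_minus_commute)
  qed (use annulus_measure vol_pos r in auto)
  moreover have "(2 * r) powr ex / (vol * r powr dim / 2) = 2 / vol * 2 powr ex * r powr (s * p)"
    using r vol_pos by (simp add: powr_mult powr_add field_simps)
  ultimately show ?thesis using that by auto
qed

end

end

section \<open>Decay of the energy and a Campanato lemma\<close>

text \<open>Adding \<open>C * T (Suc k)\<close> to both sides fills the hole and leaves the factor
  \<open>C / (1 + C) < 1\<close>. The errors decay at the faster rate \<open>q < l\<close>, so
  summing them costs only \<open>1 / (l - q)\<close>.\<close>

lemma hole_filling_decay:
  fixes T :: "nat \<Rightarrow> real"
  assumes C: "0 \<le> C" and l: "C / (1 + C) \<le> l" "q < l" and q: "0 \<le> q" and Y: "0 \<le> Y"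
    and T: "\<And>k. 0 \<le> T k"
    and step: "\<And>k. T (Suc k) \<le> C * (T k - T (Suc k)) + Y * q ^ k"
  shows "T k \<le> l ^ k * (T 0 + Y / (l - q))"
proof -
  have st: "T (Suc k) \<le> l * T k + Y * q ^ k" for k
  proof -
    have "(1 + C) * T (Suc k) \<le> C * T k + Y * q ^ k" using step[of k] by (simp add: algebra_simps)
    then have "T (Suc k) \<le> (C * T k + Y * q ^ k) / (1 + C)" using C by (simp add: field_simps)
    also have "\<dots> = C / (1 + C) * T k + Y * q ^ k / (1 + C)" by (simp add: add_divide_distrib)
    also have "\<dots> \<le> l * T k + Y * q ^ k / 1"
      using C l T Y q by (intro add_mono mult_right_mono divide_left_mono) auto
    finally show ?thesis by simp
  qed
  have l0: "0 < l" using q l by simp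
  \<comment> \<open>The quotient is the closed form of the accumulated errors, the sum of
    \<open>l ^ (k - 1 - j) * q ^ j\<close> over \<open>j < k\<close>.\<close>
  have "T k \<le> l ^ k * T 0 + Y * (l ^ k - q ^ k) / (l - q)"
  proof (induction k)
    case (Suc k)
    have "T (Suc k) \<le> l * (l ^ k * T 0 + Y * (l ^ k - q ^ k) / (l - q)) + Y * q ^ k"
      using st[of k] Suc l0 by (smt (verit) mult_left_mono)
    also have "\<dots> = l ^ Suc k * T 0 + Y * (l ^ Suc k - q ^ Suc k) / (l - q)"
      using l by (simp add: field_simps)
    finally show ?case .
  qed simp
  also have "\<dots> \<le> l ^ k * T 0 + Y * l ^ k / (l - q)"
    using l q Y by (intro add_left_mono divide_right_mono mult_left_mono) auto
  finally show ?thesis by (simp add: algebra_simps)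
qed

text \<open>The power \<open>1 / p\<close> collects the constants of \<open>L\<close> and
  \<open>K0\<close>. The factor in front is that of \<open>campanato_L\<close>: a geometric series
  of ratio \<open>2 powr (- \<alpha>)\<close> at each of the two points, started at a scale of at
  most four times their distance.\<close>

definition campanato_const :: "real \<Rightarrow> real \<Rightarrow> real \<Rightarrow> real \<Rightarrow> real" where
  "campanato_const n s p \<alpha> = 4 * 4 powr \<alpha> / (1 - 2 powr (- \<alpha>)) *
     (2 powr (p + 1 + n) * 4 powr (n + s * p) / (unit_ball_vol n)\<^sup>2) powr (1 / p)"

context gagliardo
begin

text \<open>
  Finite energy makes almost every point good, and along shrinking balls the good values \<open>u (c k)\<close>
  converge to \<open>u x\<close> at a good point \<open>x\<close>. This replaces Lebesgue's differentiation theorem.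
\<close>

definition good :: "real ^ 'n \<Rightarrow> bool" where
  "good x \<longleftrightarrow> (\<exists>\<rho>>0. (\<integral>\<^sup>+y\<in>ball x \<rho>. G x y \<partial>lborel) < \<infinity>)"

text \<open>Integrate the triangle inequality through \<open>x\<close> over the common set
  \<open>S\<close>. This replaces the comparison of mean values on overlapping balls.\<close>

lemma compare_points:
  assumes [measurable]: "S \<in> sets borel" and m: "0 \<le> m" "ennreal m \<le> emeasure lborel S"
    and a: "(\<integral>\<^sup>+x\<in>S. ennreal (d c x powr p) \<partial>lborel) \<le> ennreal a" "0 \<le> a"
    and b: "(\<integral>\<^sup>+x\<in>S. ennreal (d c' x powr p) \<partial>lborel) \<le> ennreal b" "0 \<le> b"
  shows "d c c' powr p * m \<le> 2 powr p * (a + b)"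
proof -
  have "ennreal (d c c' powr p) * ennreal m \<le> ennreal (d c c' powr p) * emeasure lborel S"
    using m by (intro mult_left_mono) auto
  also have "\<dots> = (\<integral>\<^sup>+x. ennreal (d c c' powr p) * indicator S x \<partial>lborel)"
    by (simp add: nn_integral_cmult_indicator)
  also have "\<dots> \<le> (\<integral>\<^sup>+x. ennreal (2 powr p) * (ennreal (d c x powr p) * indicator S x + ennreal (d c' x powr p) * indicator S x) \<partial>lborel)"
  proof (intro nn_integral_mono)
    fix x
    have "d c c' powr p \<le> (d c x + d c' x) powr p"
      using d_triangle[of c c' x] p by (intro powr_mono2) (auto simp: d_sym)
    also have "\<dots> \<le> 2 powr p * (d c x powr p + d c' x powr p)" using p by (intro powr_add_le) auto
    finally have "ennreal (d c c' powr p) \<le> ennreal (2 powr p * (d c x powr p + d c' x powr p))" by (rule ennreal_leI)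
    also have "\<dots> = ennreal (2 powr p) * (ennreal (d c x powr p) + ennreal (d c' x powr p))" by (simp add: ennreal_mult)
    finally show "ennreal (d c c' powr p) * indicator S x
       \<le> ennreal (2 powr p) * (ennreal (d c x powr p) * indicator S x + ennreal (d c' x powr p) * indicator S x)"
      by (auto simp: indicator_def)
  qed
  also have "\<dots> = ennreal (2 powr p) * ((\<integral>\<^sup>+x\<in>S. ennreal (d c x powr p) \<partial>lborel) + (\<integral>\<^sup>+x\<in>S. ennreal (d c' x powr p) \<partial>lborel))"
    by (simp add: nn_integral_cmult nn_integral_add)
  also have "\<dots> \<le> ennreal (2 powr p) * (ennreal a + ennreal b)"
    by (intro mult_left_mono add_mono a b) auto
  also have "\<dots> = ennreal (2 powr p * (a + b))" using a b by (simp add: ennreal_mult)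
  finally show ?thesis using m a b by (simp add: ennreal_mult[symmetric])
qed

section \<open>Comparison of good values along dyadic balls\<close>

context
  fixes R M \<delta> \<alpha> :: real
  assumes R: "0 < R" and M: "0 \<le> M" and \<alpha>: "\<alpha> = (s * p + \<delta> - dim) / p" "0 < \<alpha>"
begin

abbreviation "rad k \<equiv> R * 2 powr (- real k)"

text \<open>The base 4, rather than 2, makes the same constant serve for the ball of radius
  \<open>2 * R\<close> in \<open>campanato_L\<close>.\<close>

definition K0 :: real where "K0 = 4 powr ex / vol * M * R powr (- \<delta>)"
text \<open>In the exponent \<open>p + 1 + dim\<close>, \<open>p\<close> comes from the triangle
  inequality, 1 from adding two equal bounds, and \<open>dim\<close> from the smaller of two
  consecutive balls, over which the comparison is made.\<close>

definition L :: real where "L = (2 powr (p + 1 + dim) * K0 / vol) powr (1 / p)"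

lemma K0_nonneg: "0 \<le> K0" using M vol_pos by (simp add: K0_def)

lemma L_nonneg: "0 \<le> L" by (simp add: L_def)

lemma rad_pos: "0 < rad k" using R by simp

lemma rad_Suc: "rad (Suc k) = rad k / 2"
proof -
  have "- real (Suc k) = - real k + (-1)" by simp
  then have "2 powr (- real (Suc k)) = 2 powr (- real k) * 2 powr (-1)" by (simp only: powr_add)
  then show ?thesis by (simp add: powr_minus)
qed

lemma alpha_p: "s * p + \<delta> = \<alpha> * p + dim" using \<alpha> p by simp

lemma sp_delta_nonneg: "0 \<le> s * p + \<delta>"
  unfolding alpha_p using \<alpha>(2) p dim_ge_1 by (intro add_nonneg_nonneg) auto

lemma chain_step:
  assumes "x powr p * (vol * (r / 2) powr dim) \<le> 2 powr p * (K0 * r powr (s * p + \<delta>) + K0 * r powr (s * p + \<delta>))"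
    and "0 < r" "0 \<le> x"
  shows "x \<le> L * r powr \<alpha>"
proof -
  have "x powr p \<le> 2 powr p * (2 * K0 * r powr (s * p + \<delta>)) / (vol * (r / 2) powr dim)"
    using assms vol_pos by (simp add: pos_le_divide_eq)
  also have "\<dots> = 2 powr (p + 1 + dim) * K0 / vol * r powr (\<alpha> * p)"
    unfolding alpha_p using assms vol_pos by (simp add: powr_add powr_divide field_simps)
  finally have "(x powr p) powr (1 / p) \<le> (2 powr (p + 1 + dim) * K0 / vol * r powr (\<alpha> * p)) powr (1 / p)"
    using p by (intro powr_mono2) auto
  also have "\<dots> = L * (r powr (\<alpha> * p)) powr (1 / p)" unfolding L_def using vol_pos K0_nonneg
    by (intro powr_mult) 
  finally show ?thesis using p assms by (simp add: powr_powr)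
qed

text \<open>Points \<open>c k\<close> are chosen by averaging in each ball. Consecutive ones are
  compared on the smaller ball and differ by at most \<open>L * rad k powr \<alpha>\<close>, a
  geometric sequence. Goodness ties the chain to \<open>x\<close> itself, since it makes
  \<open>d (c k) x\<close> tend to 0; summing the geometric series then bounds the distance from
  every link.\<close>

lemma campanato_point:
  assumes en: "\<And>k. en (ball x (rad k)) (ball x (rad k)) \<le> ennreal (M * 2 powr (- \<delta> * real k))"
    and x: "good x"
  obtains c where "\<And>k. (\<integral>\<^sup>+y\<in>ball x (rad k). ennreal (d (c k) y powr p) \<partial>lborel) \<le> ennreal (K0 * rad k powr (s * p + \<delta>))"
    "\<And>k. d (c k) x \<le> L * rad k powr \<alpha> / (1 - 2 powr (- \<alpha>))"
proof -
  have "\<exists>c. (\<integral>\<^sup>+y\<in>ball x (rad k). ennreal (d c y powr p) \<partial>lborel) \<le> ennreal (K0 * rad k powr (s * p + \<delta>))" for k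
  proof -
    have "\<exists>z\<in>ball x (rad k). (\<integral>\<^sup>+y\<in>ball x (rad k). ennreal (d z y powr p) \<partial>lborel)
      \<le> ennreal ((2 * rad k) powr ex / (vol * rad k powr dim)) * en (ball x (rad k)) (ball x (rad k))"
    proof (rule exists_average_point)
      show "norm (z - y) \<le> 2 * rad k" if "y \<in> ball x (rad k)" "z \<in> ball x (rad k)" for y z
        using that norm_triangle_ineq4[of "z - x" "y - x"] by (auto simp: dist_norm norm_minus_commute)
    qed (use R vol_pos in \<open>auto simp: emeasure_ball intro!: mult_pos_pos\<close>)
    then obtain z where "(\<integral>\<^sup>+y\<in>ball x (rad k). ennreal (d z y powr p) \<partial>lborel)
      \<le> ennreal ((2 * rad k) powr ex / (vol * rad k powr dim)) * en (ball x (rad k)) (ball x (rad k))" by blast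
    also have "\<dots> \<le> ennreal ((2 * rad k) powr ex / (vol * rad k powr dim)) * ennreal (M * 2 powr (- \<delta> * real k))"
      by (intro mult_left_mono en) auto
    also have "\<dots> = ennreal ((2 * rad k) powr ex / (vol * rad k powr dim) * (M * 2 powr (- \<delta> * real k)))"
      using M vol_pos by (intro ennreal_mult[symmetric]) auto
    also have "\<dots> \<le> ennreal (K0 * rad k powr (s * p + \<delta>))"
    proof (intro ennreal_leI)
      have 1: "(2 * rad k) powr ex = 2 powr ex * (rad k powr dim * rad k powr (s * p))"
        using R by (simp add: powr_mult powr_add)
      have 2: "2 powr (- \<delta> * real k) = R powr (- \<delta>) * rad k powr \<delta>"
        using R by (simp add: powr_mult powr_powr mult.assoc[symmetric] flip: powr_add)
          (simp add: mult.commute)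
      have "(2 * rad k) powr ex / (vol * rad k powr dim) * (M * 2 powr (- \<delta> * real k))
         = 2 powr ex / vol * M * R powr (- \<delta>) * (rad k powr (s * p) * rad k powr \<delta>)"
        unfolding 1 2 using rad_pos[of k] vol_pos by (simp add: field_simps)
      also have "\<dots> = 2 powr ex / vol * M * R powr (- \<delta>) * rad k powr (s * p + \<delta>)"
        by (simp only: powr_add)
      also have "\<dots> \<le> K0 * rad k powr (s * p + \<delta>)"
        unfolding K0_def using ex_pos vol_pos M
        by (intro mult_right_mono divide_right_mono powr_mono2) auto
      finally show "(2 * rad k) powr ex / (vol * rad k powr dim) * (M * 2 powr (- \<delta> * real k)) \<le> K0 * rad k powr (s * p + \<delta>)" .
    qed
    finally show ?thesis by blast
  qed
  then have "\<exists>c. \<forall>k. (\<integral>\<^sup>+y\<in>ball x (rad k). ennreal (d (c k) y powr p) \<partial>lborel) \<le> ennreal (K0 * rad k powr (s * p + \<delta>))"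
    by (intro choice allI)
  then obtain c where "\<forall>k. (\<integral>\<^sup>+y\<in>ball x (rad k). ennreal (d (c k) y powr p) \<partial>lborel) \<le> ennreal (K0 * rad k powr (s * p + \<delta>))"
    by (rule exE)
  note c = this [rule_format]
  have rmono: "rad (Suc k) powr (s * p + \<delta>) \<le> rad k powr (s * p + \<delta>)" for k
    unfolding rad_Suc using sp_delta_nonneg R by (intro powr_mono2) auto
  have step: "d (c k) (c (Suc k)) \<le> L * rad k powr \<alpha>" for k
  proof (rule chain_step)
    show "d (c k) (c (Suc k)) powr p * (vol * (rad k / 2) powr dim)
      \<le> 2 powr p * (K0 * rad k powr (s * p + \<delta>) + K0 * rad k powr (s * p + \<delta>))"
    proof (rule compare_points)
      show "ennreal (vol * (rad k / 2) powr dim) \<le> emeasure lborel (ball x (rad (Suc k)))"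
        unfolding rad_Suc using R by (simp add: emeasure_ball)
      have "(\<integral>\<^sup>+y\<in>ball x (rad (Suc k)). ennreal (d (c k) y powr p) \<partial>lborel) \<le> (\<integral>\<^sup>+y\<in>ball x (rad k). ennreal (d (c k) y powr p) \<partial>lborel)"
      proof -
        have "ball x (rad (Suc k)) \<subseteq> ball x (rad k)"
          unfolding rad_Suc using R by (intro subset_ball) simp
        then show ?thesis by (intro nn_integral_mono mult_left_mono) (auto simp: indicator_def)
      qed
      also note c
      finally show "(\<integral>\<^sup>+y\<in>ball x (rad (Suc k)). ennreal (d (c k) y powr p) \<partial>lborel) \<le> ennreal (K0 * rad k powr (s * p + \<delta>))" .
      show "(\<integral>\<^sup>+y\<in>ball x (rad (Suc k)). ennreal (d (c (Suc k)) y powr p) \<partial>lborel) \<le> ennreal (K0 * rad k powr (s * p + \<delta>))"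
        using rmono K0_nonneg by (intro order.trans[OF c] ennreal_leI mult_left_mono) auto
    qed (use K0_nonneg vol_pos in auto)
  qed (use R in auto)
  define q where "q = 2 powr (- \<alpha>)"
  have q: "0 < q" "q < 1" using \<alpha> by (auto simp: q_def powr_less_one)
  have radq: "rad (k + j) powr \<alpha> = rad k powr \<alpha> * q ^ j" for k j
  proof -
    have "- real (k + j) = - real k + - real j" by simp
    then have "2 powr (- real (k + j)) = 2 powr (- real k) * 2 powr (- real j)" by (simp only: powr_add)
    then have "rad (k + j) = rad k * 2 powr (- real j)" by simp
    then have "rad (k + j) powr \<alpha> = rad k powr \<alpha> * 2 powr (- real j * \<alpha>)"
      by (simp only: powr_mult powr_powr)
    also have "- real j * \<alpha> = - \<alpha> * real j" by simp
    also have "2 powr (- \<alpha> * real j) = q ^ j"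
      unfolding q_def by (simp only: powr_powr[symmetric] powr_realpow powr_gt_zero)
    finally show ?thesis .
  qed
  have chain: "d (c k) x \<le> d (c (k + j)) x + L * rad k powr \<alpha> * (\<Sum>i<j. q ^ i)" for k j
  proof (induction j)
    case (Suc j)
    have "d (c (k + j)) x \<le> d (c (k + j)) (c (Suc (k + j))) + d (c (Suc (k + j))) x" by (rule d_triangle)
    also have "d (c (k + j)) (c (Suc (k + j))) \<le> L * (rad k powr \<alpha> * q ^ j)" using step[of "k + j"] unfolding radq .
    finally show ?case using Suc by (simp add: algebra_simps)
  qed simp
  obtain \<rho> where \<rho>: "0 < \<rho>" "(\<integral>\<^sup>+y\<in>ball x \<rho>. G x y \<partial>lborel) < \<infinity>" using x unfolding good_def by blast
  define g where "g = enn2real (\<integral>\<^sup>+y\<in>ball x \<rho>. G x y \<partial>lborel)"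
  have g: "(\<integral>\<^sup>+y\<in>ball x \<rho>. G x y \<partial>lborel) = ennreal g" "0 \<le> g" using \<rho> by (auto simp: g_def)
  have rad0: "rad \<longlonglongrightarrow> 0"
  proof -
    have "(\<lambda>k. R * (1 / 2) ^ k) \<longlonglongrightarrow> R * 0" by (intro tendsto_intros) auto
    moreover have "2 powr (- real k) = (1 / 2) ^ k" for k
      by (simp add: powr_minus_divide powr_realpow power_one_over)
    ultimately show ?thesis by (simp only: mult_zero_right)
  qed
  \<comment> \<open>Near a good point the deviation from \<open>x\<close> on the ball of radius
    \<open>rad k\<close> is at most \<open>rad k powr ex * g\<close>. Divided by the volume this is
    of order \<open>rad k powr (s * p)\<close>, which tends to 0, as does the bound belonging to
    \<open>c k\<close>.\<close>
  have lim: "(\<lambda>k. d (c k) x) \<longlonglongrightarrow> 0"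
  proof -
    have ev: "\<forall>\<^sub>F k in sequentially. d (c k) x \<le> (2 powr p / vol * (K0 * rad k powr (\<alpha> * p) + g * rad k powr (s * p))) powr (1 / p)"
    proof -
      have "\<forall>\<^sub>F k in sequentially. rad k < \<rho>" using rad0 \<rho> by (auto dest: order_tendstoD)
      then show ?thesis
      proof eventually_elim
        case (elim k)
        have "d (c k) x powr p * (vol * rad k powr dim) \<le> 2 powr p * (K0 * rad k powr (s * p + \<delta>) + rad k powr ex * g)"
        proof (rule compare_points)
          have "(\<integral>\<^sup>+y\<in>ball x (rad k). ennreal (d x y powr p) \<partial>lborel) \<le> (\<integral>\<^sup>+y\<in>ball x \<rho>. ennreal (rad k powr ex) * G x y \<partial>lborel)"
            using elim by (intro nn_integral_mono) (auto simp: indicator_def dist_norm intro!: d_powr_le)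
          also have "\<dots> = ennreal (rad k powr ex * g)"
            using g by (simp add: mult.assoc nn_integral_cmult ennreal_mult)
          finally show "(\<integral>\<^sup>+y\<in>ball x (rad k). ennreal (d x y powr p) \<partial>lborel) \<le> ennreal (rad k powr ex * g)" .
        qed (use K0_nonneg vol_pos g c R in \<open>auto simp: emeasure_ball\<close>)
        then have "d (c k) x powr p \<le> 2 powr p * (K0 * rad k powr (s * p + \<delta>) + rad k powr ex * g) / (vol * rad k powr dim)"
          using R vol_pos by (subst pos_le_divide_eq) (auto intro!: mult_pos_pos)
        also have "\<dots> = 2 powr p / vol * (K0 * rad k powr (\<alpha> * p) + g * rad k powr (s * p))"
        proof -
          have "2 powr p * (K0 * r powr (\<alpha> * p + dim) + r powr ex * g) / (vol * r powr dim)
             = 2 powr p / vol * (K0 * r powr (\<alpha> * p) + g * r powr (s * p))" if "0 < r" for r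
            using that vol_pos by (simp add: powr_add field_simps)
          from this[OF rad_pos] show ?thesis unfolding alpha_p .
        qed
        finally have "(d (c k) x powr p) powr (1 / p) \<le> (2 powr p / vol * (K0 * rad k powr (\<alpha> * p) + g * rad k powr (s * p))) powr (1 / p)"
          using p by (intro powr_mono2) auto
        then show ?case using p by (simp add: powr_powr)
      qed
    qed
    have "(\<lambda>k. (2 powr p / vol * (K0 * rad k powr (\<alpha> * p) + g * rad k powr (s * p))) powr (1 / p))
       \<longlonglongrightarrow> (2 powr p / vol * (K0 * 0 powr (\<alpha> * p) + g * 0 powr (s * p))) powr (1 / p)"
    proof -
      have pos: "0 < \<alpha> * p" "0 < s * p" "0 < 1 / p" using \<alpha>(2) p s by auto
      have "\<forall>\<^sub>F k in sequentially. 0 \<le> 2 powr p / vol * (K0 * rad k powr (\<alpha> * p) + g * rad k powr (s * p))"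
        using g K0_nonneg vol_pos by (intro always_eventually) simp
      moreover have "\<forall>\<^sub>F k in sequentially. 0 \<le> rad k" using R by (intro always_eventually) simp
      ultimately show ?thesis
        using pos by (intro tendsto_intros tendsto_powr' rad0 disjI2 conjI)
    qed
    then have "(\<lambda>k. (2 powr p / vol * (K0 * rad k powr (\<alpha> * p) + g * rad k powr (s * p))) powr (1 / p)) \<longlonglongrightarrow> 0"
      by simp
    then show ?thesis
      using ev by (intro tendsto_sandwich[of "\<lambda>_. 0" "\<lambda>k. d (c k) x"]) auto
  qed
  have "d (c k) x \<le> L * rad k powr \<alpha> / (1 - 2 powr (- \<alpha>))" for k
  proof -
    have "d (c k) x \<le> d (c (k + j)) x + L * rad k powr \<alpha> * (1 / (1 - q))" for j
    proof -
      have "(\<Sum>i<j. q ^ i) \<le> 1 / (1 - q)"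
        using q sum_le_suminf[of "\<lambda>i. q ^ i" "{..<j}"] by (simp add: suminf_geometric)
      then have "L * rad k powr \<alpha> * (\<Sum>i<j. q ^ i) \<le> L * rad k powr \<alpha> * (1 / (1 - q))"
        using L_nonneg by (intro mult_left_mono) auto
      with chain[of k j] show ?thesis by simp
    qed
    moreover have "(\<lambda>j. d (c (k + j)) x + L * rad k powr \<alpha> * (1 / (1 - q))) \<longlonglongrightarrow> 0 + L * rad k powr \<alpha> * (1 / (1 - q))"
      using LIMSEQ_ignore_initial_segment[OF lim, of k] by (intro tendsto_intros) (simp add: add.commute)
    ultimately have "d (c k) x \<le> 0 + L * rad k powr \<alpha> * (1 / (1 - q))"
      by (intro tendsto_lowerbound[of "\<lambda>j. d (c (k + j)) x + L * rad k powr \<alpha> * (1 / (1 - q))" _ sequentially]) auto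
    then show ?thesis by (simp add: q_def)
  qed
  then show ?thesis using c that by blast
qed

text \<open>Two chains of balls shrinking to \<open>x\<close> and to \<open>y\<close> are joined at
  a scale comparable to the distance of the points. If they are closer than \<open>R / 2\<close>, a
  ball around \<open>y\<close> fits into the next larger one around \<open>x\<close>; otherwise the
  chains start at radius \<open>R\<close> and are joined through a good value \<open>w\<close> for
  the ball of radius \<open>2 * R\<close>.\<close>

lemma campanato_L: 
  assumes x: "x \<in> ball x0 R" "good x" and y: "y \<in> ball x0 R" "good y"
    and en: "\<And>z k. z \<in> ball x0 R \<Longrightarrow> en (ball z (rad k)) (ball z (rad k)) \<le> ennreal (M * 2 powr (- \<delta> * real k))"
    and en2: "en (ball x0 (2 * R)) (ball x0 (2 * R)) \<le> ennreal M"
  shows "d x y \<le> 4 * 4 powr \<alpha> / (1 - 2 powr (- \<alpha>)) * L * norm (x - y) powr \<alpha>"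
proof (cases "x = y")
  case False
  define t where "t = norm (x - y)"
  have t: "t > 0" using False by (simp add: t_def)
  define Q where "Q = 1 / (1 - 2 powr (- \<alpha>))"
  have "2 powr (- \<alpha>) < 1" "0 < 2 powr (- \<alpha>)" using \<alpha> by (auto simp: powr_less_one)
  then have Q: "1 \<le> Q" by (simp add: Q_def)
  obtain c where c: "\<And>k. (\<integral>\<^sup>+y\<in>ball x (rad k). ennreal (d (c k) y powr p) \<partial>lborel) \<le> ennreal (K0 * rad k powr (s * p + \<delta>))"
    "\<And>k. d (c k) x \<le> L * rad k powr \<alpha> / (1 - 2 powr (- \<alpha>))"
    using campanato_point[OF en[OF x(1)] x(2)] by blast
  obtain c' where c': "\<And>k. (\<integral>\<^sup>+z\<in>ball y (rad k). ennreal (d (c' k) z powr p) \<partial>lborel) \<le> ennreal (K0 * rad k powr (s * p + \<delta>))"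
    "\<And>k. d (c' k) y \<le> L * rad k powr \<alpha> / (1 - 2 powr (- \<alpha>))"
    using campanato_point[OF en[OF y(1)] y(2)] by blast
  have rmono: "rad (Suc k) powr (s * p + \<delta>) \<le> rad k powr (s * p + \<delta>)" for k
    unfolding rad_Suc using sp_delta_nonneg R by (intro powr_mono2) auto
  have main: "d x y \<le> 4 * 4 powr \<alpha> * Q * L * t powr \<alpha>"
  proof (cases "t < R / 2")
    case True
    then have "1 \<le> R / (2 * t)" using t by simp
    \<comment> \<open>This \<open>k\<close> gives both \<open>t \<le> rad (Suc k)\<close>, for the
      inclusion of the balls, and \<open>rad k \<le> 4 * t\<close>, for the return to powers of
      \<open>t\<close>.\<close>
    then obtain k where k: "2 powr real k \<le> R / (2 * t)" "R / (2 * t) < 2 powr (real k + 1)" by (rule dyadic_shell)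
    have k1: "t \<le> rad (Suc k)" using k(1) t R unfolding rad_Suc by (simp add: powr_minus field_simps)
    have k2: "rad k \<le> 4 * t" using k(2) t R by (simp add: powr_minus powr_add field_simps)
    have sub: "ball y (rad (Suc k)) \<subseteq> ball x (rad k)"
    proof
      fix z assume z: "z \<in> ball y (rad (Suc k))"
      have "dist x z \<le> t + dist y z" unfolding t_def by (metis dist_norm dist_triangle)
      then show "z \<in> ball x (rad k)" using z k1 unfolding rad_Suc by simp
    qed
    have "d (c k) (c' (Suc k)) \<le> L * rad k powr \<alpha>"
    proof (rule chain_step)
      show "d (c k) (c' (Suc k)) powr p * (vol * (rad k / 2) powr dim)
        \<le> 2 powr p * (K0 * rad k powr (s * p + \<delta>) + K0 * rad k powr (s * p + \<delta>))"
      proof (rule compare_points)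
        show "ennreal (vol * (rad k / 2) powr dim) \<le> emeasure lborel (ball y (rad (Suc k)))"
          unfolding rad_Suc using R by (simp add: emeasure_ball)
        have "(\<integral>\<^sup>+y\<in>ball y (rad (Suc k)). ennreal (d (c k) y powr p) \<partial>lborel) \<le> (\<integral>\<^sup>+y\<in>ball x (rad k). ennreal (d (c k) y powr p) \<partial>lborel)"
          using sub by (intro nn_integral_mono mult_left_mono) (auto simp: indicator_def)
        also note c(1)
        finally show "(\<integral>\<^sup>+y\<in>ball y (rad (Suc k)). ennreal (d (c k) y powr p) \<partial>lborel) \<le> ennreal (K0 * rad k powr (s * p + \<delta>))" .
        show "(\<integral>\<^sup>+z\<in>ball y (rad (Suc k)). ennreal (d (c' (Suc k)) z powr p) \<partial>lborel) \<le> ennreal (K0 * rad k powr (s * p + \<delta>))"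
          using rmono K0_nonneg by (intro order.trans[OF c'(1)] ennreal_leI mult_left_mono) auto
      qed (use K0_nonneg vol_pos in auto)
    qed (use R in auto)
    moreover have "d (c' (Suc k)) y \<le> L * rad k powr \<alpha> * Q"
    proof -
      have "L * rad (Suc k) powr \<alpha> * Q \<le> L * rad k powr \<alpha> * Q"
        using L_nonneg Q R \<alpha> unfolding rad_Suc by (intro mult_right_mono mult_left_mono powr_mono2) auto
      with c'(2)[of "Suc k"] show ?thesis by (simp add: Q_def)
    qed
    moreover have "d x (c k) \<le> L * rad k powr \<alpha> * Q" using c(2)[of k] by (simp add: Q_def d_sym)
    moreover have "d x y \<le> d x (c k) + d (c k) (c' (Suc k)) + d (c' (Suc k)) y"
      using d_triangle[of x y "c k"] d_triangle[of "c k" y "c' (Suc k)"] by simp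
    moreover have "L * rad k powr \<alpha> * 1 \<le> L * rad k powr \<alpha> * Q"
      using L_nonneg Q by (intro mult_left_mono) auto
    ultimately have "d x y \<le> 3 * (L * rad k powr \<alpha> * Q)" by simp
    also have "\<dots> \<le> 3 * (L * (4 * t) powr \<alpha> * Q)"
    proof -
      have "rad k powr \<alpha> \<le> (4 * t) powr \<alpha>" using k2 R \<alpha>(2) by (intro powr_mono2) auto
      then show ?thesis using L_nonneg Q by (intro mult_left_mono mult_right_mono) auto
    qed
    \<comment> \<open>Rounded up to the 4 of the distant case, so that both cases share one
      constant.\<close>
    also have "\<dots> \<le> 4 * (L * (4 * t) powr \<alpha> * Q)"
      using L_nonneg Q by (intro mult_right_mono) auto
    also have "\<dots> = 4 * 4 powr \<alpha> * Q * L * t powr \<alpha>" using t by (simp add: powr_mult)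
    finally show ?thesis .
  next
    case False
    have "\<exists>z\<in>ball x0 (2 * R). (\<integral>\<^sup>+y\<in>ball x0 (2 * R). ennreal (d z y powr p) \<partial>lborel)
      \<le> ennreal ((4 * R) powr ex / (vol * (2 * R) powr dim)) * en (ball x0 (2 * R)) (ball x0 (2 * R))"
    proof (rule exists_average_point)
      show "norm (z - y) \<le> 4 * R" if "y \<in> ball x0 (2 * R)" "z \<in> ball x0 (2 * R)" for y z
        using that norm_triangle_ineq4[of "z - x0" "y - x0"] by (auto simp: dist_norm norm_minus_commute)
    qed (use R vol_pos in \<open>auto simp: emeasure_ball\<close>)
    then obtain w where "(\<integral>\<^sup>+y\<in>ball x0 (2 * R). ennreal (d w y powr p) \<partial>lborel)
      \<le> ennreal ((4 * R) powr ex / (vol * (2 * R) powr dim)) * en (ball x0 (2 * R)) (ball x0 (2 * R))" by blast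
    also have "\<dots> \<le> ennreal ((4 * R) powr ex / (vol * (2 * R) powr dim)) * ennreal M"
      by (intro mult_left_mono en2) auto
    also have "\<dots> = ennreal ((4 * R) powr ex / (vol * (2 * R) powr dim) * M)"
      using M vol_pos by (intro ennreal_mult[symmetric]) auto
    also have "\<dots> \<le> ennreal (K0 * R powr (s * p + \<delta>))"
    proof (intro ennreal_leI)
      have "K0 * R powr (s * p + \<delta>) = 4 powr ex / vol * M * (R powr (- \<delta>) * R powr (s * p + \<delta>))" by (simp add: K0_def)
      also have "R powr (- \<delta>) * R powr (s * p + \<delta>) = R powr (s * p)" by (simp flip: powr_add)
      finally have 1: "K0 * R powr (s * p + \<delta>) = 4 powr ex / vol * M * R powr (s * p)" .
      have "(4 * R) powr ex / (vol * (2 * R) powr dim) * M = 4 powr ex / vol * M * R powr (s * p) / 2 powr dim"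
        using R vol_pos by (simp add: powr_mult powr_add field_simps)
      also have "\<dots> \<le> 4 powr ex / vol * M * R powr (s * p) / 1"
        using vol_pos M dim_ge_1 by (intro divide_left_mono ge_one_powr_ge_zero) auto
      finally show "(4 * R) powr ex / (vol * (2 * R) powr dim) * M \<le> K0 * R powr (s * p + \<delta>)" unfolding 1 by simp
    qed
    finally have w: "(\<integral>\<^sup>+y\<in>ball x0 (2 * R). ennreal (d w y powr p) \<partial>lborel) \<le> ennreal (K0 * R powr (s * p + \<delta>))" .
    have cw: "d cc w \<le> L * R powr \<alpha>"
      if a: "a \<in> ball x0 R" and cc: "(\<integral>\<^sup>+y\<in>ball a (rad 0). ennreal (d cc y powr p) \<partial>lborel) \<le> ennreal (K0 * rad 0 powr (s * p + \<delta>))" for a cc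
    proof (rule chain_step)
      have "(R / 2) powr dim \<le> R powr dim" using R dim_ge_1 by (intro powr_mono2) auto
      then have "d cc w powr p * (vol * (R / 2) powr dim) \<le> d cc w powr p * (vol * R powr dim)"
        using vol_pos by (intro mult_left_mono) auto
      also have "\<dots> \<le> 2 powr p * (K0 * R powr (s * p + \<delta>) + K0 * R powr (s * p + \<delta>))"
      proof (rule compare_points)
        have "ball a R \<subseteq> ball x0 (2 * R)"
        proof
          fix z assume "z \<in> ball a R" with a dist_triangle[of x0 z a] show "z \<in> ball x0 (2 * R)" by simp
        qed
        then have "(\<integral>\<^sup>+y\<in>ball a R. ennreal (d w y powr p) \<partial>lborel) \<le> (\<integral>\<^sup>+y\<in>ball x0 (2 * R). ennreal (d w y powr p) \<partial>lborel)"
          by (intro nn_integral_mono mult_left_mono) (auto simp: indicator_def)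
        also note w
        finally show "(\<integral>\<^sup>+y\<in>ball a R. ennreal (d w y powr p) \<partial>lborel) \<le> ennreal (K0 * R powr (s * p + \<delta>))" .
      qed (use cc K0_nonneg vol_pos R in \<open>auto simp: emeasure_ball\<close>)
      finally show "d cc w powr p * (vol * (R / 2) powr dim) \<le> 2 powr p * (K0 * R powr (s * p + \<delta>) + K0 * R powr (s * p + \<delta>))" .
    qed (use R in auto)
    have "d x y \<le> d x (c 0) + d (c 0) w + (d w (c' 0) + d (c' 0) y)"
      using d_triangle[of x y "c 0"] d_triangle[of "c 0" y w] d_triangle[of w y "c' 0"] by simp
    also have "\<dots> \<le> L * R powr \<alpha> * Q + L * R powr \<alpha> + (L * R powr \<alpha> + L * R powr \<alpha> * Q)"
    proof (intro add_mono)
      show "d x (c 0) \<le> L * R powr \<alpha> * Q" using c(2)[of 0] by (simp add: Q_def d_sym)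
      show "d (c' 0) y \<le> L * R powr \<alpha> * Q" using c'(2)[of 0] by (simp add: Q_def)
      show "d (c 0) w \<le> L * R powr \<alpha>" by (rule cw[OF x(1) c(1)])
      have "d (c' 0) w \<le> L * R powr \<alpha>" by (rule cw[OF y(1) c'(1)])
      then show "d w (c' 0) \<le> L * R powr \<alpha>" by (simp add: d_sym)
    qed
    also have "\<dots> \<le> 4 * (L * R powr \<alpha> * Q)"
      using mult_left_mono[OF Q, of "L * R powr \<alpha>"] L_nonneg by (simp add: mult_ac)
    also have "\<dots> \<le> 4 * (L * (4 * t) powr \<alpha> * Q)"
      using L_nonneg Q R \<alpha> False t by (intro mult_left_mono mult_right_mono powr_mono2) auto
    also have "\<dots> = 4 * 4 powr \<alpha> * Q * L * t powr \<alpha>" using t by (simp add: powr_mult)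
    finally show ?thesis .
  qed
  then show ?thesis by (simp add: Q_def t_def)
qed simp

end

theorem campanato:
  assumes R: "0 < R" and M: "0 \<le> M" and \<alpha>: "\<alpha> = (s * p + \<delta> - dim) / p" "0 < \<alpha>"
    and x: "x \<in> ball x0 R" "good x" and y: "y \<in> ball x0 R" "good y"
    and en: "\<And>z k. z \<in> ball x0 R \<Longrightarrow> en (ball z (R * 2 powr (- real k))) (ball z (R * 2 powr (- real k)))
       \<le> ennreal (M * 2 powr (- \<delta> * real k))"
    and en2: "en (ball x0 (2 * R)) (ball x0 (2 * R)) \<le> ennreal M"
  shows "d x y \<le> campanato_const dim s p \<alpha> * (M * R powr (- \<delta>)) powr (1 / p) * norm (x - y) powr \<alpha>"
proof -
  have "2 powr (p + 1 + dim) * K0 R M \<delta> / vol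
     = 2 powr (p + 1 + dim) * 4 powr ex / vol\<^sup>2 * (M * R powr (- \<delta>))"
    using K0_def[OF assms(1-4)] vol_pos by (simp add: power2_eq_square)
  then have "L R M \<delta> = (2 powr (p + 1 + dim) * 4 powr ex / vol\<^sup>2) powr (1 / p) * (M * R powr (- \<delta>)) powr (1 / p)"
    by (simp only: L_def[OF assms(1-4)] powr_mult)
  then show ?thesis
    using campanato_L[OF assms] by (simp add: campanato_const_def mult.assoc)
qed

end

section \<open>Mollifiers\<close>

text \<open>Differentiating \<open>exp (- 1 / t)\<close> produces powers of \<open>1 / t\<close>.
  Carrying them along makes the family closed under differentiation, up to linear
  combinations.\<close>

definition flat_exp :: "nat \<Rightarrow> real \<Rightarrow> real" where
  "flat_exp m t = (if 0 < t then exp (- 1 / t) / t ^ m else 0)"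

lemma flat_exp_tendsto_0: "(flat_exp m \<longlongrightarrow> 0) (at 0)"
proof -
  have "((\<lambda>x::real. x ^ m / exp x) \<longlongrightarrow> 0) at_top" by (rule tendsto_power_div_exp_0)
  from filterlim_compose[OF this filterlim_inverse_at_top_right]
  have "((\<lambda>t::real. inverse t ^ m / exp (inverse t)) \<longlongrightarrow> 0) (at_right 0)" .
  moreover have "\<forall>\<^sub>F t::real in at_right 0. inverse t ^ m / exp (inverse t) = flat_exp m t"
    unfolding eventually_at_right_field
    by (intro exI[of _ 1]) (auto simp: flat_exp_def exp_minus field_simps)
  ultimately have r: "(flat_exp m \<longlongrightarrow> 0) (at_right 0)" by (rule Lim_transform_eventually)
  have "\<forall>\<^sub>F t::real in at_left 0. 0 = flat_exp m t"
    unfolding eventually_at_left_field by (intro exI[of _ "-1"]) (auto simp: flat_exp_def)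
  then have "(flat_exp m \<longlongrightarrow> 0) (at_left 0)" by (rule Lim_transform_eventually[OF tendsto_const])
  with r show ?thesis by (simp add: filterlim_split_at)
qed

lemma flat_exp_has_derivative:
  "(flat_exp m has_field_derivative (- real m * flat_exp (m + 1) t + flat_exp (m + 2) t)) (at t)"
proof -
  consider "t > 0" | "t < 0" | "t = 0" by linarith
  then show ?thesis
  proof cases
    case 1
    have "((\<lambda>t. exp (- 1 / t) / t ^ m) has_field_derivative (- real m * flat_exp (m + 1) t + flat_exp (m + 2) t)) (at t)"
      using 1 by (auto intro!: derivative_eq_intros simp: flat_exp_def)
        (cases m; simp add: field_simps power2_eq_square)
    then show ?thesis
      by (rule has_field_derivative_transform_within_open[where S = "{0<..}"]) (use 1 in \<open>auto simp: flat_exp_def\<close>)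
  next
    case 2
    have "((\<lambda>t. 0) has_field_derivative (- real m * flat_exp (m + 1) t + flat_exp (m + 2) t)) (at t)"
      using 2 by (auto simp: flat_exp_def)
    then show ?thesis
      by (rule has_field_derivative_transform_within_open[where S = "{..<0}"]) (use 2 in \<open>auto simp: flat_exp_def\<close>)
  next
    case 3
    have "(\<lambda>h. flat_exp m h / h) = flat_exp (m + 1)" by (auto simp: flat_exp_def fun_eq_iff)
    then show ?thesis using 3 flat_exp_tendsto_0[of "m + 1"]
      by (simp add: DERIV_def flat_exp_def[of _ 0])
  qed
qed

text \<open>Closure under partial derivatives replaces the computation of higher ones: the induction
  on \<open>k\<close> passes from \<open>f\<close> to its partial derivatives, which lie in the same
  set. The set of interest consists of convolutions, whose derivatives are again
  convolutions.\<close>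

lemma Ck_if_closed:
  fixes \<C> :: "(real ^ 'n::finite \<Rightarrow> real) set"
  assumes cl: "\<And>f. f \<in> \<C> \<Longrightarrow> \<exists>D. (\<forall>x. (f has_derivative (\<lambda>h. \<Sum>i\<in>UNIV. h $ i * D i x)) (at x)) \<and> (\<forall>i. D i \<in> \<C>)"
    and f: "f \<in> \<C>"
  shows "Ck k f"
  using f
proof (induction k arbitrary: f)
  case 0
  then obtain D where "\<And>x. (f has_derivative (\<lambda>h. \<Sum>i\<in>UNIV. h $ i * D i x)) (at x)" using cl[OF 0] by blast
  then show ?case by (auto intro!: continuous_at_imp_continuous_on intro: has_derivative_continuous)
next
  case (Suc k)
  then obtain D where D: "\<And>x. (f has_derivative (\<lambda>h. \<Sum>i\<in>UNIV. h $ i * D i x)) (at x)" "\<And>i. D i \<in> \<C>"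
    using cl[OF Suc.prems] by blast
  have "frechet_derivative f (at x) (axis i 1) = D i x" for i x
  proof -
    have "frechet_derivative f (at x) (axis i 1) = (\<Sum>j\<in>UNIV. axis i 1 $ j * D j x)"
      using frechet_derivative_at[OF D(1), of x] by metis
    also have "\<dots> = (\<Sum>j\<in>UNIV. if j = i then D j x else 0)" by (intro sum.cong) (auto simp: axis_def)
    finally show ?thesis by simp
  qed
  moreover have "f differentiable (at x)" for x using D(1)[of x] by (rule differentiableI)
  ultimately show ?case using Suc.IH[OF D(2)] by simp
qed

text \<open>An algebra that contains the standard bump and is visibly closed under differentiation:
  the chain rule brings in the coordinates and constants, the sum and product rules the algebra
  operations.\<close>

inductive_set bump_algebra :: "real \<Rightarrow> (real ^ 'n::finite \<Rightarrow> real) set" for e where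
  const: "(\<lambda>_. c) \<in> bump_algebra e"
| coord: "(\<lambda>x. x $ i) \<in> bump_algebra e"
| bump: "(\<lambda>x. flat_exp m (1 - (x \<bullet> x) / e\<^sup>2)) \<in> bump_algebra e"
| add: "f \<in> bump_algebra e \<Longrightarrow> g \<in> bump_algebra e \<Longrightarrow> (\<lambda>x. f x + g x) \<in> bump_algebra e"
| mult: "f \<in> bump_algebra e \<Longrightarrow> g \<in> bump_algebra e \<Longrightarrow> (\<lambda>x. f x * g x) \<in> bump_algebra e"

lemma bump_algebra_derivative:
  fixes f :: "real ^ 'n::finite \<Rightarrow> real"
  assumes "f \<in> bump_algebra e"
  shows "\<exists>D. (\<forall>x. (f has_derivative (\<lambda>h. \<Sum>i\<in>UNIV. h $ i * D i x)) (at x)) \<and> (\<forall>i. D i \<in> bump_algebra e)"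
  using assms
proof induction
  case (const c)
  show ?case by (intro exI[of _ "\<lambda>_ _. 0"]) (auto intro: bump_algebra.const)
next
  case (coord i)
  have "(\<lambda>h::real^'n. \<Sum>j\<in>UNIV. h $ j * (if j = i then 1 else 0)) = (\<lambda>h. h $ i)" by (simp add: if_distrib cong: if_cong)
  then show ?case
    by (intro exI[of _ "\<lambda>j _. if j = i then 1 else 0"])
      (auto intro: bump_algebra.const bounded_linear.has_derivative[OF bounded_linear_vec_nth has_derivative_ident])
next
  case (bump m)
  define F where "F = (\<lambda>x::real^'n. - real m * flat_exp (m + 1) (1 - (x \<bullet> x) / e\<^sup>2) + flat_exp (m + 2) (1 - (x \<bullet> x) / e\<^sup>2))"
  have F: "F \<in> bump_algebra e" unfolding F_def by (intro bump_algebra.intros)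
  have "((\<lambda>x. flat_exp m (1 - (x \<bullet> x) / e\<^sup>2)) has_derivative (\<lambda>h. \<Sum>i\<in>UNIV. h $ i * ((- 2 / e\<^sup>2) * (F x * x $ i)))) (at x)" for x :: "real ^ 'n"
  proof -
    have g: "((\<lambda>x. 1 - (x \<bullet> x) / e\<^sup>2) has_derivative (\<lambda>h. - 2 / e\<^sup>2 * (x \<bullet> h))) (at x)"
    proof -
      have "((\<lambda>x. 1 - (x \<bullet> x) * inverse (e\<^sup>2)) has_derivative (\<lambda>h. 0 - (x \<bullet> h + h \<bullet> x) * inverse (e\<^sup>2))) (at x)"
        by (intro derivative_intros)
      moreover have "0 - (x \<bullet> h + h \<bullet> x) * inverse (e\<^sup>2) = - 2 / e\<^sup>2 * (x \<bullet> h)" for h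
        by (simp add: inner_commute divide_inverse)
      ultimately show ?thesis by (simp only: divide_inverse)
    qed
    have "((\<lambda>x. flat_exp m (1 - (x \<bullet> x) / e\<^sup>2)) has_derivative (\<lambda>h. F x * (- 2 / e\<^sup>2 * (x \<bullet> h)))) (at x)"
      using has_derivative_compose[OF g flat_exp_has_derivative[unfolded has_field_derivative_def], of m]
      by (simp add: F_def)
    moreover have "F x * (- 2 / e\<^sup>2 * (x \<bullet> h)) = (\<Sum>i\<in>UNIV. h $ i * ((- 2 / e\<^sup>2) * (F x * x $ i)))" for h
      by (simp add: inner_vec_def sum_distrib_left algebra_simps)
    ultimately show ?thesis by simp
  qed
  moreover have "(\<lambda>x. (- 2 / e\<^sup>2) * (F x * x $ i)) \<in> bump_algebra e" for i
    by (intro bump_algebra.mult bump_algebra.const bump_algebra.coord F)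
  ultimately show ?case by (intro exI[of _ "\<lambda>i x. (- 2 / e\<^sup>2) * (F x * x $ i)"] conjI allI)
next
  case (add f g)
  obtain D where D: "\<And>x. (f has_derivative (\<lambda>h. \<Sum>i\<in>UNIV. h $ i * D i x)) (at x)" "\<And>i. D i \<in> bump_algebra e"
    using add.IH(1) by blast
  obtain D' where D': "\<And>x. (g has_derivative (\<lambda>h. \<Sum>i\<in>UNIV. h $ i * D' i x)) (at x)" "\<And>i. D' i \<in> bump_algebra e"
    using add.IH(2) by blast
  have "((\<lambda>x. f x + g x) has_derivative (\<lambda>h. \<Sum>i\<in>UNIV. h $ i * (D i x + D' i x))) (at x)" for x
    using has_derivative_add[OF D(1) D'(1), of x] by (simp add: sum.distrib algebra_simps)
  then show ?case using D D' by (intro exI[of _ "\<lambda>i x. D i x + D' i x"]) (auto intro: bump_algebra.add)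
next
  case (mult f g)
  obtain D where D: "\<And>x. (f has_derivative (\<lambda>h. \<Sum>i\<in>UNIV. h $ i * D i x)) (at x)" "\<And>i. D i \<in> bump_algebra e"
    using mult.IH(1) by blast
  obtain D' where D': "\<And>x. (g has_derivative (\<lambda>h. \<Sum>i\<in>UNIV. h $ i * D' i x)) (at x)" "\<And>i. D' i \<in> bump_algebra e"
    using mult.IH(2) by blast
  have "((\<lambda>x. f x * g x) has_derivative (\<lambda>h. \<Sum>i\<in>UNIV. h $ i * (f x * D' i x + g x * D i x))) (at x)" for x
    using has_derivative_mult[OF D(1) D'(1), of x]
    by (simp add: sum.distrib sum_distrib_left sum_distrib_right algebra_simps)
  then show ?case using D D' mult by (intro exI[of _ "\<lambda>i x. f x * D' i x + g x * D i x"]) (auto intro!: bump_algebra.intros)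
qed

definition bumps :: "real \<Rightarrow> (real ^ 'n::finite \<Rightarrow> real) set" where
  "bumps e = {f \<in> bump_algebra e. \<forall>x. x \<notin> cball 0 e \<longrightarrow> f x = 0}"

text \<open>Outside the closed ball \<open>f\<close> vanishes on an open set, so its partial
  derivatives vanish there too.\<close>

lemma bumps_derivative:
  fixes f :: "real ^ 'n::finite \<Rightarrow> real"
  assumes f: "f \<in> bumps e"
  shows "\<exists>D. (\<forall>x. (f has_derivative (\<lambda>h. \<Sum>i\<in>UNIV. h $ i * D i x)) (at x)) \<and> (\<forall>i. D i \<in> bumps e)"
proof -
  obtain D where D: "\<And>x. (f has_derivative (\<lambda>h. \<Sum>i\<in>UNIV. h $ i * D i x)) (at x)" "\<And>i. D i \<in> bump_algebra e"
    using bump_algebra_derivative f unfolding bumps_def by blast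
  have "D i x = 0" if x: "x \<notin> cball 0 e" for i x
  proof -
    have "((\<lambda>_. 0) has_derivative (\<lambda>h. \<Sum>i\<in>UNIV. h $ i * D i x)) (at x)"
      by (rule has_derivative_transform_within_open[OF D(1), where s = "- cball 0 e"]) (use x f in \<open>auto simp: bumps_def\<close>)
    moreover have "((\<lambda>_. 0::real) has_derivative (\<lambda>h::real^'n. 0)) (at x)" by simp
    ultimately have "(\<lambda>h::real^'n. \<Sum>i\<in>UNIV. h $ i * D i x) = (\<lambda>h. 0)" by (rule has_derivative_unique)
    then have "(\<Sum>j\<in>UNIV. axis i 1 $ j * D j x) = 0" by metis
    also have "(\<Sum>j\<in>UNIV. axis i 1 $ j * D j x) = (\<Sum>j\<in>UNIV. if j = i then D j x else 0)" by (intro sum.cong) (auto simp: axis_def)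
    finally show ?thesis by simp
  qed
  then show ?thesis using D by (intro exI[of _ D]) (auto simp: bumps_def)
qed

lemma bumps_continuous: "f \<in> bumps e \<Longrightarrow> continuous_on UNIV f"
  by (meson bumps_derivative continuous_at_imp_continuous_on has_derivative_continuous)

lemma bumps_measurable: "f \<in> bumps e \<Longrightarrow> f \<in> borel_measurable borel"
  by (intro borel_measurable_continuous_onI bumps_continuous)

lemma bumps_bounded:
  fixes f :: "real ^ 'n::finite \<Rightarrow> real"
  assumes "f \<in> bumps e"
  obtains b where "0 \<le> b" "\<And>x. \<bar>f x\<bar> \<le> b"
proof -
  have "compact (f ` cball 0 e)"
    by (rule compact_continuous_image[OF continuous_on_subset[OF bumps_continuous[OF assms] subset_UNIV] compact_cball])
  then have "bounded (f ` cball 0 e)" by (rule compact_imp_bounded)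
  then obtain b where "\<forall>x\<in>cball 0 e. \<bar>f x\<bar> \<le> b" unfolding bounded_iff by auto
  then have b: "\<bar>f x\<bar> \<le> b" if "x \<in> cball 0 e" for x using that by blast
  have "\<bar>f x\<bar> \<le> \<bar>b\<bar>" for x
    using b[of x] assms by (cases "x \<in> cball 0 e") (auto simp: bumps_def)
  then show ?thesis by (intro that[of "\<bar>b\<bar>"]) auto
qed

text \<open>A single constant bounds both the increments of \<open>f\<close> and its linear
  approximation, so the Taylor remainder is at most \<open>2 * l * norm h\<close> uniformly in the
  point. This yields the majorant in \<open>conv_derivative\<close>.\<close>

lemma bumps_remainder:
  fixes f :: "real ^ 'n::finite \<Rightarrow> real"
  assumes f: "f \<in> bumps e"
    and D: "\<And>x. (f has_derivative (\<lambda>h. \<Sum>i\<in>UNIV. h $ i * D i x)) (at x)" "\<And>i. D i \<in> bumps e"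
  obtains l where "0 \<le> l" "\<And>x y. \<bar>f x - f y\<bar> \<le> l * norm (x - y)"
    "\<And>x h. \<bar>\<Sum>i\<in>UNIV. h $ i * D i x\<bar> \<le> l * norm h"
proof -
  have "\<exists>b. 0 \<le> b \<and> (\<forall>x. \<bar>D i x\<bar> \<le> b)" for i using bumps_bounded[OF D(2)[of i]] by metis
  then obtain b where b: "\<And>i. 0 \<le> b i" "\<And>i x. \<bar>D i x\<bar> \<le> b i" by metis
  define l where "l = sum b UNIV"
  have lin: "\<bar>\<Sum>i\<in>UNIV. h $ i * D i x\<bar> \<le> l * norm h" for x h
  proof -
    have "\<bar>\<Sum>i\<in>UNIV. h $ i * D i x\<bar> \<le> (\<Sum>i\<in>UNIV. \<bar>h $ i * D i x\<bar>)" by (rule sum_abs)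
    also have "\<dots> \<le> (\<Sum>i\<in>UNIV. norm h * b i)"
      unfolding abs_mult using b by (intro sum_mono mult_mono component_le_norm_cart) auto
    finally show ?thesis by (simp add: l_def sum_distrib_left mult.commute)
  qed
  have "norm (f x - f y) \<le> l * norm (x - y)" for x y
  proof (rule differentiable_bound[of UNIV f "\<lambda>x h. \<Sum>i\<in>UNIV. h $ i * D i x"])
    show "onorm (\<lambda>h. \<Sum>i\<in>UNIV. h $ i * D i x) \<le> l" for x
      using lin by (intro onorm_le) (simp add: mult.commute)
  qed (use D in auto)
  then show ?thesis using lin b by (intro that[of l]) (auto simp: l_def sum_nonneg)
qed

section \<open>Convolution with a bump\<close>

definition conv :: "(real ^ 'n::finite \<Rightarrow> real) \<Rightarrow> (real ^ 'n \<Rightarrow> real) \<Rightarrow> real ^ 'n \<Rightarrow> real" where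
  "conv f g x = (LINT z|lborel. f (x - z) * g z)"

lemma conv_integrable:
  fixes g :: "real ^ 'n::finite \<Rightarrow> real"
  assumes f: "f \<in> bumps e" and g: "integrable lborel g"
  shows "integrable lborel (\<lambda>z. f (x - z) * g z)"
proof -
  obtain b where b: "0 \<le> b" "\<And>x. \<bar>f x\<bar> \<le> b" by (rule bumps_bounded[OF f]) (rule that)
  note [measurable] = bumps_measurable[OF f]
  have [measurable]: "g \<in> borel_measurable borel" using g by auto
  show ?thesis
    by (rule Bochner_Integration.integrable_bound[of _ "\<lambda>z. b * g z"])
      (use g b in \<open>auto simp: abs_mult intro!: mult_right_mono\<close>)
qed

text \<open>Differentiation under the integral: the remainder divided by \<open>norm h\<close> tends
  to 0 pointwise and is at most \<open>2 * l\<close>, so \<open>2 * l * \<bar>g z\<bar>\<close>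
  dominates. The limit is taken along sequences \<open>H\<close>, the form in which dominated
  convergence applies.\<close>

lemma conv_derivative:
  fixes g :: "real ^ 'n::finite \<Rightarrow> real"
  assumes f: "f \<in> bumps e" and g: "integrable lborel g"
    and D: "\<And>x. (f has_derivative (\<lambda>h. \<Sum>i\<in>UNIV. h $ i * D i x)) (at x)" "\<And>i. D i \<in> bumps e"
  shows "(conv f g has_derivative (\<lambda>h. \<Sum>i\<in>UNIV. h $ i * conv (D i) g x)) (at x)"
proof -
  obtain l where l: "0 \<le> l" "\<And>x y. \<bar>f x - f y\<bar> \<le> l * norm (x - y)"
    "\<And>x h. \<bar>\<Sum>i\<in>UNIV. h $ i * D i x\<bar> \<le> l * norm h" by (rule bumps_remainder[OF f D]) (rule that)
  note [measurable] = bumps_measurable[OF f] bumps_measurable[OF D(2)]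
  have [measurable]: "g \<in> borel_measurable borel" using g by auto
  define rem where "rem = (\<lambda>h z. (f (x + h - z) - f (x - z) - (\<Sum>i\<in>UNIV. h $ i * D i (x - z))) / norm h)"
  have rem_eq: "(conv f g (x + h) - conv f g x - (\<Sum>i\<in>UNIV. h $ i * conv (D i) g x)) / norm h
     = (LINT z|lborel. rem h z * g z)" for h
  proof -
    have "(LINT z|lborel. rem h z * g z) = (LINT z|lborel. (f (x + h - z) * g z - f (x - z) * g z
        - (\<Sum>i\<in>UNIV. h $ i * (D i (x - z) * g z))) / norm h)"
      unfolding rem_def by (intro Bochner_Integration.integral_cong refl) (simp add: algebra_simps sum_distrib_right sum_distrib_left)
    also have "\<dots> = (conv f g (x + h) - conv f g x - (\<Sum>i\<in>UNIV. h $ i * conv (D i) g x)) / norm h"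
      unfolding conv_def using conv_integrable[OF f g] conv_integrable[OF D(2) g]
      by (simp add: Bochner_Integration.integral_diff Bochner_Integration.integral_sum Bochner_Integration.integrable_sum)
    finally show ?thesis ..
  qed
  have "((\<lambda>h. (conv f g (x + h) - conv f g x - (\<Sum>i\<in>UNIV. h $ i * conv (D i) g x)) / norm h) \<longlongrightarrow> 0) (at 0)"
    unfolding rem_eq tendsto_at_iff_sequentially
  proof (intro allI impI)
    fix H :: "nat \<Rightarrow> real ^ 'n"
    assume H: "\<forall>i. H i \<in> UNIV - {0}" "H \<longlonglongrightarrow> 0"
    have "(\<lambda>k. LINT z|lborel. rem (H k) z * g z) \<longlonglongrightarrow> (LINT z|(lborel::(real^'n) measure). 0)"
    proof (rule integral_dominated_convergence[where w = "\<lambda>z. 2 * l * \<bar>g z\<bar>"])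
      show "AE z in lborel. (\<lambda>k. rem (H k) z * g z) \<longlonglongrightarrow> 0"
      proof (intro AE_I2)
        fix z
        have "((\<lambda>h. norm (f (x - z + h) - f (x - z) - (\<Sum>i\<in>UNIV. h $ i * D i (x - z))) / norm h) \<longlongrightarrow> 0) (at 0)"
          using D(1)[of "x - z"] unfolding has_derivative_at by blast
        moreover have "norm (rem h z) = norm (f (x - z + h) - f (x - z) - (\<Sum>i\<in>UNIV. h $ i * D i (x - z))) / norm h" for h
        proof -
          have "f (x + h - z) = f (x - z + h)" by (simp add: algebra_simps)
          then show ?thesis unfolding rem_def by (simp add: abs_divide)
        qed
        ultimately have "((\<lambda>h. norm (rem h z)) \<longlongrightarrow> 0) (at 0)" by (simp only:)
        then have "((\<lambda>h. rem h z) \<longlongrightarrow> 0) (at 0)" by (rule tendsto_norm_zero_cancel)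
        then have "((\<lambda>h. rem h z) \<circ> H) \<longlonglongrightarrow> 0" using H unfolding tendsto_at_iff_sequentially by blast
        then have "(\<lambda>k. rem (H k) z) \<longlonglongrightarrow> 0" by (simp add: o_def)
        then show "(\<lambda>k. rem (H k) z * g z) \<longlonglongrightarrow> 0" using tendsto_mult_left_zero by blast
      qed
      show "AE z in lborel. norm (rem (H k) z * g z) \<le> 2 * l * \<bar>g z\<bar>" for k
      proof (intro AE_I2)
        fix z
        have "\<bar>f (x + H k - z) - f (x - z) - (\<Sum>i\<in>UNIV. H k $ i * D i (x - z))\<bar> \<le> 2 * l * norm (H k)"
          using l(2)[of "x + H k - z" "x - z"] l(3)[of "H k" "x - z"] by simp
        then have "\<bar>rem (H k) z\<bar> \<le> 2 * l" using H by (simp add: rem_def divide_le_eq)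
        then show "norm (rem (H k) z * g z) \<le> 2 * l * \<bar>g z\<bar>" by (simp add: abs_mult mult_right_mono)
      qed
      show "(\<lambda>z. rem (H k) z * g z) \<in> borel_measurable lborel" for k unfolding rem_def by measurable
    qed (use g in auto)
    then show "((\<lambda>h. LINT z|lborel. rem h z * g z) \<circ> H) \<longlonglongrightarrow> 0" by (simp add: o_def)
  qed
  then have "((\<lambda>h. norm (conv f g (x + h) - conv f g x - (\<Sum>i\<in>UNIV. h $ i * conv (D i) g x)) / norm h) \<longlongrightarrow> 0) (at 0)"
    using tendsto_norm_zero by fastforce
  moreover have "bounded_linear (\<lambda>h::real^'n. \<Sum>i\<in>UNIV. h $ i * conv (D i) g x)"
    by (intro bounded_linear_sum bounded_linear_mult_const bounded_linear_vec_nth)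
  ultimately show ?thesis unfolding has_derivative_at by blast
qed

lemma conv_Ck:
  fixes g :: "real ^ 'n::finite \<Rightarrow> real"
  assumes "f \<in> bumps e" "integrable lborel g"
  shows "Ck k (conv f g)"
proof (rule Ck_if_closed[of "{conv f g | f. f \<in> bumps e}"])
  fix F assume "F \<in> {conv f g | f. f \<in> bumps e}"
  then obtain f where f: "f \<in> bumps e" "F = conv f g" by blast
  obtain D where D: "\<And>x. (f has_derivative (\<lambda>h. \<Sum>i\<in>UNIV. h $ i * D i x)) (at x)" "\<And>i. D i \<in> bumps e"
    using bumps_derivative[OF f(1)] by blast
  show "\<exists>D. (\<forall>x. (F has_derivative (\<lambda>h. \<Sum>i\<in>UNIV. h $ i * D i x)) (at x)) \<and> (\<forall>i. D i \<in> {conv f g | f. f \<in> bumps e})"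
    using conv_derivative[OF f(1) assms(2) D] D(2) f(2) by (intro exI[of _ "\<lambda>i. conv (D i) g"]) auto
qed (use assms in auto)

lemma conv_lipschitz:
  fixes g :: "real ^ 'n::finite \<Rightarrow> real"
  assumes f: "f \<in> bumps e" and g: "integrable lborel g"
  obtains l where "0 \<le> l" "\<And>x y. \<bar>conv f g x - conv f g y\<bar> \<le> l * norm (x - y)"
proof -
  obtain D where D: "\<And>x. (f has_derivative (\<lambda>h. \<Sum>i\<in>UNIV. h $ i * D i x)) (at x)" "\<And>i. D i \<in> bumps e"
    using bumps_derivative[OF f(1)] by blast
  obtain l where l: "0 \<le> l" "\<And>x y. \<bar>f x - f y\<bar> \<le> l * norm (x - y)"
    "\<And>x h. \<bar>\<Sum>i\<in>UNIV. h $ i * D i x\<bar> \<le> l * norm h"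
    by (rule bumps_remainder[OF f D]) (rule that)
  have "\<bar>conv f g x - conv f g y\<bar> \<le> (l * (LINT z|lborel. \<bar>g z\<bar>)) * norm (x - y)" for x y
  proof -
    have "conv f g x - conv f g y = (LINT z|lborel. f (x - z) * g z - f (y - z) * g z)"
      unfolding conv_def using conv_integrable[OF f g] by simp
    also have "\<bar>\<dots>\<bar> \<le> (LINT z|lborel. \<bar>f (x - z) * g z - f (y - z) * g z\<bar>)"
      using integral_norm_bound[of lborel "\<lambda>z. f (x - z) * g z - f (y - z) * g z"] by simp
    also have "\<dots> \<le> (LINT z|lborel. l * norm (x - y) * \<bar>g z\<bar>)"
    proof (rule integral_mono)
      show "\<bar>f (x - z) * g z - f (y - z) * g z\<bar> \<le> l * norm (x - y) * \<bar>g z\<bar>" for z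
        using mult_right_mono[OF l(2)[of "x - z" "y - z"], of "\<bar>g z\<bar>"]
        by (simp add: abs_mult[symmetric] algebra_simps)
    qed (use g conv_integrable[OF f g] in auto)
    finally show ?thesis by (simp add: mult_ac)
  qed
  then show ?thesis using l by (intro that[of "l * (LINT z|lborel. \<bar>g z\<bar>)"]) auto
qed

text \<open>The pointwise bound of order \<open>e powr (- n)\<close>, with a constant free of
  \<open>e\<close>, is the purpose: through it \<open>averaged_translation\<close> compares the
  mollifier with the singular kernel.\<close>

lemma mollifier_exists:
  assumes e: "0 < e"
  obtains \<rho> :: "real ^ 'n::finite \<Rightarrow> real" where "\<rho> \<in> bumps e" "\<And>x. 0 \<le> \<rho> x"
    "(\<integral>\<^sup>+x. ennreal (\<rho> x) \<partial>lborel) = 1"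
    "\<And>x. \<rho> x \<le> exp 2 * 2 powr real CARD('n) / unit_ball_vol (real CARD('n)) * e powr (- real CARD('n))"
proof -
  define n where "n = real CARD('n)"
  define w where "w = unit_ball_vol n"
  have w: "w > 0" by (simp add: w_def n_def)
  define b where "b = (\<lambda>x::real^'n. flat_exp 0 (1 - (x \<bullet> x) / e\<^sup>2))"
  have b: "b \<in> bumps e"
  proof -
    have "b x = 0" if "x \<notin> cball 0 e" for x
    proof -
      have "e\<^sup>2 \<le> (norm x)\<^sup>2" using that e by (intro power_mono) auto
      then show ?thesis using e by (simp add: b_def flat_exp_def power2_norm_eq_inner)
    qed
    then show ?thesis unfolding bumps_def b_def by (auto intro: bump_algebra.bump)
  qed
  note [measurable] = bumps_measurable[OF b]
  have b01: "0 \<le> b x" "b x \<le> 1" for x by (auto simp: b_def flat_exp_def)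
  define c where "c = enn2real (\<integral>\<^sup>+x. ennreal (b x) \<partial>lborel)"
  have fin: "(\<integral>\<^sup>+x. ennreal (b x) \<partial>lborel) < \<infinity>"
  proof -
    have "(\<integral>\<^sup>+x. ennreal (b x) \<partial>lborel) \<le> (\<integral>\<^sup>+x. indicator (cball (0 :: real ^ 'n) e) x \<partial>lborel)"
    proof (intro nn_integral_mono)
      fix x
      show "ennreal (b x) \<le> indicator (cball 0 e) x"
        using b b01[of x] by (cases "x \<in> cball 0 e") (auto simp: bumps_def ennreal_le_1)
    qed
    also have "\<dots> < \<infinity>" using emeasure_lborel_cball_finite[of "0::real^'n" e] by simp
    finally show ?thesis .
  qed
  then have c: "(\<integral>\<^sup>+x. ennreal (b x) \<partial>lborel) = ennreal c" "0 \<le> c" by (auto simp: c_def)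
  \<comment> \<open>On the ball of radius \<open>e / 2\<close> the argument of
    \<open>flat_exp\<close> is at least 1/2, where the value is at least \<open>exp (- 2)\<close>.
    This bounds the normalising constant from below and hence the mollifier from above.\<close>
  have lower: "exp (- 2) * (w * (e / 2) powr n) \<le> c"
  proof -
    have "ennreal (exp (- 2)) * ennreal (w * (e / 2) powr n) = (\<integral>\<^sup>+x. ennreal (exp (- 2)) * indicator (ball (0::real^'n) (e / 2)) x \<partial>lborel)"
      using e by (simp add: nn_integral_cmult_indicator emeasure_ball_powr w_def n_def)
    also have "\<dots> \<le> (\<integral>\<^sup>+x. ennreal (b x) \<partial>lborel)"
    proof (intro nn_integral_mono)
      fix x :: "real ^ 'n"
      show "ennreal (exp (- 2)) * indicator (ball (0::real^'n) (e / 2)) x \<le> ennreal (b x)"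
      proof (cases "x \<in> ball 0 (e / 2)")
        case True
        then have "(norm x)\<^sup>2 \<le> (e / 2)\<^sup>2" by (intro power_mono) auto
        then have "x \<bullet> x \<le> (e / 2)\<^sup>2" by (simp only: power2_norm_eq_inner)
        then have "4 * (x \<bullet> x) \<le> e\<^sup>2" by (simp add: power_divide)
        moreover have "0 \<le> x \<bullet> x" by simp
        ultimately have "2 * (x \<bullet> x) \<le> e\<^sup>2" by linarith
        then have q: "1 / 2 \<le> 1 - (x \<bullet> x) / e\<^sup>2" using e by (simp add: field_simps)
        define t where "t = 1 - (x \<bullet> x) / e\<^sup>2"
        have "1 / 2 \<le> t" using q by (simp only: t_def)
        then have "exp (- 2) \<le> flat_exp 0 t" by (simp add: flat_exp_def field_simps)
        then have "exp (- 2) \<le> b x" by (simp only: b_def t_def)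
        then show ?thesis using True by (simp add: ennreal_leI)
      qed simp
    qed
    finally show ?thesis using c w by (simp add: ennreal_mult[symmetric])
  qed
  have lo: "0 < exp (- 2) * (w * (e / 2) powr n)" using w e by simp
  then have c0: "0 < c" using lower by linarith
  show ?thesis
  proof (rule that[of "\<lambda>x. b x * (1 / c)"])
    show "(\<lambda>x. b x * (1 / c)) \<in> bumps e" using b by (auto simp: bumps_def intro: bump_algebra.mult bump_algebra.const simp del: times_divide_eq_right mult_1_right)
    show "0 \<le> b x * (1 / c)" for x using b01 c0 by simp
    show "(\<integral>\<^sup>+x. ennreal (b x * (1 / c)) \<partial>lborel) = 1"
    proof -
      have "ennreal (b x * (1 / c)) = ennreal (b x) * ennreal (1 / c)" for x
        using b01[of x] c0 by (intro ennreal_mult) auto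
      then have "(\<integral>\<^sup>+x. ennreal (b x * (1 / c)) \<partial>lborel) = (\<integral>\<^sup>+x. ennreal (b x) \<partial>lborel) * ennreal (1 / c)"
        by (simp add: nn_integral_multc del: times_divide_eq_right mult_1_right)
      also have "\<dots> = ennreal (c * (1 / c))" unfolding c(1) using c0 by (intro ennreal_mult[symmetric]) auto
      finally show ?thesis using c0 by simp
    qed
    show "b x * (1 / c) \<le> exp 2 * 2 powr real CARD('n) / unit_ball_vol (real CARD('n)) * e powr (- real CARD('n))" for x
    proof -
      have "b x * (1 / c) \<le> 1 * (1 / (exp (- 2) * (w * (e / 2) powr n)))"
        using b01[of x] lower lo c0 by (intro mult_mono divide_left_mono) auto
      also have "\<dots> = exp 2 * 2 powr n / w * e powr (- n)"
        using e w by (simp add: powr_divide exp_minus powr_minus field_simps)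
      finally show ?thesis by (simp add: n_def w_def)
    qed
  qed
qed

section \<open>Density of smooth test functions\<close>

lemma lborel_distr_reflect: "distr lborel borel (\<lambda>w. x - w) = (lborel :: 'a::euclidean_space measure)"
  using lborel_affine[of "-1" x] by (simp add: density_1)

lemma lborel_distr_shift: "distr lborel borel (\<lambda>w. w - x) = (lborel :: 'a::euclidean_space measure)"
  using lborel_affine[of 1 "- x"] by (simp add: density_1)

lemma nn_integral_reflect:
  fixes f :: "'a::euclidean_space \<Rightarrow> ennreal"
  assumes [measurable]: "f \<in> borel_measurable borel"
  shows "(\<integral>\<^sup>+w. f (x - w) \<partial>lborel) = (\<integral>\<^sup>+w. f w \<partial>lborel)"
  by (subst (2) lborel_distr_reflect[of x, symmetric], subst nn_integral_distr) auto

lemma nn_integral_shift: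
  fixes f :: "'a::euclidean_space \<Rightarrow> ennreal"
  assumes [measurable]: "f \<in> borel_measurable borel"
  shows "(\<integral>\<^sup>+w. f (w - x) \<partial>lborel) = (\<integral>\<^sup>+w. f w \<partial>lborel)"
  by (subst (2) lborel_distr_shift[of x, symmetric], subst nn_integral_distr) auto

lemma ennreal_tendsto_0I:
  fixes f :: "nat \<Rightarrow> ennreal"
  assumes "\<And>e. 0 < e \<Longrightarrow> \<forall>\<^sub>F j in sequentially. f j \<le> ennreal e"
  shows "f \<longlonglongrightarrow> 0"
proof (rule order_tendstoI)
  fix a :: ennreal assume "0 < a"
  then obtain b where b: "0 < b" "b < a" using dense by blast
  then have "0 < enn2real b" "ennreal (enn2real b) = b"
    by (auto simp: enn2real_positive_iff less_top[symmetric] intro!: ennreal_enn2real)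
  then have "\<forall>\<^sub>F j in sequentially. f j \<le> b" using assms[of "enn2real b"] by simp
  then show "\<forall>\<^sub>F j in sequentially. f j < a" by eventually_elim (use b in auto)
qed auto

text \<open>The free factor \<open>t\<close> shifts weight between the two powers; the factors
  \<open>1 / p\<close> and \<open>1 / q\<close> are simply estimated by 1.\<close>

lemma Young_scaled:
  fixes a b t :: real
  assumes "0 \<le> a" "0 \<le> b" "0 < t" "1 < p" "1 < q" "1 / p + 1 / q = 1"
  shows "a * b \<le> t powr (- q / p) * a powr q + t * b powr p"
proof -
  have "a * b = (a * t powr (- 1 / p)) * (b * t powr (1 / p))"
    using assms by (simp add: powr_minus)
  also have "\<dots> \<le> (a * t powr (- 1 / p)) powr q / q + (b * t powr (1 / p)) powr p / p"
    using assms by (intro Youngs_inequality) auto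
  also have "\<dots> \<le> (a * t powr (- 1 / p)) powr q / 1 + (b * t powr (1 / p)) powr p / 1"
    using assms by (intro add_mono divide_left_mono) auto
  also have "\<dots> = t powr (- q / p) * a powr q + t * b powr p"
    using assms by (simp add: powr_mult powr_powr mult.commute)
  finally show ?thesis .
qed

text \<open>
  Weak convergence by truncation: on \<open>S k\<close> the weight \<open>V\<close> is bounded and \<open>L\<^sup>1\<close> convergence suffices,
  off \<open>S k\<close> Young's inequality trades \<open>X\<close> for its uniformly bounded \<open>p\<close>-norm.
\<close>

lemma truncated_limit:
  fixes \<rho> :: "nat \<Rightarrow> 'z \<Rightarrow> ennreal" and V :: "'m \<Rightarrow> real" and X :: "'z \<Rightarrow> 'm \<Rightarrow> real"
  assumes M: "sigma_finite_measure M"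
    and [measurable]: "\<And>j. \<rho> j \<in> borel_measurable L" "V \<in> borel_measurable M" "case_prod X \<in> borel_measurable (L \<Otimes>\<^sub>M M)"
      "\<And>k. S k \<in> sets M"
    and nn: "\<And>m. 0 \<le> V m" "\<And>z m. 0 \<le> X z m"
    and pq: "1 < p" "1 < q" "1 / p + 1 / q = 1"
    and \<rho>: "\<And>j. (\<integral>\<^sup>+z. \<rho> j z \<partial>L) = 1"
    and V: "(\<integral>\<^sup>+m. ennreal (V m powr q) \<partial>M) < \<infinity>"
    and X: "\<And>j. (\<integral>\<^sup>+z. \<rho> j z * (\<integral>\<^sup>+m. ennreal (X z m powr p) \<partial>M) \<partial>L) \<le> ennreal B"
    and S: "\<And>m. m \<in> space M \<Longrightarrow> V m \<noteq> 0 \<Longrightarrow> \<forall>\<^sub>F k in sequentially. m \<in> S k"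
    and b: "\<And>k m. m \<in> S k \<Longrightarrow> V m \<le> b k" "\<And>k. 0 \<le> b k"
    and lim: "\<And>k. (\<lambda>j. \<integral>\<^sup>+z. \<rho> j z * (\<integral>\<^sup>+m\<in>S k. ennreal (X z m) \<partial>M) \<partial>L) \<longlonglongrightarrow> 0"
  shows "(\<lambda>j. \<integral>\<^sup>+z. \<rho> j z * (\<integral>\<^sup>+m. ennreal (V m * X z m) \<partial>M) \<partial>L) \<longlonglongrightarrow> 0"
proof (rule ennreal_tendsto_0I)
  interpret sigma_finite_measure M by (rule M)
  fix e :: real assume e: "0 < e"
  \<comment> \<open>The three parts of the bound are made small in the order \<open>t\<close>,
    \<open>k\<close>, \<open>j\<close>: first the part with the norms of \<open>X\<close>, then the
    part of \<open>V\<close> outside \<open>S k\<close>, last the integral over \<open>S k\<close>.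
    Adding 1 avoids division by 0.\<close>
  define t where "t = e / (3 * (\<bar>B\<bar> + 1))"
  have t: "0 < t" using e by (simp add: t_def)
  have tB: "t * B \<le> e / 3"
  proof -
    have "t * B \<le> t * (\<bar>B\<bar> + 1)" using t by (intro mult_left_mono) auto
    also have "\<dots> = e / 3" by (simp add: t_def field_simps add_pos_nonneg)
    finally show ?thesis .
  qed
  define C where "C = t powr (- q / p)"
  define tail where "tail = (\<lambda>k. \<integral>\<^sup>+m\<in>space M - S k. ennreal (V m powr q) \<partial>M)"
  have "tail \<longlonglongrightarrow> (\<integral>\<^sup>+m. 0 \<partial>M)"
    unfolding tail_def
  proof (rule nn_integral_dominated_convergence[where w = "\<lambda>m. ennreal (V m powr q)"])
    show "AE m in M. (\<lambda>k. ennreal (V m powr q) * indicator (space M - S k) m) \<longlonglongrightarrow> 0"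
    proof (intro AE_I2)
      fix m assume m: "m \<in> space M"
      have "\<forall>\<^sub>F k in sequentially. 0 = ennreal (V m powr q) * indicator (space M - S k) m"
      proof (cases "V m = 0")
        case False
        from S[OF m this] show ?thesis by eventually_elim simp
      qed simp
      then show "(\<lambda>k. ennreal (V m powr q) * indicator (space M - S k) m) \<longlonglongrightarrow> 0"
        by (rule Lim_transform_eventually[OF tendsto_const])
    qed
  qed (use V in \<open>auto simp: indicator_def\<close>)
  then have "(\<lambda>k. ennreal C * tail k) \<longlonglongrightarrow> ennreal C * 0" by (intro ennreal_tendsto_cmult) auto
  then have "\<forall>\<^sub>F k in sequentially. ennreal C * tail k < ennreal (e / 3)"
    using e by (intro order_tendstoD) auto
  then obtain k where k: "ennreal C * tail k < ennreal (e / 3)" by (auto simp: eventually_sequentially)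
  have "(\<lambda>j. ennreal (b k) * (\<integral>\<^sup>+z. \<rho> j z * (\<integral>\<^sup>+m\<in>S k. ennreal (X z m) \<partial>M) \<partial>L)) \<longlonglongrightarrow> ennreal (b k) * 0"
    by (intro ennreal_tendsto_cmult lim) auto
  then have "\<forall>\<^sub>F j in sequentially. ennreal (b k) * (\<integral>\<^sup>+z. \<rho> j z * (\<integral>\<^sup>+m\<in>S k. ennreal (X z m) \<partial>M) \<partial>L) < ennreal (e / 3)"
    using e by (intro order_tendstoD) auto
  then show "\<forall>\<^sub>F j in sequentially. (\<integral>\<^sup>+z. \<rho> j z * (\<integral>\<^sup>+m. ennreal (V m * X z m) \<partial>M) \<partial>L) \<le> ennreal e"
  proof eventually_elim
    case (elim j)
    have inner: "(\<integral>\<^sup>+m. ennreal (V m * X z m) \<partial>M) \<le> ennreal (b k) * (\<integral>\<^sup>+m\<in>S k. ennreal (X z m) \<partial>M)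
        + ennreal C * tail k + ennreal t * (\<integral>\<^sup>+m. ennreal (X z m powr p) \<partial>M)" if z: "z \<in> space L" for z
    proof -
      have [measurable]: "X z \<in> borel_measurable M" using z by measurable
      have "(\<integral>\<^sup>+m. ennreal (V m * X z m) \<partial>M) \<le> (\<integral>\<^sup>+m. ennreal (b k) * (ennreal (X z m) * indicator (S k) m)
        + ennreal C * (ennreal (V m powr q) * indicator (space M - S k) m) + ennreal t * ennreal (X z m powr p) \<partial>M)"
      proof (intro nn_integral_mono)
        fix m assume m: "m \<in> space M"
        show "ennreal (V m * X z m) \<le> ennreal (b k) * (ennreal (X z m) * indicator (S k) m)
          + ennreal C * (ennreal (V m powr q) * indicator (space M - S k) m) + ennreal t * ennreal (X z m powr p)"
        proof (cases "m \<in> S k")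
          case True
          have "ennreal (V m * X z m) \<le> ennreal (b k * X z m)"
            using b(1)[OF True] nn by (intro ennreal_leI mult_right_mono) auto
          also have "\<dots> = ennreal (b k) * (ennreal (X z m) * indicator (S k) m)"
            using True b nn by (simp add: ennreal_mult)
          finally show ?thesis by (simp add: add_increasing2 add.assoc)
        next
          case False
          have "ennreal (V m * X z m) \<le> ennreal (C * V m powr q + t * X z m powr p)"
            unfolding C_def using nn t pq by (intro ennreal_leI Young_scaled) auto
          also have "\<dots> = ennreal C * ennreal (V m powr q) + ennreal t * ennreal (X z m powr p)"
            using t by (simp add: ennreal_mult C_def)
          finally show ?thesis using False m by simp
        qed
      qed
      also have "\<dots> = ennreal (b k) * (\<integral>\<^sup>+m\<in>S k. ennreal (X z m) \<partial>M)
        + ennreal C * tail k + ennreal t * (\<integral>\<^sup>+m. ennreal (X z m powr p) \<partial>M)"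
        unfolding tail_def by (simp add: nn_integral_add nn_integral_cmult)
      finally show ?thesis .
    qed
    have "(\<integral>\<^sup>+z. \<rho> j z * (\<integral>\<^sup>+m. ennreal (V m * X z m) \<partial>M) \<partial>L)
      \<le> (\<integral>\<^sup>+z. ennreal (b k) * (\<rho> j z * (\<integral>\<^sup>+m\<in>S k. ennreal (X z m) \<partial>M)) + ennreal C * tail k * \<rho> j z
          + ennreal t * (\<rho> j z * (\<integral>\<^sup>+m. ennreal (X z m powr p) \<partial>M)) \<partial>L)"
    proof (intro nn_integral_mono)
      fix z assume "z \<in> space L"
      from mult_left_mono[OF inner[OF this], of "\<rho> j z"]
      show "\<rho> j z * (\<integral>\<^sup>+m. ennreal (V m * X z m) \<partial>M) \<le> ennreal (b k) * (\<rho> j z * (\<integral>\<^sup>+m\<in>S k. ennreal (X z m) \<partial>M)) + ennreal C * tail k * \<rho> j z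
          + ennreal t * (\<rho> j z * (\<integral>\<^sup>+m. ennreal (X z m powr p) \<partial>M))"
        by (simp add: distrib_left mult_ac)
    qed
    also have "\<dots> = ennreal (b k) * (\<integral>\<^sup>+z. \<rho> j z * (\<integral>\<^sup>+m\<in>S k. ennreal (X z m) \<partial>M) \<partial>L) + ennreal C * tail k
        + ennreal t * (\<integral>\<^sup>+z. \<rho> j z * (\<integral>\<^sup>+m. ennreal (X z m powr p) \<partial>M) \<partial>L)"
      by (simp add: nn_integral_add nn_integral_cmult \<rho>)
    also have "\<dots> \<le> ennreal (e / 3) + ennreal (e / 3) + ennreal t * ennreal B"
      using elim k X by (intro add_mono mult_left_mono) auto
    also have "ennreal t * ennreal B \<le> ennreal (e / 3)"
      using tB t by (cases "0 \<le> B") (auto simp: ennreal_mult[symmetric] ennreal_leI ennreal_neg)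
    finally show ?case using e by (simp add: ennreal_plus[symmetric] del: ennreal_plus)
  qed
qed

context gagliardo
begin

definition q :: real where "q = p / (p - 1)"

lemma q: "1 < q" "1 / p + 1 / q = 1" "(p - 1) * q = p"
  using p by (auto simp: q_def field_simps)

text \<open>The \<open>p\<close>-th power of the scalar Gagliardo seminorm over the whole space; its
  finiteness makes a function admissible for testing.\<close>

definition gag :: "(real ^ 'n \<Rightarrow> real) \<Rightarrow> ennreal" where
  "gag \<psi> = (\<integral>\<^sup>+x. (\<integral>\<^sup>+y. ennreal (\<bar>\<psi> x - \<psi> y\<bar> powr p / norm (x - y) powr ex) \<partial>lborel) \<partial>lborel)"

section \<open>Translations averaged over mollifiers of shrinking radius\<close>

context
  fixes \<psi> :: "real ^ 'n \<Rightarrow> real" and \<rho> :: "nat \<Rightarrow> real ^ 'n \<Rightarrow> real" and \<epsilon> :: "nat \<Rightarrow> real" and c :: real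
  assumes \<psi> [measurable]: "\<psi> \<in> borel_measurable borel" and gag: "gag \<psi> < \<infinity>"
    and \<epsilon>: "\<And>j. 0 < \<epsilon> j" "\<epsilon> \<longlonglongrightarrow> 0"
    and \<rho>: "\<And>j. \<rho> j \<in> bumps (\<epsilon> j)" "\<And>j x. 0 \<le> \<rho> j x" "\<And>j. (\<integral>\<^sup>+x. ennreal (\<rho> j x) \<partial>lborel) = 1"
      "\<And>j x. \<rho> j x \<le> c * \<epsilon> j powr (- dim)"
begin

lemma \<rho>_measurable: "\<rho> j \<in> borel_measurable borel"
  by (rule bumps_measurable[OF \<rho>(1)])

lemma c_nonneg: "0 \<le> c"
proof -
  have "0 \<le> c * \<epsilon> 0 powr (- dim)" using \<rho>(2)[of 0 0] \<rho>(4)[of 0 0] by linarith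
  moreover have "0 < \<epsilon> 0 powr (- dim)" using \<epsilon>(1)[of 0] by simp
  ultimately show ?thesis by (simp add: zero_le_mult_iff)
qed

text \<open>The mollifier is at most \<open>c * \<epsilon> j powr (s * p)\<close> times the singular
  kernel: on its support the distance is at most \<open>\<epsilon> j\<close>, and its height is at
  most \<open>c * \<epsilon> j powr (- dim)\<close>. So the energy of \<open>\<psi>\<close> gives
  convergence with a rate, without appeal to continuity of translations in
  \<open>L^p\<close>.\<close>

lemma averaged_translation:
  "(\<integral>\<^sup>+z. ennreal (\<rho> j z) * (\<integral>\<^sup>+x. ennreal (\<bar>\<psi> (x - z) - \<psi> x\<bar> powr p) \<partial>lborel) \<partial>lborel)
     \<le> ennreal (c * \<epsilon> j powr (s * p)) * gag \<psi>"
proof -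
  note [measurable] = \<rho>_measurable
  have "(\<integral>\<^sup>+z. ennreal (\<rho> j z) * (\<integral>\<^sup>+x. ennreal (\<bar>\<psi> (x - z) - \<psi> x\<bar> powr p) \<partial>lborel) \<partial>lborel)
    = (\<integral>\<^sup>+z. (\<integral>\<^sup>+x. ennreal (\<rho> j z) * ennreal (\<bar>\<psi> (x - z) - \<psi> x\<bar> powr p) \<partial>lborel) \<partial>lborel)"
    by (simp add: nn_integral_cmult)
  also have "\<dots> = (\<integral>\<^sup>+x. (\<integral>\<^sup>+z. ennreal (\<rho> j z) * ennreal (\<bar>\<psi> (x - z) - \<psi> x\<bar> powr p) \<partial>lborel) \<partial>lborel)"
    by (rule lborel_pair.Fubini') measurable
  also have "\<dots> = (\<integral>\<^sup>+x. (\<integral>\<^sup>+y. ennreal (\<rho> j (x - y)) * ennreal (\<bar>\<psi> y - \<psi> x\<bar> powr p) \<partial>lborel) \<partial>lborel)"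
  proof (rule nn_integral_cong)
    fix x
    have "(\<integral>\<^sup>+z. ennreal (\<rho> j z) * ennreal (\<bar>\<psi> (x - z) - \<psi> x\<bar> powr p) \<partial>lborel)
      = (\<integral>\<^sup>+z. (\<lambda>z. ennreal (\<rho> j z) * ennreal (\<bar>\<psi> (x - z) - \<psi> x\<bar> powr p)) (x - z) \<partial>lborel)"
      by (rule nn_integral_reflect[symmetric]) measurable
    then show "(\<integral>\<^sup>+z. ennreal (\<rho> j z) * ennreal (\<bar>\<psi> (x - z) - \<psi> x\<bar> powr p) \<partial>lborel)
      = (\<integral>\<^sup>+y. ennreal (\<rho> j (x - y)) * ennreal (\<bar>\<psi> y - \<psi> x\<bar> powr p) \<partial>lborel)" by simp
  qed
  also have "\<dots> \<le> (\<integral>\<^sup>+x. (\<integral>\<^sup>+y. ennreal (c * \<epsilon> j powr (s * p)) * ennreal (\<bar>\<psi> x - \<psi> y\<bar> powr p / norm (x - y) powr ex) \<partial>lborel) \<partial>lborel)"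
  proof (intro nn_integral_mono)
    fix x y
    have "\<rho> j (x - y) * \<bar>\<psi> y - \<psi> x\<bar> powr p \<le> (c * \<epsilon> j powr (s * p)) * (\<bar>\<psi> x - \<psi> y\<bar> powr p / norm (x - y) powr ex)"
    proof (cases "x = y \<or> \<rho> j (x - y) = 0")
      case True
      then show ?thesis using c_nonneg p by auto
    next
      case False
      then have n: "0 < norm (x - y)" "norm (x - y) \<le> \<epsilon> j" using \<rho>(1)[of j] by (auto simp: bumps_def)
      have "c * \<epsilon> j powr (- dim) * norm (x - y) powr ex \<le> c * \<epsilon> j powr (- dim) * \<epsilon> j powr ex"
        using n c_nonneg ex_pos by (intro mult_left_mono powr_mono2) auto
      also have "\<dots> = c * (\<epsilon> j powr (- dim) * \<epsilon> j powr ex)" by (simp only: mult.assoc)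
      also have "\<epsilon> j powr (- dim) * \<epsilon> j powr ex = \<epsilon> j powr (s * p)" by (simp flip: powr_add)
      finally have 1: "c * \<epsilon> j powr (- dim) * norm (x - y) powr ex \<le> c * \<epsilon> j powr (s * p)" .
      have "\<rho> j (x - y) * norm (x - y) powr ex \<le> c * \<epsilon> j powr (- dim) * norm (x - y) powr ex"
        by (intro mult_right_mono \<rho>(4)) auto
      with 1 have "\<rho> j (x - y) * norm (x - y) powr ex \<le> c * \<epsilon> j powr (s * p)" by linarith
      then have "\<rho> j (x - y) \<le> c * \<epsilon> j powr (s * p) / norm (x - y) powr ex" using n by (simp add: pos_le_divide_eq)
      from mult_right_mono[OF this, of "\<bar>\<psi> y - \<psi> x\<bar> powr p"] show ?thesis by (simp add: abs_minus_commute)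
    qed
    then show "ennreal (\<rho> j (x - y)) * ennreal (\<bar>\<psi> y - \<psi> x\<bar> powr p)
      \<le> ennreal (c * \<epsilon> j powr (s * p)) * ennreal (\<bar>\<psi> x - \<psi> y\<bar> powr p / norm (x - y) powr ex)"
      using c_nonneg \<rho>(2) by (simp add: ennreal_mult[symmetric] ennreal_leI)
  qed
  also have "\<dots> = ennreal (c * \<epsilon> j powr (s * p)) * gag \<psi>"
    unfolding gag_def by (simp add: nn_integral_cmult)
  finally show ?thesis .
qed

text \<open>Young's inequality with a large \<open>t\<close> makes the part with \<open>V\<close>
  small for all \<open>j\<close>; with \<open>t\<close> fixed, \<open>averaged_translation\<close>
  makes the other part small for large \<open>j\<close>.\<close>

lemma averaged_translation_tendsto:
  assumes [measurable]: "V \<in> borel_measurable borel" and V0: "\<And>x. 0 \<le> V x"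
    and V: "(\<integral>\<^sup>+x. ennreal (V x powr q) \<partial>lborel) < \<infinity>"
  shows "(\<lambda>j. \<integral>\<^sup>+z. ennreal (\<rho> j z) * (\<integral>\<^sup>+x. ennreal (V x * \<bar>\<psi> (x - z) - \<psi> x\<bar>) \<partial>lborel) \<partial>lborel) \<longlonglongrightarrow> 0"
proof (rule ennreal_tendsto_0I)
  note [measurable] = \<rho>_measurable
  fix e :: real assume e: "0 < e"
  define v where "v = enn2real (\<integral>\<^sup>+x. ennreal (V x powr q) \<partial>lborel)"
  have v: "(\<integral>\<^sup>+x. ennreal (V x powr q) \<partial>lborel) = ennreal v" "0 \<le> v" using V by (auto simp: v_def)
  have "((\<lambda>t. t powr (- q / p) * v) \<longlongrightarrow> 0 * v) at_top"
    using p q by (intro tendsto_mult_right tendsto_neg_powr filterlim_ident) auto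
  then have "\<forall>\<^sub>F t in at_top. t powr (- q / p) * v < e / 2 \<and> 0 < t"
    using e by (intro eventually_conj order_tendstoD(2) eventually_gt_at_top) auto
  then obtain t where t: "t powr (- q / p) * v < e / 2" "0 < t"
    using eventually_happens'[OF trivial_limit_at_top_linorder] by blast
  define g where "g = enn2real (gag \<psi>)"
  have g: "gag \<psi> = ennreal g" "0 \<le> g" using gag by (auto simp: g_def)
  have "(\<lambda>j. t * (c * \<epsilon> j powr (s * p) * g)) \<longlonglongrightarrow> t * (c * 0 powr (s * p) * g)"
    using sp_pos \<epsilon> by (intro tendsto_intros tendsto_powr') (auto intro!: always_eventually less_imp_le)
  then have "\<forall>\<^sub>F j in sequentially. t * (c * \<epsilon> j powr (s * p) * g) < e / 2"
    using e by (intro order_tendstoD) auto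
  then show "\<forall>\<^sub>F j in sequentially. (\<integral>\<^sup>+z. ennreal (\<rho> j z) * (\<integral>\<^sup>+x. ennreal (V x * \<bar>\<psi> (x - z) - \<psi> x\<bar>) \<partial>lborel) \<partial>lborel) \<le> ennreal e"
  proof eventually_elim
    case (elim j)
    have "(\<integral>\<^sup>+z. ennreal (\<rho> j z) * (\<integral>\<^sup>+x. ennreal (V x * \<bar>\<psi> (x - z) - \<psi> x\<bar>) \<partial>lborel) \<partial>lborel)
      \<le> (\<integral>\<^sup>+z. ennreal (\<rho> j z) * (ennreal (t powr (- q / p)) * ennreal v
         + ennreal t * (\<integral>\<^sup>+x. ennreal (\<bar>\<psi> (x - z) - \<psi> x\<bar> powr p) \<partial>lborel)) \<partial>lborel)"
    proof (intro nn_integral_mono mult_left_mono)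
      fix z
      have "(\<integral>\<^sup>+x. ennreal (V x * \<bar>\<psi> (x - z) - \<psi> x\<bar>) \<partial>lborel)
        \<le> (\<integral>\<^sup>+x. ennreal (t powr (- q / p)) * ennreal (V x powr q) + ennreal t * ennreal (\<bar>\<psi> (x - z) - \<psi> x\<bar> powr p) \<partial>lborel)"
      proof (rule nn_integral_mono)
        fix x
        have "V x * \<bar>\<psi> (x - z) - \<psi> x\<bar> \<le> t powr (- q / p) * V x powr q + t * \<bar>\<psi> (x - z) - \<psi> x\<bar> powr p"
          using V0 t p q by (intro Young_scaled) auto
        then have "ennreal (V x * \<bar>\<psi> (x - z) - \<psi> x\<bar>) \<le> ennreal (t powr (- q / p) * V x powr q + t * \<bar>\<psi> (x - z) - \<psi> x\<bar> powr p)"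
          by (rule ennreal_leI)
        also have "\<dots> = ennreal (t powr (- q / p)) * ennreal (V x powr q) + ennreal t * ennreal (\<bar>\<psi> (x - z) - \<psi> x\<bar> powr p)"
          using t by (simp add: ennreal_mult)
        finally show "ennreal (V x * \<bar>\<psi> (x - z) - \<psi> x\<bar>)
          \<le> ennreal (t powr (- q / p)) * ennreal (V x powr q) + ennreal t * ennreal (\<bar>\<psi> (x - z) - \<psi> x\<bar> powr p)" .
      qed
      also have "\<dots> = ennreal (t powr (- q / p)) * ennreal v + ennreal t * (\<integral>\<^sup>+x. ennreal (\<bar>\<psi> (x - z) - \<psi> x\<bar> powr p) \<partial>lborel)"
        by (simp add: nn_integral_add nn_integral_cmult v)
      finally show "(\<integral>\<^sup>+x. ennreal (V x * \<bar>\<psi> (x - z) - \<psi> x\<bar>) \<partial>lborel) \<le> \<dots>" .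
    qed auto
    also have "\<dots> = ennreal (t powr (- q / p)) * ennreal v
         + ennreal t * (\<integral>\<^sup>+z. ennreal (\<rho> j z) * (\<integral>\<^sup>+x. ennreal (\<bar>\<psi> (x - z) - \<psi> x\<bar> powr p) \<partial>lborel) \<partial>lborel)"
    proof -
      have "(\<integral>\<^sup>+z. ennreal (\<rho> j z) * (ennreal (t powr (- q / p)) * ennreal v
         + ennreal t * (\<integral>\<^sup>+x. ennreal (\<bar>\<psi> (x - z) - \<psi> x\<bar> powr p) \<partial>lborel)) \<partial>lborel)
        = (\<integral>\<^sup>+z. (ennreal (t powr (- q / p)) * ennreal v) * ennreal (\<rho> j z)
         + ennreal t * (ennreal (\<rho> j z) * (\<integral>\<^sup>+x. ennreal (\<bar>\<psi> (x - z) - \<psi> x\<bar> powr p) \<partial>lborel)) \<partial>lborel)"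
        by (simp add: distrib_left mult_ac)
      also have "\<dots> = (ennreal (t powr (- q / p)) * ennreal v) * (\<integral>\<^sup>+z. ennreal (\<rho> j z) \<partial>lborel)
         + ennreal t * (\<integral>\<^sup>+z. ennreal (\<rho> j z) * (\<integral>\<^sup>+x. ennreal (\<bar>\<psi> (x - z) - \<psi> x\<bar> powr p) \<partial>lborel) \<partial>lborel)"
        by (subst nn_integral_add, measurable, subst (1 2) nn_integral_cmult, measurable)
      finally show ?thesis by (simp add: \<rho>(3))
    qed
    also have "\<dots> \<le> ennreal (t powr (- q / p)) * ennreal v + ennreal t * (ennreal (c * \<epsilon> j powr (s * p)) * gag \<psi>)"
      by (intro add_left_mono mult_left_mono averaged_translation) auto
    also have "\<dots> = ennreal (t powr (- q / p) * v + t * (c * \<epsilon> j powr (s * p) * g))"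
      using v g t c_nonneg by (simp add: ennreal_mult)
    also have "\<dots> \<le> ennreal e" using elim t by (intro ennreal_leI) simp
    finally show ?case .
  qed
qed

text \<open>The kernel exponent is split as \<open>ex / q + ex / p\<close>. With the first share the
  weight \<open>d powr (p - 1)\<close> lies in \<open>L^q\<close>, because
  \<open>(p - 1) * q = p\<close> turns its norm into the energy of \<open>A\<close>; with the second
  share the increments are bounded in \<open>L^p\<close> uniformly in \<open>z\<close>. By
  \<open>truncated_limit\<close> only an \<open>L^1\<close> statement remains, on sets where weight
  and kernel are bounded.\<close>

lemma averaged_increment_tendsto:
  assumes A [measurable]: "A \<in> sets borel" and fin: "emeasure lborel A < \<infinity>" "en A A < \<infinity>"
  shows "(\<lambda>j. \<integral>\<^sup>+z. ennreal (\<rho> j z) * (\<integral>\<^sup>+m. ennreal (indicator (A \<times> A) m * d (fst m) (snd m) powr (p - 1)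
      * \<bar>\<psi> (fst m - z) - \<psi> (snd m - z) - (\<psi> (fst m) - \<psi> (snd m))\<bar> * norm (fst m - snd m) powr (- ex)) \<partial>(lborel \<Otimes>\<^sub>M lborel)) \<partial>lborel) \<longlonglongrightarrow> 0"
proof -
  note [measurable] = \<rho>_measurable
  define M2 where "M2 = (lborel \<Otimes>\<^sub>M lborel :: ((real ^ 'n) \<times> (real ^ 'n)) measure)"
  define V where "V = (\<lambda>m. indicator (A \<times> A) m * d (fst m) (snd m) powr (p - 1) * norm (fst m - snd m) powr (- ex / q))"
  define X where "X = (\<lambda>z m. \<bar>\<psi> (fst m - z) - \<psi> (snd m - z) - (\<psi> (fst m) - \<psi> (snd m))\<bar> * norm (fst m - snd m) powr (- ex / p))"
  \<comment> \<open>Here \<open>d\<close> is bounded and the two points stay apart, so the weight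
    and the second share of the kernel are bounded by constants depending on
    \<open>k\<close>.\<close>
  define S where "S = (\<lambda>k::nat. {m \<in> space M2. m \<in> A \<times> A \<and> d (fst m) (snd m) \<le> real k + 1 \<and> 1 / (real k + 1) \<le> norm (fst m - snd m)})"
  have AA [measurable]: "A \<times> A \<in> sets M2" unfolding M2_def by auto
  have fs [measurable]: "fst \<in> borel_measurable M2" "snd \<in> borel_measurable M2"
    unfolding M2_def by measurable
  have sf: "sigma_finite_measure M2" unfolding M2_def by (rule lborel_pair.sigma_finite_measure_axioms)
  interpret M2: sigma_finite_measure M2 by (rule sf)
  have Vm [measurable]: "V \<in> borel_measurable M2" unfolding V_def by measurable
  have Xm [measurable]: "case_prod X \<in> borel_measurable (lborel \<Otimes>\<^sub>M M2)"
    unfolding X_def split_beta' by measurable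
  have Sm [measurable]: "S k \<in> sets M2" for k unfolding S_def by measurable
  have e0: "a powr (- ex / q) * a powr (- ex / p) = a powr (- ex)" for a :: real
  proof -
    have "u / q + u / p = u * (1 / p + 1 / q)" for u by (simp add: algebra_simps)
    then have "- ex / q + - ex / p = - ex" using q(2) by (metis mult.right_neutral)
    then show ?thesis by (simp only: powr_add[symmetric])
  qed
  have exn: "- ex / p \<le> 0" "- ex / q \<le> 0"
    using ex_pos p q by (auto intro!: divide_nonpos_pos simp del: minus_add_distrib)
  have lim: "(\<lambda>j. \<integral>\<^sup>+z. ennreal (\<rho> j z) * (\<integral>\<^sup>+m\<in>S k. ennreal (X z m) \<partial>M2) \<partial>lborel) \<longlonglongrightarrow> 0" for k
  proof -
    define b where "b = (1 / (real k + 1)) powr (- ex / p)"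
    define T where "T = (\<lambda>z. \<integral>\<^sup>+x. ennreal (indicator A x * \<bar>\<psi> (x - z) - \<psi> x\<bar>) \<partial>lborel)"
    have Tm [measurable]: "T \<in> borel_measurable borel" unfolding T_def by measurable
    have le: "(\<integral>\<^sup>+m\<in>S k. ennreal (X z m) \<partial>M2) \<le> ennreal b * (2 * emeasure lborel A) * T z" for z
    proof -
      have "(\<integral>\<^sup>+m\<in>S k. ennreal (X z m) \<partial>M2) \<le> (\<integral>\<^sup>+m. ennreal b * (ennreal (indicator A (fst m) * \<bar>\<psi> (fst m - z) - \<psi> (fst m)\<bar>) * indicator A (snd m)
           + ennreal (indicator A (snd m) * \<bar>\<psi> (snd m - z) - \<psi> (snd m)\<bar>) * indicator A (fst m)) \<partial>M2)"
      proof (rule nn_integral_mono)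
        fix m
        show "ennreal (X z m) * indicator (S k) m \<le> ennreal b * (ennreal (indicator A (fst m) * \<bar>\<psi> (fst m - z) - \<psi> (fst m)\<bar>) * indicator A (snd m)
           + ennreal (indicator A (snd m) * \<bar>\<psi> (snd m - z) - \<psi> (snd m)\<bar>) * indicator A (fst m))"
        proof (cases "m \<in> S k")
          case True
          then have m: "fst m \<in> A" "snd m \<in> A" "1 / (real k + 1) \<le> norm (fst m - snd m)" by (auto simp: S_def)
          have "norm (fst m - snd m) powr (- ex / p) \<le> (1 / (real k + 1)) powr (- ex / p)"
            using m(3) by (intro powr_mono2' exn) auto
          also have "\<dots> = b" by (simp only: b_def)
          finally have bb: "norm (fst m - snd m) powr (- ex / p) \<le> b" .
          have "X z m \<le> (\<bar>\<psi> (fst m - z) - \<psi> (fst m)\<bar> + \<bar>\<psi> (snd m - z) - \<psi> (snd m)\<bar>) * b"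
            unfolding X_def using bb by (intro mult_mono) auto
          then have "ennreal (X z m) \<le> ennreal (b * (\<bar>\<psi> (fst m - z) - \<psi> (fst m)\<bar> + \<bar>\<psi> (snd m - z) - \<psi> (snd m)\<bar>))"
            by (intro ennreal_leI) (simp add: mult.commute)
          also have "\<dots> = ennreal b * (ennreal \<bar>\<psi> (fst m - z) - \<psi> (fst m)\<bar> + ennreal \<bar>\<psi> (snd m - z) - \<psi> (snd m)\<bar>)"
            by (simp add: ennreal_mult b_def)
          finally show ?thesis using m True by simp
        qed simp
      qed
      also have "\<dots> = ennreal b * ((\<integral>\<^sup>+m. ennreal (indicator A (fst m) * \<bar>\<psi> (fst m - z) - \<psi> (fst m)\<bar>) * indicator A (snd m) \<partial>M2)
           + (\<integral>\<^sup>+m. ennreal (indicator A (snd m) * \<bar>\<psi> (snd m - z) - \<psi> (snd m)\<bar>) * indicator A (fst m) \<partial>M2))"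
        by (simp add: nn_integral_cmult nn_integral_add)
      also have "(\<integral>\<^sup>+m. ennreal (indicator A (fst m) * \<bar>\<psi> (fst m - z) - \<psi> (fst m)\<bar>) * indicator A (snd m) \<partial>M2)
         = T z * emeasure lborel A"
        unfolding M2_def T_def
        by (subst lborel.nn_integral_fst[symmetric]) (auto simp: nn_integral_cmult nn_integral_multc)
      also have "(\<integral>\<^sup>+m. ennreal (indicator A (snd m) * \<bar>\<psi> (snd m - z) - \<psi> (snd m)\<bar>) * indicator A (fst m) \<partial>M2)
         = T z * emeasure lborel A"
        unfolding M2_def T_def
        by (subst lborel.nn_integral_fst[symmetric]) (auto simp: nn_integral_cmult nn_integral_multc)
      finally show ?thesis by (simp add: mult_ac flip: mult_2)
    qed
    have Tlim: "(\<lambda>j. \<integral>\<^sup>+z. ennreal (\<rho> j z) * T z \<partial>lborel) \<longlonglongrightarrow> 0"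
      unfolding T_def
    proof (rule averaged_translation_tendsto)
      have "(\<integral>\<^sup>+x. ennreal (indicator A x powr q) \<partial>lborel) = (\<integral>\<^sup>+x. indicator A x \<partial>lborel)"
        by (intro nn_integral_cong) (auto simp: indicator_def)
      then show "(\<integral>\<^sup>+x. ennreal (indicator A x powr q) \<partial>lborel) < \<infinity>" using fin by simp
    qed auto
    have "ennreal b * (2 * emeasure lborel A) < \<infinity>" using fin by (simp add: ennreal_mult_less_top)
    then have "(\<lambda>j. ennreal b * (2 * emeasure lborel A) * (\<integral>\<^sup>+z. ennreal (\<rho> j z) * T z \<partial>lborel)) \<longlonglongrightarrow> ennreal b * (2 * emeasure lborel A) * 0"
      by (intro ennreal_tendsto_cmult Tlim) auto
    then have up: "(\<lambda>j. ennreal b * (2 * emeasure lborel A) * (\<integral>\<^sup>+z. ennreal (\<rho> j z) * T z \<partial>lborel)) \<longlonglongrightarrow> 0" by simp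
    have bd: "(\<integral>\<^sup>+z. ennreal (\<rho> j z) * (\<integral>\<^sup>+m\<in>S k. ennreal (X z m) \<partial>M2) \<partial>lborel)
       \<le> ennreal b * (2 * emeasure lborel A) * (\<integral>\<^sup>+z. ennreal (\<rho> j z) * T z \<partial>lborel)" for j
    proof -
      have "(\<integral>\<^sup>+z. ennreal (\<rho> j z) * (\<integral>\<^sup>+m\<in>S k. ennreal (X z m) \<partial>M2) \<partial>lborel)
        \<le> (\<integral>\<^sup>+z. ennreal b * (2 * emeasure lborel A) * (ennreal (\<rho> j z) * T z) \<partial>lborel)"
      proof (rule nn_integral_mono)
        fix z
        from mult_left_mono[OF le[of z], of "ennreal (\<rho> j z)"]
        show "ennreal (\<rho> j z) * (\<integral>\<^sup>+m\<in>S k. ennreal (X z m) \<partial>M2) \<le> ennreal b * (2 * emeasure lborel A) * (ennreal (\<rho> j z) * T z)"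
          by (simp add: mult_ac)
      qed
      then show ?thesis by (simp add: nn_integral_cmult)
    qed
    show ?thesis by (rule tendsto_sandwich[OF _ _ tendsto_const up]) (auto intro!: always_eventually bd)
  qed
  \<comment> \<open>The bound does not depend on \<open>z\<close>, since the double integral
    defining \<open>gag\<close> is invariant under simultaneous translation of both points.\<close>
  have bX: "(\<integral>\<^sup>+m. ennreal (X z m powr p) \<partial>M2) \<le> ennreal (2 powr (p + 1)) * gag \<psi>" for z
  proof -
    have "(\<integral>\<^sup>+m. ennreal (X z m powr p) \<partial>M2)
      = (\<integral>\<^sup>+x. (\<integral>\<^sup>+y. ennreal (X z (x, y) powr p) \<partial>lborel) \<partial>lborel)"
      unfolding M2_def
      by (rule lborel.nn_integral_fst[symmetric]) (auto simp: X_def split_beta')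
    also have "\<dots> \<le> (\<integral>\<^sup>+x. (\<integral>\<^sup>+y. ennreal (2 powr p) * (ennreal (\<bar>\<psi> (x - z) - \<psi> (y - z)\<bar> powr p / norm (x - y) powr ex)
        + ennreal (\<bar>\<psi> x - \<psi> y\<bar> powr p / norm (x - y) powr ex)) \<partial>lborel) \<partial>lborel)"
    proof (intro nn_integral_mono)
      fix x y
      have "X z (x, y) powr p = \<bar>\<psi> (x - z) - \<psi> (y - z) - (\<psi> x - \<psi> y)\<bar> powr p * norm (x - y) powr (- ex)"
        unfolding X_def using p by (simp add: powr_mult powr_powr)
      also have "\<dots> = \<bar>\<psi> (x - z) - \<psi> (y - z) - (\<psi> x - \<psi> y)\<bar> powr p / norm (x - y) powr ex"
        by (metis divide_powr_uminus)
      also have "\<dots> \<le> (2 powr p * (\<bar>\<psi> (x - z) - \<psi> (y - z)\<bar> powr p + \<bar>\<psi> x - \<psi> y\<bar> powr p)) / norm (x - y) powr ex"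
      proof (rule divide_right_mono)
        have "\<bar>\<psi> (x - z) - \<psi> (y - z) - (\<psi> x - \<psi> y)\<bar> powr p \<le> (\<bar>\<psi> (x - z) - \<psi> (y - z)\<bar> + \<bar>\<psi> x - \<psi> y\<bar>) powr p"
          using p by (intro powr_mono2) auto
        also have "\<dots> \<le> 2 powr p * (\<bar>\<psi> (x - z) - \<psi> (y - z)\<bar> powr p + \<bar>\<psi> x - \<psi> y\<bar> powr p)"
          using p by (intro powr_add_le) auto
        finally show "\<bar>\<psi> (x - z) - \<psi> (y - z) - (\<psi> x - \<psi> y)\<bar> powr p \<le> 2 powr p * (\<bar>\<psi> (x - z) - \<psi> (y - z)\<bar> powr p + \<bar>\<psi> x - \<psi> y\<bar> powr p)" .
      qed simp
      also have "\<dots> = 2 powr p * (\<bar>\<psi> (x - z) - \<psi> (y - z)\<bar> powr p / norm (x - y) powr ex + \<bar>\<psi> x - \<psi> y\<bar> powr p / norm (x - y) powr ex)"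
        by (simp add: add_divide_distrib algebra_simps)
      finally show "ennreal (X z (x, y) powr p) \<le> ennreal (2 powr p) * (ennreal (\<bar>\<psi> (x - z) - \<psi> (y - z)\<bar> powr p / norm (x - y) powr ex)
        + ennreal (\<bar>\<psi> x - \<psi> y\<bar> powr p / norm (x - y) powr ex))"
        by (simp add: ennreal_mult[symmetric] ennreal_plus[symmetric] ennreal_leI del: ennreal_plus)
    qed
    also have "\<dots> = ennreal (2 powr p) * ((\<integral>\<^sup>+x. (\<integral>\<^sup>+y. ennreal (\<bar>\<psi> (x - z) - \<psi> (y - z)\<bar> powr p / norm (x - y) powr ex) \<partial>lborel) \<partial>lborel) + gag \<psi>)"
      unfolding gag_def by (simp add: nn_integral_cmult nn_integral_add)
    also have "(\<integral>\<^sup>+x. (\<integral>\<^sup>+y. ennreal (\<bar>\<psi> (x - z) - \<psi> (y - z)\<bar> powr p / norm (x - y) powr ex) \<partial>lborel) \<partial>lborel) = gag \<psi>"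
    proof -
      define F where "F = (\<lambda>x y. ennreal (\<bar>\<psi> x - \<psi> y\<bar> powr p / norm (x - y) powr ex))"
      have Fm [measurable]: "case_prod F \<in> borel_measurable (borel \<Otimes>\<^sub>M borel)" "F x \<in> borel_measurable borel" for x
        unfolding F_def split_beta' by measurable
      have "(\<integral>\<^sup>+x. (\<integral>\<^sup>+y. F (x - z) (y - z) \<partial>lborel) \<partial>lborel) = (\<integral>\<^sup>+x. (\<integral>\<^sup>+y. F (x - z) y \<partial>lborel) \<partial>lborel)"
        by (intro nn_integral_cong nn_integral_shift) auto
      also have "\<dots> = (\<integral>\<^sup>+x. (\<integral>\<^sup>+y. F x y \<partial>lborel) \<partial>lborel)"
        by (rule nn_integral_shift[of "\<lambda>x. \<integral>\<^sup>+y. F x y \<partial>lborel" z]) measurable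
      finally show ?thesis by (simp add: F_def gag_def)
    qed
    finally show ?thesis by (simp add: mult.assoc[symmetric] mult_2[symmetric] powr_add ennreal_mult)
  qed
  define g where "g = enn2real (gag \<psi>)"
  have g: "gag \<psi> = ennreal g" "0 \<le> g" using gag by (auto simp: g_def)
  have main: "(\<lambda>j. \<integral>\<^sup>+z. ennreal (\<rho> j z) * (\<integral>\<^sup>+m. ennreal (V m * X z m) \<partial>M2) \<partial>lborel) \<longlonglongrightarrow> 0"
  proof (rule truncated_limit[where \<rho> = "\<lambda>j z. ennreal (\<rho> j z)" and S = S and p = p and q = q
        and B = "2 powr (p + 1) * g" and b = "\<lambda>k. (real k + 1) powr (p - 1) * (1 / (real k + 1)) powr (- ex / q)"])
    show "(\<integral>\<^sup>+m. ennreal (V m powr q) \<partial>M2) < \<infinity>"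
    proof -
      have "(\<integral>\<^sup>+m. ennreal (V m powr q) \<partial>M2) = (\<integral>\<^sup>+m. G (fst m) (snd m) * indicator A (snd m) * indicator A (fst m) \<partial>M2)"
      proof (rule nn_integral_cong)
        fix m
        have "V m powr q = indicator (A \<times> A) m * (d (fst m) (snd m) powr p * norm (fst m - snd m) powr (- ex))"
          unfolding V_def using q by (simp add: powr_mult powr_powr) (auto simp: indicator_def)
        then have "ennreal (V m powr q) = ennreal (indicator (A \<times> A) m * (d (fst m) (snd m) powr p / norm (fst m - snd m) powr ex))"
          by (metis divide_powr_uminus)
        then show "ennreal (V m powr q) = G (fst m) (snd m) * indicator A (snd m) * indicator A (fst m)"
          by (cases m) (auto simp: G_def indicator_def)
      qed
      also have "\<dots> = en A A"
        unfolding M2_def en_def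
        by (subst lborel.nn_integral_fst[symmetric]) (auto simp: nn_integral_multc)
      finally show ?thesis using fin by simp
    qed
    show "(\<integral>\<^sup>+z. ennreal (\<rho> j z) * (\<integral>\<^sup>+m. ennreal (X z m powr p) \<partial>M2) \<partial>lborel) \<le> ennreal (2 powr (p + 1) * g)" for j
    proof -
      have "(\<integral>\<^sup>+z. ennreal (\<rho> j z) * (\<integral>\<^sup>+m. ennreal (X z m powr p) \<partial>M2) \<partial>lborel)
        \<le> (\<integral>\<^sup>+z. ennreal (\<rho> j z) * (ennreal (2 powr (p + 1)) * gag \<psi>) \<partial>lborel)"
        by (intro nn_integral_mono mult_left_mono bX) auto
      also have "\<dots> = ennreal (2 powr (p + 1) * g)"
        using g \<rho>(3) by (simp add: nn_integral_multc ennreal_mult)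
      finally show ?thesis .
    qed
    show "\<forall>\<^sub>F k in sequentially. m \<in> S k" if m: "m \<in> space M2" "V m \<noteq> 0" for m
    proof -
      have AA: "m \<in> A \<times> A" and ne: "0 < norm (fst m - snd m)" using m by (auto simp: V_def indicator_def split: if_splits)
      obtain k1 :: nat where k1: "d (fst m) (snd m) \<le> real k1" using real_arch_simple by blast
      obtain k2 :: nat where k2: "1 / norm (fst m - snd m) \<le> real k2" using real_arch_simple by blast
      have "m \<in> S k" if "k \<ge> max k1 k2" for k
      proof -
        have "d (fst m) (snd m) \<le> real k + 1" using k1 that by (auto intro: order.trans)
        moreover have "1 / norm (fst m - snd m) \<le> real k + 1" using k2 that by (auto intro: order.trans)
        then have "1 / (real k + 1) \<le> norm (fst m - snd m)" using ne by (simp add: field_simps)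
        ultimately show ?thesis using AA m by (simp add: S_def)
      qed
      then show ?thesis unfolding eventually_sequentially by blast
    qed
    show "V m \<le> (real k + 1) powr (p - 1) * (1 / (real k + 1)) powr (- ex / q)" if "m \<in> S k" for k m
    proof -
      have m: "m \<in> A \<times> A" "d (fst m) (snd m) \<le> real k + 1" "1 / (real k + 1) \<le> norm (fst m - snd m)"
        using that by (auto simp: S_def)
      have "norm (fst m - snd m) powr (- ex / q) \<le> (1 / (real k + 1)) powr (- ex / q)"
        using m(3) by (intro powr_mono2' exn) auto
      moreover have "d (fst m) (snd m) powr (p - 1) \<le> (real k + 1) powr (p - 1)" using m(2) p by (intro powr_mono2) auto
      ultimately show ?thesis using m(1) unfolding V_def by (auto intro!: mult_mono)
    qed
  qed (use sf lim p q \<rho>(3) in \<open>auto simp: V_def X_def\<close>)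
  have "V m * X z m = indicator (A \<times> A) m * d (fst m) (snd m) powr (p - 1)
      * \<bar>\<psi> (fst m - z) - \<psi> (snd m - z) - (\<psi> (fst m) - \<psi> (snd m))\<bar> * norm (fst m - snd m) powr (- ex)" for m z
    unfolding V_def X_def e0[symmetric] by (simp only: mult_ac)
  then show ?thesis using main unfolding M2_def by simp
qed

end

end

section \<open>Passing to the limit in integrals of mollified functions\<close>

lemma conv_commute:
  fixes f g :: "real ^ 'n::finite \<Rightarrow> real"
  assumes [measurable]: "f \<in> borel_measurable borel" "g \<in> borel_measurable borel"
  shows "conv f g x = (LINT w|lborel. f w * g (x - w))"
  unfolding conv_def
  by (subst lborel_distr_reflect[of x, symmetric], subst integral_distr) auto

lemma conv_vanishes:
  assumes f: "f \<in> bumps e" and g: "\<And>x. x \<notin> cball x1 r \<Longrightarrow> g x = 0" and x: "x \<notin> cball x1 (r + e)"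
  shows "conv f g x = 0"
proof -
  have "f (x - z) * g z = 0" for z
  proof (cases "z \<in> cball x1 r")
    case True
    have "dist x1 x \<le> dist x1 z + norm (x - z)" by (metis dist_norm dist_triangle dist_commute)
    then have "x - z \<notin> cball 0 e" using True x by auto
    then show ?thesis using f by (auto simp: bumps_def)
  qed (use g in simp)
  then have "(\<lambda>z. f (x - z) * g z) = (\<lambda>_. 0)" by (rule ext)
  then show ?thesis by (simp only: conv_def Bochner_Integration.integral_zero)
qed

text \<open>Integrability of \<open>u n\<close> is inferred from a finite \<open>L^1\<close>
  distance to \<open>f\<close>, which is known only from some index on; hence the shift by
  \<open>n0\<close>.\<close>

lemma tendsto_integral_L1:
  fixes u :: "nat \<Rightarrow> 'a \<Rightarrow> real"
  assumes [measurable]: "\<And>n. u n \<in> borel_measurable M" and f: "integrable M f"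
    and lim: "(\<lambda>n. \<integral>\<^sup>+x. ennreal \<bar>u n x - f x\<bar> \<partial>M) \<longlonglongrightarrow> 0"
  shows "(\<lambda>n. LINT x|M. u n x) \<longlonglongrightarrow> (LINT x|M. f x)"
proof -
  have [measurable]: "f \<in> borel_measurable M" using f by auto
  have "\<forall>\<^sub>F n in sequentially. (\<integral>\<^sup>+x. ennreal \<bar>u n x - f x\<bar> \<partial>M) < \<infinity>"
    using lim by (intro order_tendstoD) auto
  then obtain n0 where n0: "\<And>n. n \<ge> n0 \<Longrightarrow> (\<integral>\<^sup>+x. ennreal \<bar>u n x - f x\<bar> \<partial>M) < \<infinity>"
    by (auto simp: eventually_sequentially)
  have int: "integrable M (u (n + n0))" for n
  proof -
    have "integrable M (\<lambda>x. u (n + n0) x - f x)"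
      using n0[of "n + n0"] by (intro integrableI_bounded) auto
    then have "integrable M (\<lambda>x. (u (n + n0) x - f x) + f x)" using f by (rule Bochner_Integration.integrable_add)
    then show ?thesis by simp
  qed
  have "(\<lambda>n. LINT x|M. u (n + n0) x) \<longlonglongrightarrow> (LINT x|M. f x)"
    using LIMSEQ_ignore_initial_segment[OF lim, of n0] by (intro tendsto_L1_int int f) simp
  then show ?thesis by (rule LIMSEQ_offset)
qed

text \<open>A kernel of mass 1 turns the difference of \<open>conv \<rho> \<psi>\<close> and
  \<open>\<psi>\<close> into an average of increments of \<open>\<psi>\<close>. The second bound
  translates both points together, as the singular kernel requires.\<close>

lemma conv_increment:
  fixes \<rho> \<psi> :: "real ^ 'n::finite \<Rightarrow> real"
  assumes \<rho>: "\<rho> \<in> bumps e" "\<And>x. 0 \<le> \<rho> x" "(\<integral>\<^sup>+x. ennreal (\<rho> x) \<partial>lborel) = 1" and \<psi>: "integrable lborel \<psi>"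
  shows "ennreal \<bar>conv \<rho> \<psi> x - \<psi> x\<bar> \<le> (\<integral>\<^sup>+w. ennreal (\<rho> w) * ennreal \<bar>\<psi> (x - w) - \<psi> x\<bar> \<partial>lborel)"
    and "ennreal \<bar>conv \<rho> \<psi> x - conv \<rho> \<psi> y - (\<psi> x - \<psi> y)\<bar>
      \<le> (\<integral>\<^sup>+w. ennreal (\<rho> w) * ennreal \<bar>\<psi> (x - w) - \<psi> (y - w) - (\<psi> x - \<psi> y)\<bar> \<partial>lborel)"
proof -
  note [measurable] = bumps_measurable[OF \<rho>(1)]
  have [measurable]: "\<psi> \<in> borel_measurable borel" using \<psi> by auto
  have \<rho>i: "integrable lborel \<rho>" using \<rho> by (intro integrableI_nonneg) auto
  have \<rho>1: "(LINT w|lborel. \<rho> w) = 1" using \<rho> by (simp add: integral_eq_nn_integral)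
  have ii: "integrable lborel (\<lambda>w. \<rho> w * \<psi> (x - w))" for x
  proof -
    have "integrable (distr lborel borel (\<lambda>w. x - w)) (\<lambda>w. \<rho> (x - w) * \<psi> w)"
      unfolding lborel_distr_reflect by (rule conv_integrable[OF \<rho>(1) \<psi>])
    then show ?thesis by (subst (asm) integrable_distr_eq) auto
  qed
  have eq: "conv \<rho> \<psi> x - \<psi> x = (LINT w|lborel. \<rho> w * (\<psi> (x - w) - \<psi> x))" for x
    unfolding conv_commute[OF bumps_measurable[OF \<rho>(1)] \<open>\<psi> \<in> borel_measurable borel\<close>] right_diff_distrib
    using ii \<rho>i \<rho>1 by simp
  have ii': "integrable lborel (\<lambda>w. \<rho> w * (\<psi> (x - w) - \<psi> x))" for x
    unfolding right_diff_distrib using ii \<rho>i by simp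
  have "ennreal \<bar>conv \<rho> \<psi> x - \<psi> x\<bar> \<le> (\<integral>\<^sup>+w. ennreal \<bar>\<rho> w * (\<psi> (x - w) - \<psi> x)\<bar> \<partial>lborel)"
    unfolding eq using integral_norm_bound_ennreal[OF ii', of x] by simp
  then show "ennreal \<bar>conv \<rho> \<psi> x - \<psi> x\<bar> \<le> (\<integral>\<^sup>+w. ennreal (\<rho> w) * ennreal \<bar>\<psi> (x - w) - \<psi> x\<bar> \<partial>lborel)"
    using \<rho>(2) by (simp add: abs_mult ennreal_mult)
  have "conv \<rho> \<psi> x - conv \<rho> \<psi> y - (\<psi> x - \<psi> y) = (conv \<rho> \<psi> x - \<psi> x) - (conv \<rho> \<psi> y - \<psi> y)" by simp
  also have "\<dots> = (LINT w|lborel. \<rho> w * (\<psi> (x - w) - \<psi> x) - \<rho> w * (\<psi> (y - w) - \<psi> y))"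
    unfolding eq using ii' by simp
  finally have e2: "conv \<rho> \<psi> x - conv \<rho> \<psi> y - (\<psi> x - \<psi> y) = (LINT w|lborel. \<rho> w * (\<psi> (x - w) - \<psi> x) - \<rho> w * (\<psi> (y - w) - \<psi> y))" .
  have "ennreal \<bar>conv \<rho> \<psi> x - conv \<rho> \<psi> y - (\<psi> x - \<psi> y)\<bar>
     \<le> (\<integral>\<^sup>+w. ennreal \<bar>\<rho> w * (\<psi> (x - w) - \<psi> x) - \<rho> w * (\<psi> (y - w) - \<psi> y)\<bar> \<partial>lborel)"
    unfolding e2 using integral_norm_bound_ennreal[OF Bochner_Integration.integrable_diff[OF ii' ii'], of x y] by simp
  also have "\<dots> = (\<integral>\<^sup>+w. ennreal (\<rho> w) * ennreal \<bar>\<psi> (x - w) - \<psi> (y - w) - (\<psi> x - \<psi> y)\<bar> \<partial>lborel)"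
  proof (rule nn_integral_cong)
    fix w
    have "\<rho> w * (\<psi> (x - w) - \<psi> x) - \<rho> w * (\<psi> (y - w) - \<psi> y) = \<rho> w * (\<psi> (x - w) - \<psi> (y - w) - (\<psi> x - \<psi> y))"
      by (simp add: algebra_simps)
    then show "ennreal \<bar>\<rho> w * (\<psi> (x - w) - \<psi> x) - \<rho> w * (\<psi> (y - w) - \<psi> y)\<bar>
      = ennreal (\<rho> w) * ennreal \<bar>\<psi> (x - w) - \<psi> (y - w) - (\<psi> x - \<psi> y)\<bar>"
      using \<rho>(2) by (simp add: abs_mult ennreal_mult)
  qed
  finally show "ennreal \<bar>conv \<rho> \<psi> x - conv \<rho> \<psi> y - (\<psi> x - \<psi> y)\<bar>
      \<le> (\<integral>\<^sup>+w. ennreal (\<rho> w) * ennreal \<bar>\<psi> (x - w) - \<psi> (y - w) - (\<psi> x - \<psi> y)\<bar> \<partial>lborel)" .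
qed

lemma integrable_of_powr:
  fixes \<psi> :: "'a::euclidean_space \<Rightarrow> real"
  assumes [measurable]: "\<psi> \<in> borel_measurable borel" and p: "1 \<le> p"
    and \<psi>0: "\<And>x. x \<notin> cball c r \<Longrightarrow> \<psi> x = 0" and \<psi>p: "(\<integral>\<^sup>+x. ennreal (\<bar>\<psi> x\<bar> powr p) \<partial>lborel) < \<infinity>"
  shows "integrable lborel \<psi>"
proof (rule integrableI_bounded)
  have [measurable]: "cball c r \<in> sets borel" by simp
  have "(\<integral>\<^sup>+x. ennreal (norm (\<psi> x)) \<partial>lborel) \<le> (\<integral>\<^sup>+x. indicator (cball c r) x + ennreal (\<bar>\<psi> x\<bar> powr p) \<partial>lborel)"
  proof (rule nn_integral_mono)
    fix x
    show "ennreal (norm (\<psi> x)) \<le> indicator (cball c r) x + ennreal (\<bar>\<psi> x\<bar> powr p)"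
    proof (cases "x \<in> cball c r")
      case True
      have "\<bar>\<psi> x\<bar> \<le> 1 + \<bar>\<psi> x\<bar> powr p"
      proof (cases "\<bar>\<psi> x\<bar> \<le> 1")
        case False
        then have "\<bar>\<psi> x\<bar> powr 1 \<le> \<bar>\<psi> x\<bar> powr p" using p by (intro powr_mono) auto
        then show ?thesis using False by simp
      qed (simp add: add_increasing2)
      then have "ennreal \<bar>\<psi> x\<bar> \<le> ennreal (1 + \<bar>\<psi> x\<bar> powr p)" by (rule ennreal_leI)
      then show ?thesis using True by (simp add: ennreal_plus)
    qed (use \<psi>0 in simp)
  qed
  also have "\<dots> = emeasure lborel (cball c r) + (\<integral>\<^sup>+x. ennreal (\<bar>\<psi> x\<bar> powr p) \<partial>lborel)"
    by (simp add: nn_integral_add)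
  also have "\<dots> < \<infinity>" using \<psi>p emeasure_lborel_cball_finite[of c r] by simp
  finally show "(\<integral>\<^sup>+x. ennreal (norm (\<psi> x)) \<partial>lborel) < \<infinity>" .
qed simp

lemma increment_measurable:
  assumes v: "v \<in> borel_measurable (lborel \<Otimes>\<^sub>M lborel)" and \<psi>: "\<psi> \<in> borel_measurable borel"
  shows "(\<lambda>m. v m * (\<psi> (fst m) - \<psi> (snd m)) :: real) \<in> borel_measurable (lborel \<Otimes>\<^sub>M lborel)"
  by (intro borel_measurable_times v borel_measurable_diff measurable_compose[OF measurable_fst]
      measurable_compose[OF measurable_snd]) (use \<psi> in auto)

context gagliardo
begin

lemma increment_integrable:
  assumes A [measurable]: "A \<in> sets borel" and fin: "en A A < \<infinity>"
    and v: "v \<in> borel_measurable (lborel \<Otimes>\<^sub>M lborel)"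
      and vb: "\<And>m. \<bar>v m\<bar> \<le> indicator (A \<times> A) m * d (fst m) (snd m) powr (p - 1) * norm (fst m - snd m) powr (- ex)"
    and \<psi> [measurable]: "\<psi> \<in> borel_measurable borel" and gag: "gag \<psi> < \<infinity>"
  shows "integrable (lborel \<Otimes>\<^sub>M lborel) (\<lambda>m. v m * (\<psi> (fst m) - \<psi> (snd m)))"
proof (rule integrableI_bounded)
  have "(\<integral>\<^sup>+m. ennreal (norm (v m * (\<psi> (fst m) - \<psi> (snd m)))) \<partial>(lborel \<Otimes>\<^sub>M lborel))
    = (\<integral>\<^sup>+x. (\<integral>\<^sup>+y. ennreal (norm (v (x, y) * (\<psi> x - \<psi> y))) \<partial>lborel) \<partial>lborel)"
  proof -
    define F where "F = (\<lambda>m. ennreal (norm (v m * (\<psi> (fst m) - \<psi> (snd m)))))"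
    have "F \<in> borel_measurable (lborel \<Otimes>\<^sub>M lborel)"
      unfolding F_def using increment_measurable[OF v \<psi>] by simp
    then have "(\<integral>\<^sup>+x. (\<integral>\<^sup>+y. F (x, y) \<partial>lborel) \<partial>lborel) = integral\<^sup>N (lborel \<Otimes>\<^sub>M lborel) F"
      by (rule lborel.nn_integral_fst)
    then show ?thesis by (simp only: F_def fst_conv snd_conv)
  qed
  also have "\<dots> \<le> (\<integral>\<^sup>+x. (\<integral>\<^sup>+y. G x y * indicator A y * indicator A x + ennreal (\<bar>\<psi> x - \<psi> y\<bar> powr p / norm (x - y) powr ex) \<partial>lborel) \<partial>lborel)"
  proof (intro nn_integral_mono)
    fix x y
    have "\<bar>v (x, y) * (\<psi> x - \<psi> y)\<bar> \<le> indicator (A \<times> A) (x, y) * d x y powr (p - 1) * norm (x - y) powr (- ex) * \<bar>\<psi> x - \<psi> y\<bar>"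
      using mult_right_mono[OF vb[of "(x, y)"], of "\<bar>\<psi> x - \<psi> y\<bar>"] by (simp add: abs_mult)
    also have "\<dots> = indicator (A \<times> A) (x, y) * ((d x y powr (p - 1) * \<bar>\<psi> x - \<psi> y\<bar>) / norm (x - y) powr ex)"
      by (simp only: divide_powr_uminus mult_ac)
    also have "\<dots> \<le> indicator (A \<times> A) (x, y) * ((d x y powr p + \<bar>\<psi> x - \<psi> y\<bar> powr p) / norm (x - y) powr ex)"
      using p by (intro mult_left_mono divide_right_mono powr_mult_le_add) auto
    also have "\<dots> \<le> (d x y powr p / norm (x - y) powr ex) * indicator (A \<times> A) (x, y) + \<bar>\<psi> x - \<psi> y\<bar> powr p / norm (x - y) powr ex"
      by (auto simp: indicator_def add_divide_distrib)
    finally have "ennreal (norm (v (x, y) * (\<psi> x - \<psi> y))) \<le> ennreal ((d x y powr p / norm (x - y) powr ex) * indicator (A \<times> A) (x, y) + \<bar>\<psi> x - \<psi> y\<bar> powr p / norm (x - y) powr ex)"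
      by (intro ennreal_leI) simp
    also have "\<dots> = G x y * indicator A y * indicator A x + ennreal (\<bar>\<psi> x - \<psi> y\<bar> powr p / norm (x - y) powr ex)"
      by (auto simp: G_def indicator_def)
    finally show "ennreal (norm (v (x, y) * (\<psi> x - \<psi> y))) \<le> G x y * indicator A y * indicator A x + ennreal (\<bar>\<psi> x - \<psi> y\<bar> powr p / norm (x - y) powr ex)" .
  qed
  also have "\<dots> = (\<integral>\<^sup>+x. (\<integral>\<^sup>+y. G x y * indicator A y * indicator A x \<partial>lborel)
      + (\<integral>\<^sup>+y. ennreal (\<bar>\<psi> x - \<psi> y\<bar> powr p / norm (x - y) powr ex) \<partial>lborel) \<partial>lborel)"
    by (intro nn_integral_cong nn_integral_add) measurable
  also have "\<dots> = (\<integral>\<^sup>+x. (\<integral>\<^sup>+y. G x y * indicator A y * indicator A x \<partial>lborel) \<partial>lborel) + gag \<psi>"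
    unfolding gag_def by (intro nn_integral_add) measurable
  also have "(\<integral>\<^sup>+x. (\<integral>\<^sup>+y. G x y * indicator A y * indicator A x \<partial>lborel) \<partial>lborel) = en A A"
    unfolding en_def by (intro nn_integral_cong nn_integral_multc) measurable
  also have "en A A + gag \<psi> < \<infinity>" using fin gag by simp
  finally show "(\<integral>\<^sup>+m. ennreal (norm (v m * (\<psi> (fst m) - \<psi> (snd m)))) \<partial>(lborel \<Otimes>\<^sub>M lborel)) < \<infinity>" .
qed (rule increment_measurable[OF v \<psi>])

text \<open>Convolutions of \<open>\<psi>\<close> with mollifiers satisfy the equation by
  \<open>eq\<close>, and both sides converge to those for \<open>\<psi>\<close>: the left by
  \<open>averaged_increment_tendsto\<close>, the right by
  \<open>averaged_translation_tendsto\<close>. The smooth functions in \<open>eq\<close> come with a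
  Lipschitz bound, which convolutions have and which later gives absolute convergence when the weak
  form is split.\<close>

theorem weak_form_density:
  assumes A [measurable]: "A \<in> sets borel" and fin: "emeasure lborel A < \<infinity>" "en A A < \<infinity>"
    and v: "v \<in> borel_measurable (lborel \<Otimes>\<^sub>M lborel)"
      and vb: "\<And>m. \<bar>v m\<bar> \<le> indicator (A \<times> A) m * d (fst m) (snd m) powr (p - 1) * norm (fst m - snd m) powr (- ex)"
    and \<psi> [measurable]: "\<psi> \<in> borel_measurable borel" and gag: "gag \<psi> < \<infinity>"
      and \<psi>0: "\<And>x. x \<notin> cball x1 r1 \<Longrightarrow> \<psi> x = 0" and \<psi>p: "(\<integral>\<^sup>+x. ennreal (\<bar>\<psi> x\<bar> powr p) \<partial>lborel) < \<infinity>"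
    and r: "r1 < r2"
    and g [measurable]: "g \<in> borel_measurable borel" and gq: "(\<integral>\<^sup>+x\<in>cball x1 r2. ennreal (\<bar>g x\<bar> powr q) \<partial>lborel) < \<infinity>"
    and eq: "\<And>\<phi> l. (\<And>k. Ck k \<phi>) \<Longrightarrow> (\<And>x. x \<notin> cball x1 r2 \<Longrightarrow> \<phi> x = 0) \<Longrightarrow> 0 \<le> l
        \<Longrightarrow> (\<And>x y. \<bar>\<phi> x - \<phi> y\<bar> \<le> l * norm (x - y))
      \<Longrightarrow> (LINT m|(lborel \<Otimes>\<^sub>M lborel). v m * (\<phi> (fst m) - \<phi> (snd m))) = (LINT x|lborel. g x * \<phi> x)"
  shows "(LINT m|(lborel \<Otimes>\<^sub>M lborel). v m * (\<psi> (fst m) - \<psi> (snd m))) = (LINT x|lborel. g x * \<psi> x)"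
    "integrable lborel (\<lambda>x. g x * \<psi> x)"
proof -
  \<comment> \<open>Mollifying enlarges the support by at most \<open>\<epsilon> j\<close>, and
    \<open>\<epsilon> j \<le> r2 - r1\<close> keeps it inside the closed ball of radius
    \<open>r2\<close>.\<close>
  define \<epsilon> where "\<epsilon> = (\<lambda>j::nat. (r2 - r1) * (1 / (real j + 1)))"
  have \<epsilon>: "0 < \<epsilon> j" "\<epsilon> j \<le> r2 - r1" for j
    using r mult_left_mono[of "1 / (real j + 1)" 1 "r2 - r1"] by (auto simp: \<epsilon>_def)
  have "\<epsilon> \<longlonglongrightarrow> (r2 - r1) * 0"
    unfolding \<epsilon>_def using LIMSEQ_inverse_real_of_nat by (intro tendsto_intros) (simp add: divide_inverse add.commute)
  then have \<epsilon>0: "\<epsilon> \<longlonglongrightarrow> 0" by simp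
  define c where "c = exp 2 * 2 powr dim / vol"
  have "\<exists>\<rho>. \<rho> \<in> bumps (\<epsilon> j) \<and> (\<forall>x. 0 \<le> \<rho> x) \<and> (\<integral>\<^sup>+x. ennreal (\<rho> x) \<partial>(lborel :: (real ^ 'n) measure)) = 1
      \<and> (\<forall>x. \<rho> x \<le> c * \<epsilon> j powr (- dim))" for j
  proof -
    obtain f :: "real ^ 'n \<Rightarrow> real" where "f \<in> bumps (\<epsilon> j)" "\<And>x. 0 \<le> f x" "(\<integral>\<^sup>+x. ennreal (f x) \<partial>lborel) = 1"
      "\<And>x. f x \<le> exp 2 * 2 powr real CARD('n) / unit_ball_vol (real CARD('n)) * \<epsilon> j powr (- real CARD('n))"
      by (rule mollifier_exists[OF \<epsilon>(1)[of j]]) (rule that)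
    then show ?thesis unfolding c_def dim by (intro exI[of _ f]) simp
  qed
  then obtain \<rho> :: "nat \<Rightarrow> real ^ 'n \<Rightarrow> real" where \<rho>: "\<And>j. \<rho> j \<in> bumps (\<epsilon> j)" "\<And>j x. 0 \<le> \<rho> j x"
     "\<And>j. (\<integral>\<^sup>+x. ennreal (\<rho> j x) \<partial>lborel) = 1" "\<And>j x. \<rho> j x \<le> c * \<epsilon> j powr (- dim)"
    by metis
  note ctx = \<psi> gag \<epsilon>(1) \<epsilon>0 \<rho>
  have [measurable]: "\<rho> j \<in> borel_measurable borel" for j by (rule bumps_measurable[OF \<rho>(1)])
  have \<psi>i: "integrable lborel \<psi>" using p by (intro integrable_of_powr[OF _ _ \<psi>0 \<psi>p]) auto
  define \<phi> where "\<phi> = (\<lambda>j. conv (\<rho> j) \<psi>)"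
  have \<phi>0: "\<phi> j x = 0" if "x \<notin> cball x1 r2" for j x
    unfolding \<phi>_def by (rule conv_vanishes[OF \<rho>(1) \<psi>0]) (use that \<epsilon>(2)[of j] in auto)
  have \<phi>k: "Ck k (\<phi> j)" for k j unfolding \<phi>_def by (rule conv_Ck[OF \<rho>(1) \<psi>i])
  have "continuous_on UNIV (\<phi> j)" for j using \<phi>k[of 0 j] by simp
  then have \<phi>m [measurable]: "\<phi> j \<in> borel_measurable borel" for j by (rule borel_measurable_continuous_onI)
  have eqj: "(LINT m|(lborel \<Otimes>\<^sub>M lborel). v m * (\<phi> j (fst m) - \<phi> j (snd m))) = (LINT x|lborel. g x * \<phi> j x)" for j
  proof -
    obtain l where l: "0 \<le> l" "\<And>x y. \<bar>conv (\<rho> j) \<psi> x - conv (\<rho> j) \<psi> y\<bar> \<le> l * norm (x - y)"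
      by (rule conv_lipschitz[OF \<rho>(1)[of j] \<psi>i]) (rule that)
    then have "\<bar>\<phi> j x - \<phi> j y\<bar> \<le> l * norm (x - y)" for x y by (simp add: \<phi>_def)
    with l(1) show ?thesis by (intro eq[OF \<phi>k \<phi>0])
  qed
  have lim1: "(\<lambda>j. LINT m|(lborel \<Otimes>\<^sub>M lborel). v m * (\<phi> j (fst m) - \<phi> j (snd m)))
      \<longlonglongrightarrow> (LINT m|(lborel \<Otimes>\<^sub>M lborel). v m * (\<psi> (fst m) - \<psi> (snd m)))"
  proof (rule tendsto_integral_L1)
    show "integrable (lborel \<Otimes>\<^sub>M lborel) (\<lambda>m. v m * (\<psi> (fst m) - \<psi> (snd m)))"
      by (rule increment_integrable[OF A fin(2) v vb \<psi> gag])
    have bd: "(\<integral>\<^sup>+m. ennreal \<bar>v m * (\<phi> j (fst m) - \<phi> j (snd m)) - v m * (\<psi> (fst m) - \<psi> (snd m))\<bar> \<partial>(lborel \<Otimes>\<^sub>M lborel))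
      \<le> (\<integral>\<^sup>+z. ennreal (\<rho> j z) * (\<integral>\<^sup>+m. ennreal (indicator (A \<times> A) m * d (fst m) (snd m) powr (p - 1)
      * \<bar>\<psi> (fst m - z) - \<psi> (snd m - z) - (\<psi> (fst m) - \<psi> (snd m))\<bar> * norm (fst m - snd m) powr (- ex)) \<partial>(lborel \<Otimes>\<^sub>M lborel)) \<partial>lborel)" for j
    proof -
      define W where "W = (\<lambda>m. indicator (A \<times> A) m * d (fst m) (snd m) powr (p - 1) * norm (fst m - snd m) powr (- ex))"
      define \<xi> where "\<xi> = (\<lambda>z m. \<bar>\<psi> (fst m - z) - \<psi> (snd m - z) - (\<psi> (fst m) - \<psi> (snd m))\<bar>)"
      have AA [measurable]: "A \<times> A \<in> sets (borel \<Otimes>\<^sub>M borel)" by auto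
      have [measurable]: "W \<in> borel_measurable (borel \<Otimes>\<^sub>M borel)" unfolding W_def by measurable
      have [measurable]: "case_prod \<xi> \<in> borel_measurable (borel \<Otimes>\<^sub>M (borel \<Otimes>\<^sub>M borel))"
        unfolding \<xi>_def split_beta' by measurable
      have W0: "0 \<le> W m" for m by (simp add: W_def)
      have pf: "pair_sigma_finite (lborel :: (real ^ 'n) measure) (lborel \<Otimes>\<^sub>M lborel :: ((real ^ 'n) \<times> (real ^ 'n)) measure)"
        by (simp add: pair_sigma_finite_def sigma_finite_lborel lborel_pair.sigma_finite_measure_axioms)
      have "(\<integral>\<^sup>+m. ennreal \<bar>v m * (\<phi> j (fst m) - \<phi> j (snd m)) - v m * (\<psi> (fst m) - \<psi> (snd m))\<bar> \<partial>(lborel \<Otimes>\<^sub>M lborel))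
        \<le> (\<integral>\<^sup>+m. (\<integral>\<^sup>+z. ennreal (\<rho> j z) * ennreal (W m * \<xi> z m) \<partial>lborel) \<partial>(lborel \<Otimes>\<^sub>M lborel))"
      proof (rule nn_integral_mono)
        fix m
        have "\<bar>v m * (\<phi> j (fst m) - \<phi> j (snd m)) - v m * (\<psi> (fst m) - \<psi> (snd m))\<bar>
          = \<bar>v m\<bar> * \<bar>\<phi> j (fst m) - \<phi> j (snd m) - (\<psi> (fst m) - \<psi> (snd m))\<bar>"
          by (simp add: abs_mult[symmetric] algebra_simps)
        also have "\<dots> \<le> W m * \<bar>\<phi> j (fst m) - \<phi> j (snd m) - (\<psi> (fst m) - \<psi> (snd m))\<bar>"
          unfolding W_def by (intro mult_right_mono vb) auto
        finally have "ennreal \<bar>v m * (\<phi> j (fst m) - \<phi> j (snd m)) - v m * (\<psi> (fst m) - \<psi> (snd m))\<bar>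
          \<le> ennreal (W m) * ennreal \<bar>\<phi> j (fst m) - \<phi> j (snd m) - (\<psi> (fst m) - \<psi> (snd m))\<bar>"
          using W0 by (simp add: ennreal_mult[symmetric] ennreal_leI)
        also have "\<dots> \<le> ennreal (W m) * (\<integral>\<^sup>+z. ennreal (\<rho> j z) * ennreal (\<xi> z m) \<partial>lborel)"
          unfolding \<phi>_def \<xi>_def by (intro mult_left_mono conv_increment(2)[OF \<rho>(1-3) \<psi>i]) auto
        also have "\<dots> = (\<integral>\<^sup>+z. ennreal (W m) * (ennreal (\<rho> j z) * ennreal (\<xi> z m)) \<partial>lborel)"
          by (rule nn_integral_cmult[symmetric]) (simp add: \<xi>_def)
        also have "\<dots> = (\<integral>\<^sup>+z. ennreal (\<rho> j z) * ennreal (W m * \<xi> z m) \<partial>lborel)"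
          using W0 by (intro nn_integral_cong) (simp add: ennreal_mult \<xi>_def mult_ac)
        finally show "ennreal \<bar>v m * (\<phi> j (fst m) - \<phi> j (snd m)) - v m * (\<psi> (fst m) - \<psi> (snd m))\<bar>
          \<le> (\<integral>\<^sup>+z. ennreal (\<rho> j z) * ennreal (W m * \<xi> z m) \<partial>lborel)" .
      qed
      also have "\<dots> = (\<integral>\<^sup>+z. (\<integral>\<^sup>+m. ennreal (\<rho> j z) * ennreal (W m * \<xi> z m) \<partial>(lborel \<Otimes>\<^sub>M lborel)) \<partial>lborel)"
        by (rule pair_sigma_finite.Fubini'[OF pf]) measurable
      also have "\<dots> = (\<integral>\<^sup>+z. ennreal (\<rho> j z) * (\<integral>\<^sup>+m. ennreal (W m * \<xi> z m) \<partial>(lborel \<Otimes>\<^sub>M lborel)) \<partial>lborel)"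
        by (intro nn_integral_cong nn_integral_cmult) measurable
      finally show ?thesis unfolding W_def \<xi>_def by (simp only: mult_ac)
    qed
    show "(\<lambda>j. \<integral>\<^sup>+m. ennreal \<bar>v m * (\<phi> j (fst m) - \<phi> j (snd m)) - v m * (\<psi> (fst m) - \<psi> (snd m))\<bar> \<partial>(lborel \<Otimes>\<^sub>M lborel)) \<longlonglongrightarrow> 0"
      by (rule tendsto_sandwich[OF _ _ tendsto_const averaged_increment_tendsto[OF ctx A fin]])
        (intro always_eventually allI zero_le bd)+
  qed (rule increment_measurable[OF v \<phi>m])
  \<comment> \<open>\<open>g\<close> is known to be in \<open>L^q\<close> only on the ball of radius
    \<open>r2\<close>. Cutting it off there leaves the products unchanged, as \<open>\<psi>\<close>
    and all \<open>\<phi> j\<close> vanish outside.\<close>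
  define g' where "g' = (\<lambda>x. indicator (cball x1 r2) x * g x)"
  have cb [measurable]: "cball x1 r2 \<in> sets borel" by simp
  have g'm [measurable]: "g' \<in> borel_measurable borel" unfolding g'_def using g by measurable
  have g'q: "(\<integral>\<^sup>+x. ennreal (\<bar>g' x\<bar> powr q) \<partial>lborel) < \<infinity>"
  proof -
    have "(\<integral>\<^sup>+x. ennreal (\<bar>g' x\<bar> powr q) \<partial>lborel) = (\<integral>\<^sup>+x\<in>cball x1 r2. ennreal (\<bar>g x\<bar> powr q) \<partial>lborel)"
      by (intro nn_integral_cong) (auto simp: g'_def indicator_def)
    then show ?thesis using gq by simp
  qed
  have \<psi>0': "\<psi> x = 0" if "x \<notin> cball x1 r2" for x using that r by (intro \<psi>0) auto
  have gg: "g x * \<psi> x = g' x * \<psi> x" "g x * \<phi> j x = g' x * \<phi> j x" for x j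
    using \<phi>0[of x j] \<psi>0'[of x] by (auto simp: g'_def indicator_def)
  show int2: "integrable lborel (\<lambda>x. g x * \<psi> x)"
  proof (rule integrableI_bounded)
    have "(\<integral>\<^sup>+x. ennreal (norm (g x * \<psi> x)) \<partial>lborel) \<le> (\<integral>\<^sup>+x. ennreal (\<bar>g' x\<bar> powr q) + ennreal (\<bar>\<psi> x\<bar> powr p) \<partial>lborel)"
    proof (rule nn_integral_mono)
      fix x
      have "\<bar>g' x\<bar> * \<bar>\<psi> x\<bar> \<le> 1 powr (- q / p) * \<bar>g' x\<bar> powr q + 1 * \<bar>\<psi> x\<bar> powr p"
        using p q by (intro Young_scaled) auto
      then have "norm (g x * \<psi> x) \<le> \<bar>g' x\<bar> powr q + \<bar>\<psi> x\<bar> powr p" by (simp add: gg abs_mult)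
      from ennreal_leI[OF this] show "ennreal (norm (g x * \<psi> x)) \<le> ennreal (\<bar>g' x\<bar> powr q) + ennreal (\<bar>\<psi> x\<bar> powr p)"
        by (simp add: ennreal_plus)
    qed
    also have "\<dots> < \<infinity>" using g'q \<psi>p by (simp add: nn_integral_add)
    finally show "(\<integral>\<^sup>+x. ennreal (norm (g x * \<psi> x)) \<partial>lborel) < \<infinity>" .
  qed measurable
  have lim2: "(\<lambda>j. LINT x|lborel. g x * \<phi> j x) \<longlonglongrightarrow> (LINT x|lborel. g x * \<psi> x)"
  proof (rule tendsto_integral_L1[OF _ int2])
    have bd: "(\<integral>\<^sup>+x. ennreal \<bar>g x * \<phi> j x - g x * \<psi> x\<bar> \<partial>lborel)
      \<le> (\<integral>\<^sup>+z. ennreal (\<rho> j z) * (\<integral>\<^sup>+x. ennreal (\<bar>g' x\<bar> * \<bar>\<psi> (x - z) - \<psi> x\<bar>) \<partial>lborel) \<partial>lborel)" for j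
    proof -
      have "(\<integral>\<^sup>+x. ennreal \<bar>g x * \<phi> j x - g x * \<psi> x\<bar> \<partial>lborel)
        \<le> (\<integral>\<^sup>+x. (\<integral>\<^sup>+z. ennreal (\<rho> j z) * ennreal (\<bar>g' x\<bar> * \<bar>\<psi> (x - z) - \<psi> x\<bar>) \<partial>lborel) \<partial>lborel)"
      proof (rule nn_integral_mono)
        fix x
        have "\<bar>g x * \<phi> j x - g x * \<psi> x\<bar> = \<bar>g' x\<bar> * \<bar>\<phi> j x - \<psi> x\<bar>"
          unfolding gg by (simp add: abs_mult[symmetric] algebra_simps)
        then have "ennreal \<bar>g x * \<phi> j x - g x * \<psi> x\<bar> = ennreal \<bar>g' x\<bar> * ennreal \<bar>\<phi> j x - \<psi> x\<bar>"
          by (simp add: ennreal_mult)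
        also have "\<dots> \<le> ennreal \<bar>g' x\<bar> * (\<integral>\<^sup>+z. ennreal (\<rho> j z) * ennreal \<bar>\<psi> (x - z) - \<psi> x\<bar> \<partial>lborel)"
          unfolding \<phi>_def by (intro mult_left_mono conv_increment(1)[OF \<rho>(1-3) \<psi>i]) auto
        also have "\<dots> = (\<integral>\<^sup>+z. ennreal \<bar>g' x\<bar> * (ennreal (\<rho> j z) * ennreal \<bar>\<psi> (x - z) - \<psi> x\<bar>) \<partial>lborel)"
          by (rule nn_integral_cmult[symmetric]) measurable
        also have "\<dots> = (\<integral>\<^sup>+z. ennreal (\<rho> j z) * ennreal (\<bar>g' x\<bar> * \<bar>\<psi> (x - z) - \<psi> x\<bar>) \<partial>lborel)"
          by (intro nn_integral_cong) (simp add: ennreal_mult mult_ac)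
        finally show "ennreal \<bar>g x * \<phi> j x - g x * \<psi> x\<bar> \<le> (\<integral>\<^sup>+z. ennreal (\<rho> j z) * ennreal (\<bar>g' x\<bar> * \<bar>\<psi> (x - z) - \<psi> x\<bar>) \<partial>lborel)" .
      qed
      also have "\<dots> = (\<integral>\<^sup>+z. (\<integral>\<^sup>+x. ennreal (\<rho> j z) * ennreal (\<bar>g' x\<bar> * \<bar>\<psi> (x - z) - \<psi> x\<bar>) \<partial>lborel) \<partial>lborel)"
        by (rule lborel_pair.Fubini') measurable
      also have "\<dots> = (\<integral>\<^sup>+z. ennreal (\<rho> j z) * (\<integral>\<^sup>+x. ennreal (\<bar>g' x\<bar> * \<bar>\<psi> (x - z) - \<psi> x\<bar>) \<partial>lborel) \<partial>lborel)"
        by (intro nn_integral_cong nn_integral_cmult) measurable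
      finally show ?thesis .
    qed
    have lim: "(\<lambda>j. \<integral>\<^sup>+z. ennreal (\<rho> j z) * (\<integral>\<^sup>+x. ennreal (\<bar>g' x\<bar> * \<bar>\<psi> (x - z) - \<psi> x\<bar>) \<partial>lborel) \<partial>lborel) \<longlonglongrightarrow> 0"
      by (rule averaged_translation_tendsto[OF ctx]) (use g'q in auto)
    show "(\<lambda>j. \<integral>\<^sup>+x. ennreal \<bar>g x * \<phi> j x - g x * \<psi> x\<bar> \<partial>lborel) \<longlonglongrightarrow> 0"
      by (rule tendsto_sandwich[OF _ _ tendsto_const lim]) (intro always_eventually allI zero_le bd)+
  qed measurable
  show "(LINT m|(lborel \<Otimes>\<^sub>M lborel). v m * (\<psi> (fst m) - \<psi> (snd m))) = (LINT x|lborel. g x * \<psi> x)"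
    using LIMSEQ_unique[OF lim1 lim2[folded eqj]] .
qed

end

section \<open>Hole filling for solutions\<close>

lemma vnorm_nonneg [simp]: "0 \<le> vnorm N v"
  by (simp add: vnorm_def)

lemma vdist_nonneg [simp]: "0 \<le> vdist N v w"
  by (simp add: vdist_def)

lemma vdist_commute: "vdist N v w = vdist N w v"
  by (simp add: vdist_def vnorm_def L2_set_def power2_commute)

lemma vdist_self [simp]: "vdist N v v = 0"
  by (simp add: vdist_def vnorm_def L2_set_def)

lemma vdist_triangle: "vdist N v w \<le> vdist N v x + vdist N x w"
  using L2_set_triangle_ineq[of "\<lambda>i. v i - x i" "\<lambda>i. x i - w i" "{..<N}"]
  by (simp add: vdist_def vnorm_def)

lemma abs_le_vnorm: "i < N \<Longrightarrow> \<bar>v i\<bar> \<le> vnorm N v"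
  using member_le_L2_set[of "{..<N}" i "\<lambda>i. \<bar>v i\<bar>"] by (simp add: vnorm_def L2_set_def)

lemma vinner_self: "vinner N v v = (vnorm N v)\<^sup>2"
  by (simp add: vinner_def vnorm_def L2_set_def sum_nonneg power2_eq_square)

lemma abs_vinner_le: "\<bar>vinner N v w\<bar> \<le> vnorm N v * vnorm N w"
proof -
  have "\<bar>vinner N v w\<bar> \<le> (\<Sum>i<N. \<bar>v i\<bar> * \<bar>w i\<bar>)"
    unfolding vinner_def by (rule order.trans[OF sum_abs]) (simp add: abs_mult)
  also have "\<dots> \<le> vnorm N v * vnorm N w" unfolding vnorm_def by (rule L2_set_mult_ineq)
  finally show ?thesis .
qed

lemma vnorm_measurable:
  assumes "\<And>i. i < N \<Longrightarrow> (\<lambda>x. f x i) \<in> borel_measurable M"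
  shows "(\<lambda>x. vnorm N (f x)) \<in> borel_measurable M"
proof -
  have [measurable]: "(\<lambda>x. \<Sum>i<N. (f x i)\<^sup>2) \<in> borel_measurable M"
    using assms by (intro borel_measurable_sum borel_measurable_power) auto
  show ?thesis unfolding vnorm_def L2_set_def by measurable
qed

text \<open>Borel measurable components make all integrands measurable on products. The given field
  is only Lebesgue measurable and is replaced by a Borel representative at the end.\<close>

locale gag_field =
  fixes s p dim :: real and N :: nat and u :: "'n::finite vfield"
  assumes dim: "dim = real CARD('n)" and s: "0 < s" "s < 1" and p: "1 < p"
    and u_measurable: "\<And>i. i < N \<Longrightarrow> (\<lambda>x. u x i) \<in> borel_measurable borel"

sublocale gag_field \<subseteq> gagliardo s p dim "\<lambda>x y. vdist N (u x) (u y)"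
proof
  show "case_prod (\<lambda>x y. vdist N (u x) (u y)) \<in> borel_measurable (borel \<Otimes>\<^sub>M borel)"
    unfolding vdist_def split_beta'
    by (intro vnorm_measurable borel_measurable_diff measurable_compose[OF measurable_fst] measurable_compose[OF measurable_snd] u_measurable)
qed (use dim s p vdist_triangle in \<open>auto simp: vdist_commute\<close>)

context gag_field
begin

abbreviation D where "D x y \<equiv> vdist N (u x) (u y)"

text \<open>One component of the nonlinear flux of the operator, restricted to pairs in
  \<open>A\<close>. Components are separated because the density theorem is scalar.\<close>

definition flux :: "(real ^ 'n) set \<Rightarrow> nat \<Rightarrow> (real ^ 'n) \<times> (real ^ 'n) \<Rightarrow> real" where
  "flux A i m = indicator (A \<times> A) m * D (fst m) (snd m) powr (p - 2) * (u (fst m) i - u (snd m) i)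
    * norm (fst m - snd m) powr (- ex)"

lemma flux_measurable:
  assumes [measurable]: "A \<in> sets borel" and i: "i < N"
  shows "flux A i \<in> borel_measurable (lborel \<Otimes>\<^sub>M lborel)"
proof -
  note [measurable] = u_measurable[OF i]
  have AA [measurable]: "A \<times> A \<in> sets (borel \<Otimes>\<^sub>M borel)" by auto
  have "(\<lambda>m. indicator (A \<times> A) m * D (fst m) (snd m) powr (p - 2) * (u (fst m) i - u (snd m) i)
    * norm (fst m - snd m) powr (- ex)) \<in> borel_measurable (borel \<Otimes>\<^sub>M borel)" by measurable
  moreover have "sets (lborel \<Otimes>\<^sub>M lborel :: ((real ^ 'n) \<times> (real ^ 'n)) measure) = sets (borel \<Otimes>\<^sub>M borel)"
    by (intro sets_pair_measure_cong) auto
  ultimately show ?thesis unfolding flux_def[abs_def] using measurable_cong_sets by blast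
qed

text \<open>Both identities include \<open>a = 0\<close> even when \<open>p < 2\<close>, because
  \<open>0 powr x = 0\<close> for every exponent. This covers pairs of points at which
  \<open>u\<close> takes equal values.\<close>

lemma powr_minus_2: "0 \<le> a \<Longrightarrow> a powr (p - 2) * a = a powr (p - 1)"
  "0 \<le> a \<Longrightarrow> a powr (p - 2) * a\<^sup>2 = a powr p" for a :: real
proof -
  have 1: "a powr (p - 2) * a powr 1 = a powr (p - 1)" "a powr (p - 2) * a powr 2 = a powr p" if "a \<noteq> 0"
    by (simp_all only: powr_add[symmetric]) (simp_all add: algebra_simps)
  show "0 \<le> a \<Longrightarrow> a powr (p - 2) * a = a powr (p - 1)" using 1 by (cases "a = 0") auto
  show "0 \<le> a \<Longrightarrow> a powr (p - 2) * a\<^sup>2 = a powr p" using 1 by (cases "a = 0") (auto simp: powr_numeral)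
qed

lemma flux_bound:
  assumes "i < N"
  shows "\<bar>flux A i m\<bar> \<le> indicator (A \<times> A) m * D (fst m) (snd m) powr (p - 1) * norm (fst m - snd m) powr (- ex)"
proof -
  have "\<bar>u (fst m) i - u (snd m) i\<bar> \<le> D (fst m) (snd m)"
    using abs_le_vnorm[OF assms, of "\<lambda>i. u (fst m) i - u (snd m) i"] by (simp add: vdist_def)
  then have "D (fst m) (snd m) powr (p - 2) * \<bar>u (fst m) i - u (snd m) i\<bar> \<le> D (fst m) (snd m) powr (p - 2) * D (fst m) (snd m)"
    by (intro mult_left_mono) auto
  also have "\<dots> = D (fst m) (snd m) powr (p - 1)" by (rule powr_minus_2) simp
  finally have 1: "D (fst m) (snd m) powr (p - 2) * \<bar>u (fst m) i - u (snd m) i\<bar> \<le> D (fst m) (snd m) powr (p - 1)" .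
  have "\<bar>flux A i m\<bar> = indicator (A \<times> A) m * (D (fst m) (snd m) powr (p - 2) * \<bar>u (fst m) i - u (snd m) i\<bar>)
    * norm (fst m - snd m) powr (- ex)"
    by (simp add: flux_def abs_mult)
  also have "\<dots> \<le> indicator (A \<times> A) m * D (fst m) (snd m) powr (p - 1) * norm (fst m - snd m) powr (- ex)"
    by (intro mult_right_mono mult_left_mono 1) auto
  finally show ?thesis .
qed

text \<open>The constant of \<open>exists_good_point\<close>, named because its \<open>p\<close>-th
  root multiplies the right-hand side in every step of the iteration.\<close>

definition good_const :: real where "good_const = 2 / vol * 2 powr ex"

lemma good_const_pos: "0 < good_const" using vol_pos by (simp add: good_const_def)

section \<open>Testing on one ball with the good point \<open>z\<close>\<close>

context
  fixes x1 z :: "real ^ 'n" and r :: real and A :: "(real ^ 'n) set"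
  assumes r: "0 < r" and A: "A \<in> sets borel" and BA: "ball x1 r \<subseteq> A"
    and finA: "emeasure lborel A < \<infinity>" "en A A < \<infinity>"
    and z: "z \<in> ball x1 r - ball x1 (r / 2)"
    and zP: "(\<integral>\<^sup>+x\<in>ball x1 r. ennreal (D z x powr p) \<partial>lborel)
      \<le> ennreal (good_const * r powr (s * p)) * en (ball x1 r - ball x1 (r / 2)) (ball x1 r)"
begin

definition test :: "nat \<Rightarrow> real ^ 'n \<Rightarrow> real" where
  "test i x = cutoff x1 r x * (u x i - u z i)"

lemma test_measurable: "i < N \<Longrightarrow> test i \<in> borel_measurable borel"
  unfolding test_def[abs_def] using u_measurable by measurable

lemma finite_zP: "(\<integral>\<^sup>+x\<in>ball x1 r. ennreal (D z x powr p) \<partial>lborel) < \<infinity>"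
proof -
  have "en (ball x1 r - ball x1 (r / 2)) (ball x1 r) \<le> en A A" using BA by (intro en_mono) auto
  then have "ennreal (good_const * r powr (s * p)) * en (ball x1 r - ball x1 (r / 2)) (ball x1 r) < \<infinity>"
    using le_less_trans[OF _ finA(2)] by (simp add: ennreal_mult_less_top)
  then show ?thesis using zP by (rule le_less_trans[rotated])
qed

lemma component_le: "i < N \<Longrightarrow> \<bar>u x i - u y i\<bar> \<le> D x y"
  using abs_le_vnorm[of i N "\<lambda>i. u x i - u y i"] by (simp add: vdist_def)

lemma cutoff_outside: "x \<notin> ball x1 r \<Longrightarrow> cutoff x1 r x = 0"
  using r by (intro cutoff_eq_0) auto

text \<open>A discrete product rule, arranged so that the deviation from \<open>u z\<close> is taken
  at \<open>x\<close> only, the point known to lie in the ball; the increment of \<open>u\<close> is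
  multiplied by the cutoff at \<open>y\<close>, which confines \<open>y\<close> to the ball as
  well.\<close>

lemma test_increment:
  assumes i: "i < N" and x: "x \<in> ball x1 r"
  shows "ennreal (\<bar>test i x - test i y\<bar> powr p / norm (x - y) powr ex)
    \<le> ennreal (2 powr p) * (G x y * indicator (ball x1 r) y
      + ennreal (D z x powr p) * ennreal (min 1 (4 * norm (x - y) / r) powr p / norm (x - y) powr ex))"
proof -
  have "test i x - test i y = cutoff x1 r y * (u x i - u y i) + (cutoff x1 r x - cutoff x1 r y) * (u x i - u z i)"
    by (simp add: test_def algebra_simps)
  also have "\<bar>\<dots>\<bar> \<le> \<bar>cutoff x1 r y * (u x i - u y i)\<bar> + \<bar>(cutoff x1 r x - cutoff x1 r y) * (u x i - u z i)\<bar>"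
    by (rule abs_triangle_ineq)
  also have "\<dots> \<le> D x y * indicator (ball x1 r) y + min 1 (4 * norm (x - y) / r) * D z x"
  proof (rule add_mono)
    show "\<bar>cutoff x1 r y * (u x i - u y i)\<bar> \<le> D x y * indicator (ball x1 r) y"
      using cutoff_range[of x1 r y] mult_mono[OF cutoff_range(2)[of x1 r y] component_le[OF i, of x y]] cutoff_outside[of y]
      by (auto simp: indicator_def abs_mult)
    show "\<bar>(cutoff x1 r x - cutoff x1 r y) * (u x i - u z i)\<bar> \<le> min 1 (4 * norm (x - y) / r) * D z x"
      unfolding abs_mult using cutoff_diff[OF r, of x1 x y] component_le[OF i, of x z] r
      by (intro mult_mono) (auto simp: vdist_commute)
  qed
  finally have "\<bar>test i x - test i y\<bar> powr p \<le> (D x y * indicator (ball x1 r) y + min 1 (4 * norm (x - y) / r) * D z x) powr p"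
    using p by (intro powr_mono2) auto
  also have "\<dots> \<le> 2 powr p * ((D x y * indicator (ball x1 r) y) powr p + (min 1 (4 * norm (x - y) / r) * D z x) powr p)"
    using p r by (intro powr_add_le) auto
  also have "(D x y * indicator (ball x1 r) y) powr p = D x y powr p * indicator (ball x1 r) y"
    using p by (auto simp: indicator_def)
  also have "(min 1 (4 * norm (x - y) / r) * D z x) powr p = min 1 (4 * norm (x - y) / r) powr p * D z x powr p"
    by (rule powr_mult)
  finally have "\<bar>test i x - test i y\<bar> powr p / norm (x - y) powr ex
    \<le> 2 powr p * (D x y powr p * indicator (ball x1 r) y + min 1 (4 * norm (x - y) / r) powr p * D z x powr p) / norm (x - y) powr ex"
    by (rule divide_right_mono) simp
  also have "\<dots> = 2 powr p * (D x y powr p / norm (x - y) powr ex * indicator (ball x1 r) y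
      + D z x powr p * (min 1 (4 * norm (x - y) / r) powr p / norm (x - y) powr ex))"
    by (simp add: add_divide_distrib algebra_simps)
  finally have "ennreal (\<bar>test i x - test i y\<bar> powr p / norm (x - y) powr ex) \<le> ennreal \<dots>" by (rule ennreal_leI)
  also have "\<dots> = ennreal (2 powr p) * (G x y * indicator (ball x1 r) y
      + ennreal (D z x powr p) * ennreal (min 1 (4 * norm (x - y) / r) powr p / norm (x - y) powr ex))"
    by (simp add: ennreal_mult ennreal_plus G_def del: times_divide_eq_right) (simp add: indicator_def)
  finally show ?thesis .
qed

text \<open>Admits the test field to \<open>weak_form_density\<close>. If \<open>x\<close> lies in
  the ball, integrate \<open>test_increment\<close>; otherwise \<open>y\<close> lies there or the
  increment is 0, and symmetry applies.\<close>

lemma gag_test: 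
  assumes i: "i < N"
  shows "gag (test i) < \<infinity>"
proof -
  note [measurable] = test_measurable[OF i]
  define F where "F = (\<lambda>x y. ennreal (\<bar>test i x - test i y\<bar> powr p / norm (x - y) powr ex))"
  have Fm [measurable (raw)]: "(\<lambda>t. F (f t) (g t)) \<in> borel_measurable M"
    if [measurable]: "f \<in> borel_measurable M" "g \<in> borel_measurable M" for f g and M :: "'m measure"
    unfolding F_def by measurable
  have F1 [measurable]: "F x \<in> borel_measurable borel" for x
    unfolding F_def by measurable
  have Fsym: "F x y = F y x" for x y by (simp add: F_def abs_minus_commute norm_minus_commute)
  define k where "k = (\<lambda>(x :: real ^ 'n) (y :: real ^ 'n). ennreal (min 1 (4 * norm (x - y) / r) powr p / norm (x - y) powr ex))"
  have km [measurable (raw)]: "(\<lambda>t. k (f t) (g t)) \<in> borel_measurable M"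
    if [measurable]: "f \<in> borel_measurable M" "g \<in> borel_measurable M" for f g and M :: "'m measure"
    unfolding k_def by measurable
  have k1 [measurable]: "k x \<in> borel_measurable borel" for x
    unfolding k_def by measurable
  define I where "I = ennreal (\<kappa> * r powr (- (s * p)))"
  have kI: "(\<integral>\<^sup>+y. k x y \<partial>lborel) \<le> I" for x
    unfolding k_def I_def by (rule kernel_integral'[OF r])
  define S where "S = (\<integral>\<^sup>+x. (\<integral>\<^sup>+y. F x y * indicator (ball x1 r) x \<partial>lborel) \<partial>lborel)"
  have "S \<le> (\<integral>\<^sup>+x. ennreal (2 powr p) * ((\<integral>\<^sup>+y\<in>ball x1 r. G x y \<partial>lborel) * indicator (ball x1 r) x
        + I * (ennreal (D z x powr p) * indicator (ball x1 r) x)) \<partial>lborel)"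
    unfolding S_def
  proof (rule nn_integral_mono)
    fix x
    show "(\<integral>\<^sup>+y. F x y * indicator (ball x1 r) x \<partial>lborel) \<le> ennreal (2 powr p) * ((\<integral>\<^sup>+y\<in>ball x1 r. G x y \<partial>lborel) * indicator (ball x1 r) x
        + I * (ennreal (D z x powr p) * indicator (ball x1 r) x))"
    proof (cases "x \<in> ball x1 r")
      case True
      have "(\<integral>\<^sup>+y. F x y \<partial>lborel) \<le> (\<integral>\<^sup>+y. ennreal (2 powr p) * (G x y * indicator (ball x1 r) y + ennreal (D z x powr p) * k x y) \<partial>lborel)"
        unfolding F_def k_def by (intro nn_integral_mono test_increment[OF i True])
      also have "\<dots> = ennreal (2 powr p) * ((\<integral>\<^sup>+y\<in>ball x1 r. G x y \<partial>lborel) + ennreal (D z x powr p) * (\<integral>\<^sup>+y. k x y \<partial>lborel))"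
        by (simp add: nn_integral_cmult nn_integral_add)
      also have "\<dots> \<le> ennreal (2 powr p) * ((\<integral>\<^sup>+y\<in>ball x1 r. G x y \<partial>lborel) + ennreal (D z x powr p) * I)"
        by (intro mult_left_mono add_left_mono kI) auto
      finally show ?thesis using True by (simp add: mult.commute)
    qed simp
  qed
  also have "\<dots> = ennreal (2 powr p) * (en (ball x1 r) (ball x1 r) + I * (\<integral>\<^sup>+x\<in>ball x1 r. ennreal (D z x powr p) \<partial>lborel))"
    unfolding en_def by (simp add: nn_integral_cmult nn_integral_add)
  also have "\<dots> < \<infinity>"
  proof -
    have "en (ball x1 r) (ball x1 r) < \<infinity>" by (rule le_less_trans[OF en_mono[OF BA BA] finA(2)])
    moreover have "I * (\<integral>\<^sup>+x\<in>ball x1 r. ennreal (D z x powr p) \<partial>lborel) < \<infinity>"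
      using finite_zP by (simp add: I_def ennreal_mult_less_top)
    ultimately show ?thesis by (simp add: ennreal_mult_less_top)
  qed
  finally have S: "S < \<infinity>" .
  have "gag (test i) \<le> (\<integral>\<^sup>+x. (\<integral>\<^sup>+y. F x y * indicator (ball x1 r) x + F y x * indicator (ball x1 r) y \<partial>lborel) \<partial>lborel)"
  proof -
    have "gag (test i) = (\<integral>\<^sup>+x. (\<integral>\<^sup>+y. F x y \<partial>lborel) \<partial>lborel)" unfolding gag_def F_def ..
    also have "\<dots> \<le> (\<integral>\<^sup>+x. (\<integral>\<^sup>+y. F x y * indicator (ball x1 r) x + F y x * indicator (ball x1 r) y \<partial>lborel) \<partial>lborel)"
  proof (intro nn_integral_mono)
    fix x y
    have "x \<in> ball x1 r \<or> y \<in> ball x1 r \<or> F x y = 0"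
      using cutoff_outside p by (auto simp: F_def test_def)
    then show "F x y \<le> F x y * indicator (ball x1 r) x + F y x * indicator (ball x1 r) y"
      by (auto simp: indicator_def Fsym[of y x])
  qed
    finally show ?thesis .
  qed
  also have "\<dots> = S + (\<integral>\<^sup>+x. (\<integral>\<^sup>+y. F y x * indicator (ball x1 r) y \<partial>lborel) \<partial>lborel)"
    unfolding S_def by (simp add: nn_integral_add)
  also have "(\<integral>\<^sup>+x. (\<integral>\<^sup>+y. F y x * indicator (ball x1 r) y \<partial>lborel) \<partial>lborel) = S"
    unfolding S_def by (rule lborel_pair.Fubini') measurable
  also have "S + S < \<infinity>" using S by simp
  finally show ?thesis .
qed

lemma test_powr:
  assumes i: "i < N"
  shows "(\<integral>\<^sup>+x. ennreal (\<bar>test i x\<bar> powr p) \<partial>lborel) < \<infinity>"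
proof -
  have "(\<integral>\<^sup>+x. ennreal (\<bar>test i x\<bar> powr p) \<partial>lborel) \<le> (\<integral>\<^sup>+x\<in>ball x1 r. ennreal (D z x powr p) \<partial>lborel)"
  proof (rule nn_integral_mono)
    fix x
    show "ennreal (\<bar>test i x\<bar> powr p) \<le> ennreal (D z x powr p) * indicator (ball x1 r) x"
    proof (cases "x \<in> ball x1 r")
      case True
      have "\<bar>test i x\<bar> \<le> 1 * D z x"
        unfolding test_def abs_mult using cutoff_range[of x1 r x] component_le[OF i, of x z]
        by (intro mult_mono) (auto simp: vdist_commute)
      then show ?thesis using True p by (simp add: ennreal_leI powr_mono2)
    qed (use cutoff_outside p in \<open>simp add: test_def\<close>)
  qed
  then show ?thesis using finite_zP by (rule le_less_trans)
qed

text \<open>With \<open>a = u x - u z\<close>, \<open>b = u y - u z\<close> and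
  \<open>e = a - b\<close>, the pairing of \<open>e\<close> with
  \<open>\<eta> x * a - \<eta> y * b\<close> is half of \<open>\<eta> x + \<eta> y\<close> times the
  square of \<open>e\<close>, plus half of \<open>\<eta> x - \<eta> y\<close> times the pairing of
  \<open>e\<close> with \<open>a + b\<close>. The first term is the energy; Cauchy-Schwarz bounds
  the second.\<close>

lemma flux_test_lower:
  assumes "m \<in> A \<times> A"
  shows "1 / 2 * (cutoff x1 r (fst m) + cutoff x1 r (snd m)) * (D (fst m) (snd m) powr p / norm (fst m - snd m) powr ex)
     \<le> (\<Sum>i<N. flux A i m * (test i (fst m) - test i (snd m)))
      + 1 / 2 * (\<bar>cutoff x1 r (fst m) - cutoff x1 r (snd m)\<bar> * D (fst m) (snd m) powr (p - 1) * (D z (fst m) + D z (snd m))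
      / norm (fst m - snd m) powr ex)"
proof -
  obtain x y where m: "m = (x, y)" by (cases m)
  define \<eta> where "\<eta> = cutoff x1 r"
  define w where "w = (\<lambda>i. (u x i - u z i) + (u y i - u z i))"
  define e where "e = (\<lambda>i. u x i - u y i)"
  have en: "vnorm N e = D x y" by (simp add: e_def vdist_def)
  have wn: "vnorm N w \<le> D z x + D z y"
    using L2_set_triangle_ineq[of "\<lambda>i. u x i - u z i" "\<lambda>i. u y i - u z i" "{..<N}"]
    by (simp add: w_def vdist_commute[of _ "u z"]) (simp add: vdist_def vnorm_def)
  have "(\<Sum>i<N. (u x i - u y i) * (test i x - test i y))
     = (\<Sum>i<N. 1 / 2 * (\<eta> x + \<eta> y) * (e i * e i) + 1 / 2 * (\<eta> x - \<eta> y) * (e i * w i))"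
    unfolding test_def \<eta>_def[symmetric] e_def w_def by (intro sum.cong refl) (simp add: field_simps)
  also have "\<dots> = 1 / 2 * (\<eta> x + \<eta> y) * (D x y)\<^sup>2 + 1 / 2 * (\<eta> x - \<eta> y) * vinner N e w"
    unfolding en[symmetric] vinner_self[symmetric] by (simp add: vinner_def sum.distrib sum_distrib_left)
  finally have eq: "(\<Sum>i<N. (u x i - u y i) * (test i x - test i y)) = 1 / 2 * (\<eta> x + \<eta> y) * (D x y)\<^sup>2 + 1 / 2 * (\<eta> x - \<eta> y) * vinner N e w" .
  have "\<bar>(\<eta> x - \<eta> y) * vinner N e w\<bar> \<le> \<bar>\<eta> x - \<eta> y\<bar> * (D x y * (D z x + D z y))"
  proof -
    have "\<bar>vinner N e w\<bar> \<le> D x y * vnorm N w" using abs_vinner_le[of N e w] by (simp add: en)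
    also have "\<dots> \<le> D x y * (D z x + D z y)" by (intro mult_left_mono wn) simp
    finally show ?thesis unfolding abs_mult by (intro mult_left_mono) auto
  qed
  then have "1 / 2 * (\<eta> x + \<eta> y) * (D x y)\<^sup>2
     \<le> (\<Sum>i<N. (u x i - u y i) * (test i x - test i y)) + 1 / 2 * (\<bar>\<eta> x - \<eta> y\<bar> * (D x y * (D z x + D z y)))"
    unfolding eq by (simp add: abs_le_iff)
  from mult_left_mono[OF this, of "D x y powr (p - 2) * norm (x - y) powr (- ex)"]
  have le: "D x y powr (p - 2) * norm (x - y) powr (- ex) * (1 / 2 * (\<eta> x + \<eta> y) * (D x y)\<^sup>2)
     \<le> D x y powr (p - 2) * norm (x - y) powr (- ex) * ((\<Sum>i<N. (u x i - u y i) * (test i x - test i y)) + 1 / 2 * (\<bar>\<eta> x - \<eta> y\<bar> * (D x y * (D z x + D z y))))"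
    by simp
  have e1: "D x y powr (p - 2) * norm (x - y) powr (- ex) * (1 / 2 * (\<eta> x + \<eta> y) * (D x y)\<^sup>2)
    = 1 / 2 * (\<eta> x + \<eta> y) * (D x y powr p * norm (x - y) powr (- ex))"
    unfolding powr_minus_2(2)[OF vdist_nonneg, symmetric] by (simp only: mult_ac)
  have e2: "D x y powr (p - 2) * norm (x - y) powr (- ex) * ((\<Sum>i<N. (u x i - u y i) * (test i x - test i y)) + 1 / 2 * (\<bar>\<eta> x - \<eta> y\<bar> * (D x y * (D z x + D z y))))
    = (\<Sum>i<N. flux A i m * (test i x - test i y)) + 1 / 2 * (\<bar>\<eta> x - \<eta> y\<bar> * D x y powr (p - 1) * (D z x + D z y) * norm (x - y) powr (- ex))"
  proof -
    have "(\<Sum>i<N. flux A i m * (test i x - test i y)) = D x y powr (p - 2) * norm (x - y) powr (- ex) * (\<Sum>i<N. (u x i - u y i) * (test i x - test i y))"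
      unfolding sum_distrib_left using assms m by (intro sum.cong refl) (simp add: flux_def mult_ac del: minus_add_distrib)
    then show ?thesis unfolding powr_minus_2(1)[OF vdist_nonneg, symmetric] by (simp only: distrib_left mult_ac)
  qed
  show ?thesis using le unfolding e1 e2 by (simp only: m fst_conv snd_conv \<eta>_def divide_powr_uminus)
qed

text \<open>Integrate \<open>flux_test_lower\<close> over all pairs. On the left only
  \<open>x\<close> in the inner ball is kept, where the cutoff is 1. By density the flux term equals
  the integral of \<open>g\<close> against the test field; Hoelder's inequality and the choice of
  \<open>z\<close> bound it by a multiple of \<open>r powr s * \<Gamma> * W\<close>. The error term
  is that of \<open>cutoff_energy\<close>.\<close>

lemma hole_estimate:
  assumes g: "\<And>i. i < N \<Longrightarrow> (\<lambda>x. g x i) \<in> borel_measurable borel"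
    and \<Gamma>: "0 \<le> \<Gamma>" "(\<integral>\<^sup>+x\<in>ball x1 r. ennreal (vnorm N (g x) powr q) \<partial>lborel) \<le> ennreal (\<Gamma> powr q)"
    and W: "0 \<le> W" "en (ball x1 r - ball x1 (r / 2)) (ball x1 r) \<le> ennreal (W powr p)"
    and eq: "\<And>i \<phi> l. i < N \<Longrightarrow> (\<And>k. Ck k \<phi>) \<Longrightarrow> (\<And>x. x \<notin> cball x1 (7 * r / 8) \<Longrightarrow> \<phi> x = 0) \<Longrightarrow> 0 \<le> l
        \<Longrightarrow> (\<And>x y. \<bar>\<phi> x - \<phi> y\<bar> \<le> l * norm (x - y))
      \<Longrightarrow> (LINT m|(lborel \<Otimes>\<^sub>M lborel). flux A i m * (\<phi> (fst m) - \<phi> (snd m))) = (LINT x|lborel. g x i * \<phi> x)"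
  shows "en (ball x1 (r / 2)) A \<le> ennreal (hole_const dim s p) * en (ball x1 r - ball x1 (r / 2)) A
      + ennreal (2 * good_const powr (1 / p) * r powr s * \<Gamma> * W)"
proof -
  note [measurable] = A
  have AA [measurable]: "A \<times> A \<in> sets (borel \<Otimes>\<^sub>M borel)" using A by auto
  have vg [measurable]: "(\<lambda>x. vnorm N (g x)) \<in> borel_measurable borel" by (rule vnorm_measurable[OF g])
  define Z where "Z = ball x1 r - ball x1 (r / 2)"
  define Q where "Q = (\<lambda>x y. \<bar>cutoff x1 r x - cutoff x1 r y\<bar> * D x y powr (p - 1) * (D z x + D z y) / norm (x - y) powr ex)"
  define a where "a = (\<lambda>m. indicator (A \<times> A) m * (1 / 2 * (cutoff x1 r (fst m) + cutoff x1 r (snd m)) * (D (fst m) (snd m) powr p / norm (fst m - snd m) powr ex)))"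
  define b where "b = (\<lambda>m. \<Sum>i<N. flux A i m * (test i (fst m) - test i (snd m)))"
  define c where "c = (\<lambda>m. indicator (A \<times> A) m * (1 / 2 * Q (fst m) (snd m)))"
  let ?M = "lborel \<Otimes>\<^sub>M lborel :: ((real ^ 'n) \<times> (real ^ 'n)) measure"
  have Q0: "0 \<le> Q x y" for x y by (simp add: Q_def)
  have cm: "c \<in> borel_measurable ?M" unfolding c_def Q_def by measurable
  have am: "a \<in> borel_measurable ?M" unfolding a_def by measurable
  have abc: "a m \<le> b m + c m" for m
  proof (cases "m \<in> A \<times> A")
    case True
    then show ?thesis using flux_test_lower[OF True] by (simp add: a_def b_def c_def Q_def)
  next
    case False
    then show ?thesis by (simp add: a_def b_def c_def flux_def)
  qed
  have a0: "0 \<le> a m" for m unfolding a_def using cutoff_range by (intro mult_nonneg_nonneg add_nonneg_nonneg) auto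
  have c0: "0 \<le> c m" for m unfolding c_def using Q0 by simp
  have BZ: "Z \<subseteq> A" using BA by (auto simp: Z_def)
  have enZ: "en Z A < \<infinity>" using BZ by (intro le_less_trans[OF en_mono finA(2)]) auto
  have zP': "(\<integral>\<^sup>+x\<in>ball x1 r. ennreal (D z x powr p) \<partial>lborel) \<le> ennreal (2 / vol * 2 powr ex * r powr (s * p)) * en Z (ball x1 r)"
    using zP by (simp add: good_const_def Z_def)
  have cint: "(\<integral>\<^sup>+m. ennreal (c m) \<partial>?M) \<le> ennreal (1 / 2) * (ennreal (hole_const dim s p) * en Z A)"
  proof -
    have "(\<integral>\<^sup>+m. ennreal (c m) \<partial>?M) = (\<integral>\<^sup>+x. (\<integral>\<^sup>+y. ennreal (c (x, y)) \<partial>lborel) \<partial>lborel)"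
      by (rule lborel.nn_integral_fst[symmetric]) (use cm in simp)
    also have "\<dots> = (\<integral>\<^sup>+x. (\<integral>\<^sup>+y. ennreal (1 / 2) * (ennreal (Q x y) * indicator A y * indicator A x) \<partial>lborel) \<partial>lborel)"
    proof -
      have "ennreal (c (x, y)) = ennreal (1 / 2) * (ennreal (Q x y) * indicator A y * indicator A x)" for x y
        unfolding c_def using Q0[of x y] by (cases "x \<in> A"; cases "y \<in> A") (simp_all add: ennreal_mult[symmetric] del: ennreal_half)
      then show ?thesis by simp
    qed
    also have "\<dots> = ennreal (1 / 2) * (\<integral>\<^sup>+x\<in>A. (\<integral>\<^sup>+y\<in>A. ennreal (Q x y) \<partial>lborel) \<partial>lborel)"
    proof -
      have [measurable]: "(\<lambda>(x, y). Q x y) \<in> borel_measurable (borel \<Otimes>\<^sub>M borel)" "Q x \<in> borel_measurable borel" for x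
        unfolding Q_def split_beta' by measurable
      show ?thesis by (simp add: nn_integral_cmult nn_integral_multc)
    qed
    also have "(\<integral>\<^sup>+x\<in>A. (\<integral>\<^sup>+y\<in>A. ennreal (Q x y) \<partial>lborel) \<partial>lborel) \<le> ennreal (hole_const dim s p) * en Z A"
      unfolding Q_def Z_def by (rule cutoff_energy[OF r A BA z zP'[unfolded Z_def]])
    finally show ?thesis by (simp add: mult_left_mono)
  qed
  have ci: "integrable ?M c"
  proof (rule integrableI_nonneg)
    show "(\<integral>\<^sup>+m. ennreal (c m) \<partial>?M) < \<infinity>"
      by (rule le_less_trans[OF cint]) (use enZ in \<open>simp only: ennreal_mult_less_top infinity_ennreal_def ennreal_less_top simp_thms\<close>)
  qed (use cm c0 in auto)
  have gi: "(\<integral>\<^sup>+x\<in>cball x1 (7 * r / 8). ennreal (\<bar>g x i\<bar> powr q) \<partial>lborel) < \<infinity>" if i: "i < N" for i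
  proof -
    have "(\<integral>\<^sup>+x\<in>cball x1 (7 * r / 8). ennreal (\<bar>g x i\<bar> powr q) \<partial>lborel) \<le> (\<integral>\<^sup>+x\<in>ball x1 r. ennreal (vnorm N (g x) powr q) \<partial>lborel)"
      using r q(1) abs_le_vnorm[OF i]
      by (intro nn_integral_mono mult_mono ennreal_leI powr_mono2) (auto simp: indicator_def)
    also have "\<dots> < \<infinity>" by (rule le_less_trans[OF \<Gamma>(2)]) simp
    finally show ?thesis .
  qed
  have wf: "(LINT m|?M. flux A i m * (test i (fst m) - test i (snd m))) = (LINT x|lborel. g x i * test i x)"
    "integrable lborel (\<lambda>x. g x i * test i x)" if i: "i < N" for i
  proof -
    have t0: "test i x = 0" if "x \<notin> cball x1 (3 * r / 4)" for x
      using cutoff_eq_0[OF r, of x x1] that by (simp add: test_def)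
    \<comment> \<open>The test field lives in radius \<open>3 * r / 4\<close> and its mollifications
      in radius \<open>7 * r / 8\<close>, still compactly inside the ball of radius
      \<open>r\<close>.\<close>
    have r1: "3 * r / 4 < 7 * r / 8" using r by simp
    show "(LINT m|?M. flux A i m * (test i (fst m) - test i (snd m))) = (LINT x|lborel. g x i * test i x)"
      by (rule weak_form_density(1)[OF A finA flux_measurable[OF A i] flux_bound[OF i] test_measurable[OF i] gag_test[OF i] _ test_powr[OF i] r1 g[OF i] gi[OF i]],
          erule t0, rule eq[OF i])
    show "integrable lborel (\<lambda>x. g x i * test i x)"
      by (rule weak_form_density(2)[OF A finA flux_measurable[OF A i] flux_bound[OF i] test_measurable[OF i] gag_test[OF i] _ test_powr[OF i] r1 g[OF i] gi[OF i]],
          erule t0, rule eq[OF i])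
  qed
  have ii: "integrable ?M (\<lambda>m. flux A i m * (test i (fst m) - test i (snd m)))" if i: "i < N" for i
    by (rule increment_integrable[OF A finA(2) flux_measurable[OF A i] flux_bound[OF i] test_measurable[OF i] gag_test[OF i]])
  have bi: "integrable ?M b" unfolding b_def using ii by (intro Bochner_Integration.integrable_sum) auto
  define F where "F = (\<lambda>x. \<Sum>i<N. g x i * test i x)"
  have Fi: "integrable lborel F" unfolding F_def using wf(2) by (intro Bochner_Integration.integrable_sum) auto
  have bF: "(LINT m|?M. b m) = (LINT x|lborel. F x)"
    unfolding b_def F_def using ii wf by (simp add: Bochner_Integration.integral_sum)
  have Fle: "ennreal (LINT x|lborel. F x) \<le> ennreal (\<Gamma> * (good_const powr (1 / p) * r powr s * W))"
  proof -
    have "ennreal (LINT x|lborel. F x) \<le> ennreal (norm (LINT x|lborel. F x))" by (intro ennreal_leI) simp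
    also have "\<dots> \<le> (\<integral>\<^sup>+x. ennreal (norm (F x)) \<partial>lborel)" by (rule integral_norm_bound_ennreal[OF Fi])
    also have "\<dots> \<le> (\<integral>\<^sup>+x. ennreal ((vnorm N (g x) * indicator (ball x1 r) x) * (D z x * indicator (ball x1 r) x)) \<partial>lborel)"
    proof (intro nn_integral_mono ennreal_leI)
      fix x
      show "norm (F x) \<le> (vnorm N (g x) * indicator (ball x1 r) x) * (D z x * indicator (ball x1 r) x)"
      proof (cases "x \<in> ball x1 r")
        case True
        have "F x = cutoff x1 r x * vinner N (g x) (\<lambda>i. u x i - u z i)"
          by (simp add: F_def test_def vinner_def sum_distrib_left mult_ac)
        then have "norm (F x) = cutoff x1 r x * \<bar>vinner N (g x) (\<lambda>i. u x i - u z i)\<bar>"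
          using cutoff_range[of x1 r x] by (simp add: abs_mult)
        also have "\<dots> \<le> 1 * (vnorm N (g x) * vnorm N (\<lambda>i. u x i - u z i))"
          using cutoff_range[of x1 r x] abs_vinner_le by (intro mult_mono) auto
        finally show ?thesis using True by (simp add: vdist_commute[of N "u z"]) (simp add: vdist_def)
      next
        case False
        then show ?thesis using cutoff_outside[OF False] by (simp add: F_def test_def)
      qed
    qed
    also have "\<dots> \<le> ennreal (\<Gamma> * (good_const powr (1 / p) * r powr s * W))"
    proof (rule nn_integral_Holder[where p = q and q = p])
      show "(\<integral>\<^sup>+x. ennreal ((vnorm N (g x) * indicator (ball x1 r) x) powr q) \<partial>lborel) \<le> ennreal (\<Gamma> powr q)"
      proof -
        have "(\<integral>\<^sup>+x. ennreal ((vnorm N (g x) * indicator (ball x1 r) x) powr q) \<partial>lborel) = (\<integral>\<^sup>+x\<in>ball x1 r. ennreal (vnorm N (g x) powr q) \<partial>lborel)"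
          by (intro nn_integral_cong) (auto simp: indicator_def)
        then show ?thesis using \<Gamma> by simp
      qed
      show "(\<integral>\<^sup>+x. ennreal ((D z x * indicator (ball x1 r) x) powr p) \<partial>lborel) \<le> ennreal ((good_const powr (1 / p) * r powr s * W) powr p)"
      proof -
        have "(\<integral>\<^sup>+x. ennreal ((D z x * indicator (ball x1 r) x) powr p) \<partial>lborel) = (\<integral>\<^sup>+x\<in>ball x1 r. ennreal (D z x powr p) \<partial>lborel)"
          by (intro nn_integral_cong) (auto simp: indicator_def)
        also have "\<dots> \<le> ennreal (good_const * r powr (s * p)) * ennreal (W powr p)"
          by (rule order.trans[OF zP]) (intro mult_left_mono W(2), simp)
        also have "\<dots> = ennreal ((good_const powr (1 / p) * r powr s * W) powr p)"
          using good_const_pos p by (simp add: ennreal_mult[symmetric] powr_mult powr_powr)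
        finally show ?thesis .
      qed
    qed (use p q \<Gamma>(1) W(1) good_const_pos vg in \<open>auto simp: add.commute\<close>)
    finally show ?thesis .
  qed
  have "ennreal (1 / 2) * en (ball x1 (r / 2)) A \<le> (\<integral>\<^sup>+m. ennreal (a m) \<partial>?M)"
  proof -
    have "ennreal (1 / 2) * en (ball x1 (r / 2)) A = (\<integral>\<^sup>+x. (\<integral>\<^sup>+y. ennreal (1 / 2) * (G x y * indicator A y * indicator (ball x1 (r / 2)) x) \<partial>lborel) \<partial>lborel)"
      unfolding en_def by (simp add: nn_integral_cmult nn_integral_multc)
    also have "\<dots> \<le> (\<integral>\<^sup>+x. (\<integral>\<^sup>+y. ennreal (a (x, y)) \<partial>lborel) \<partial>lborel)"
    proof (intro nn_integral_mono)
      fix x y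
      show "ennreal (1 / 2) * (G x y * indicator A y * indicator (ball x1 (r / 2)) x) \<le> ennreal (a (x, y))"
      proof (cases "y \<in> A \<and> x \<in> ball x1 (r / 2)")
        case True
        then have xA: "x \<in> A" using BA r by auto
        have "cutoff x1 r x = 1" using True cutoff_eq_1[OF r] by blast
        \<comment> \<open>The cutoff at \<open>y\<close> is only known to be nonnegative, so half of
          the energy is kept; doubling at the end restores the factor.\<close>
        then have "1 / 2 * (D x y powr p / norm (x - y) powr ex) \<le> 1 / 2 * (cutoff x1 r x + cutoff x1 r y) * (D x y powr p / norm (x - y) powr ex)"
          using cutoff_range[of x1 r y] by (intro mult_right_mono) auto
        also have "\<dots> = a (x, y)" using True xA by (simp add: a_def)
        finally have "ennreal (1 / 2 * (D x y powr p / norm (x - y) powr ex)) \<le> ennreal (a (x, y))" by (rule ennreal_leI)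
        moreover have "ennreal (1 / 2 * (D x y powr p / norm (x - y) powr ex)) = ennreal (1 / 2) * G x y"
          unfolding G_def by (intro ennreal_mult) auto
        ultimately show ?thesis using True by simp
      next
        case False
        then have "G x y * indicator A y * indicator (ball x1 (r / 2)) x = 0" by (auto simp: indicator_def)
        then show ?thesis by (simp only: mult_zero_right zero_le)
      qed
    qed
    also have "\<dots> = (\<integral>\<^sup>+m. ennreal (a m) \<partial>?M)"
      by (rule lborel.nn_integral_fst) (use am in simp)
    finally show ?thesis .
  qed
  also have "\<dots> \<le> (\<integral>\<^sup>+m. ennreal (b m + c m) \<partial>?M)" by (intro nn_integral_mono ennreal_leI abc)
  also have "\<dots> = ennreal (LINT m|?M. b m + c m)"
    using bi ci order.trans[OF a0 abc] by (intro nn_integral_eq_integral) auto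
  also have "\<dots> = ennreal ((LINT x|lborel. F x) + (LINT m|?M. c m))" using bi ci by (simp add: bF)
  also have "\<dots> \<le> ennreal (LINT x|lborel. F x) + ennreal (LINT m|?M. c m)"
    by (cases "0 \<le> (LINT x|lborel. F x)") (use c0 in \<open>auto simp: ennreal_plus ennreal_neg intro!: ennreal_leI\<close>)
  also have "ennreal (LINT m|?M. c m) = (\<integral>\<^sup>+m. ennreal (c m) \<partial>?M)" using ci c0 by (simp add: nn_integral_eq_integral)
  finally have "ennreal (1 / 2) * en (ball x1 (r / 2)) A \<le> ennreal (LINT x|lborel. F x) + (\<integral>\<^sup>+m. ennreal (c m) \<partial>?M)" .
  also have "\<dots> \<le> ennreal (\<Gamma> * (good_const powr (1 / p) * r powr s * W)) + ennreal (1 / 2) * (ennreal (hole_const dim s p) * en Z A)"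
    by (intro add_mono Fle cint)
  finally have "ennreal 2 * (ennreal (1 / 2) * en (ball x1 (r / 2)) A) \<le> ennreal 2 * (ennreal (\<Gamma> * (good_const powr (1 / p) * r powr s * W)) + ennreal (1 / 2) * (ennreal (hole_const dim s p) * en Z A))"
    by (rule mult_left_mono) simp
  moreover have h: "ennreal 2 * (ennreal (1 / 2) * Y) = Y" for Y
  proof -
    have "ennreal 2 * ennreal (1 / 2) = ennreal (2 * (1 / 2))" by (rule ennreal_mult[symmetric]) auto
    then show ?thesis unfolding mult.assoc[symmetric] by simp
  qed
  moreover have "ennreal 2 * ennreal (\<Gamma> * (good_const powr (1 / p) * r powr s * W)) = ennreal (2 * (\<Gamma> * (good_const powr (1 / p) * r powr s * W)))"
    using \<Gamma>(1) W(1) by (intro ennreal_mult[symmetric]) auto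
  ultimately have "en (ball x1 (r / 2)) A \<le> ennreal (2 * (\<Gamma> * (good_const powr (1 / p) * r powr s * W))) + ennreal (hole_const dim s p) * en Z A"
    by (simp only: distrib_left)
  then show ?thesis by (simp only: Z_def add.commute mult_ac)
qed

end

end

text \<open>The accumulated error of the iteration: \<open>2 * good_const powr (1 / p)\<close> over
  the gap between the rates \<open>2 powr (- \<delta>)\<close> and \<open>2 powr (- s)\<close>,
  which is positive for \<open>\<delta> < s\<close>.\<close>

definition reg_const :: "real \<Rightarrow> real \<Rightarrow> real \<Rightarrow> real \<Rightarrow> real" where
  "reg_const n s p \<delta> = 2 * (2 / unit_ball_vol n * 2 powr (n + s * p)) powr (1 / p) / (2 powr (- \<delta>) - 2 powr (- s))"

context gag_field
begin

text \<open>At radius \<open>R * 2 powr (- real k)\<close> the hole estimate has the form required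
  by \<open>hole_filling_decay\<close>, with errors of rate \<open>2 powr (- s)\<close>. The second
  condition on \<open>\<delta>\<close> says that the contraction factor is at most
  \<open>2 powr (- \<delta>)\<close>. The set \<open>A\<close> stays fixed while the balls shrink,
  and the decay has one constant for all centres, as \<open>campanato\<close> requires.\<close>

theorem regional_holder:
  assumes R: "0 < R" and A: "A \<in> sets borel" "emeasure lborel A < \<infinity>" "en A A < \<infinity>" and BA: "ball x0 (2 * R) \<subseteq> A"
    and \<delta>: "\<delta> < s" "hole_const dim s p / (1 + hole_const dim s p) \<le> 2 powr (- \<delta>)"
    and \<alpha>: "\<alpha> = (s * p + \<delta> - dim) / p" "0 < \<alpha>"
    and g: "\<And>i. i < N \<Longrightarrow> (\<lambda>x. g x i) \<in> borel_measurable borel"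
    and \<Gamma>: "0 \<le> \<Gamma>" "(\<integral>\<^sup>+x\<in>ball x0 (2 * R). ennreal (vnorm N (g x) powr q) \<partial>lborel) \<le> ennreal (\<Gamma> powr q)"
    and W: "0 \<le> W" "en (ball x0 (2 * R)) (ball x0 (2 * R)) \<le> ennreal (W powr p)"
    and eq: "\<And>i \<phi> l K. i < N \<Longrightarrow> (\<And>k. Ck k \<phi>) \<Longrightarrow> compact K \<Longrightarrow> K \<subseteq> ball x0 (2 * R) \<Longrightarrow> (\<And>x. x \<notin> K \<Longrightarrow> \<phi> x = 0) \<Longrightarrow> 0 \<le> l
        \<Longrightarrow> (\<And>x y. \<bar>\<phi> x - \<phi> y\<bar> \<le> l * norm (x - y))
      \<Longrightarrow> (LINT m|(lborel \<Otimes>\<^sub>M lborel). flux A i m * (\<phi> (fst m) - \<phi> (snd m))) = (LINT x|lborel. g x i * \<phi> x)"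
    and x: "x \<in> ball x0 R" "good x" and y: "y \<in> ball x0 R" "good y"
  shows "D x y \<le> campanato_const dim s p \<alpha> * ((enn2real (en A A) + reg_const dim s p \<delta> * (R powr s * \<Gamma> * W)) * R powr (- \<delta>)) powr (1 / p)
     * norm (x - y) powr \<alpha>"
proof -
  define Y where "Y = 2 * good_const powr (1 / p) * (R powr s * \<Gamma> * W)"
  have Y: "0 \<le> Y" using \<Gamma> W by (simp add: Y_def)
  define l where "l = (2::real) powr (- \<delta>)"
  define qs where "qs = (2::real) powr (- s)"
  have ql: "qs < l" "0 < qs" "0 < l" using \<delta> by (auto simp: l_def qs_def)
  define E where "E = enn2real (en A A)"
  have E: "en A A = ennreal E" "0 \<le> E" using A by (auto simp: E_def)
  define M where "M = E + Y / (l - qs)"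
  have YM: "Y / (l - qs) = reg_const dim s p \<delta> * (R powr s * \<Gamma> * W)"
    by (simp add: Y_def reg_const_def l_def qs_def good_const_def)
  have M: "0 \<le> M" "E \<le> M" using E Y ql by (auto simp: M_def)
  have fin: "en X X' < \<infinity>" if "X \<subseteq> A" "X' \<subseteq> A" for X X' by (rule le_less_trans[OF en_mono[OF that] A(3)])
  have decay: "en (ball z (R * 2 powr (- real k))) A \<le> ennreal (M * l ^ k)" if z: "z \<in> ball x0 R" for z k
  proof -
    have rp: "0 < R * 2 powr (- real k)" for k using R by simp
    have rle: "R * 2 powr (- real k) \<le> R" for k
    proof -
      have "2 powr (- real k) \<le> 2 powr 0" by (intro powr_mono) auto
      then show ?thesis using R by simp
    qed
    have sub: "ball z (R * 2 powr (- real k)) \<subseteq> ball x0 (2 * R)" for k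
    proof
      fix w assume "w \<in> ball z (R * 2 powr (- real k))"
      then have "dist z w < R" using rle[of k] by (simp add: less_le_trans)
      with z dist_triangle[of x0 w z] show "w \<in> ball x0 (2 * R)" by simp
    qed
    define T where "T = (\<lambda>k. enn2real (en (ball z (R * 2 powr (- real k))) A))"
    have T: "en (ball z (R * 2 powr (- real k))) A = ennreal (T k)" "0 \<le> T k" for k
      using fin[of "ball z (R * 2 powr (- real k))" A] sub[of k] BA by (auto simp: T_def)
    have step: "T (Suc k) \<le> hole_const dim s p * (T k - T (Suc k)) + Y * qs ^ k" for k
    proof -
      define r where "r = R * 2 powr (- real k)"
      have r: "0 < r" using rp by (simp add: r_def)
      have rB: "ball z r \<subseteq> ball x0 (2 * R)" unfolding r_def by (rule sub)
      then have rA: "ball z r \<subseteq> A" using BA by blast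
      have half: "R * 2 powr (- real (Suc k)) = r / 2"
      proof -
        have "- real (Suc k) = - real k + (-1)" by simp
        then have "2 powr (- real (Suc k)) = 2 powr (- real k) * 2 powr (-1)" by (simp only: powr_add)
        then show ?thesis by (simp add: r_def powr_minus)
      qed
      define Z where "Z = ball z r - ball z (r / 2)"
      have ZA: "Z \<subseteq> A" using rA by (auto simp: Z_def)
      define H where "H = enn2real (en Z A)"
      have H: "en Z A = ennreal H" "0 \<le> H" using fin[OF ZA order_refl] by (auto simp: H_def)
      have "ball z (r / 2) \<union> Z = ball z r" using r by (auto simp: Z_def)
      moreover have "en (ball z (r / 2) \<union> Z) A = en (ball z (r / 2)) A + en Z A"
        by (rule en_Un) (use A in \<open>auto simp: Z_def\<close>)
      ultimately have "en (ball z r) A = en (ball z (r / 2)) A + en Z A" by simp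
      \<comment> \<open>The energy of the annulus is exactly what is lost from one radius to the
        next, the difference that hole filling works with.\<close>
      then have TH: "T k = T (Suc k) + H"
        using T(1)[of k] T(1)[of "Suc k"] H T(2)[of "Suc k"] T(2)[of k] unfolding half r_def[symmetric]
        by (simp add: ennreal_plus[symmetric] del: ennreal_plus)
      obtain z' where z': "z' \<in> ball z r - ball z (r / 2)"
        "(\<integral>\<^sup>+x\<in>ball z r. ennreal (D z' x powr p) \<partial>lborel) \<le> ennreal (good_const * r powr (s * p)) * en (ball z r - ball z (r / 2)) (ball z r)"
        by (rule exists_good_point[OF r A(1) rA, folded good_const_def]) (rule that)
      have "en (ball z (r / 2)) A \<le> ennreal (hole_const dim s p) * en Z A + ennreal (2 * good_const powr (1 / p) * r powr s * \<Gamma> * W)"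
        unfolding Z_def
      proof (rule hole_estimate[OF r A(1) rA A(2,3) z' g \<Gamma>(1) _ W(1)])
        have "(\<integral>\<^sup>+x\<in>ball z r. ennreal (vnorm N (g x) powr q) \<partial>lborel) \<le> (\<integral>\<^sup>+x\<in>ball x0 (2 * R). ennreal (vnorm N (g x) powr q) \<partial>lborel)"
          using rB by (intro nn_integral_mono mult_left_mono) (auto simp: indicator_def)
        then show "(\<integral>\<^sup>+x\<in>ball z r. ennreal (vnorm N (g x) powr q) \<partial>lborel) \<le> ennreal (\<Gamma> powr q)"
          using \<Gamma>(2) by (rule order.trans)
        show "en (ball z r - ball z (r / 2)) (ball z r) \<le> ennreal (W powr p)"
          using rB by (intro order.trans[OF en_mono W(2)]) auto
        show "(LINT m|(lborel \<Otimes>\<^sub>M lborel). flux A i m * (\<phi> (fst m) - \<phi> (snd m))) = (LINT x|lborel. g x i * \<phi> x)"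
          if "i < N" "\<And>k. Ck k \<phi>" "\<And>x. x \<notin> cball z (7 * r / 8) \<Longrightarrow> \<phi> x = 0" "0 \<le> l"
            "\<And>x y. \<bar>\<phi> x - \<phi> y\<bar> \<le> l * norm (x - y)" for i \<phi> l
        proof (rule eq[OF that(1,2) compact_cball _ that(3,4,5)])
          have "cball z (7 * r / 8) \<subseteq> ball z r" using r by auto
          then show "cball z (7 * r / 8) \<subseteq> ball x0 (2 * R)" using rB by blast
        qed
      qed
      also have "\<dots> = ennreal (hole_const dim s p * H + 2 * good_const powr (1 / p) * r powr s * \<Gamma> * W)"
        using H \<Gamma> W hole_const_nonneg by (simp add: ennreal_mult[symmetric] ennreal_plus[symmetric] del: ennreal_plus)
      finally have "ennreal (T (Suc k)) \<le> ennreal (hole_const dim s p * H + 2 * good_const powr (1 / p) * r powr s * \<Gamma> * W)"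
        using T(1)[of "Suc k"] unfolding half by simp
      then have "T (Suc k) \<le> hole_const dim s p * H + 2 * good_const powr (1 / p) * r powr s * \<Gamma> * W"
        using H \<Gamma> W hole_const_nonneg by (subst (asm) ennreal_le_iff) auto
      moreover have "2 * good_const powr (1 / p) * r powr s * \<Gamma> * W = Y * qs ^ k"
      proof -
        have "r powr s = R powr s * 2 powr (- real k * s)" unfolding r_def by (simp only: powr_mult powr_powr)
        also have "- real k * s = - s * real k" by simp
        also have "2 powr (- s * real k) = qs ^ k" unfolding qs_def by (simp only: powr_powr[symmetric] powr_realpow powr_gt_zero)
        finally have "r powr s = R powr s * qs ^ k" .
        then show ?thesis unfolding Y_def by (simp only: mult_ac)
      qed
      ultimately show ?thesis using TH by simp
    qed
    have "T k \<le> l ^ k * (T 0 + Y / (l - qs))"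
      by (rule hole_filling_decay[OF hole_const_nonneg \<delta>(2)[folded l_def] ql(1) _ Y T(2) step]) (use ql in simp)
    also have "\<dots> \<le> l ^ k * M"
    proof (rule mult_left_mono)
      \<comment> \<open>The starting energy is replaced by the energy of \<open>A\<close>, which
        does not depend on the centre \<open>z\<close>.\<close>
      have "ennreal (T 0) \<le> ennreal E" unfolding T(1)[symmetric] E(1)[symmetric] using sub[of 0] BA by (intro en_mono) auto
      then show "T 0 + Y / (l - qs) \<le> M" using E by (simp add: M_def)
    qed (use ql in simp)
    finally have "ennreal (T k) \<le> ennreal (l ^ k * M)" by (rule ennreal_leI)
    then show ?thesis unfolding T(1) by (simp add: mult.commute)
  qed
  have lk: "l ^ k = 2 powr (- \<delta> * real k)" for k
    unfolding l_def by (simp only: powr_powr[symmetric] powr_realpow powr_gt_zero)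
  have "D x y \<le> campanato_const dim s p \<alpha> * (M * R powr (- \<delta>)) powr (1 / p) * norm (x - y) powr \<alpha>"
  proof (rule campanato[OF R M(1) \<alpha> x y])
    fix z k assume z: "z \<in> ball x0 R"
    have "ball z (R * 2 powr (- real k)) \<subseteq> A"
    proof
      fix w assume w: "w \<in> ball z (R * 2 powr (- real k))"
      have "2 powr (- real k) \<le> 2 powr 0" by (intro powr_mono) auto
      then have "R * 2 powr (- real k) \<le> R" using R by simp
      then have "dist z w < R" using w by (simp add: less_le_trans)
      with z dist_triangle[of x0 w z] have "w \<in> ball x0 (2 * R)" by simp
      then show "w \<in> A" using BA by blast
    qed
    then have "en (ball z (R * 2 powr (- real k))) (ball z (R * 2 powr (- real k))) \<le> en (ball z (R * 2 powr (- real k))) A" by (intro en_mono) auto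
    also have "\<dots> \<le> ennreal (M * 2 powr (- \<delta> * real k))" using decay[OF z, of k] unfolding lk .
    finally show "en (ball z (R * 2 powr (- real k))) (ball z (R * 2 powr (- real k))) \<le> ennreal (M * 2 powr (- \<delta> * real k))" .
  next
    have "en (ball x0 (2 * R)) (ball x0 (2 * R)) \<le> en A A" using BA by (intro en_mono) auto
    also have "\<dots> \<le> ennreal M" unfolding E using M by (intro ennreal_leI) auto
    finally show "en (ball x0 (2 * R)) (ball x0 (2 * R)) \<le> ennreal M" .
  qed
  then show ?thesis unfolding M_def YM E_def .
qed

end

section \<open>Localisation\<close>

lemma powr_superadditive:
  assumes "0 \<le> (a::real)" "0 \<le> b" "1 \<le> q"
  shows "a powr q + b powr q \<le> (a + b) powr q"
proof (cases "a = 0 \<or> b = 0")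
  case False
  then have ab: "0 < a" "0 < b" using assms by auto
  have "a powr q = a * a powr (q - 1)" "b powr q = b * b powr (q - 1)" "(a + b) powr q = (a + b) * (a + b) powr (q - 1)"
    using ab by (simp_all add: powr_diff)
  moreover have "a * a powr (q - 1) \<le> a * (a + b) powr (q - 1)" "b * b powr (q - 1) \<le> b * (a + b) powr (q - 1)"
    using ab assms by (auto intro!: mult_left_mono powr_mono2)
  ultimately show ?thesis by (simp add: distrib_right)
qed (use assms in auto)

context gag_field
begin

section \<open>Interaction with the exterior of the ball of radius \<open>4 * R\<close>\<close>

context
  fixes x0 :: "real ^ 'n" and R :: real
  assumes R: "0 < R"
begin

text \<open>Extended-valued and formed with absolute values, so that it can be estimated before the
  signed integral \<open>far_part\<close> is known to converge.\<close>

definition far_potential :: "real ^ 'n \<Rightarrow> ennreal" where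
  "far_potential x = (\<integral>\<^sup>+y\<in>- (ball x0 (4 * R)). ennreal (D x y powr (p - 1) * norm (x - y) powr (- ex)) \<partial>lborel)"

lemma far_potential_measurable [measurable]: "far_potential \<in> borel_measurable borel"
  unfolding far_potential_def[abs_def] by measurable

lemma far_norm:
  assumes "x \<in> (ball x0 (2 * R))" "y \<notin> (ball x0 (4 * R))"
  shows "2 * R \<le> norm (x - y)"
  using assms dist_triangle[of x0 y x] by (simp add: dist_norm)

lemma far_kernel:
  assumes x: "x \<in> (ball x0 (2 * R))"
  shows "(\<integral>\<^sup>+y\<in>- (ball x0 (4 * R)). ennreal (norm (x - y) powr (- ex)) \<partial>lborel) \<le> ennreal (\<kappa> * R powr (- (s * p)))"
proof -
  have "(\<integral>\<^sup>+y\<in>- (ball x0 (4 * R)). ennreal (norm (x - y) powr (- ex)) \<partial>lborel)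
     \<le> (\<integral>\<^sup>+y. ennreal (min 1 (4 * norm (x - y) / R) powr p / norm (x - y) powr ex) \<partial>lborel)"
  proof (rule nn_integral_mono)
    fix y
    show "ennreal (norm (x - y) powr (- ex)) * indicator (- (ball x0 (4 * R))) y \<le> ennreal (min 1 (4 * norm (x - y) / R) powr p / norm (x - y) powr ex)"
    proof (cases "y \<in> (ball x0 (4 * R))")
      case False
      have "R \<le> 4 * norm (x - y)" using far_norm[OF x False] R by simp
      then have "1 \<le> 4 * norm (x - y) / R" using R by simp
      then have "min 1 (4 * norm (x - y) / R) = 1" by (rule min_absorb1)
      then show ?thesis using False unfolding divide_powr_uminus by (simp del: minus_add_distrib)
    qed simp
  qed
  also have "\<dots> \<le> ennreal (\<kappa> * R powr (- (s * p)))" by (rule kernel_integral'[OF R])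
  finally show ?thesis .
qed

text \<open>For \<open>x\<close> within radius \<open>2 * R\<close> and \<open>y\<close> outside
  radius \<open>4 * R\<close> the kernel is bounded by a multiple of the weight
  \<open>1 / (1 + norm y powr ex)\<close> of the tail space. The growth in \<open>u x\<close> has
  exponent \<open>p - 1\<close>, and \<open>(p - 1) * q = p\<close>; hence the exterior contributes
  an \<open>L^q\<close> function.\<close>

lemma far_potential_tail:
  assumes tail: "(\<integral>\<^sup>+x. ennreal (vnorm N (u x) powr (p - 1) / (1 + norm x powr ex)) \<partial>lborel) < \<infinity>"
  obtains c1 c2 where "0 \<le> c1" "0 \<le> c2" "\<And>x. x \<in> (ball x0 (2 * R)) \<Longrightarrow> far_potential x \<le> ennreal (c1 * vnorm N (u x) powr (p - 1) + c2)"
proof -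
  note [measurable] = vnorm_measurable[OF u_measurable]
  define t where "t = enn2real (\<integral>\<^sup>+x. ennreal (vnorm N (u x) powr (p - 1) / (1 + norm x powr ex)) \<partial>lborel)"
  have t: "(\<integral>\<^sup>+x. ennreal (vnorm N (u x) powr (p - 1) / (1 + norm x powr ex)) \<partial>lborel) = ennreal t" "0 \<le> t"
    using tail by (auto simp: t_def)
  \<comment> \<open>Chosen so that \<open>norm y \<le> b * norm (x - y)\<close>: the length of
    \<open>x\<close> is at most \<open>norm x0 + 2 * R\<close>, while
    \<open>norm (x - y) \<ge> 2 * R\<close>.\<close>
  define b where "b = 1 + (norm x0 + 2 * R) / (2 * R)"
  define C where "C = (2 * R) powr (- ex) + b powr ex"
  have C: "0 \<le> C" by (simp add: C_def)
  define k where "k = \<kappa> * R powr (- (s * p))"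
  have k: "0 \<le> k" using \<kappa>_pos by (simp add: k_def)
  have Cy: "norm (x - y) powr (- ex) \<le> C / (1 + norm y powr ex)" if x: "x \<in> (ball x0 (2 * R))" and y: "y \<notin> (ball x0 (4 * R))" for x y
  proof -
    define n where "n = norm (x - y)"
    have n: "2 * R \<le> n" "0 < n" using far_norm[OF x y] R by (auto simp: n_def)
    have b0: "0 \<le> b" using R by (simp add: b_def)
    have "1 = (2 * R) powr (- ex) * (2 * R) powr ex" using R by (simp flip: powr_add)
    also have "\<dots> \<le> (2 * R) powr (- ex) * n powr ex" using n R ex_pos by (intro mult_left_mono powr_mono2) auto
    finally have 1: "1 \<le> (2 * R) powr (- ex) * n powr ex" .
    have "norm y \<le> n + norm x" unfolding n_def using norm_triangle_sub[of y x] by (simp add: norm_minus_commute add.commute)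
    also have "norm x \<le> norm x0 + 2 * R" using x norm_triangle_sub[of x x0] by (simp add: dist_norm norm_minus_commute)
    also have "n + (norm x0 + 2 * R) \<le> n + (norm x0 + 2 * R) * (n / (2 * R))"
      using n R mult_left_mono[of 1 "n / (2 * R)" "norm x0 + 2 * R"] by simp
    also have "\<dots> = b * n" using R by (simp add: b_def field_simps)
    finally have "norm y powr ex \<le> (b * n) powr ex" using ex_pos by (intro powr_mono2) auto
    also have "\<dots> = b powr ex * n powr ex" by (rule powr_mult)
    finally have le: "1 + norm y powr ex \<le> C * n powr ex" using 1 by (simp add: C_def distrib_right)
    have pos: "0 < 1 + norm y powr ex" by (simp add: add_pos_nonneg)
    have "(1 + norm y powr ex) * n powr (- ex) \<le> C * n powr ex * n powr (- ex)" by (rule mult_right_mono[OF le]) simp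
    also have "\<dots> = C * (n powr ex * n powr (- ex))" by (rule mult.assoc)
    also have "n powr ex * n powr (- ex) = 1" using n by (simp flip: powr_add)
    finally have "(1 + norm y powr ex) * n powr (- ex) \<le> C" by simp
    then show ?thesis using pos by (simp add: n_def pos_le_divide_eq mult.commute del: minus_add_distrib)
  qed
  have "far_potential x \<le> ennreal (2 powr (p - 1) * k * vnorm N (u x) powr (p - 1) + 2 powr (p - 1) * C * t)" if x: "x \<in> (ball x0 (2 * R))" for x
  proof -
    have "far_potential x \<le> (\<integral>\<^sup>+y. ennreal (2 powr (p - 1) * vnorm N (u x) powr (p - 1)) * (ennreal (norm (x - y) powr (- ex)) * indicator (- (ball x0 (4 * R))) y)
       + ennreal (2 powr (p - 1) * C) * ennreal (vnorm N (u y) powr (p - 1) / (1 + norm y powr ex)) \<partial>lborel)"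
      unfolding far_potential_def
    proof (rule nn_integral_mono)
      fix y
      show "ennreal (D x y powr (p - 1) * norm (x - y) powr (- ex)) * indicator (- (ball x0 (4 * R))) y
        \<le> ennreal (2 powr (p - 1) * vnorm N (u x) powr (p - 1)) * (ennreal (norm (x - y) powr (- ex)) * indicator (- (ball x0 (4 * R))) y)
       + ennreal (2 powr (p - 1) * C) * ennreal (vnorm N (u y) powr (p - 1) / (1 + norm y powr ex))"
      proof (cases "y \<in> (ball x0 (4 * R))")
        case False
        have "D x y \<le> vnorm N (u x) + vnorm N (u y)"
          using vdist_triangle[of N "u x" "u y" "\<lambda>_. 0"] by (simp add: vdist_commute[of N "\<lambda>_. 0"]) (simp add: vdist_def)
        then have "D x y powr (p - 1) \<le> (vnorm N (u x) + vnorm N (u y)) powr (p - 1)" using p by (intro powr_mono2) auto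
        also have "\<dots> \<le> 2 powr (p - 1) * (vnorm N (u x) powr (p - 1) + vnorm N (u y) powr (p - 1))" using p by (intro powr_add_le) auto
        finally have "D x y powr (p - 1) * norm (x - y) powr (- ex)
          \<le> 2 powr (p - 1) * (vnorm N (u x) powr (p - 1) + vnorm N (u y) powr (p - 1)) * norm (x - y) powr (- ex)"
          by (rule mult_right_mono) simp
        also have "\<dots> = 2 powr (p - 1) * vnorm N (u x) powr (p - 1) * norm (x - y) powr (- ex)
           + 2 powr (p - 1) * vnorm N (u y) powr (p - 1) * norm (x - y) powr (- ex)" by (simp only: distrib_left distrib_right)
        also have "\<dots> \<le> 2 powr (p - 1) * vnorm N (u x) powr (p - 1) * norm (x - y) powr (- ex)
           + 2 powr (p - 1) * vnorm N (u y) powr (p - 1) * (C / (1 + norm y powr ex))"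
          by (intro add_left_mono mult_left_mono Cy x False) auto
        also have "2 powr (p - 1) * vnorm N (u y) powr (p - 1) * (C / (1 + norm y powr ex))
          = (2 powr (p - 1) * C) * (vnorm N (u y) powr (p - 1) / (1 + norm y powr ex))" by simp
        finally have "ennreal (D x y powr (p - 1) * norm (x - y) powr (- ex)) \<le>
           ennreal (2 powr (p - 1) * vnorm N (u x) powr (p - 1) * norm (x - y) powr (- ex)
           + (2 powr (p - 1) * C) * (vnorm N (u y) powr (p - 1) / (1 + norm y powr ex)))" by (rule ennreal_leI)
        also have "\<dots> = ennreal (2 powr (p - 1) * vnorm N (u x) powr (p - 1)) * ennreal (norm (x - y) powr (- ex))
           + ennreal (2 powr (p - 1) * C) * ennreal (vnorm N (u y) powr (p - 1) / (1 + norm y powr ex))"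
          using C by (subst ennreal_plus) (auto simp: ennreal_mult[symmetric])
        finally show ?thesis using False by simp
      qed simp
    qed
    also have "\<dots> = ennreal (2 powr (p - 1) * vnorm N (u x) powr (p - 1)) * (\<integral>\<^sup>+y\<in>- (ball x0 (4 * R)). ennreal (norm (x - y) powr (- ex)) \<partial>lborel)
       + ennreal (2 powr (p - 1) * C) * ennreal t"
      unfolding t(1)[symmetric] by (simp add: nn_integral_add nn_integral_cmult)
    also have "\<dots> \<le> ennreal (2 powr (p - 1) * vnorm N (u x) powr (p - 1)) * ennreal k + ennreal (2 powr (p - 1) * C) * ennreal t"
      unfolding k_def by (intro add_mono mult_left_mono far_kernel x) auto
    also have "\<dots> = ennreal (2 powr (p - 1) * k * vnorm N (u x) powr (p - 1) + 2 powr (p - 1) * C * t)"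
      using C t k by (subst ennreal_plus) (auto simp: ennreal_mult[symmetric] mult_ac)
    finally show ?thesis .
  qed
  then show ?thesis using that[of "2 powr (p - 1) * k" "2 powr (p - 1) * C * t"] C t k by simp
qed

text \<open>Hoelder's inequality with the kernel exponent split as \<open>ex / q + ex / p\<close>;
  the second share is bounded by \<open>far_kernel\<close>. Unlike in
  \<open>far_potential_tail\<close>, the constant is free of \<open>u\<close>, at the price of the
  energy of \<open>x\<close> against the whole space.\<close>

lemma far_potential_energy:
  assumes x: "x \<in> (ball x0 (2 * R))" and fin: "far_potential x < \<infinity>"
  shows "ennreal (enn2real (far_potential x) powr q) \<le> ennreal ((\<kappa> * R powr (- (s * p))) powr (q / p)) * (\<integral>\<^sup>+y. G x y \<partial>lborel)"
proof (cases "(\<integral>\<^sup>+y. G x y \<partial>lborel) = \<infinity>")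
  case True
  have "0 < (\<kappa> * R powr (- (s * p))) powr (q / p)" using \<kappa>_pos R by (simp add: powr_gt_zero)
  then show ?thesis using True by (simp add: ennreal_mult_top)
next
  case False
  define e where "e = enn2real (\<integral>\<^sup>+y. G x y \<partial>lborel)"
  have e: "(\<integral>\<^sup>+y. G x y \<partial>lborel) = ennreal e" "0 \<le> e" using False by (auto simp: e_def less_top)
  define k where "k = \<kappa> * R powr (- (s * p))"
  have k: "0 \<le> k" using \<kappa>_pos by (simp add: k_def)
  have e0: "a powr (- ex / q) * a powr (- ex / p) = a powr (- ex)" for a :: real
  proof -
    have "w / q + w / p = w * (1 / p + 1 / q)" for w by (simp add: algebra_simps)
    then have "- ex / q + - ex / p = - ex" using q(2) by (metis mult.right_neutral)
    then show ?thesis by (simp only: powr_add[symmetric])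
  qed
  have "far_potential x = (\<integral>\<^sup>+y. ennreal ((indicator (- (ball x0 (4 * R))) y * (D x y powr (p - 1) * norm (x - y) powr (- ex / q))) * (indicator (- (ball x0 (4 * R))) y * norm (x - y) powr (- ex / p))) \<partial>lborel)"
    unfolding far_potential_def
  proof (rule nn_integral_cong)
    fix y
    define a1 where "a1 = norm (x - y) powr (- ex / q)"
    define a2 where "a2 = norm (x - y) powr (- ex / p)"
    have "norm (x - y) powr (- ex) = a1 * a2" unfolding a1_def a2_def by (rule e0[symmetric])
    then show "ennreal (D x y powr (p - 1) * norm (x - y) powr (- ex)) * indicator (- (ball x0 (4 * R))) y =
       ennreal ((indicator (- (ball x0 (4 * R))) y * (D x y powr (p - 1) * norm (x - y) powr (- ex / q))) * (indicator (- (ball x0 (4 * R))) y * norm (x - y) powr (- ex / p)))"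
      unfolding a1_def[symmetric] a2_def[symmetric] by (cases "y \<in> (ball x0 (4 * R))") (simp_all add: mult.assoc)
  qed
  also have "\<dots> \<le> ennreal (e powr (1 / q) * k powr (1 / p))"
  proof (rule nn_integral_Holder[where p = q and q = p])
    show "(\<integral>\<^sup>+y. ennreal ((indicator (- (ball x0 (4 * R))) y * (D x y powr (p - 1) * norm (x - y) powr (- ex / q))) powr q) \<partial>lborel) \<le> ennreal ((e powr (1 / q)) powr q)"
    proof -
      have "(\<integral>\<^sup>+y. ennreal ((indicator (- (ball x0 (4 * R))) y * (D x y powr (p - 1) * norm (x - y) powr (- ex / q))) powr q) \<partial>lborel) \<le> (\<integral>\<^sup>+y. G x y \<partial>lborel)"
      proof (rule nn_integral_mono)
        fix y
        have "- ex / q * q = - ex" using q(1) by simp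
        then have "(D x y powr (p - 1) * norm (x - y) powr (- ex / q)) powr q = D x y powr p * norm (x - y) powr (- ex)"
          by (simp only: powr_mult powr_powr q(3))
        also have "\<dots> = D x y powr p / norm (x - y) powr ex" by (simp only: divide_powr_uminus)
        finally show "ennreal ((indicator (- (ball x0 (4 * R))) y * (D x y powr (p - 1) * norm (x - y) powr (- ex / q))) powr q) \<le> G x y"
          by (cases "y \<in> (ball x0 (4 * R))") (simp_all add: G_def del: minus_add_distrib)
      qed
      also have "\<dots> = ennreal ((e powr (1 / q)) powr q)" using e q(1) by (simp add: powr_powr)
      finally show ?thesis .
    qed
    show "(\<integral>\<^sup>+y. ennreal ((indicator (- (ball x0 (4 * R))) y * norm (x - y) powr (- ex / p)) powr p) \<partial>lborel) \<le> ennreal ((k powr (1 / p)) powr p)"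
    proof -
      have "(\<integral>\<^sup>+y. ennreal ((indicator (- (ball x0 (4 * R))) y * norm (x - y) powr (- ex / p)) powr p) \<partial>lborel) = (\<integral>\<^sup>+y\<in>- (ball x0 (4 * R)). ennreal (norm (x - y) powr (- ex)) \<partial>lborel)"
      proof (rule nn_integral_cong)
        fix y
        have "- ex / p * p = - ex" using p by simp
        then have "(norm (x - y) powr (- ex / p)) powr p = norm (x - y) powr (- ex)" by (simp only: powr_powr)
        then show "ennreal ((indicator (- (ball x0 (4 * R))) y * norm (x - y) powr (- ex / p)) powr p) = ennreal (norm (x - y) powr (- ex)) * indicator (- (ball x0 (4 * R))) y"
          by (cases "y \<in> (ball x0 (4 * R))") (simp_all del: minus_add_distrib)
      qed
      also have "\<dots> \<le> ennreal k" unfolding k_def by (rule far_kernel[OF x])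
      also have "\<dots> = ennreal ((k powr (1 / p)) powr p)" using k p by (simp add: powr_powr)
      finally show ?thesis .
    qed
  qed (use p q in \<open>auto simp: add.commute\<close>)
  finally have "enn2real (far_potential x) \<le> e powr (1 / q) * k powr (1 / p)"
    by (intro enn2real_leI) auto
  then have "enn2real (far_potential x) powr q \<le> (e powr (1 / q) * k powr (1 / p)) powr q"
    using q(1) by (intro powr_mono2) auto
  also have "\<dots> = k powr (q / p) * e" using e q(1) by (simp add: powr_mult powr_powr)
  finally show ?thesis using e by (simp add: k_def[symmetric] ennreal_mult[symmetric] ennreal_leI)
qed

definition far_part :: "real ^ 'n \<Rightarrow> nat \<Rightarrow> real" where
  "far_part x i = (LINT y|lborel. indicator (- (ball x0 (4 * R))) y * D x y powr (p - 2) * (u x i - u y i) * norm (x - y) powr (- ex))"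

lemma far_part_measurable: "i < N \<Longrightarrow> (\<lambda>x. far_part x i) \<in> borel_measurable borel"
  unfolding far_part_def[abs_def] using u_measurable by measurable

lemma component_flux_le:
  assumes "i < N"
  shows "D x y powr (p - 2) * \<bar>u x i - u y i\<bar> \<le> D x y powr (p - 1)"
proof -
  have "D x y powr (p - 2) * \<bar>u x i - u y i\<bar> \<le> D x y powr (p - 2) * D x y"
    using abs_le_vnorm[OF assms, of "\<lambda>i. u x i - u y i"] by (intro mult_left_mono) (auto simp: vdist_def)
  also have "\<dots> = D x y powr (p - 1)" by (rule powr_minus_2) simp
  finally show ?thesis .
qed

lemma far_part_integrable:
  assumes i: "i < N" and fin: "far_potential x < \<infinity>"
  shows "integrable lborel (\<lambda>y. indicator (- (ball x0 (4 * R))) y * D x y powr (p - 2) * (u x i - u y i) * norm (x - y) powr (- ex))"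
proof (rule integrableI_bounded)
  note [measurable] = u_measurable[OF i]
  show "(\<lambda>y. indicator (- (ball x0 (4 * R))) y * D x y powr (p - 2) * (u x i - u y i) * norm (x - y) powr (- ex)) \<in> borel_measurable lborel"
    by measurable
  have "(\<integral>\<^sup>+y. ennreal (norm (indicator (- (ball x0 (4 * R))) y * D x y powr (p - 2) * (u x i - u y i) * norm (x - y) powr (- ex))) \<partial>lborel) \<le> far_potential x"
    unfolding far_potential_def
  proof (rule nn_integral_mono)
    fix y
    have "norm (indicator (- (ball x0 (4 * R))) y * D x y powr (p - 2) * (u x i - u y i) * norm (x - y) powr (- ex))
      = indicator (- (ball x0 (4 * R))) y * ((D x y powr (p - 2) * \<bar>u x i - u y i\<bar>) * norm (x - y) powr (- ex))" by (simp add: abs_mult)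
    also have "\<dots> \<le> indicator (- (ball x0 (4 * R))) y * (D x y powr (p - 1) * norm (x - y) powr (- ex))"
      by (intro mult_left_mono mult_right_mono component_flux_le i) auto
    finally show "ennreal (norm (indicator (- (ball x0 (4 * R))) y * D x y powr (p - 2) * (u x i - u y i) * norm (x - y) powr (- ex)))
      \<le> ennreal (D x y powr (p - 1) * norm (x - y) powr (- ex)) * indicator (- (ball x0 (4 * R))) y"
      by (cases "y \<in> (ball x0 (4 * R))") (auto intro!: ennreal_leI)
  qed
  then show "(\<integral>\<^sup>+y. ennreal (norm (indicator (- (ball x0 (4 * R))) y * D x y powr (p - 2) * (u x i - u y i) * norm (x - y) powr (- ex))) \<partial>lborel) < \<infinity>"
    using fin by (rule le_less_trans)
qed

text \<open>The length of an integral is at most the integral of the length: pair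
  \<open>far_part x\<close> with itself, move the pairing under the integral, apply Cauchy-Schwarz
  and divide by the length.\<close>

lemma far_part_bound:
  assumes fin: "far_potential x < \<infinity>"
  shows "vnorm N (far_part x) \<le> enn2real (far_potential x)"
proof (cases "vnorm N (far_part x) = 0")
  case False
  define F where "F = (\<lambda>i y. indicator (- (ball x0 (4 * R))) y * D x y powr (p - 2) * (u x i - u y i) * norm (x - y) powr (- ex))"
  define P where "P = (\<lambda>y. indicator (- (ball x0 (4 * R))) y * (D x y powr (p - 1) * norm (x - y) powr (- ex)))"
  have Pn: "(\<integral>\<^sup>+y. ennreal (P y) \<partial>lborel) = far_potential x"
    unfolding P_def far_potential_def by (intro nn_integral_cong) (auto simp: indicator_def)
  have Pi: "integrable lborel P"
    by (rule integrableI_nonneg) (use fin Pn in \<open>auto simp: P_def\<close>)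
  have PL: "(LINT y|lborel. P y) = enn2real (far_potential x)"
    unfolding Pn[symmetric] by (rule integral_eq_nn_integral) (auto simp: P_def)
  have Fi: "integrable lborel (F i)" if "i < N" for i unfolding F_def by (rule far_part_integrable[OF that fin])
  have "vnorm N (far_part x) * vnorm N (far_part x) = (\<Sum>i<N. far_part x i * far_part x i)"
    using vinner_self[of N "far_part x"] by (simp add: vinner_def power2_eq_square)
  also have "\<dots> = (\<Sum>i<N. LINT y|lborel. far_part x i * F i y)"
    by (intro sum.cong refl) (simp add: far_part_def F_def)
  also have "\<dots> = (LINT y|lborel. (\<Sum>i<N. far_part x i * F i y))"
    using Fi by (intro Bochner_Integration.integral_sum[symmetric]) auto
  also have "\<dots> \<le> (LINT y|lborel. vnorm N (far_part x) * P y)"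
  proof (rule integral_mono)
    show "integrable lborel (\<lambda>y. \<Sum>i<N. far_part x i * F i y)" using Fi by (intro Bochner_Integration.integrable_sum) auto
    show "integrable lborel (\<lambda>y. vnorm N (far_part x) * P y)" using Pi by simp
    fix y
    have "(\<Sum>i<N. far_part x i * F i y) = indicator (- (ball x0 (4 * R))) y * (D x y powr (p - 2) * vinner N (far_part x) (\<lambda>i. u x i - u y i) * norm (x - y) powr (- ex))"
      unfolding F_def vinner_def sum_distrib_left sum_distrib_right by (intro sum.cong refl) (simp only: mult_ac)
    also have "\<dots> \<le> indicator (- (ball x0 (4 * R))) y * (D x y powr (p - 2) * (vnorm N (far_part x) * D x y) * norm (x - y) powr (- ex))"
      using abs_vinner_le[of N "far_part x" "\<lambda>i. u x i - u y i"]
      by (intro mult_left_mono mult_right_mono) (auto simp: vdist_def)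
    also have "\<dots> = vnorm N (far_part x) * P y"
      unfolding P_def powr_minus_2(1)[OF vdist_nonneg, symmetric] by (simp only: mult_ac)
    finally show "(\<Sum>i<N. far_part x i * F i y) \<le> vnorm N (far_part x) * P y" .
  qed
  also have "\<dots> = vnorm N (far_part x) * enn2real (far_potential x)" using PL by simp
  finally show ?thesis using False by (simp add: mult_le_cancel_left) (smt (verit) vnorm_nonneg)
qed simp

end

end

context gag_field
begin

section \<open>Splitting the weak form for Lipschitz test functions\<close>

context
  fixes x0 :: "real ^ 'n" and R l :: real and \<phi> :: "real ^ 'n \<Rightarrow> real"
  assumes R: "0 < R" and \<phi>: "\<phi> \<in> borel_measurable borel" "\<And>x. x \<notin> ball x0 (2 * R) \<Longrightarrow> \<phi> x = 0"
    and l: "0 \<le> l" "\<And>x y. \<bar>\<phi> x - \<phi> y\<bar> \<le> l * norm (x - y)"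
begin

lemma lipschitz_bounded: "\<bar>\<phi> x\<bar> \<le> 4 * R * l"
proof (cases "x \<in> ball x0 (2 * R)")
  case True
  \<comment> \<open>A point on the sphere of radius \<open>2 * R\<close>, where
    \<open>\<phi>\<close> vanishes; \<open>axis undefined 1\<close> is some unit vector.\<close>
  define y where "y = x0 + (2 * R) *\<^sub>R axis undefined 1"
  have "dist x0 y = 2 * R" using R by (simp add: y_def dist_norm)
  then have "\<phi> y = 0" "dist x y \<le> 4 * R" using \<phi>(2)[of y] True dist_triangle[of x y x0] by (auto simp: dist_commute)
  then have "\<bar>\<phi> x\<bar> \<le> l * (4 * R)" using l(2)[of x y] mult_left_mono[OF _ l(1), of "norm (x - y)" "4 * R"] by (simp add: dist_norm)
  then show ?thesis by (simp add: mult_ac)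
qed (use \<phi> R l in simp)

lemma lipschitz_powr: "(\<integral>\<^sup>+x. ennreal (\<bar>\<phi> x\<bar> powr p) \<partial>lborel) < \<infinity>"
proof -
  have "(\<integral>\<^sup>+x. ennreal (\<bar>\<phi> x\<bar> powr p) \<partial>lborel) \<le> (\<integral>\<^sup>+x. ennreal ((4 * R * l) powr p) * indicator (ball x0 (2 * R)) x \<partial>lborel)"
  proof (rule nn_integral_mono)
    fix x
    show "ennreal (\<bar>\<phi> x\<bar> powr p) \<le> ennreal ((4 * R * l) powr p) * indicator (ball x0 (2 * R)) x"
      using lipschitz_bounded[of x] \<phi>(2)[of x] p by (cases "x \<in> ball x0 (2 * R)") (auto intro!: ennreal_leI powr_mono2)
  qed
  also have "\<dots> < \<infinity>" using R by (simp add: nn_integral_cmult_indicator emeasure_ball ennreal_mult_less_top)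
  finally show ?thesis .
qed

text \<open>The Lipschitz bound at short distance and the supremum bound at long distance combine
  into a multiple of \<open>min 1 (4 * norm (x - y) / R)\<close>, to which
  \<open>kernel_integral'\<close> applies.\<close>

lemma lipschitz_gag: "gag \<phi> < \<infinity>"
proof -
  note [measurable] = \<phi>(1)
  define B where "B = ball x0 (2 * R)"
  have Bm [measurable]: "B \<in> sets borel" by (simp add: B_def)
  define k where "k = (\<lambda>(x :: real ^ 'n) (y :: real ^ 'n). ennreal (min 1 (4 * norm (x - y) / R) powr p / norm (x - y) powr ex))"
  have km [measurable (raw)]: "(\<lambda>t. k (f t) (g t)) \<in> borel_measurable M"
    if [measurable]: "f \<in> borel_measurable M" "g \<in> borel_measurable M" for f g and M :: "'m measure"
    unfolding k_def by measurable
  have k1 [measurable]: "k x \<in> borel_measurable borel" for x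
    unfolding k_def by measurable
  define I where "I = ennreal (\<kappa> * R powr (- (s * p)))"
  have kI: "(\<integral>\<^sup>+y. k x y \<partial>lborel) \<le> I" for x
    unfolding k_def I_def by (rule kernel_integral'[OF R])
  define C where "C = ennreal ((8 * R * l) powr p)"
  have S: "(\<integral>\<^sup>+x. (\<integral>\<^sup>+y. C * k x y * indicator B x \<partial>lborel) \<partial>lborel) \<le> C * I * emeasure lborel B"
  proof -
    have "(\<integral>\<^sup>+x. (\<integral>\<^sup>+y. C * k x y * indicator B x \<partial>lborel) \<partial>lborel) = (\<integral>\<^sup>+x. C * (\<integral>\<^sup>+y. k x y \<partial>lborel) * indicator B x \<partial>lborel)"
      by (simp add: nn_integral_cmult nn_integral_multc)
    also have "\<dots> \<le> (\<integral>\<^sup>+x. C * I * indicator B x \<partial>lborel)"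
      by (intro nn_integral_mono mult_right_mono mult_left_mono kI) auto
    also have "\<dots> = C * I * emeasure lborel B" by (simp add: nn_integral_cmult_indicator)
    finally show ?thesis .
  qed
  have "gag \<phi> \<le> (\<integral>\<^sup>+x. (\<integral>\<^sup>+y. C * k x y * indicator B x + C * k y x * indicator B y \<partial>lborel) \<partial>lborel)"
    unfolding gag_def
  proof (intro nn_integral_mono)
    fix x y
    show "ennreal (\<bar>\<phi> x - \<phi> y\<bar> powr p / norm (x - y) powr ex) \<le> C * k x y * indicator B x + C * k y x * indicator B y"
    proof (cases "x \<in> B \<or> y \<in> B")
      case True
      have "\<bar>\<phi> x - \<phi> y\<bar> \<le> 8 * R * l * min 1 (4 * norm (x - y) / R)"
      proof (cases "4 * norm (x - y) / R \<le> 1")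
        case True
        have "8 * R * l * (4 * norm (x - y) / R) = 32 * (l * norm (x - y))" using R by simp
        moreover have "0 \<le> l * norm (x - y)" using l(1) by simp
        ultimately show ?thesis using l(2)[of x y] True by (simp add: min_absorb2)
      next
        case False
        then show ?thesis using lipschitz_bounded[of x] lipschitz_bounded[of y] by (simp add: min_def abs_le_iff)
      qed
      then have "\<bar>\<phi> x - \<phi> y\<bar> powr p \<le> (8 * R * l * min 1 (4 * norm (x - y) / R)) powr p" using p by (intro powr_mono2) auto
      also have "\<dots> = (8 * R * l) powr p * min 1 (4 * norm (x - y) / R) powr p" by (rule powr_mult)
      finally have "\<bar>\<phi> x - \<phi> y\<bar> powr p / norm (x - y) powr ex \<le> (8 * R * l) powr p * min 1 (4 * norm (x - y) / R) powr p / norm (x - y) powr ex"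
        by (rule divide_right_mono) simp
      then have "ennreal (\<bar>\<phi> x - \<phi> y\<bar> powr p / norm (x - y) powr ex) \<le> ennreal ((8 * R * l) powr p * (min 1 (4 * norm (x - y) / R) powr p / norm (x - y) powr ex))"
        by (intro ennreal_leI) simp
      also have "\<dots> = C * k x y" unfolding C_def k_def by (rule ennreal_mult) auto
      finally have le: "ennreal (\<bar>\<phi> x - \<phi> y\<bar> powr p / norm (x - y) powr ex) \<le> C * k x y" .
      moreover have "k x y = k y x" by (simp add: k_def norm_minus_commute)
      ultimately show ?thesis using True by (auto simp: indicator_def add_increasing add_increasing2)
    next
      case False
      then show ?thesis using \<phi>(2)[of x] \<phi>(2)[of y] by (simp add: B_def)
    qed
  qed
  also have "\<dots> = (\<integral>\<^sup>+x. (\<integral>\<^sup>+y. C * k x y * indicator B x \<partial>lborel) \<partial>lborel) + (\<integral>\<^sup>+x. (\<integral>\<^sup>+y. C * k y x * indicator B y \<partial>lborel) \<partial>lborel)"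
    by (simp add: nn_integral_add)
  also have "(\<integral>\<^sup>+x. (\<integral>\<^sup>+y. C * k y x * indicator B y \<partial>lborel) \<partial>lborel) = (\<integral>\<^sup>+x. (\<integral>\<^sup>+y. C * k x y * indicator B x \<partial>lborel) \<partial>lborel)"
    by (rule lborel_pair.Fubini') measurable
  also have "(\<integral>\<^sup>+x. (\<integral>\<^sup>+y. C * k x y * indicator B x \<partial>lborel) \<partial>lborel) + (\<integral>\<^sup>+x. (\<integral>\<^sup>+y. C * k x y * indicator B x \<partial>lborel) \<partial>lborel) \<le> C * I * emeasure lborel B + C * I * emeasure lborel B"
    by (intro add_mono S)
  also have "\<dots> < \<infinity>" using R by (simp add: C_def I_def B_def emeasure_ball ennreal_mult_less_top)
  finally show ?thesis .
qed

text \<open>As \<open>\<phi>\<close> lives in radius \<open>2 * R\<close>, a contributing pair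
  either lies in the ball \<open>A\<close> of radius \<open>4 * R\<close> or has exactly one point
  outside it. The two mixed parts \<open>J\<close> and \<open>J'\<close> have equal integrals by
  symmetry, whence the factor 2. Absolute convergence of all three parts turns the iterated integral
  into an integral over the product.\<close>

lemma local_weak_form:
  assumes finA: "en (ball x0 (4 * R)) (ball x0 (4 * R)) < \<infinity>"
    and Hfin: "\<And>x. x \<in> ball x0 (2 * R) \<Longrightarrow> far_potential x0 R x < \<infinity>"
    and Hq: "(\<integral>\<^sup>+x\<in>ball x0 (2 * R). ennreal (enn2real (far_potential x0 R x) powr q) \<partial>lborel) < \<infinity>"
    and i: "i < N"
    and f: "f \<in> borel_measurable borel" and fq: "(\<integral>\<^sup>+x\<in>ball x0 (2 * R). ennreal (\<bar>f x\<bar> powr q) \<partial>lborel) < \<infinity>"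
    and weak: "(LINT x|lborel. LINT y|lborel. D x y powr (p - 2) * ((u x i - u y i) * (\<phi> x - \<phi> y)) / norm (x - y) powr ex)
       = (LINT x|lborel. f x * \<phi> x)"
  shows "(LINT m|(lborel \<Otimes>\<^sub>M lborel). flux (ball x0 (4 * R)) i m * (\<phi> (fst m) - \<phi> (snd m)))
       = (LINT x|lborel. (f x - 2 * far_part x0 R x i) * \<phi> x)"
proof -
  let ?M = "lborel \<Otimes>\<^sub>M lborel :: ((real ^ 'n) \<times> (real ^ 'n)) measure"
  note [measurable] = \<phi>(1) u_measurable[OF i] f far_potential_measurable[OF R]
  define A where "A = ball x0 (4 * R)"
  define B where "B = ball x0 (2 * R)"
  have BA: "B \<subseteq> A" using R by (auto simp: A_def B_def)
  have [measurable]: "A \<in> sets borel" "B \<in> sets borel" by (auto simp: A_def B_def)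
  define H where "H = far_potential x0 R"
  have [measurable]: "H \<in> borel_measurable borel" unfolding H_def by measurable
  define J where "J = (\<lambda>m. indicator (- A) (snd m) * D (fst m) (snd m) powr (p - 2) * (u (fst m) i - u (snd m) i) * norm (fst m - snd m) powr (- ex) * \<phi> (fst m))"
  have Jb: "J \<in> borel_measurable (borel \<Otimes>\<^sub>M borel)" unfolding J_def by measurable
  have sets_M: "sets ?M = sets (borel \<Otimes>\<^sub>M borel)" by (intro sets_pair_measure_cong) auto
  have Jm: "J \<in> borel_measurable ?M" using Jb measurable_cong_sets[OF sets_M refl] by blast
  have \<phi>B: "\<phi> x = 0" if "x \<notin> B" for x using \<phi>(2) that by (simp add: B_def)
  have Ji: "integrable ?M J"
  proof (rule integrableI_bounded[OF Jm])
    have "(\<integral>\<^sup>+m. ennreal (norm (J m)) \<partial>?M) = (\<integral>\<^sup>+x. (\<integral>\<^sup>+y. ennreal (norm (J (x, y))) \<partial>lborel) \<partial>lborel)"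
      by (rule lborel.nn_integral_fst[symmetric]) (use Jm in simp)
    also have "\<dots> \<le> (\<integral>\<^sup>+x. ennreal (enn2real (H x) powr q) * indicator B x + ennreal (\<bar>\<phi> x\<bar> powr p) \<partial>lborel)"
    proof (rule nn_integral_mono)
      fix x
      show "(\<integral>\<^sup>+y. ennreal (norm (J (x, y))) \<partial>lborel) \<le> ennreal (enn2real (H x) powr q) * indicator B x + ennreal (\<bar>\<phi> x\<bar> powr p)"
      proof (cases "x \<in> B")
        case True
        have "(\<integral>\<^sup>+y. ennreal (norm (J (x, y))) \<partial>lborel) \<le> (\<integral>\<^sup>+y. ennreal \<bar>\<phi> x\<bar> * (ennreal (D x y powr (p - 1) * norm (x - y) powr (- ex)) * indicator (- A) y) \<partial>lborel)"
        proof (rule nn_integral_mono)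
          fix y
          have "norm (J (x, y)) = \<bar>\<phi> x\<bar> * (indicator (- A) y * ((D x y powr (p - 2) * \<bar>u x i - u y i\<bar>) * norm (x - y) powr (- ex)))"
            by (simp add: J_def abs_mult mult_ac del: minus_add_distrib)
          also have "\<dots> \<le> \<bar>\<phi> x\<bar> * (indicator (- A) y * (D x y powr (p - 1) * norm (x - y) powr (- ex)))"
            by (intro mult_left_mono mult_right_mono component_flux_le[OF R i]) auto
          finally have "ennreal (norm (J (x, y))) \<le> ennreal \<dots>" by (rule ennreal_leI)
          also have "\<dots> = ennreal \<bar>\<phi> x\<bar> * (ennreal (D x y powr (p - 1) * norm (x - y) powr (- ex)) * indicator (- A) y)"
            by (cases "y \<in> A") (simp_all add: ennreal_mult del: minus_add_distrib)
          finally show "ennreal (norm (J (x, y))) \<le> ennreal \<bar>\<phi> x\<bar> * (ennreal (D x y powr (p - 1) * norm (x - y) powr (- ex)) * indicator (- A) y)" .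
        qed
        also have "\<dots> = ennreal \<bar>\<phi> x\<bar> * H x"
          unfolding H_def far_potential_def[OF R] A_def by (rule nn_integral_cmult) measurable
        also have "\<dots> = ennreal (enn2real (H x) * \<bar>\<phi> x\<bar>)"
          using Hfin[of x] True by (simp add: H_def B_def ennreal_mult less_top mult.commute)
        also have "\<dots> \<le> ennreal (enn2real (H x) powr q + \<bar>\<phi> x\<bar> powr p)"
          using Young_scaled[of "enn2real (H x)" "\<bar>\<phi> x\<bar>" 1 p q] p q by (intro ennreal_leI) simp
        finally show ?thesis using True by simp
      next
        case False
        then show ?thesis using \<phi>B by (simp add: J_def)
      qed
    qed
    also have "\<dots> < \<infinity>" using Hq lipschitz_powr by (simp add: nn_integral_add H_def B_def)
    finally show "(\<integral>\<^sup>+m. ennreal (norm (J m)) \<partial>?M) < \<infinity>" .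
  qed
  define J' where "J' = (\<lambda>m. J (snd m, fst m))"
  have Ji': "integrable ?M J'" and JJ': "(LINT m|?M. J' m) = (LINT m|?M. J m)"
    using lborel_pair.integrable_product_swap[OF Ji] lborel_pair.integral_product_swap[OF Jm]
    by (simp_all add: J'_def split_beta')
  define Fl where "Fl = (\<lambda>m. flux A i m * (\<phi> (fst m) - \<phi> (snd m)))"
  have Fli: "integrable ?M Fl"
    unfolding Fl_def by (rule increment_integrable[OF _ _ flux_measurable flux_bound[OF i] \<phi>(1) lipschitz_gag])
      (use finA i in \<open>auto simp: A_def\<close>)
  define T where "T = (\<lambda>m. D (fst m) (snd m) powr (p - 2) * ((u (fst m) i - u (snd m) i) * (\<phi> (fst m) - \<phi> (snd m))) / norm (fst m - snd m) powr ex)"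
  have T: "T m = Fl m + J m + J' m" for m
  proof -
    obtain x y where m: "m = (x, y)" by (cases m)
    define K where "K = norm (x - y) powr (- ex)"
    have K': "norm (y - x) powr (- ex) = K" by (simp add: K_def norm_minus_commute)
    have d: "D y x = D x y" by (rule vdist_commute)
    have n: "\<phi> x = 0" if "x \<notin> A" for x using that BA \<phi>B by blast
    show ?thesis
      unfolding T_def Fl_def J_def J'_def flux_def m fst_conv snd_conv divide_powr_uminus K_def[symmetric] K' d
      by (cases "x \<in> A"; cases "y \<in> A") (auto simp: n algebra_simps)
  qed
  have "(LINT x|lborel. f x * \<phi> x) = (LINT x|lborel. LINT y|lborel. T (x, y))"
    unfolding weak[symmetric] T_def by simp
  also have "\<dots> = (LINT m|?M. T m)"
    by (rule lborel_pair.integral_fst') (use Fli Ji Ji' in \<open>simp add: T[abs_def]\<close>)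
  also have "\<dots> = (LINT m|?M. Fl m) + (LINT m|?M. J m) + (LINT m|?M. J' m)"
    unfolding T using Fli Ji Ji' by simp
  also have "\<dots> = (LINT m|?M. Fl m) + 2 * (LINT m|?M. J m)" by (simp add: JJ')
  also have "(LINT m|?M. J m) = (LINT x|lborel. LINT y|lborel. J (x, y))"
    by (rule lborel_pair.integral_fst'[OF Ji, symmetric])
  finally have eq0: "(LINT x|lborel. f x * \<phi> x) = (LINT m|?M. Fl m) + 2 * (LINT x|lborel. LINT y|lborel. J (x, y))" .
  have Jx: "(LINT y|lborel. J (x, y)) = far_part x0 R x i * \<phi> x" for x
    unfolding J_def far_part_def[OF R] A_def fst_conv snd_conv by simp
  have eq: "(LINT x|lborel. f x * \<phi> x) = (LINT m|?M. Fl m) + 2 * (LINT x|lborel. far_part x0 R x i * \<phi> x)"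
    using eq0 unfolding Jx .
  have hi: "integrable lborel (\<lambda>x. far_part x0 R x i * \<phi> x)"
    using lborel_pair.integrable_fst'[OF Ji] unfolding Jx .
  have fi: "integrable lborel (\<lambda>x. f x * \<phi> x)"
  proof (rule integrableI_bounded)
    have "(\<integral>\<^sup>+x. ennreal (norm (f x * \<phi> x)) \<partial>lborel) \<le> (\<integral>\<^sup>+x. ennreal (\<bar>f x\<bar> powr q) * indicator B x + ennreal (\<bar>\<phi> x\<bar> powr p) \<partial>lborel)"
    proof (rule nn_integral_mono)
      fix x
      show "ennreal (norm (f x * \<phi> x)) \<le> ennreal (\<bar>f x\<bar> powr q) * indicator B x + ennreal (\<bar>\<phi> x\<bar> powr p)"
      proof (cases "x \<in> B")
        case True
        have "norm (f x * \<phi> x) \<le> \<bar>f x\<bar> powr q + \<bar>\<phi> x\<bar> powr p"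
          using Young_scaled[of "\<bar>f x\<bar>" "\<bar>\<phi> x\<bar>" 1 p q] p q by (simp add: abs_mult)
        from ennreal_leI[OF this] show ?thesis using True by simp
      qed (use \<phi>B in simp)
    qed
    also have "\<dots> < \<infinity>" using fq lipschitz_powr by (simp add: nn_integral_add B_def)
    finally show "(\<integral>\<^sup>+x. ennreal (norm (f x * \<phi> x)) \<partial>lborel) < \<infinity>" .
  qed measurable
  have "(LINT x|lborel. (f x - 2 * far_part x0 R x i) * \<phi> x) = (LINT x|lborel. f x * \<phi> x - 2 * (far_part x0 R x i * \<phi> x))"
    by (simp add: algebra_simps)
  also have "\<dots> = (LINT x|lborel. f x * \<phi> x) - 2 * (LINT x|lborel. far_part x0 R x i * \<phi> x)"
    using fi hi by simp
  finally show ?thesis using eq by (simp add: Fl_def A_def)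
qed

end

end

text \<open>\<open>L\<close> stands for \<open>max 1 (diameter \<Omega>)\<close> and bounds
  \<open>R powr s\<close> in front of the term with \<open>f\<close>. The first summand 1 pays for
  the energy of the ball of radius \<open>4 * R\<close>, the 2 for \<open>f\<close>, and the term
  with \<open>kernel_const\<close> for the exterior.\<close>

definition holder_const :: "real \<Rightarrow> real \<Rightarrow> real \<Rightarrow> real \<Rightarrow> real \<Rightarrow> real" where
  "holder_const n s p \<delta> L = campanato_const n s p ((s * p + \<delta> - n) / p) *
     ((1 + reg_const n s p \<delta> * (2 + 4 * kernel_const n s p powr (1 / p))) * L) powr (1 / p)"

lemma vnorm_triangle: "vnorm N (\<lambda>i. v i + w i) \<le> vnorm N v + vnorm N w"
  unfolding vnorm_def by (rule L2_set_triangle_ineq)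

lemma vnorm_scale: "vnorm N (\<lambda>i. c * v i) = \<bar>c\<bar> * vnorm N v"
  by (simp add: vnorm_def L2_set_def power_mult_distrib sum_distrib_left[symmetric] real_sqrt_mult)

context gag_field
begin

section \<open>Hoelder estimates on one ball\<close>

context
  fixes x0 :: "real ^ 'n" and R F \<delta> \<alpha> :: real and f :: "'n vfield"
  assumes R: "0 < R" 
    and finA: "en (ball x0 (4 * R)) (ball x0 (4 * R)) < \<infinity>"
    and up: "(\<integral>\<^sup>+x\<in>ball x0 (4 * R). ennreal (vnorm N (u x) powr p) \<partial>lborel) < \<infinity>"
    and tail: "(\<integral>\<^sup>+x. ennreal (vnorm N (u x) powr (p - 1) / (1 + norm x powr ex)) \<partial>lborel) < \<infinity>"
    and f: "\<And>i. i < N \<Longrightarrow> (\<lambda>x. f x i) \<in> borel_measurable borel"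
    and F: "0 \<le> F" "(\<integral>\<^sup>+x\<in>ball x0 (2 * R). ennreal (vnorm N (f x) powr q) \<partial>lborel) \<le> ennreal (F powr q)"
    and weak: "\<And>i \<phi> l K. i < N \<Longrightarrow> (\<And>k. Ck k \<phi>) \<Longrightarrow> compact K \<Longrightarrow> K \<subseteq> ball x0 (2 * R) \<Longrightarrow> (\<And>x. x \<notin> K \<Longrightarrow> \<phi> x = 0)
      \<Longrightarrow> (LINT x|lborel. LINT y|lborel. D x y powr (p - 2) * ((u x i - u y i) * (\<phi> x - \<phi> y)) / norm (x - y) powr ex)
       = (LINT x|lborel. f x i * \<phi> x)"
    and \<delta>: "\<delta> < s" "hole_const dim s p / (1 + hole_const dim s p) \<le> 2 powr (- \<delta>)"
    and \<alpha>: "\<alpha> = (s * p + \<delta> - dim) / p" "0 < \<alpha>"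
begin

lemma far_potential_finite: "x \<in> ball x0 (2 * R) \<Longrightarrow> far_potential x0 R x < \<infinity>"
proof -
  assume x: "x \<in> ball x0 (2 * R)"
  obtain c1 c2 where "0 \<le> c1" "0 \<le> c2" "\<And>x. x \<in> ball x0 (2 * R) \<Longrightarrow> far_potential x0 R x \<le> ennreal (c1 * vnorm N (u x) powr (p - 1) + c2)"
    by (rule far_potential_tail[OF R tail]) (rule that)
  from this(3)[OF x] show ?thesis by (rule le_less_trans) simp
qed

text \<open>With the exterior interaction moved to it, the right-hand side has \<open>L^q\<close>
  norm at most \<open>2 * F + 4 * h\<close>. The two theorems that follow differ in where
  \<open>h\<close> comes from.\<close>

lemma holder_with_potential:
  assumes H: "0 \<le> h" "(\<integral>\<^sup>+x\<in>ball x0 (2 * R). ennreal (enn2real (far_potential x0 R x) powr q) \<partial>lborel) \<le> ennreal (h powr q)"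
    and W: "0 \<le> W" "en (ball x0 (2 * R)) (ball x0 (2 * R)) \<le> ennreal (W powr p)"
    and x: "x \<in> ball x0 R" "good x" and y: "y \<in> ball x0 R" "good y"
  shows "D x y \<le> campanato_const dim s p \<alpha> * ((enn2real (en (ball x0 (4 * R)) (ball x0 (4 * R)))
      + reg_const dim s p \<delta> * (R powr s * (2 * F + 4 * h) * W)) * R powr (- \<delta>)) powr (1 / p) * norm (x - y) powr \<alpha>"
proof (rule regional_holder[OF R _ _ finA _ \<delta> \<alpha> _ _ _ W _ x y])
  note [measurable] = far_potential_measurable[OF R] vnorm_measurable[OF f]
  show "(\<lambda>x. f x i - 2 * far_part x0 R x i) \<in> borel_measurable borel" if "i < N" for i
    using f[OF that] far_part_measurable[OF R that] by measurable
  show "(\<integral>\<^sup>+x\<in>ball x0 (2 * R). ennreal (vnorm N (\<lambda>i. f x i - 2 * far_part x0 R x i) powr q) \<partial>lborel) \<le> ennreal ((2 * F + 4 * h) powr q)"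
  proof -
    have "(\<integral>\<^sup>+x\<in>ball x0 (2 * R). ennreal (vnorm N (\<lambda>i. f x i - 2 * far_part x0 R x i) powr q) \<partial>lborel)
      \<le> (\<integral>\<^sup>+x. ennreal (2 powr q) * (ennreal (vnorm N (f x) powr q) * indicator (ball x0 (2 * R)) x)
         + ennreal (4 powr q) * (ennreal (enn2real (far_potential x0 R x) powr q) * indicator (ball x0 (2 * R)) x) \<partial>lborel)"
    proof (rule nn_integral_mono)
      fix x
      show "ennreal (vnorm N (\<lambda>i. f x i - 2 * far_part x0 R x i) powr q) * indicator (ball x0 (2 * R)) x
        \<le> ennreal (2 powr q) * (ennreal (vnorm N (f x) powr q) * indicator (ball x0 (2 * R)) x)
         + ennreal (4 powr q) * (ennreal (enn2real (far_potential x0 R x) powr q) * indicator (ball x0 (2 * R)) x)"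
      proof (cases "x \<in> ball x0 (2 * R)")
        case True
        have "vnorm N (\<lambda>i. f x i - 2 * far_part x0 R x i) \<le> vnorm N (f x) + vnorm N (\<lambda>i. (- 2) * far_part x0 R x i)"
          using vnorm_triangle[of N "f x" "\<lambda>i. (- 2) * far_part x0 R x i"] by simp
        also have "\<dots> = vnorm N (f x) + 2 * vnorm N (far_part x0 R x)" by (subst vnorm_scale) simp
        also have "\<dots> \<le> vnorm N (f x) + 2 * enn2real (far_potential x0 R x)"
          using far_part_bound[OF R far_potential_finite[OF True]] by simp
        finally have "vnorm N (\<lambda>i. f x i - 2 * far_part x0 R x i) powr q \<le> (vnorm N (f x) + 2 * enn2real (far_potential x0 R x)) powr q"
          using q(1) by (intro powr_mono2) auto
        also have "\<dots> \<le> 2 powr q * (vnorm N (f x) powr q + (2 * enn2real (far_potential x0 R x)) powr q)"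
          using q(1) by (intro powr_add_le) auto
        also have "\<dots> = 2 powr q * vnorm N (f x) powr q + 4 powr q * enn2real (far_potential x0 R x) powr q"
        proof -
          have "(2 * enn2real (far_potential x0 R x)) powr q = 2 powr q * enn2real (far_potential x0 R x) powr q" by (rule powr_mult)
          moreover have "2 powr q * 2 powr q = (4 :: real) powr q" by (simp flip: powr_mult)
          ultimately show ?thesis by (simp add: distrib_left flip: mult.assoc)
        qed
        finally have "ennreal (vnorm N (\<lambda>i. f x i - 2 * far_part x0 R x i) powr q) \<le> ennreal (2 powr q * vnorm N (f x) powr q + 4 powr q * enn2real (far_potential x0 R x) powr q)"
          by (rule ennreal_leI)
        also have "\<dots> = ennreal (2 powr q) * ennreal (vnorm N (f x) powr q) + ennreal (4 powr q) * ennreal (enn2real (far_potential x0 R x) powr q)"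
          by (simp add: ennreal_mult)
        finally show ?thesis using True by simp
      qed simp
    qed
    also have "\<dots> = ennreal (2 powr q) * (\<integral>\<^sup>+x\<in>ball x0 (2 * R). ennreal (vnorm N (f x) powr q) \<partial>lborel)
       + ennreal (4 powr q) * (\<integral>\<^sup>+x\<in>ball x0 (2 * R). ennreal (enn2real (far_potential x0 R x) powr q) \<partial>lborel)"
      by (simp add: nn_integral_add nn_integral_cmult)
    also have "\<dots> \<le> ennreal (2 powr q) * ennreal (F powr q) + ennreal (4 powr q) * ennreal (h powr q)"
      by (intro add_mono mult_left_mono F H) auto
    also have "\<dots> = ennreal ((2 * F) powr q + (4 * h) powr q)"
      by (simp add: powr_mult ennreal_mult)
    also have "\<dots> \<le> ennreal ((2 * F + 4 * h) powr q)"
      using F H q(1) by (intro ennreal_leI powr_superadditive) auto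
    finally show ?thesis .
  qed
  show "(LINT m|(lborel \<Otimes>\<^sub>M lborel). flux (ball x0 (4 * R)) i m * (\<phi> (fst m) - \<phi> (snd m))) = (LINT x|lborel. (f x i - 2 * far_part x0 R x i) * \<phi> x)"
    if i: "i < N" and \<phi>: "\<And>k. Ck k \<phi>" "compact K" "K \<subseteq> ball x0 (2 * R)" "\<And>x. x \<notin> K \<Longrightarrow> \<phi> x = 0"
      and l: "0 \<le> l" "\<And>x y. \<bar>\<phi> x - \<phi> y\<bar> \<le> l * norm (x - y)" for i \<phi> l K
  proof (rule local_weak_form[OF R _ _ l finA far_potential_finite _ i f[OF i] _ weak[OF i \<phi>]])
    have "continuous_on UNIV \<phi>" using \<phi>(1)[of 0] by simp
    then show "\<phi> \<in> borel_measurable borel" by (rule borel_measurable_continuous_onI)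
    show "\<phi> x = 0" if "x \<notin> ball x0 (2 * R)" for x using \<phi>(3,4) that by blast
    show "(\<integral>\<^sup>+x\<in>ball x0 (2 * R). ennreal (enn2real (far_potential x0 R x) powr q) \<partial>lborel) < \<infinity>"
      by (rule le_less_trans[OF H(2)]) simp
    have "(\<integral>\<^sup>+x\<in>ball x0 (2 * R). ennreal (\<bar>f x i\<bar> powr q) \<partial>lborel) \<le> (\<integral>\<^sup>+x\<in>ball x0 (2 * R). ennreal (vnorm N (f x) powr q) \<partial>lborel)"
      using q(1) abs_le_vnorm[OF i] by (intro nn_integral_mono mult_right_mono ennreal_leI powr_mono2) auto
    also note F(2)
    also have "ennreal (F powr q) < \<infinity>" by simp
    finally show "(\<integral>\<^sup>+x\<in>ball x0 (2 * R). ennreal (\<bar>f x i\<bar> powr q) \<partial>lborel) < \<infinity>" .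
  qed
qed (use R F H in \<open>auto simp: emeasure_ball\<close>)

text \<open>Here \<open>h\<close> comes from the tail condition. The constant may depend on
  \<open>u\<close>, but it is finite even when the energy against the whole space is not, which is
  what local Hoelder continuity calls for.\<close>

theorem ball_holder_qualitative: "\<exists>C. \<forall>x\<in>ball x0 R. \<forall>y\<in>ball x0 R. good x \<longrightarrow> good y \<longrightarrow> D x y \<le> C * norm (x - y) powr \<alpha>"
proof -
  note [measurable] = far_potential_measurable[OF R] vnorm_measurable[OF u_measurable]
  obtain c1 c2 where c: "0 \<le> c1" "0 \<le> c2" "\<And>x. x \<in> ball x0 (2 * R) \<Longrightarrow> far_potential x0 R x \<le> ennreal (c1 * vnorm N (u x) powr (p - 1) + c2)"
    by (rule far_potential_tail[OF R tail]) (rule that)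
  have "(\<integral>\<^sup>+x\<in>ball x0 (2 * R). ennreal (enn2real (far_potential x0 R x) powr q) \<partial>lborel)
    \<le> (\<integral>\<^sup>+x. ennreal (2 powr q * c1 powr q) * (ennreal (vnorm N (u x) powr p) * indicator (ball x0 (4 * R)) x)
        + ennreal (2 powr q * c2 powr q) * indicator (ball x0 (2 * R)) x \<partial>lborel)"
  proof (rule nn_integral_mono)
    fix x
    show "ennreal (enn2real (far_potential x0 R x) powr q) * indicator (ball x0 (2 * R)) x
      \<le> ennreal (2 powr q * c1 powr q) * (ennreal (vnorm N (u x) powr p) * indicator (ball x0 (4 * R)) x)
        + ennreal (2 powr q * c2 powr q) * indicator (ball x0 (2 * R)) x"
    proof (cases "x \<in> ball x0 (2 * R)")
      case True
      have "enn2real (far_potential x0 R x) \<le> c1 * vnorm N (u x) powr (p - 1) + c2"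
        using c by (intro enn2real_leI c(3)[OF True]) auto
      then have "enn2real (far_potential x0 R x) powr q \<le> (c1 * vnorm N (u x) powr (p - 1) + c2) powr q"
        using q(1) by (intro powr_mono2) auto
      also have "\<dots> \<le> 2 powr q * ((c1 * vnorm N (u x) powr (p - 1)) powr q + c2 powr q)"
        using c q(1) by (intro powr_add_le) auto
      also have "(c1 * vnorm N (u x) powr (p - 1)) powr q = c1 powr q * vnorm N (u x) powr p"
        by (simp only: powr_mult powr_powr q(3))
      finally have "ennreal (enn2real (far_potential x0 R x) powr q) \<le> ennreal (2 powr q * (c1 powr q * vnorm N (u x) powr p + c2 powr q))"
        by (rule ennreal_leI)
      also have "\<dots> = ennreal (2 powr q * c1 powr q) * ennreal (vnorm N (u x) powr p) + ennreal (2 powr q * c2 powr q)"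
        by (simp add: distrib_left ennreal_mult mult.assoc)
      finally show ?thesis using True R by simp
    qed simp
  qed
  also have "\<dots> < \<infinity>"
    using up R by (simp add: nn_integral_add nn_integral_cmult nn_integral_cmult_indicator emeasure_ball ennreal_mult_less_top)
  finally have Hq: "(\<integral>\<^sup>+x\<in>ball x0 (2 * R). ennreal (enn2real (far_potential x0 R x) powr q) \<partial>lborel) < \<infinity>" .
  define h where "h = enn2real (\<integral>\<^sup>+x\<in>ball x0 (2 * R). ennreal (enn2real (far_potential x0 R x) powr q) \<partial>lborel) powr (1 / q)"
  have h: "0 \<le> h" "(\<integral>\<^sup>+x\<in>ball x0 (2 * R). ennreal (enn2real (far_potential x0 R x) powr q) \<partial>lborel) \<le> ennreal (h powr q)"
    using Hq q(1) by (simp_all add: h_def powr_powr)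
  have finB: "en (ball x0 (2 * R)) (ball x0 (2 * R)) < \<infinity>" by (rule le_less_trans[OF en_mono finA]) (use R in auto)
  define W where "W = enn2real (en (ball x0 (2 * R)) (ball x0 (2 * R))) powr (1 / p)"
  have W: "0 \<le> W" "en (ball x0 (2 * R)) (ball x0 (2 * R)) \<le> ennreal (W powr p)"
    using finB p by (simp_all add: W_def powr_powr)
  show ?thesis using holder_with_potential[OF h W] by blast
qed

text \<open>Here \<open>h\<close> comes from \<open>far_potential_energy\<close> and scales like
  \<open>R powr (- s)\<close>, which cancels the \<open>R powr s\<close> in front: the exterior
  costs a multiple of \<open>E powr (1 / q) * E powr (1 / p) = E\<close>. Only the term with
  \<open>F\<close> retains \<open>R powr s\<close>, which is at most \<open>S\<close>.\<close>

theorem ball_holder_quantitative: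
  assumes S: "1 \<le> S" "R \<le> S"
    and E: "en (ball x0 (4 * R)) UNIV = ennreal E" "0 \<le> E"
    and W: "0 \<le> W" "en (ball x0 (2 * R)) (ball x0 (2 * R)) = ennreal (W powr p)"
    and x: "x \<in> ball x0 R" "good x" and y: "y \<in> ball x0 R" "good y"
  shows "D x y \<le> holder_const dim s p \<delta> S * ((E + F * W) * R powr (- \<delta>)) powr (1 / p) * norm (x - y) powr \<alpha>"
proof -
  note [measurable] = far_potential_measurable[OF R]
  define k where "k = (\<kappa> * R powr (- (s * p))) powr (q / p)"
  have k: "0 \<le> k" by (simp add: k_def)
  define h where "h = \<kappa> powr (1 / p) * R powr (- s) * E powr (1 / q)"
  have hq: "h powr q = k * E"
  proof -
    have "h powr q = \<kappa> powr (1 / p * q) * R powr (- s * q) * E powr (1 / q * q)" unfolding h_def by (simp only: powr_mult powr_powr)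
    moreover have "k = \<kappa> powr (q / p) * R powr (- (s * p) * (q / p))" unfolding k_def by (simp only: powr_mult powr_powr)
    moreover have "- (s * p) * (q / p) = - s * q" using p by simp
    ultimately show ?thesis using q(1) E by simp
  qed
  have h: "0 \<le> h" "(\<integral>\<^sup>+x\<in>ball x0 (2 * R). ennreal (enn2real (far_potential x0 R x) powr q) \<partial>lborel) \<le> ennreal (h powr q)"
  proof -
    have "(\<integral>\<^sup>+x\<in>ball x0 (2 * R). ennreal (enn2real (far_potential x0 R x) powr q) \<partial>lborel)
      \<le> (\<integral>\<^sup>+x. ennreal k * ((\<integral>\<^sup>+y\<in>UNIV. G x y \<partial>lborel) * indicator (ball x0 (2 * R)) x) \<partial>lborel)"
      using far_potential_energy[OF R _ far_potential_finite]
      by (intro nn_integral_mono) (auto simp: indicator_def k_def)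
    also have "\<dots> = ennreal k * en (ball x0 (2 * R)) UNIV" unfolding en_def by (rule nn_integral_cmult) measurable
    also have "\<dots> \<le> ennreal k * en (ball x0 (4 * R)) UNIV" using R by (intro mult_left_mono en_mono) auto
    also have "\<dots> = ennreal (h powr q)" unfolding E hq using k E by (simp add: ennreal_mult)
    finally show "(\<integral>\<^sup>+x\<in>ball x0 (2 * R). ennreal (enn2real (far_potential x0 R x) powr q) \<partial>lborel) \<le> ennreal (h powr q)" .
  qed (simp add: h_def)
  define EA where "EA = enn2real (en (ball x0 (4 * R)) (ball x0 (4 * R)))"
  have EA: "EA \<le> E"
  proof -
    have "en (ball x0 (4 * R)) (ball x0 (4 * R)) \<le> ennreal E"
      unfolding E(1)[symmetric] by (rule en_mono[OF order_refl subset_UNIV])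
    then show ?thesis unfolding EA_def using E(2) by (rule enn2real_leI[rotated])
  qed
  have WE: "W \<le> E powr (1 / p)"
  proof -
    have "ennreal (W powr p) \<le> ennreal E" unfolding W(2)[symmetric] E(1)[symmetric] using R by (intro en_mono) auto
    then have "W powr p \<le> E" using E by simp
    then have "(W powr p) powr (1 / p) \<le> E powr (1 / p)" using p by (intro powr_mono2) auto
    then show ?thesis using W(1) p by (simp add: powr_powr)
  qed
  define c where "c = reg_const dim s p \<delta>"
  have "2 powr (- s) < 2 powr (- \<delta>)" using \<delta>(1) by simp
  then have c0: "0 \<le> c" using vol_pos by (simp add: c_def reg_const_def)
  have Rs: "R powr s \<le> S"
  proof -
    have "R powr s \<le> S powr s" using R S s by (intro powr_mono2) auto
    also have "\<dots> \<le> S powr 1" using S s by (intro powr_mono) auto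
    finally show ?thesis using S by simp
  qed
  have hW: "R powr s * h * W \<le> \<kappa> powr (1 / p) * E"
  proof -
    have "R powr s * R powr (- s) = 1" using R by (simp flip: powr_add)
    then have "R powr s * h = \<kappa> powr (1 / p) * E powr (1 / q)" by (simp add: h_def mult_ac)
    then have "R powr s * h * W \<le> \<kappa> powr (1 / p) * E powr (1 / q) * E powr (1 / p)" by (simp add: mult_left_mono WE)
    also have "\<dots> = \<kappa> powr (1 / p) * (E powr (1 / p + 1 / q))" by (simp add: powr_add mult_ac)
    also have "\<dots> = \<kappa> powr (1 / p) * E" using q(2) E(2) by simp
    finally show ?thesis .
  qed
  have "R powr s * (2 * F + 4 * h) * W = 2 * (R powr s * (F * W)) + 4 * (R powr s * h * W)" by (simp add: algebra_simps)
  also have "\<dots> \<le> 2 * (S * (F * W)) + 4 * (\<kappa> powr (1 / p) * E)"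
    using hW Rs F(1) W(1) by (intro add_mono mult_left_mono mult_right_mono) auto
  also have "\<dots> \<le> 2 * (S * (E + F * W)) + 4 * \<kappa> powr (1 / p) * (S * (E + F * W))"
  proof -
    have "S * (F * W) \<le> S * (E + F * W)" using S E by (intro mult_left_mono) auto
    moreover have "E \<le> S * (E + F * W)"
      using mult_mono[OF S(1), of E "E + F * W"] S E F(1) W(1) by simp
    then have "\<kappa> powr (1 / p) * E \<le> \<kappa> powr (1 / p) * (S * (E + F * W))" by (intro mult_left_mono) auto
    ultimately show ?thesis by simp
  qed
  also have "\<dots> = (2 + 4 * \<kappa> powr (1 / p)) * (S * (E + F * W))" by (simp add: algebra_simps)
  finally have "c * (R powr s * (2 * F + 4 * h) * W) \<le> c * ((2 + 4 * \<kappa> powr (1 / p)) * (S * (E + F * W)))"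
    using c0 by (rule mult_left_mono)
  moreover have "EA \<le> S * (E + F * W)"
    using mult_mono[OF S(1), of E "E + F * W"] S E F(1) W(1) EA by simp
  ultimately have "EA + c * (R powr s * (2 * F + 4 * h) * W) \<le> ((1 + c * (2 + 4 * \<kappa> powr (1 / p))) * S) * (E + F * W)"
    by (simp add: algebra_simps)
  then have "(EA + c * (R powr s * (2 * F + 4 * h) * W)) * R powr (- \<delta>) \<le> ((1 + c * (2 + 4 * \<kappa> powr (1 / p))) * S) * (E + F * W) * R powr (- \<delta>)"
    by (rule mult_right_mono) simp
  then have "((EA + c * (R powr s * (2 * F + 4 * h) * W)) * R powr (- \<delta>)) powr (1 / p)
     \<le> (((1 + c * (2 + 4 * \<kappa> powr (1 / p))) * S) * (E + F * W) * R powr (- \<delta>)) powr (1 / p)"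
    using p c0 F(1) h(1) W(1) by (intro powr_mono2) (auto simp: EA_def)
  also have "\<dots> = ((1 + c * (2 + 4 * \<kappa> powr (1 / p))) * S) powr (1 / p) * ((E + F * W) * R powr (- \<delta>)) powr (1 / p)"
    unfolding mult.assoc[of _ "E + F * W"] by (rule powr_mult)
  finally have le: "((EA + c * (R powr s * (2 * F + 4 * h) * W)) * R powr (- \<delta>)) powr (1 / p)
    \<le> ((1 + c * (2 + 4 * \<kappa> powr (1 / p))) * S) powr (1 / p) * ((E + F * W) * R powr (- \<delta>)) powr (1 / p)" .
  have cc: "0 \<le> campanato_const dim s p \<alpha>"
  proof -
    have "2 powr (- \<alpha>) < 1" using \<alpha>(2) by (auto simp: powr_less_one)
    then show ?thesis by (simp add: campanato_const_def)
  qed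
  have "D x y \<le> campanato_const dim s p \<alpha> * ((EA + c * (R powr s * (2 * F + 4 * h) * W)) * R powr (- \<delta>)) powr (1 / p) * norm (x - y) powr \<alpha>"
    unfolding EA_def c_def by (rule holder_with_potential[OF h W(1) _ x y]) (simp add: W(2))
  also have "\<dots> \<le> campanato_const dim s p \<alpha> * (((1 + c * (2 + 4 * \<kappa> powr (1 / p))) * S) powr (1 / p) * ((E + F * W) * R powr (- \<delta>)) powr (1 / p)) * norm (x - y) powr \<alpha>"
    by (intro mult_right_mono mult_left_mono le cc) auto
  finally show ?thesis unfolding holder_const_def \<alpha>(1)[symmetric] c_def by (simp only: mult.assoc)
qed

end

end

section \<open>Borel representatives\<close>

lemma epowr_ennreal: "0 \<le> x \<Longrightarrow> epowr (ennreal x) a = ennreal (x powr a)"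
  by (simp add: epowr_def)

lemma epowr_less_top: "epowr x a < \<infinity> \<Longrightarrow> x < \<infinity>"
  by (auto simp: epowr_def less_top split: if_splits)

lemma finite_energy_powr:
  assumes "epowr x (1 / p) < \<infinity>" "0 < p"
  obtains w where "0 \<le> w" "epowr x (1 / p) = ennreal w" "x = ennreal (w powr p)"
proof -
  have "x < \<infinity>" using assms(1) by (rule epowr_less_top)
  then obtain e where e: "x = ennreal e" "0 \<le> e" by (cases x) auto
  show ?thesis by (rule that[of "e powr (1 / p)"]) (use e assms in \<open>auto simp: epowr_ennreal powr_powr\<close>)
qed

lemma Ck_zero: "Ck k (\<lambda>_ :: real ^ 'n::finite. 0)"
  by (rule Ck_if_closed[of "{\<lambda>_. 0}"]) (auto intro!: exI[of _ "\<lambda>_ _. 0"])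

lemma compactly_inside_UNIV: "bounded U \<Longrightarrow> compactly_inside U (UNIV :: 'a::euclidean_space set)"
  by (simp add: compactly_inside_def compact_eq_bounded_closed bounded_closure)

text \<open>Measurability is given on bounded open sets; the restrictions to growing balls converge
  pointwise to the whole function.\<close>

lemma tail_space_measurable:
  fixes u :: "'n::finite vfield"
  assumes u: "u \<in> tail_space N q \<beta>" and i: "i < N"
  shows "(\<lambda>x. u x i) \<in> borel_measurable lebesgue"
proof -
  have "(\<lambda>x. indicator (ball 0 (real k)) x *\<^sub>R u x i) \<in> borel_measurable lebesgue" for k
  proof -
    have "(\<lambda>x. u x i) \<in> borel_measurable (lebesgue_on (ball 0 (real k)))"
      using u i compactly_inside_UNIV[of "ball 0 (real k)"] by (auto simp: tail_space_def Lq_loc_def Lq_def)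
    then show ?thesis by (subst (asm) borel_measurable_restrict_space_iff) auto
  qed
  moreover have "(\<lambda>k. indicator (ball 0 (real k)) x *\<^sub>R u x i) \<longlonglongrightarrow> u x i" for x
  proof -
    obtain k0 :: nat where k0: "norm x < real k0" using reals_Archimedean2 by blast
    have "\<forall>\<^sub>F k in sequentially. u x i = indicator (ball 0 (real k)) x *\<^sub>R u x i"
      using eventually_ge_at_top[of k0] by eventually_elim (use k0 in auto)
    then show ?thesis by (rule Lim_transform_eventually[OF tendsto_const])
  qed
  ultimately show ?thesis by (rule borel_measurable_LIMSEQ_real[rotated])
qed

lemma borel_representative:
  fixes u :: "'n::finite vfield"
  assumes "\<And>i. i < N \<Longrightarrow> (\<lambda>x. u x i) \<in> borel_measurable lebesgue"
  obtains w :: "'n vfield" where "\<And>i. i < N \<Longrightarrow> (\<lambda>x. w x i) \<in> borel_measurable borel" "AE x in lborel. \<forall>i<N. w x i = u x i"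
proof -
  have "\<exists>g. g \<in> borel_measurable borel \<and> (AE x in lborel. u x i = g x)" if "i < N" for i
    using completion_ex_borel_measurable_real[OF assms[OF that]] by auto
  then obtain g where g: "\<And>i. i < N \<Longrightarrow> g i \<in> borel_measurable borel" "\<And>i. i < N \<Longrightarrow> AE x in lborel. u x i = g i x"
    by metis
  have "AE x in lborel. \<forall>i\<in>{..<N}. u x i = g i x" using g(2) by (intro AE_finite_allI) auto
  then have "AE x in lborel. \<forall>i<N. g i x = u x i" by eventually_elim auto
  then show ?thesis using g(1) by (intro that[of "\<lambda>x i. g i x"]) auto
qed

lemma vnorm_cong: "(\<And>i. i < N \<Longrightarrow> v i = w i) \<Longrightarrow> vnorm N v = vnorm N w"
  by (simp add: vnorm_def L2_set_def)

lemma vdist_cong: "(\<And>i. i < N \<Longrightarrow> v i = v' i) \<Longrightarrow> (\<And>i. i < N \<Longrightarrow> w i = w' i) \<Longrightarrow> vdist N v w = vdist N v' w'"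
  unfolding vdist_def by (rule vnorm_cong) simp

context gag_field
begin

section \<open>Transfer between a field and its Borel representative\<close>

context
  fixes u0 :: "'n vfield"
  assumes ae: "AE x in lborel. \<forall>i<N. u x i = u0 x i"
begin

lemma gagliardo_energy_eq: "gagliardo_energy N s p A Y u0 = en A Y"
proof -
  have inner: "(\<integral>\<^sup>+y\<in>Y. ennreal (vdist N (u0 x) (u0 y) powr p / norm (x - y) powr (real CARD('n) + s * p)) \<partial>lebesgue)
     = (\<integral>\<^sup>+y\<in>Y. G x y \<partial>lborel)" if x: "\<forall>i<N. u x i = u0 x i" for x
  proof -
    have "(\<integral>\<^sup>+y\<in>Y. ennreal (vdist N (u0 x) (u0 y) powr p / norm (x - y) powr (real CARD('n) + s * p)) \<partial>lebesgue)
      = (\<integral>\<^sup>+y\<in>Y. ennreal (vdist N (u0 x) (u0 y) powr p / norm (x - y) powr (real CARD('n) + s * p)) \<partial>lborel)"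
      by (rule nn_integral_completion)
    also have "\<dots> = (\<integral>\<^sup>+y\<in>Y. G x y \<partial>lborel)"
    proof (rule nn_integral_cong_AE)
      show "AE y in lborel. ennreal (vdist N (u0 x) (u0 y) powr p / norm (x - y) powr (real CARD('n) + s * p)) * indicator Y y = G x y * indicator Y y"
        using ae
      proof eventually_elim
        case (elim y)
        have "vdist N (u0 x) (u0 y) = D x y" using x elim by (intro vdist_cong) auto
        then show ?case by (simp add: G_def flip: dim)
      qed
    qed
    finally show ?thesis .
  qed
  have "gagliardo_energy N s p A Y u0 = (\<integral>\<^sup>+x\<in>A. (\<integral>\<^sup>+y\<in>Y. ennreal (vdist N (u0 x) (u0 y) powr p / norm (x - y) powr (real CARD('n) + s * p)) \<partial>lebesgue) \<partial>lborel)"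
    unfolding gagliardo_energy_def by (rule nn_integral_completion)
  also have "\<dots> = en A Y"
    unfolding en_def
  proof (rule nn_integral_cong_AE)
    show "AE x in lborel. (\<integral>\<^sup>+y\<in>Y. ennreal (vdist N (u0 x) (u0 y) powr p / norm (x - y) powr (real CARD('n) + s * p)) \<partial>lebesgue) * indicator A x
      = (\<integral>\<^sup>+y\<in>Y. G x y \<partial>lborel) * indicator A x"
      using ae by eventually_elim (simp add: inner)
  qed
  finally show ?thesis .
qed

lemma Lq_integral_eq: "(\<integral>\<^sup>+x\<in>A. ennreal (vnorm N (u0 x) powr r) \<partial>lebesgue) = (\<integral>\<^sup>+x\<in>A. ennreal (vnorm N (u x) powr r) \<partial>lborel)"
proof -
  have "(\<integral>\<^sup>+x\<in>A. ennreal (vnorm N (u0 x) powr r) \<partial>lebesgue) = (\<integral>\<^sup>+x\<in>A. ennreal (vnorm N (u0 x) powr r) \<partial>lborel)"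
    by (rule nn_integral_completion)
  also have "\<dots> = (\<integral>\<^sup>+x\<in>A. ennreal (vnorm N (u x) powr r) \<partial>lborel)"
  proof (rule nn_integral_cong_AE)
    show "AE x in lborel. ennreal (vnorm N (u0 x) powr r) * indicator A x = ennreal (vnorm N (u x) powr r) * indicator A x"
      using ae
    proof eventually_elim
      case (elim x)
      then have "vnorm N (u0 x) = vnorm N (u x)" by (intro vnorm_cong) auto
      then show ?case by simp
    qed
  qed
  finally show ?thesis .
qed

lemma tail_integral_eq:
  assumes "u0 \<in> tail_space N (p - 1) (s * p)"
  shows "(\<integral>\<^sup>+x. ennreal (vnorm N (u x) powr (p - 1) / (1 + norm x powr ex)) \<partial>lborel) < \<infinity>"
proof -
  have "(\<integral>\<^sup>+x. ennreal (vnorm N (u0 x) powr (p - 1) / (1 + norm x powr (real CARD('n) + s * p))) \<partial>lebesgue)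
    = (\<integral>\<^sup>+x. ennreal (vnorm N (u0 x) powr (p - 1) / (1 + norm x powr (real CARD('n) + s * p))) \<partial>lborel)"
    by (rule nn_integral_completion)
  also have "\<dots> = (\<integral>\<^sup>+x. ennreal (vnorm N (u x) powr (p - 1) / (1 + norm x powr ex)) \<partial>lborel)"
  proof (rule nn_integral_cong_AE)
    show "AE x in lborel. ennreal (vnorm N (u0 x) powr (p - 1) / (1 + norm x powr (real CARD('n) + s * p)))
       = ennreal (vnorm N (u x) powr (p - 1) / (1 + norm x powr ex))"
      using ae
    proof eventually_elim
      case (elim x)
      then have "vnorm N (u0 x) = vnorm N (u x)" by (intro vnorm_cong) auto
      then show ?case by (simp flip: dim)
    qed
  qed
  finally show ?thesis using assms by (simp add: tail_space_def)
qed

text \<open>Test with \<open>\<phi>\<close> in component \<open>i\<close> and 0 elsewhere. As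
  \<open>f0\<close> is controlled only inside \<open>\<Omega>\<close>, measurability is asked of its
  product with \<open>\<phi>\<close>, and \<open>f\<close> agrees with it almost everywhere on
  \<open>K\<close> only.\<close>

lemma weak_solution_component:
  fixes f0 f :: "'n vfield"
  assumes u0: "\<And>i. i < N \<Longrightarrow> (\<lambda>x. u0 x i) \<in> borel_measurable lebesgue"
    and ws: "weak_solution N s p \<Omega> f0 u0"
    and i: "i < N" and \<phi>: "\<And>k. Ck k \<phi>" and K: "compact K" "K \<subseteq> \<Omega>" "\<And>x. x \<notin> K \<Longrightarrow> \<phi> x = 0"
    and f0: "(\<lambda>x. f0 x i * \<phi> x) \<in> borel_measurable lebesgue"
    and f: "(\<lambda>x. f x i) \<in> borel_measurable borel" "AE x in lborel. x \<in> K \<longrightarrow> f x i = f0 x i"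
  shows "(LINT x|lborel. LINT y|lborel. D x y powr (p - 2) * ((u x i - u y i) * (\<phi> x - \<phi> y)) / norm (x - y) powr ex)
       = (LINT x|lborel. f x i * \<phi> x)"
proof -
  have "continuous_on UNIV \<phi>" using \<phi>[of 0] by simp
  then have \<phi>m [measurable]: "\<phi> \<in> borel_measurable borel" by (rule borel_measurable_continuous_onI)
  note [measurable] = f(1) u_measurable[OF i]
  define \<Phi> where "\<Phi> = (\<lambda>x j. if j = i then \<phi> x else 0)"
  have "\<Phi> \<in> test_fields N \<Omega>"
    unfolding test_fields_def
  proof (intro CollectI conjI allI impI)
    show "Ck k (\<lambda>x. \<Phi> x j)" for k j by (cases "j = i") (simp_all add: \<Phi>_def \<phi> Ck_zero)
    show "\<exists>K. compact K \<and> K \<subseteq> \<Omega> \<and> (\<forall>x. x \<notin> K \<longrightarrow> (\<forall>i<N. \<Phi> x i = 0))"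
      using K by (intro exI[of _ K]) (auto simp: \<Phi>_def)
  qed
  note eq = ws[unfolded weak_solution_def, rule_format, OF this]
  have vin: "vinner N a (\<lambda>j. \<Phi> x j - \<Phi> y j) = a i * (\<phi> x - \<phi> y)" "vinner N a (\<Phi> x) = a i * \<phi> x" for a x y
  proof -
    have "vinner N a (\<lambda>j. \<Phi> x j - \<Phi> y j) = (\<Sum>j<N. if j = i then a i * (\<phi> x - \<phi> y) else 0)"
      unfolding vinner_def \<Phi>_def by (intro sum.cong) auto
    then show "vinner N a (\<lambda>j. \<Phi> x j - \<Phi> y j) = a i * (\<phi> x - \<phi> y)" using i by simp
    have "vinner N a (\<Phi> x) = (\<Sum>j<N. if j = i then a i * \<phi> x else 0)"
      unfolding vinner_def \<Phi>_def by (intro sum.cong) auto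
    then show "vinner N a (\<Phi> x) = a i * \<phi> x" using i by simp
  qed
  define T where "T = (\<lambda>x y. D x y powr (p - 2) * ((u x i - u y i) * (\<phi> x - \<phi> y)) / norm (x - y) powr ex)"
  define T0 where "T0 = (\<lambda>x y. vdist N (u0 x) (u0 y) powr (p - 2) * ((u0 x i - u0 y i) * (\<phi> x - \<phi> y)) / norm (x - y) powr ex)"
  have Tm [measurable]: "case_prod T \<in> borel_measurable (borel \<Otimes>\<^sub>M borel)" unfolding T_def split_beta' by measurable
  have Tm1 [measurable]: "T x \<in> borel_measurable borel" for x unfolding T_def by measurable
  have aeT: "AE y in lborel. T x y = T0 x y" if x: "\<forall>i<N. u x i = u0 x i" for x
    using ae
  proof eventually_elim
    case (elim y)
    have "vdist N (u0 x) (u0 y) = D x y" using x elim by (intro vdist_cong) auto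
    then show ?case using x elim i by (simp add: T_def T0_def)
  qed
  have inner: "(LINT y|lebesgue. T0 x y) = (LINT y|lborel. T x y)" if x: "\<forall>i<N. u x i = u0 x i" for x
  proof -
    have Tl: "T x \<in> borel_measurable lebesgue" by (rule measurable_completion) simp
    have aeT': "AE y in lebesgue. T x y = T0 x y" by (rule AE_completion[OF aeT[OF x]])
    \<comment> \<open>\<open>T0 x\<close> equals a Borel function only almost everywhere, so its
      measurability rests on completeness of the measure.\<close>
    have "T0 x \<in> borel_measurable lebesgue" by (rule borel_measurable_AE[OF Tl aeT'])
    then have "(LINT y|lebesgue. T0 x y) = (LINT y|lebesgue. T x y)"
      using Tl aeT' by (intro integral_cong_AE) auto
    also have "\<dots> = (LINT y|lborel. T x y)" by (rule integral_completion) simp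
    finally show ?thesis .
  qed
  have "(LINT x|lebesgue. LINT y|lebesgue. T0 x y) = (LINT x|lborel. LINT y|lborel. T x y)"
  proof -
    have Im: "(\<lambda>x. LINT y|lborel. T x y) \<in> borel_measurable lborel" by measurable
    have Il: "(\<lambda>x. LINT y|lborel. T x y) \<in> borel_measurable lebesgue" by (rule measurable_completion[OF Im])
    have "AE x in lborel. (LINT y|lborel. T x y) = (LINT y|lebesgue. T0 x y)"
      using ae by eventually_elim (simp add: inner)
    then have a: "AE x in lebesgue. (LINT y|lborel. T x y) = (LINT y|lebesgue. T0 x y)" by (rule AE_completion)
    have "(\<lambda>x. LINT y|lebesgue. T0 x y) \<in> borel_measurable lebesgue" by (rule borel_measurable_AE[OF Il a])
    then have "(LINT x|lebesgue. LINT y|lebesgue. T0 x y) = (LINT x|lebesgue. LINT y|lborel. T x y)"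
      using Il a by (intro integral_cong_AE) auto
    also have "\<dots> = (LINT x|lborel. LINT y|lborel. T x y)" by (rule integral_completion[OF Im])
    finally show ?thesis .
  qed
  moreover have "(LINT x|lebesgue. f0 x i * \<phi> x) = (LINT x|lborel. f x i * \<phi> x)"
  proof -
    have fm: "(\<lambda>x. f x i * \<phi> x) \<in> borel_measurable lborel" by measurable
    have "AE x in lborel. f0 x i * \<phi> x = f x i * \<phi> x" using f(2) by eventually_elim (use K(3) in auto)
    then have "AE x in lebesgue. f0 x i * \<phi> x = f x i * \<phi> x" by (rule AE_completion)
    then have "(LINT x|lebesgue. f0 x i * \<phi> x) = (LINT x|lebesgue. f x i * \<phi> x)"
      using f0 measurable_completion[OF fm] by (intro integral_cong_AE) auto
    also have "\<dots> = (LINT x|lborel. f x i * \<phi> x)" by (rule integral_completion[OF fm])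
    finally show ?thesis .
  qed
  moreover have "(LINT x|lebesgue. LINT y|lebesgue. T0 x y) = (LINT x|lebesgue. f0 x i * \<phi> x)"
    using eq unfolding vin T0_def dim .
  ultimately show ?thesis unfolding T_def by simp
qed

end

text \<open>A finite double integral has almost everywhere finite inner integrals, and around each
  point of the open ball a small ball fits inside.\<close>

lemma AE_good_local:
  assumes r: "0 < r" and fin: "en (ball x0 r) (ball x0 r) < \<infinity>"
  shows "AE x in lborel. x \<in> ball x0 r \<longrightarrow> good x"
proof -
  have "AE x in lborel. (\<integral>\<^sup>+y\<in>ball x0 r. G x y \<partial>lborel) * indicator (ball x0 r) x \<noteq> \<infinity>"
    by (rule nn_integral_noteq_infinite) (use fin in \<open>auto simp: en_def\<close>)
  then show ?thesis
  proof eventually_elim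
    case (elim x)
    show ?case
    proof
      assume x: "x \<in> ball x0 r"
      then have "\<exists>\<rho>>0. ball x \<rho> \<subseteq> ball x0 r" using open_ball open_contains_ball by blast
      then obtain \<rho> where \<rho>: "0 < \<rho>" "ball x \<rho> \<subseteq> ball x0 r" by blast
      have "(\<integral>\<^sup>+y\<in>ball x \<rho>. G x y \<partial>lborel) \<le> (\<integral>\<^sup>+y\<in>ball x0 r. G x y \<partial>lborel)"
        using \<rho>(2) by (intro nn_integral_mono mult_left_mono) (auto simp: indicator_def)
      also have "\<dots> < \<infinity>" using elim x by (simp add: less_top)
      finally show "good x" unfolding good_def using \<rho>(1) by blast
    qed
  qed
qed

end

section \<open>Continuous extension\<close>

lemma vdist_tendsto:
  assumes "\<And>i. i < N \<Longrightarrow> (\<lambda>k. f k i) \<longlonglongrightarrow> v i" "\<And>i. i < N \<Longrightarrow> (\<lambda>k. g k i) \<longlonglongrightarrow> w i"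
  shows "(\<lambda>k. vdist N (f k) (g k)) \<longlonglongrightarrow> vdist N v w"
  unfolding vdist_def vnorm_def L2_set_def using assms
  by (intro tendsto_intros) auto

lemma Cauchy_holder_image:
  fixes a :: "nat \<Rightarrow> 'a::real_normed_vector" and g :: "'a \<Rightarrow> real"
  assumes a: "Cauchy a" and \<alpha>: "0 < \<alpha>"
    and h: "\<forall>\<^sub>F k in sequentially. a k \<in> T" "\<And>x y. x \<in> T \<Longrightarrow> y \<in> T \<Longrightarrow> \<bar>g x - g y\<bar> \<le> C * norm (x - y) powr \<alpha>"
  shows "Cauchy (\<lambda>k. g (a k))"
proof (rule metric_CauchyI)
  fix e :: real assume e: "0 < e"
  \<comment> \<open>Solves \<open>(\<bar>C\<bar> + 1) * d powr \<alpha> = e\<close>; the absolute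
    value admits any sign of \<open>C\<close>, and the added 1 makes the final inequality
    strict.\<close>
  define d where "d = (e / (\<bar>C\<bar> + 1)) powr (1 / \<alpha>)"
  have d: "0 < d" using e by (simp add: d_def powr_gt_zero)
  obtain k1 where k1: "\<And>k. k \<ge> k1 \<Longrightarrow> a k \<in> T" using h(1) by (auto simp: eventually_sequentially)
  obtain k2 where k2: "\<And>m k. m \<ge> k2 \<Longrightarrow> k \<ge> k2 \<Longrightarrow> dist (a m) (a k) < d" using metric_CauchyD[OF a d] by blast
  have "dist (g (a m)) (g (a k)) < e" if mk: "m \<ge> max k1 k2" "k \<ge> max k1 k2" for m k
  proof -
    have "\<bar>g (a m) - g (a k)\<bar> \<le> C * norm (a m - a k) powr \<alpha>" using mk by (intro h(2) k1) auto
    also have "\<dots> \<le> \<bar>C\<bar> * d powr \<alpha>"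
      using k2[of m k] mk \<alpha> by (intro mult_mono powr_mono2) (auto simp: dist_norm)
    also have "d powr \<alpha> = e / (\<bar>C\<bar> + 1)" using \<alpha> e by (simp add: d_def powr_powr)
    also have "\<bar>C\<bar> * (e / (\<bar>C\<bar> + 1)) < e" using e by (simp add: field_simps add_pos_nonneg)
    finally show ?thesis by (simp add: dist_real_def)
  qed
  then show "\<exists>M. \<forall>m\<ge>M. \<forall>n\<ge>M. dist (g (a m)) (g (a n)) < e" by blast
qed

text \<open>One sequence in \<open>S\<close> is fixed for every point of \<open>\<Omega>\<close>,
  and \<open>v\<close> is the limit of \<open>u\<close> along it. Since \<open>v\<close> is chosen
  before balls, constants and exponents, the same \<open>v\<close> inherits the qualitative and the
  quantitative estimate.\<close>

lemma holder_extension: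
  fixes u :: "'n::finite vfield"
  assumes dense: "\<And>x e. x \<in> \<Omega> \<Longrightarrow> 0 < e \<Longrightarrow> \<exists>y\<in>S. dist y x < e"
  obtains v :: "'n vfield" where "\<And>x. x \<in> S \<Longrightarrow> v x = u x"
    "\<And>x0 r C \<alpha>. ball x0 r \<subseteq> \<Omega> \<Longrightarrow> 0 < \<alpha>
       \<Longrightarrow> \<forall>x\<in>ball x0 r \<inter> S. \<forall>y\<in>ball x0 r \<inter> S. vdist N (u x) (u y) \<le> C * norm (x - y) powr \<alpha>
       \<Longrightarrow> \<forall>x\<in>ball x0 r. \<forall>y\<in>ball x0 r. vdist N (v x) (v y) \<le> C * norm (x - y) powr \<alpha>"
proof -
  \<comment> \<open>At points of \<open>S\<close> the constant sequence is taken, so that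
    \<open>v\<close> agrees with \<open>u\<close> there.\<close>
  have "\<exists>b. (x \<in> S \<longrightarrow> b = (\<lambda>_. x)) \<and> (x \<in> \<Omega> \<longrightarrow> (\<forall>k. b k \<in> S) \<and> b \<longlonglongrightarrow> x)" for x
  proof (cases "x \<in> S")
    case False
    show ?thesis
    proof (cases "x \<in> \<Omega>")
      case True
      have "\<exists>y\<in>S. dist y x < inverse (real (Suc k))" for k by (rule dense[OF True]) simp
      then have "\<exists>b. \<forall>k. b k \<in> S \<and> dist (b k) x < inverse (real (Suc k))"
        by (intro choice allI) blast
      then obtain b where b: "\<forall>k. b k \<in> S \<and> dist (b k) x < inverse (real (Suc k))" by (rule exE)
      have "(\<lambda>k. dist (b k) x) \<longlonglongrightarrow> 0"
      proof (rule tendsto_sandwich[OF _ _ tendsto_const LIMSEQ_inverse_real_of_nat])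
        show "\<forall>\<^sub>F k in sequentially. dist (b k) x \<le> inverse (real (Suc k))"
        proof (intro always_eventually allI)
          fix k
          from b[rule_format, of k] show "dist (b k) x \<le> inverse (real (Suc k))" by simp
        qed
      qed simp
      then have "b \<longlonglongrightarrow> x" by (subst tendsto_dist_iff)
      then show ?thesis by (intro exI[of _ b] conjI impI allI) (use b False in \<open>simp_all\<close>)
    next
      case f: False
      then show ?thesis using False by (intro exI[of _ "\<lambda>_. x"]) simp
    qed
  next
    case True
    then show ?thesis by (intro exI[of _ "\<lambda>_. x"]) simp
  qed
  then have "\<exists>a. \<forall>x. (x \<in> S \<longrightarrow> a x = (\<lambda>_. x)) \<and> (x \<in> \<Omega> \<longrightarrow> (\<forall>k. a x k \<in> S) \<and> a x \<longlonglongrightarrow> x)"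
    by (intro choice allI)
  then obtain a :: "real ^ 'n \<Rightarrow> nat \<Rightarrow> real ^ 'n" where a: "\<And>x. x \<in> S \<Longrightarrow> a x = (\<lambda>_. x)" "\<And>x k. x \<in> \<Omega> \<Longrightarrow> a x k \<in> S" "\<And>x. x \<in> \<Omega> \<Longrightarrow> a x \<longlonglongrightarrow> x"
    by blast
  define v :: "'n vfield" where "v = (\<lambda>x i. lim (\<lambda>k. u (a x k) i))"
  show ?thesis
  proof (rule that[of v])
    show "v x = u x" if "x \<in> S" for x using a(1)[OF that] by (simp add: v_def)
    fix x0 r and C \<alpha> :: real
    assume B: "ball x0 r \<subseteq> \<Omega>" and \<alpha>: "0 < \<alpha>"
      and h: "\<forall>x\<in>ball x0 r \<inter> S. \<forall>y\<in>ball x0 r \<inter> S. vdist N (u x) (u y) \<le> C * norm (x - y) powr \<alpha>"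
    have ev: "\<forall>\<^sub>F k in sequentially. a x k \<in> ball x0 r \<inter> S" if x: "x \<in> ball x0 r" for x
    proof -
      have "\<forall>\<^sub>F k in sequentially. a x k \<in> ball x0 r" using a(3) B x by (intro topological_tendstoD[of "a x" x]) auto
      then show ?thesis by eventually_elim (use a(2) B x in auto)
    qed
    have lim: "(\<lambda>k. u (a x k) i) \<longlonglongrightarrow> v x i" if x: "x \<in> ball x0 r" and i: "i < N" for x i
    proof -
      have "Cauchy (a x)" using a(3)[of x] B x by (intro LIMSEQ_imp_Cauchy) auto
      then have "Cauchy (\<lambda>k. u (a x k) i)"
      proof (rule Cauchy_holder_image[OF _ \<alpha> ev[OF x]])
        fix z y assume "z \<in> ball x0 r \<inter> S" "y \<in> ball x0 r \<inter> S"
        then have "vdist N (u z) (u y) \<le> C * norm (z - y) powr \<alpha>" using h by blast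
        moreover have "\<bar>u z i - u y i\<bar> \<le> vdist N (u z) (u y)" using abs_le_vnorm[OF i, of "\<lambda>i. u z i - u y i"] by (simp add: vdist_def)
        ultimately show "\<bar>u z i - u y i\<bar> \<le> C * norm (z - y) powr \<alpha>" by linarith
      qed
      then show ?thesis unfolding v_def by (simp add: Cauchy_convergent convergent_LIMSEQ_iff[symmetric])
    qed
    show "\<forall>x\<in>ball x0 r. \<forall>y\<in>ball x0 r. vdist N (v x) (v y) \<le> C * norm (x - y) powr \<alpha>"
    proof (intro ballI)
      fix x y assume x: "x \<in> ball x0 r" and y: "y \<in> ball x0 r"
      have "(\<lambda>k. vdist N (u (a x k)) (u (a y k))) \<longlonglongrightarrow> vdist N (v x) (v y)"
        by (intro vdist_tendsto lim x y)
      moreover have "(\<lambda>k. C * norm (a x k - a y k) powr \<alpha>) \<longlonglongrightarrow> C * norm (x - y) powr \<alpha>"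
        using a(3) B x y \<alpha> by (intro tendsto_intros tendsto_powr') (auto intro!: always_eventually)
      moreover have "\<forall>\<^sub>F k in sequentially. vdist N (u (a x k)) (u (a y k)) \<le> C * norm (a x k - a y k) powr \<alpha>"
        using ev[OF x] ev[OF y] by eventually_elim (use h in blast)
      ultimately show "vdist N (v x) (v y) \<le> C * norm (x - y) powr \<alpha>"
        by (intro tendsto_le[OF sequentially_bot])
    qed
  qed
qed

section \<open>From balls to compact sets\<close>

lemma ball_compactly_inside:
  fixes \<Omega> :: "(real ^ 'n::finite) set"
  assumes "open \<Omega>" "x \<in> \<Omega>"
  obtains r where "0 < r" "compactly_inside (ball x (4 * r)) \<Omega>"
proof -
  obtain e where e: "0 < e" "cball x e \<subseteq> \<Omega>" using assms open_contains_cball by blast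
  have "closure (ball x e) = cball x e" using e by simp
  then have "compactly_inside (ball x (4 * (e / 4))) \<Omega>" using e by (simp add: compactly_inside_def)
  then show ?thesis using that[of "e / 4"] e by simp
qed

lemma compactly_inside_subset: "U \<subseteq> V \<Longrightarrow> compactly_inside V \<Omega> \<Longrightarrow> compactly_inside U (\<Omega> :: 'a::metric_space set)"
  unfolding compactly_inside_def by (metis closure_mono closed_closure compact_Int_closed inf.absorb_iff2 subset_trans)

text \<open>Otherwise there are pairs in \<open>K\<close> with unbounded Hoelder quotients, and a
  subsequence of the pairs converges. If the two limits coincide, both points enter one ball with a
  local bound. If not, the distances stay away from 0 while the local bounds at the two limits keep
  the numerators bounded.\<close>

lemma holder_on_compact:
  fixes v :: "'n::finite vfield"
  assumes K: "compact K" and \<alpha>: "0 < \<alpha>"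
    and loc: "\<And>x. x \<in> K \<Longrightarrow> \<exists>r>0. \<exists>C. \<forall>y\<in>ball x r. \<forall>z\<in>ball x r. vdist N (v y) (v z) \<le> C * norm (y - z) powr \<alpha>"
  shows "\<exists>C. \<forall>x\<in>K. \<forall>y\<in>K. vdist N (v x) (v y) \<le> C * norm (x - y) powr \<alpha>"
proof (rule ccontr)
  assume "\<not> ?thesis"
  then have "\<forall>k::nat. \<exists>m. fst m \<in> K \<and> snd m \<in> K \<and> real k * norm (fst m - snd m) powr \<alpha> < vdist N (v (fst m)) (v (snd m))"
    by (force simp: not_le)
  then have "\<exists>m. \<forall>k::nat. fst (m k) \<in> K \<and> snd (m k) \<in> K \<and> real k * norm (fst (m k) - snd (m k)) powr \<alpha> < vdist N (v (fst (m k))) (v (snd (m k)))"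
    by (rule choice)
  then obtain m where m: "\<And>k. fst (m k) \<in> K" "\<And>k. snd (m k) \<in> K" "\<And>k::nat. real k * norm (fst (m k) - snd (m k)) powr \<alpha> < vdist N (v (fst (m k))) (v (snd (m k)))"
    by blast
  have "compact (K \<times> K)" using K by (intro compact_Times)
  then obtain l r where l: "l \<in> K \<times> K" "strict_mono r" "(m \<circ> r) \<longlonglongrightarrow> l"
    unfolding compact_def using m(1,2) by (metis mem_Times_iff)
  define a where "a = (\<lambda>k. fst (m (r k)))"
  define b where "b = (\<lambda>k. snd (m (r k)))"
  have ab: "a \<longlonglongrightarrow> fst l" "b \<longlonglongrightarrow> snd l"
    using tendsto_fst[OF l(3)] tendsto_snd[OF l(3)] by (auto simp: a_def b_def o_def)
  have big: "real k * norm (a k - b k) powr \<alpha> < vdist N (v (a k)) (v (b k))" for k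
  proof -
    have "real k * norm (a k - b k) powr \<alpha> \<le> real (r k) * norm (a k - b k) powr \<alpha>"
      using seq_suble[OF l(2), of k] by (intro mult_right_mono) auto
    also have "\<dots> < vdist N (v (a k)) (v (b k))" unfolding a_def b_def by (rule m(3))
    finally show ?thesis .
  qed
  obtain ra Ca where ra: "0 < ra" "\<forall>y\<in>ball (fst l) ra. \<forall>z\<in>ball (fst l) ra. vdist N (v y) (v z) \<le> Ca * norm (y - z) powr \<alpha>"
    using loc[of "fst l"] l(1) by (auto simp: mem_Times_iff)
  obtain rb Cb where rb: "0 < rb" "\<forall>y\<in>ball (snd l) rb. \<forall>z\<in>ball (snd l) rb. vdist N (v y) (v z) \<le> Cb * norm (y - z) powr \<alpha>"
    using loc[of "snd l"] l(1) by (auto simp: mem_Times_iff)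
  have eva: "\<forall>\<^sub>F k in sequentially. a k \<in> ball (fst l) ra" using ab(1) ra(1) by (intro topological_tendstoD) auto
  have evb: "\<forall>\<^sub>F k in sequentially. b k \<in> ball (snd l) rb" using ab(2) rb(1) by (intro topological_tendstoD) auto
  show False
  proof (cases "fst l = snd l")
    case True
    obtain k0 :: nat where k0: "Ca \<le> real k0" using real_arch_simple by blast
    have evb': "\<forall>\<^sub>F k in sequentially. b k \<in> ball (fst l) ra" using ab(2) ra(1) True by (intro topological_tendstoD) auto
    have "\<forall>\<^sub>F k in sequentially. False"
      using eva evb' eventually_ge_at_top[of k0]
    proof eventually_elim
      case (elim k)
      have "vdist N (v (a k)) (v (b k)) \<le> Ca * norm (a k - b k) powr \<alpha>" using ra(2) elim by blast
      also have "\<dots> \<le> real k * norm (a k - b k) powr \<alpha>" using k0 elim by (intro mult_right_mono) auto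
      finally show ?case using big[of k] by simp
    qed
    then show False by simp
  next
    case False
    define t where "t = norm (fst l - snd l)"
    have t: "0 < t" using False by (simp add: t_def)
    define W where "W = vdist N (v (fst l)) (v (snd l))"
    obtain k0 :: nat where k0: "(\<bar>Ca\<bar> * ra powr \<alpha> + W + \<bar>Cb\<bar> * rb powr \<alpha>) / (t / 2) powr \<alpha> \<le> real k0" using real_arch_simple by blast
    have tn: "(\<lambda>k. norm (a k - b k)) \<longlonglongrightarrow> t" unfolding t_def by (intro tendsto_intros ab)
    then have evt: "\<forall>\<^sub>F k in sequentially. t / 2 < norm (a k - b k)" using t by (intro order_tendstoD) auto
    have "\<forall>\<^sub>F k in sequentially. False"
      using eva evb evt eventually_ge_at_top[of k0]
    proof eventually_elim
      case (elim k)
      have "vdist N (v (a k)) (v (fst l)) \<le> Ca * norm (a k - fst l) powr \<alpha>" using ra elim by (metis centre_in_ball)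
      also have "\<dots> \<le> \<bar>Ca\<bar> * ra powr \<alpha>" using elim \<alpha> by (intro mult_mono powr_mono2) (auto simp: dist_norm norm_minus_commute)
      finally have 1: "vdist N (v (a k)) (v (fst l)) \<le> \<bar>Ca\<bar> * ra powr \<alpha>" .
      have "vdist N (v (snd l)) (v (b k)) \<le> Cb * norm (snd l - b k) powr \<alpha>" using rb elim by (metis centre_in_ball)
      also have "\<dots> \<le> \<bar>Cb\<bar> * rb powr \<alpha>" using elim \<alpha> by (intro mult_mono powr_mono2) (auto simp: dist_norm)
      finally have 2: "vdist N (v (snd l)) (v (b k)) \<le> \<bar>Cb\<bar> * rb powr \<alpha>" .
      have "vdist N (v (a k)) (v (b k)) \<le> \<bar>Ca\<bar> * ra powr \<alpha> + W + \<bar>Cb\<bar> * rb powr \<alpha>"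
        using 1 2 vdist_triangle[of N "v (a k)" "v (b k)" "v (fst l)"] vdist_triangle[of N "v (fst l)" "v (b k)" "v (snd l)"]
        unfolding W_def by linarith
      also have "\<dots> \<le> real k0 * (t / 2) powr \<alpha>" using k0 t by (simp add: pos_divide_le_eq)
      also have "\<dots> \<le> real k * norm (a k - b k) powr \<alpha>" using elim t \<alpha> by (intro mult_mono powr_mono2) auto
      finally show ?case using big[of k] by simp
    qed
    then show False by simp
  qed
qed

lemma holder_seminorm_le:
  assumes "\<And>x y. x \<in> U \<Longrightarrow> y \<in> U \<Longrightarrow> vdist N (v x) (v y) \<le> C * norm (x - y) powr \<alpha>"
  shows "holder_seminorm N \<alpha> U v \<le> ennreal C"
  unfolding holder_seminorm_def
proof (rule SUP_least, clarsimp)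
  fix x y assume xy: "x \<in> U" "y \<in> U" "x \<noteq> y"
  then have "0 < norm (x - y) powr \<alpha>" by (simp add: powr_gt_zero)
  then show "ennreal (vdist N (v x) (v y) / norm (x - y) powr \<alpha>) \<le> ennreal C"
    using assms[OF xy(1,2)] by (intro ennreal_leI) (simp add: pos_divide_le_eq)
qed

text \<open>The constant is increasing in \<open>kernel_const\<close> and in the exponents of its
  powers, so \<open>kernel_const_mono\<close> yields one bound for the whole parameter
  range.\<close>

lemma hole_const_bounded:
  assumes "1 \<le> n" "0 < s1" "s2 < 1" "1 < p1"
  obtains H where "0 < H" "\<And>s p. s1 < s \<Longrightarrow> s < s2 \<Longrightarrow> p1 < p \<Longrightarrow> p < p2 \<Longrightarrow> hole_const n s p \<le> H"
proof -
  define k where "k = unit_ball_vol n *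
     (4 powr p2 * 2 powr (n + p2) / (1 - 2 powr (- (p1 * (1 - s2)))) + 2 powr n / (1 - 2 powr (- (s1 * p1))))"
  define F where "F = 2 / unit_ball_vol n * 2 powr p2 * (2 powr (n + p2) * k + 4 powr (n + p2) * unit_ball_vol n)"
  define H where "H = 6 * (2 + F) + 4 * k * (2 / unit_ball_vol n * 2 powr (n + p2))"
  have v: "0 < unit_ball_vol n" using assms by simp
  have "hole_const n s p \<le> \<bar>H\<bar> + 1" if sp: "s1 < s" "s < s2" "p1 < p" "p < p2" for s p
  proof -
    have k: "0 < kernel_const n s p" "kernel_const n s p \<le> k"
      unfolding k_def using assms sp by (auto intro!: kernel_const_pos kernel_const_mono)
    have "s * p \<le> 1 * p" using assms sp by (intro mult_right_mono) auto
    then have e: "n + s * p \<le> n + p2" using sp by simp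
    have F: "far_const n s p \<le> F"
      unfolding far_const_def F_def using v k e sp
      by (intro mult_mono add_mono powr_mono) auto
    have "0 \<le> far_const n s p" using v k by (simp add: far_const_def)
    then have "hole_const n s p \<le> H"
      unfolding hole_const_def H_def using v k e F
      by (intro add_mono mult_mono powr_mono) auto
    then show ?thesis by simp
  qed
  then show ?thesis by (intro that[of "\<bar>H\<bar> + 1"]) auto
qed

section \<open>The regularity theorem\<close>

text \<open>The estimates hold between good points of a Borel representative. Almost every point of
  \<open>\<Omega>\<close> is good, hence good points are dense, and the Hoelder bounds extend from
  them to a continuous \<open>v\<close>.\<close>

lemma local_regularity:
  fixes \<Omega> :: "(real ^ 'n::finite) set" and u f :: "'n vfield"
  assumes s: "0 < s" "s < 1" and p: "1 < p"
    and \<delta>: "\<delta> < s" "hole_const (real CARD('n)) s p / (1 + hole_const (real CARD('n)) s p) \<le> 2 powr (- \<delta>)"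
    and \<alpha>: "\<alpha> = (s * p + \<delta> - real CARD('n)) / p" "0 < \<alpha>"
    and \<Omega>: "open \<Omega>" "bounded \<Omega>"
    and uW: "u \<in> W_loc N s p \<Omega>" and ut: "u \<in> tail_space N (p - 1) (s * p)"
    and f: "f \<in> Lq_loc N (p / (p - 1)) \<Omega>"
    and ws: "weak_solution N s p \<Omega> f u"
    and C: "0 < C" "holder_const (real CARD('n)) s p \<delta> (max 1 (diameter \<Omega>)) \<le> C"
  shows "\<exists>v :: 'n vfield. (AE x in lebesgue. x \<in> \<Omega> \<longrightarrow> (\<forall>i<N. v x i = u x i)) \<and> v \<in> holder_loc N \<alpha> \<Omega> \<and>
     (\<forall>x0 R. 0 < R \<and> compactly_inside (ball x0 (4 * R)) \<Omega> \<longrightarrow>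
        holder_seminorm N \<alpha> (ball x0 R) v \<le> holder_bound N s p \<delta> C f u x0 R)"
proof -
  have um: "(\<lambda>x. u x i) \<in> borel_measurable lebesgue" if "i < N" for i by (rule tail_space_measurable[OF ut that])
  obtain w :: "'n vfield" where w: "\<And>i. i < N \<Longrightarrow> (\<lambda>x. w x i) \<in> borel_measurable borel" "AE x in lborel. \<forall>i<N. w x i = u x i"
    by (rule borel_representative[of N u], erule um, rule that)
  interpret gag_field s p "real CARD('n)" N w
    by standard (use s p w in auto)
  have qe: "q = p / (p - 1)" by (rule q_def)
  have sub2: "compactly_inside (ball x0 (2 * R)) \<Omega>" if "0 < R" "compactly_inside (ball x0 (4 * R)) \<Omega>" for x0 R
    using that by (intro compactly_inside_subset[of "ball x0 (2 * R)" "ball x0 (4 * R)"] subset_ball) auto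
  have subO: "U \<subseteq> \<Omega>" if "compactly_inside U \<Omega>" for U
    using that closure_subset unfolding compactly_inside_def by blast
  have finU: "en U U < \<infinity>" "W_seminorm N s p U u = epowr (en U U) (1 / p)" "W_seminorm N s p U u < \<infinity>"
      "(\<integral>\<^sup>+x\<in>U. ennreal (vnorm N (w x) powr p) \<partial>lborel) < \<infinity>"
    if U: "open U" "compactly_inside U \<Omega>" for U
  proof -
    have "u \<in> W_space N s p U" using uW U by (auto simp: W_loc_def)
    then have W: "W_seminorm N s p U u < \<infinity>" "Lq_norm N p U u < \<infinity>" by (auto simp: W_space_def Lq_def)
    show e: "W_seminorm N s p U u = epowr (en U U) (1 / p)" by (simp add: W_seminorm_def gagliardo_energy_eq[OF w(2)])
    show "en U U < \<infinity>" using W(1) unfolding e by (rule epowr_less_top)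
    show "W_seminorm N s p U u < \<infinity>" by fact
    show "(\<integral>\<^sup>+x\<in>U. ennreal (vnorm N (w x) powr p) \<partial>lborel) < \<infinity>"
      using W(2) unfolding Lq_norm_def Lq_integral_eq[OF w(2)] by (rule epowr_less_top)
  qed
  \<comment> \<open>Two estimates on each ball: one with an unspecified constant, always available,
    and one with the constant of \<open>holder_bound\<close>, available when the energy against the
    whole space is finite.\<close>
  have est: "(\<exists>c. \<forall>x\<in>ball x0 R. \<forall>y\<in>ball x0 R. good x \<longrightarrow> good y \<longrightarrow> D x y \<le> c * norm (x - y) powr \<alpha>) \<and>
      (gagliardo_energy N s p (ball x0 (4 * R)) UNIV u < \<infinity> \<longrightarrow>
        (\<exists>c. ennreal c \<le> holder_bound N s p \<delta> C f u x0 R \<and>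
          (\<forall>x\<in>ball x0 R. \<forall>y\<in>ball x0 R. good x \<longrightarrow> good y \<longrightarrow> D x y \<le> c * norm (x - y) powr \<alpha>)))"
    if R: "0 < R" and cR: "compactly_inside (ball x0 (4 * R)) \<Omega>" for x0 R
  proof -
    let ?U = "ball x0 (4 * R)" and ?V = "ball x0 (2 * R)"
    have VU: "?V \<subseteq> ?U" using R by auto
    \<comment> \<open>\<open>f\<close> is measurable only locally in \<open>\<Omega>\<close>;
      extension by 0 from the ball makes it globally measurable before a Borel representative is
      taken.\<close>
    have fm: "(\<lambda>x. indicator ?U x *\<^sub>R f x i) \<in> borel_measurable lebesgue" if i: "i < N" for i
    proof -
      have "(\<lambda>x. f x i) \<in> borel_measurable (lebesgue_on ?U)" using f cR i by (auto simp: Lq_loc_def Lq_def)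
      then show ?thesis by (subst (asm) borel_measurable_restrict_space_iff) auto
    qed
    obtain g :: "'n vfield" where g: "\<And>i. i < N \<Longrightarrow> (\<lambda>x. g x i) \<in> borel_measurable borel"
      "AE x in lborel. \<forall>i<N. g x i = indicator ?U x *\<^sub>R f x i"
      by (rule borel_representative[of N "\<lambda>x i. indicator ?U x *\<^sub>R f x i"], erule fm, rule that)
    have gV: "(\<integral>\<^sup>+x\<in>?V. ennreal (vnorm N (f x) powr q) \<partial>lebesgue) = (\<integral>\<^sup>+x\<in>?V. ennreal (vnorm N (g x) powr q) \<partial>lborel)"
    proof -
      have "(\<integral>\<^sup>+x\<in>?V. ennreal (vnorm N (f x) powr q) \<partial>lebesgue) = (\<integral>\<^sup>+x\<in>?V. ennreal (vnorm N (f x) powr q) \<partial>lborel)"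
        by (rule nn_integral_completion)
      also have "\<dots> = (\<integral>\<^sup>+x\<in>?V. ennreal (vnorm N (g x) powr q) \<partial>lborel)"
      proof (rule nn_integral_cong_AE)
        show "AE x in lborel. ennreal (vnorm N (f x) powr q) * indicator ?V x = ennreal (vnorm N (g x) powr q) * indicator ?V x"
          using g(2)
        proof eventually_elim
          case (elim x)
          show ?case
          proof (cases "x \<in> ?V")
            case True
            then have "x \<in> ?U" using VU by blast
            then have "vnorm N (g x) = vnorm N (f x)" using elim by (intro vnorm_cong) simp
            then show ?thesis by simp
          qed simp
        qed
      qed
      finally show ?thesis .
    qed
    have "f \<in> Lq N q ?V" using f sub2[OF R cR] unfolding qe Lq_loc_def by auto
    then have "epowr (\<integral>\<^sup>+x\<in>?V. ennreal (vnorm N (g x) powr q) \<partial>lborel) (1 / q) < \<infinity>"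
      by (simp add: Lq_def Lq_norm_def gV)
    then obtain F where F: "0 \<le> F" "epowr (\<integral>\<^sup>+x\<in>?V. ennreal (vnorm N (g x) powr q) \<partial>lborel) (1 / q) = ennreal F"
      "(\<integral>\<^sup>+x\<in>?V. ennreal (vnorm N (g x) powr q) \<partial>lborel) = ennreal (F powr q)"
      by (rule finite_energy_powr) (use q in auto)
    have Fn: "Lq_norm N (p / (p - 1)) ?V f = ennreal F" unfolding qe[symmetric] Lq_norm_def gV by (rule F(2))
    have weak: "(LINT x|lborel. LINT y|lborel. D x y powr (p - 2) * ((w x i - w y i) * (\<phi> x - \<phi> y)) / norm (x - y) powr ex)
       = (LINT x|lborel. g x i * \<phi> x)"
      if i: "i < N" and \<phi>: "\<And>k. Ck k \<phi>" and K: "compact K" "K \<subseteq> ?V" "\<And>x. x \<notin> K \<Longrightarrow> \<phi> x = 0" for i \<phi> K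
    proof (rule weak_solution_component[where f = g and \<phi> = \<phi> and K = K and i = i, OF w(2) um ws i \<phi> K(1) _ K(3) _ g(1)[OF i]])
      show "K \<subseteq> \<Omega>" using K(2) VU subO[OF cR] by blast
      have "continuous_on UNIV \<phi>" using \<phi>[of 0] by simp
      then have "\<phi> \<in> borel_measurable lborel" using borel_measurable_continuous_onI by simp
      then have \<phi>m: "\<phi> \<in> borel_measurable lebesgue" by (rule measurable_completion)
      have "(\<lambda>x. f x i * \<phi> x) = (\<lambda>x. (indicator ?U x *\<^sub>R f x i) * \<phi> x)"
      proof
        fix x
        show "f x i * \<phi> x = (indicator ?U x *\<^sub>R f x i) * \<phi> x"
        proof (cases "x \<in> K")
          case True
          then have "x \<in> ?U" using K(2) VU by blast
          then show ?thesis by simp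
        qed (simp add: K(3))
      qed
      then show "(\<lambda>x. f x i * \<phi> x) \<in> borel_measurable lebesgue" using fm[OF i] \<phi>m by simp
      show "AE x in lborel. x \<in> K \<longrightarrow> g x i = f x i"
        using g(2)
      proof eventually_elim
        case (elim x)
        show ?case
        proof
          assume "x \<in> K"
          then have "x \<in> ?U" using K(2) VU by blast
          then show "g x i = f x i" using elim i by simp
        qed
      qed
    qed
    note up = finU(4)[OF open_ball cR]
    note tl = tail_integral_eq[OF w(2) ut]
    note ctx = R finU(1)[OF open_ball cR] up tl g(1) F(1) eq_refl[OF F(3)] weak \<delta> \<alpha>
    have a: "\<exists>c. \<forall>x\<in>ball x0 R. \<forall>y\<in>ball x0 R. good x \<longrightarrow> good y \<longrightarrow> D x y \<le> c * norm (x - y) powr \<alpha>"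
      by (rule ball_holder_qualitative[OF ctx])
    have b: "\<exists>c. ennreal c \<le> holder_bound N s p \<delta> C f u x0 R \<and>
          (\<forall>x\<in>ball x0 R. \<forall>y\<in>ball x0 R. good x \<longrightarrow> good y \<longrightarrow> D x y \<le> c * norm (x - y) powr \<alpha>)"
      if fin: "gagliardo_energy N s p ?U UNIV u < \<infinity>"
    proof -
      obtain E where E: "gagliardo_energy N s p ?U UNIV u = ennreal E" "0 \<le> E" using fin by (cases "gagliardo_energy N s p ?U UNIV u") auto
      then have E': "en ?U UNIV = ennreal E" using gagliardo_energy_eq[OF w(2)] by simp
      have "epowr (en ?V ?V) (1 / p) < \<infinity>" using finU(2,3)[OF open_ball sub2[OF R cR]] by simp
      then obtain W where W: "0 \<le> W" "epowr (en ?V ?V) (1 / p) = ennreal W" "en ?V ?V = ennreal (W powr p)"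
        by (rule finite_energy_powr) (use p in auto)
      have Wn: "W_seminorm N s p ?V u = ennreal W" using finU(2)[OF open_ball sub2[OF R cR]] W(2) by simp
      define S where "S = max 1 (diameter \<Omega>)"
      have S: "1 \<le> S" "R \<le> S"
      proof -
        \<comment> \<open>A point of \<open>\<Omega>\<close> at distance exactly \<open>R\<close>
          from \<open>x0\<close>, which shows that \<open>R\<close> is at most the diameter.\<close>
        define y where "y = x0 + R *\<^sub>R axis undefined 1"
        have dy: "dist x0 y = R" using R by (simp add: y_def dist_norm)
        then have "x0 \<in> \<Omega>" "y \<in> \<Omega>" using subO[OF cR] R by auto
        then have "dist x0 y \<le> diameter \<Omega>" by (rule diameter_bounded_bound[OF \<Omega>(2)])
        then show "R \<le> S" using dy by (simp add: S_def)
      qed (simp add: S_def)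
      define c where "c = C * ((E + F * W) * R powr (- \<delta>)) powr (1 / p)"
      have "D x y \<le> c * norm (x - y) powr \<alpha>" if "x \<in> ball x0 R" "y \<in> ball x0 R" "good x" "good y" for x y
      proof -
        have "D x y \<le> holder_const (real CARD('n)) s p \<delta> S * ((E + F * W) * R powr (- \<delta>)) powr (1 / p) * norm (x - y) powr \<alpha>"
          by (rule ball_holder_quantitative[OF ctx S E' E(2) W(1,3)]) (use that in auto)
        also have "\<dots> \<le> c * norm (x - y) powr \<alpha>"
          unfolding c_def using C(2) by (intro mult_right_mono) (auto simp: S_def)
        finally show ?thesis .
      qed
      moreover have "holder_bound N s p \<delta> C f u x0 R = ennreal c"
      proof -
        have "holder_bound N s p \<delta> C f u x0 R = ennreal C * ennreal (R powr (- \<delta> / p)) * epowr (ennreal E + ennreal F * ennreal W) (1 / p)"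
          by (simp add: holder_bound_def E(1) Fn Wn)
        also have "ennreal E + ennreal F * ennreal W = ennreal (E + F * W)"
          using E F W by (simp add: ennreal_mult)
        also have "epowr (ennreal (E + F * W)) (1 / p) = ennreal ((E + F * W) powr (1 / p))"
          using E F W by (intro epowr_ennreal) auto
        also have "ennreal C * ennreal (R powr (- \<delta> / p)) * ennreal ((E + F * W) powr (1 / p)) = ennreal (C * R powr (- \<delta> / p) * (E + F * W) powr (1 / p))"
          using C by (simp add: ennreal_mult)
        also have "C * R powr (- \<delta> / p) * (E + F * W) powr (1 / p) = c"
          by (simp add: c_def powr_mult powr_powr)
        finally show ?thesis .
      qed
      ultimately show ?thesis by (intro exI[of _ c]) auto
    qed
    show ?thesis using a b by blast
  qed
  define S where "S = {x \<in> \<Omega>. good x}"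
  have AEgood: "AE x in lborel. x \<in> \<Omega> \<longrightarrow> good x"
  proof -
    \<comment> \<open>In each of these balls almost every point is good; Lindelof's theorem leaves
      countably many null sets to discard.\<close>
    define \<F> where "\<F> = {ball x r | x r. 0 < r \<and> compactly_inside (ball x (4 * r)) \<Omega>}"
    obtain \<F>' where F': "\<F>' \<subseteq> \<F>" "countable \<F>'" "\<Union>\<F>' = \<Union>\<F>" by (rule Lindelof[of \<F>]) (auto simp: \<F>_def)
    have "AE x in lborel. x \<in> B \<longrightarrow> good x" if BF: "B \<in> \<F>'" for B
    proof -
      have "B \<in> \<F>" using BF F'(1) by blast
      then obtain x0 r where B: "B = ball x0 r" "0 < r" "compactly_inside (ball x0 (4 * r)) \<Omega>" unfolding \<F>_def by blast
      have "compactly_inside (ball x0 r) \<Omega>" by (rule compactly_inside_subset[OF _ B(3)]) (use B(2) in auto)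
      then show ?thesis unfolding B(1) by (intro AE_good_local B(2) finU(1)) auto
    qed
    then have "AE x in lborel. \<forall>B\<in>\<F>'. x \<in> B \<longrightarrow> good x" unfolding AE_ball_countable[OF F'(2)] by blast
    then show ?thesis
    proof eventually_elim
      case (elim x)
      show ?case
      proof
        assume x: "x \<in> \<Omega>"
        obtain r where "0 < r" "compactly_inside (ball x (4 * r)) \<Omega>" by (rule ball_compactly_inside[OF \<Omega>(1) x])
        then have "x \<in> \<Union>\<F>" unfolding \<F>_def by (auto intro!: exI[of _ "ball x r"] exI[of _ x] exI[of _ r])
        then show "good x" using elim F'(3) by blast
      qed
    qed
  qed
  \<comment> \<open>A ball in \<open>\<Omega>\<close> without good points would be a null
    set.\<close>
  have dense: "\<exists>y\<in>S. dist y x < e" if x: "x \<in> \<Omega>" and e: "0 < e" for x e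
  proof (rule ccontr)
    assume no: "\<not> ?thesis"
    obtain r where r: "0 < r" "ball x r \<subseteq> \<Omega>" using \<Omega>(1) x open_contains_ball by blast
    define t where "t = min r e"
    have t: "0 < t" using r e by (simp add: t_def)
    have "AE y in lborel. y \<notin> ball x t"
      using AEgood
    proof eventually_elim
      case (elim y)
      show ?case
      proof
        assume y: "y \<in> ball x t"
        then have "y \<in> \<Omega>" "dist y x < e" using r by (auto simp: t_def dist_commute)
        then show False using elim no by (auto simp: S_def)
      qed
    qed
    then have "ball x t \<in> null_sets lborel" by (subst AE_iff_null_sets) auto
    then have "emeasure lborel (ball x t) = 0" by auto
    then show False using t vol_pos by (simp add: emeasure_ball)
  qed
  obtain v :: "'n vfield" where v: "\<And>x. x \<in> S \<Longrightarrow> v x = w x"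
    "\<And>x0 r C \<alpha>. ball x0 r \<subseteq> \<Omega> \<Longrightarrow> 0 < \<alpha>
       \<Longrightarrow> \<forall>x\<in>ball x0 r \<inter> S. \<forall>y\<in>ball x0 r \<inter> S. vdist N (w x) (w y) \<le> C * norm (x - y) powr \<alpha>
       \<Longrightarrow> \<forall>x\<in>ball x0 r. \<forall>y\<in>ball x0 r. vdist N (v x) (v y) \<le> C * norm (x - y) powr \<alpha>"
    by (rule holder_extension[of \<Omega> S], erule (1) dense, rule that)
  have vh: "vdist N (v x) (v y) \<le> c * norm (x - y) powr \<alpha>"
    if "0 < R" "compactly_inside (ball x0 (4 * R)) \<Omega>"
      and h: "\<forall>x\<in>ball x0 R. \<forall>y\<in>ball x0 R. good x \<longrightarrow> good y \<longrightarrow> D x y \<le> c * norm (x - y) powr \<alpha>"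
      and "x \<in> ball x0 R" "y \<in> ball x0 R" for x0 R c x y
  proof -
    have "ball x0 R \<subseteq> \<Omega>" using subO[OF that(2)] that(1) by (intro order.trans[OF subset_ball[of R "4 * R"]]) auto
    from v(2)[OF this \<alpha>(2), of c] h that(4,5) show ?thesis by (auto simp: S_def)
  qed
  have "AE x in lborel. x \<in> \<Omega> \<longrightarrow> (\<forall>i<N. v x i = u x i)"
    using AEgood w(2) by eventually_elim (auto simp: S_def v(1))
  then have 1: "AE x in lebesgue. x \<in> \<Omega> \<longrightarrow> (\<forall>i<N. v x i = u x i)" by (rule AE_completion)
  have 2: "v \<in> holder_loc N \<alpha> \<Omega>"
    unfolding holder_loc_def
  proof (intro CollectI allI impI)
    fix U assume U: "open U \<and> compactly_inside U \<Omega>"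
    have "\<exists>c. \<forall>x\<in>closure U. \<forall>y\<in>closure U. vdist N (v x) (v y) \<le> c * norm (x - y) powr \<alpha>"
    proof (rule holder_on_compact[OF _ \<alpha>(2)])
      show "compact (closure U)" using U by (simp add: compactly_inside_def)
      fix x assume "x \<in> closure U"
      then have "x \<in> \<Omega>" using U by (auto simp: compactly_inside_def)
      then obtain r where r: "0 < r" "compactly_inside (ball x (4 * r)) \<Omega>" by (rule ball_compactly_inside[OF \<Omega>(1)])
      from est[OF r] obtain c where "\<forall>y\<in>ball x r. \<forall>z\<in>ball x r. good y \<longrightarrow> good z \<longrightarrow> D y z \<le> c * norm (y - z) powr \<alpha>" by blast
      from vh[OF r this] show "\<exists>r>0. \<exists>C. \<forall>y\<in>ball x r. \<forall>z\<in>ball x r. vdist N (v y) (v z) \<le> C * norm (y - z) powr \<alpha>"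
        using r(1) by blast
    qed
    then obtain c where c: "\<And>x y. x \<in> closure U \<Longrightarrow> y \<in> closure U \<Longrightarrow> vdist N (v x) (v y) \<le> c * norm (x - y) powr \<alpha>" by blast
    have "holder_seminorm N \<alpha> U v \<le> ennreal c"
      using closure_subset by (intro holder_seminorm_le c) auto
    then show "holder_seminorm N \<alpha> U v < \<infinity>" by (rule le_less_trans) simp
  qed
  have 3: "holder_seminorm N \<alpha> (ball x0 R) v \<le> holder_bound N s p \<delta> C f u x0 R"
    if R: "0 < R" "compactly_inside (ball x0 (4 * R)) \<Omega>" for x0 R
  proof (cases "gagliardo_energy N s p (ball x0 (4 * R)) UNIV u < \<infinity>")
    case True
    with est[OF R] obtain c where c: "ennreal c \<le> holder_bound N s p \<delta> C f u x0 R"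
      "\<forall>x\<in>ball x0 R. \<forall>y\<in>ball x0 R. good x \<longrightarrow> good y \<longrightarrow> D x y \<le> c * norm (x - y) powr \<alpha>" by blast
    have "holder_seminorm N \<alpha> (ball x0 R) v \<le> ennreal c"
      by (rule holder_seminorm_le) (rule vh[OF R c(2)])
    then show ?thesis using c(1) by (rule order.trans)
  next
    \<comment> \<open>With infinite energy against the whole space the bound itself is infinite,
      because \<open>C\<close> and the power of \<open>R\<close> are positive.\<close>
    case False
    then have "gagliardo_energy N s p (ball x0 (4 * R)) UNIV u = \<infinity>" unfolding infinity_ennreal_def
    using top.not_eq_extremum by blast
    moreover have "0 < R powr (- \<delta> / p)" using R(1) by simp
    ultimately have "holder_bound N s p \<delta> C f u x0 R = \<infinity>"
      using C(1) by (simp add: holder_bound_def epowr_def ennreal_mult_top ennreal_mult_eq_top_iff)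
    then show ?thesis by simp
  qed
  show ?thesis using 1 2 3 by blast
qed

text \<open>The function \<open>C\<close> can be chosen before \<open>N\<close> because every
  constant above depends only on the dimension, \<open>s\<close>, \<open>p\<close>,
  \<open>\<delta>\<close> and the diameter.\<close>

theorem theorem1p6:
  shows "\<exists>C :: real \<Rightarrow> real \<Rightarrow> real \<Rightarrow> real \<Rightarrow> real.
    (\<forall>s p \<delta> D. C s p \<delta> D > 0) \<and>
    (\<forall>(N::nat) s1 s2 p1 p2.
      1 \<le> N \<and> 1 < p1 \<and> p1 < p2 \<and> 0 < s1 \<and> s1 < s2 \<and> s2 < 1 \<longrightarrow>
      (\<exists>\<delta>>0. \<forall>s p.
        s1 < s \<and> s < s2 \<and> p1 < p \<and> p < p2 \<and> s * p + \<delta> > real CARD('n) \<longrightarrow>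
        (\<forall>(\<Omega> :: (real ^ 'n::finite) set) (u :: 'n vfield) (f :: 'n vfield).
          open \<Omega> \<and> bounded \<Omega> \<and>
          u \<in> W_loc N s p \<Omega> \<inter> tail_space N (p - 1) (s * p) \<and>
          f \<in> Lq_loc N (p / (p - 1)) \<Omega> \<and>
          weak_solution N s p \<Omega> f u \<longrightarrow>
          (let \<alpha> = (s * p + \<delta> - real CARD('n)) / p in
            \<exists>v :: 'n vfield.
              (AE x in lebesgue. x \<in> \<Omega> \<longrightarrow> (\<forall>i<N. v x i = u x i)) \<and>
              v \<in> holder_loc N \<alpha> \<Omega> \<and>
              (\<forall>x0 R. 0 < R \<and> compactly_inside (ball x0 (4 * R)) \<Omega> \<longrightarrow>
                holder_seminorm N \<alpha> (ball x0 R) v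
                  \<le> holder_bound N s p \<delta> (C s p \<delta> (max 1 (diameter \<Omega>))) f u x0 R)))))"
\<comment> \<open>The maximum with 1 makes the constant positive for all arguments, including those
  outside the admissible range.\<close>
proof (rule exI[of _ "\<lambda>s p \<delta> L. max 1 (holder_const (real CARD('n)) s p \<delta> L)"], intro conjI allI impI, goal_cases)
  case (1 s p \<delta> D)
  show ?case by simp
next
  case (2 N s1 s2 p1 p2)
  then have par: "1 < p1" "0 < s1" "s2 < 1" by auto
  obtain H where H: "0 < H" "\<And>s p. s1 < s \<Longrightarrow> s < s2 \<Longrightarrow> p1 < p \<Longrightarrow> p < p2 \<Longrightarrow> hole_const (real CARD('n)) s p \<le> H"
    by (rule hole_const_bounded[of "real CARD('n)" s1 s2 p1 p2]) (use par in \<open>auto simp: Suc_leI intro: that\<close>)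
  define \<theta> where "\<theta> = H / (1 + H)"
  have \<theta>: "0 < \<theta>" "\<theta> < 1" using H(1) by (auto simp: \<theta>_def)
  \<comment> \<open>The first bound ensures \<open>\<delta> < s1 < s\<close>, so that the errors
    decay faster than the energy; the second gives
    \<open>\<theta> \<le> 2 powr (- \<delta>)\<close>, the contraction condition for the largest
    \<open>hole_const\<close> in the range.\<close>
  define \<delta> where "\<delta> = min (s1 / 2) (- log 2 \<theta>)"
  have \<delta>: "0 < \<delta>" "\<delta> < s1" "\<delta> \<le> - log 2 \<theta>" using \<theta> par(2) by (auto simp: \<delta>_def)
  have \<theta>\<delta>: "\<theta> \<le> 2 powr (- \<delta>)"
  proof -
    have "\<theta> = 2 powr (log 2 \<theta>)" using \<theta> by simp
    also have "\<dots> \<le> 2 powr (- \<delta>)" using \<delta>(3) by (intro powr_mono) auto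
    finally show ?thesis .
  qed
  show ?case
  proof (rule exI[of _ \<delta>], intro conjI allI impI, rule \<delta>(1), goal_cases)
    case (1 s p \<Omega> u f)
    then have sp: "s1 < s" "s < s2" "p1 < p" "p < p2" "real CARD('n) < s * p + \<delta>" by auto
    have h0: "0 \<le> hole_const (real CARD('n)) s p"
    proof -
      have "0 < kernel_const (real CARD('n)) s p" using sp par by (intro kernel_const_pos) auto
      then show ?thesis by (simp add: hole_const_def far_const_def)
    qed
    have "hole_const (real CARD('n)) s p / (1 + hole_const (real CARD('n)) s p) \<le> \<theta>"
      unfolding \<theta>_def using h0 H(2)[OF sp(1-4)] H(1) by (simp add: field_simps)
    then have hole: "hole_const (real CARD('n)) s p / (1 + hole_const (real CARD('n)) s p) \<le> 2 powr (- \<delta>)"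
      using \<theta>\<delta> by linarith
    have \<alpha>: "0 < (s * p + \<delta> - real CARD('n)) / p" using sp par by simp
    show ?case
      unfolding Let_def
      by (rule local_regularity[OF _ _ _ _ hole refl \<alpha>]) (use 1 sp par \<delta> in auto)
  qed
qed

end
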